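(* The C*-probability spaces $(C_r^*(\mathbb{F}_\infty),\tau)$ and $(\mathcal{O}_\infty,\phi)$ are selfless, where $\mathbb{F}_\infty$ is the free group on countably infinitely many generators, $\tau$ is the unique tracial state of $C_r^*(\mathbb{F}_\infty)$, $\mathcal O_\infty$ is the Cuntz algebra generated by infinitely many isometries, and $\phi$ is the state on $\mathcal O_\infty$ corresponding to the free product state under the isomorphism $(\mathcal{O}_\infty,\phi)\cong \ast_{n=1}^\infty (C_r^*(\mathbb{N}),\delta_0)$.
   Context: A C*-probability space is a pair $(A,\rho)$ with $A$ a unital C*-algebra and $\rho$ a state on $A$. An embedding $\theta\colon(A,\rho)\to(B,\tau)$ of C*-probability spaces is an injective unital *-homomorphism $\theta\colon A\to B$ with $\tau\circ\theta=\rho$. For an ultrafilter $\mathcal U$ on a set $I$, the ultrapower $(A^{\mathcal U},\rho^{\mathcal U})$ is given by the norm ultrapower $A^{\mathcal U}=\ell^\infty(I,A)/\{(x_i)_i:\lim_{\mathcal U}\|x_i\|=0\}$ and $\rho^{\mathcal U}([(x_i)_{i}])=\lim_{\mathcal U}\rho(x_i)$. The diagonal embedding $(A,\rho)\to(A^{\mathcal U},\rho^{\mathcal U})$ sends $a$ to the class of the constant family. An embedding $\theta\colon(A,\rho)\to(B,\tau)$ is existential if there exist an ultrafilter $\mathcal U$ (on some set) and an embedding $\sigma\colon(B,\tau)\to(A^{\mathcal U},\rho^{\mathcal U})$ such that $\sigma\theta$ is the diagonal embedding of $A$ in $A^{\mathcal U}$. $\ast$ denotes the reduced free product of C*-probability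 spaces whose states have faithful GNS representations (Avitzour, Voiculescu), equipped with its free product state and its canonical embeddings of the factors; the first factor embedding is the canonical embedding of the first factor. A C*-probability space $(A,\rho)$, with $\rho$ having faithful GNS representation, is selfless if $A\neq\mathbb{C}$ and the first factor embedding $(A,\rho)\hookrightarrow(A,\rho)*(A,\rho)$ is existential. $C_r^*(\mathbb{N})$ denotes the C*-algebra on $\ell^2(\{0,1,2,\dots\})$ generated by the unilateral shift $s_1$ (the Toeplitz algebra), and $\delta_0$ denotes the vector state on it given by the basis vector at $0$; in particular $\delta_0(s_1^n)=0$ for all $n\geq1$. It is known that $\ast_{n=1}^\infty(C_r^*(\mathbb{N}),\delta_0)$ has underlying C*-algebra isomorphic to $\mathcal O_\infty$. *)

theory Defs
  imports
    "HOL-Analysis.Infinite_Sum"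
    "HOL-Library.FuncSet"
    "HOL-Library.Nonpos_Ints"
    "HOL-Algebra.QuotRing"
    "HOL-Algebra.Module"
    "HOL-Algebra.Subrings"
begin

section \<open>C*-algebras\<close>

definition complex_ring :: "complex ring" where
  "complex_ring = \<lparr>carrier = UNIV, mult = (*), one = 1, zero = 0, add = (+)\<rparr>"

record 'a cstar = "(complex, 'a) module" +
  star :: "'a \<Rightarrow> 'a"
  cnorm :: "'a \<Rightarrow> real"

definition cstar_tendsto :: "('a, 'm) cstar_scheme \<Rightarrow> (nat \<Rightarrow> 'a) \<Rightarrow> 'a \<Rightarrow> bool" where
  "cstar_tendsto A x l \<longleftrightarrow> (\<lambda>n. cnorm A (x n \<ominus>\<^bsub>A\<^esub> l)) \<longlonglongrightarrow> 0"

locale unital_cstar_algebra = ring A + Module.module complex_ring A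
  for A :: "('a, 'm) cstar_scheme" (structure) +
  assumes smult_mult_left:
      "\<lbrakk>x \<in> carrier A; y \<in> carrier A\<rbrakk> \<Longrightarrow> (c \<odot> x) \<otimes> y = c \<odot> (x \<otimes> y)"
    and smult_mult_right:
      "\<lbrakk>x \<in> carrier A; y \<in> carrier A\<rbrakk> \<Longrightarrow> x \<otimes> (c \<odot> y) = c \<odot> (x \<otimes> y)"
    and star_closed: "x \<in> carrier A \<Longrightarrow> star A x \<in> carrier A"
    and star_star: "x \<in> carrier A \<Longrightarrow> star A (star A x) = x"
    and star_add:
      "\<lbrakk>x \<in> carrier A; y \<in> carrier A\<rbrakk> \<Longrightarrow> star A (x \<oplus> y) = star A x \<oplus> star A y"
    and star_smult: "x \<in> carrier A \<Longrightarrow> star A (c \<odot> x) = cnj c \<odot> star A x"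
    and star_mult:
      "\<lbrakk>x \<in> carrier A; y \<in> carrier A\<rbrakk> \<Longrightarrow> star A (x \<otimes> y) = star A y \<otimes> star A x"
    and cnorm_nonneg: "x \<in> carrier A \<Longrightarrow> 0 \<le> cnorm A x"
    and cnorm_eq_0: "x \<in> carrier A \<Longrightarrow> cnorm A x = 0 \<Longrightarrow> x = \<zero>"
    and cnorm_triangle:
      "\<lbrakk>x \<in> carrier A; y \<in> carrier A\<rbrakk> \<Longrightarrow> cnorm A (x \<oplus> y) \<le> cnorm A x + cnorm A y"
    and cnorm_smult: "x \<in> carrier A \<Longrightarrow> cnorm A (c \<odot> x) = cmod c * cnorm A x"
    and cnorm_mult:
      "\<lbrakk>x \<in> carrier A; y \<in> carrier A\<rbrakk> \<Longrightarrow> cnorm A (x \<otimes> y) \<le> cnorm A x * cnorm A y"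
    and cstar_identity: "x \<in> carrier A \<Longrightarrow> cnorm A (star A x \<otimes> x) = (cnorm A x)\<^sup>2"
    and complete:
      "\<lbrakk>\<And>n. z n \<in> carrier A;
        \<And>e. 0 < e \<Longrightarrow> \<exists>M. \<forall>m\<ge>M. \<forall>n\<ge>M. cnorm A (z m \<ominus> z n) < e\<rbrakk>
       \<Longrightarrow> \<exists>l\<in>carrier A. cstar_tendsto A z l"

definition cstar_subalgebra :: "'a set \<Rightarrow> ('a, 'm) cstar_scheme \<Rightarrow> bool" where
  "cstar_subalgebra C A \<longleftrightarrow> subring C A \<and>
     (\<forall>c. \<forall>x\<in>C. c \<odot>\<^bsub>A\<^esub> x \<in> C) \<and>
     (\<forall>x\<in>C. star A x \<in> C) \<and>
     (\<forall>x l. (\<forall>n. x n \<in> C) \<and> l \<in> carrier A \<and> cstar_tendsto A x l \<longrightarrow> l \<in> C)"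

text \<open>The C*-subalgebra generated by a set and the unit.\<close>

definition cstar_generated :: "('a, 'm) cstar_scheme \<Rightarrow> 'a set \<Rightarrow> ('a, 'm) cstar_scheme" where
  "cstar_generated A S = A\<lparr>carrier := \<Inter>{C. cstar_subalgebra C A \<and> S \<subseteq> C}\<rparr>"


section \<open>C*-probability spaces and embeddings\<close>

definition state :: "('a, 'm) cstar_scheme \<Rightarrow> ('a \<Rightarrow> complex) \<Rightarrow> bool" where
  "state A \<rho> \<longleftrightarrow>
     (\<forall>x\<in>carrier A. \<forall>y\<in>carrier A. \<rho> (x \<oplus>\<^bsub>A\<^esub> y) = \<rho> x + \<rho> y) \<and>
     (\<forall>c. \<forall>x\<in>carrier A. \<rho> (c \<odot>\<^bsub>A\<^esub> x) = c * \<rho> x) \<and>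
     (\<forall>x\<in>carrier A. \<rho> (star A x \<otimes>\<^bsub>A\<^esub> x) \<in> \<real>\<^sub>\<ge>\<^sub>0) \<and>
     \<rho> \<one>\<^bsub>A\<^esub> = 1"

definition tracial_state :: "('a, 'm) cstar_scheme \<Rightarrow> ('a \<Rightarrow> complex) \<Rightarrow> bool" where
  "tracial_state A \<tau> \<longleftrightarrow> state A \<tau> \<and>
     (\<forall>x\<in>carrier A. \<forall>y\<in>carrier A. \<tau> (x \<otimes>\<^bsub>A\<^esub> y) = \<tau> (y \<otimes>\<^bsub>A\<^esub> x))"

definition cstar_prob_space :: "('a, 'm) cstar_scheme \<Rightarrow> ('a \<Rightarrow> complex) \<Rightarrow> bool" where
  "cstar_prob_space A \<rho> \<longleftrightarrow> unital_cstar_algebra A \<and> state A \<rho>"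

definition unital_star_hom ::
    "('a, 'm) cstar_scheme \<Rightarrow> ('b, 'n) cstar_scheme \<Rightarrow> ('a \<Rightarrow> 'b) \<Rightarrow> bool" where
  "unital_star_hom A B \<theta> \<longleftrightarrow> \<theta> \<in> ring_hom A B \<and>
     (\<forall>c. \<forall>x\<in>carrier A. \<theta> (c \<odot>\<^bsub>A\<^esub> x) = c \<odot>\<^bsub>B\<^esub> \<theta> x) \<and>
     (\<forall>x\<in>carrier A. \<theta> (star A x) = star B (\<theta> x))"

definition embedding ::
    "('a, 'm) cstar_scheme \<Rightarrow> ('a \<Rightarrow> complex) \<Rightarrow> ('b, 'n) cstar_scheme \<Rightarrow> ('b \<Rightarrow> complex)
      \<Rightarrow> ('a \<Rightarrow> 'b) \<Rightarrow> bool" where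
  "embedding A \<rho> B \<tau> \<theta> \<longleftrightarrow> unital_star_hom A B \<theta> \<and> inj_on \<theta> (carrier A) \<and>
     (\<forall>x\<in>carrier A. \<tau> (\<theta> x) = \<rho> x)"

definition prob_space_isomorphism ::
    "('a, 'm) cstar_scheme \<Rightarrow> ('a \<Rightarrow> complex) \<Rightarrow> ('b, 'n) cstar_scheme \<Rightarrow> ('b \<Rightarrow> complex)
      \<Rightarrow> ('a \<Rightarrow> 'b) \<Rightarrow> bool" where
  "prob_space_isomorphism A \<rho> B \<tau> \<theta> \<longleftrightarrow>
     embedding A \<rho> B \<tau> \<theta> \<and> \<theta> ` carrier A = carrier B"


section \<open>Ultrapowers and existential embeddings\<close>

text \<open>
  A filter on the type \<open>'i\<close> also stands for filters on its subsets: an ultrafilter on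
  \<open>J \<subseteq> UNIV\<close> generates an ultrafilter on \<open>'i\<close> with the same ultrapowers.
\<close>

definition ultrafilter :: "'i filter \<Rightarrow> bool" where
  "ultrafilter U \<longleftrightarrow> U \<noteq> bot \<and> (\<forall>P. eventually P U \<or> eventually (\<lambda>i. \<not> P i) U)"

definition linf :: "('a, 'm) cstar_scheme \<Rightarrow> ('i \<Rightarrow> 'a) cstar" where
  "linf A = \<lparr>
     carrier = {x. (\<forall>i. x i \<in> carrier A) \<and> bdd_above (range (\<lambda>i. cnorm A (x i)))},
     mult = (\<lambda>x y i. x i \<otimes>\<^bsub>A\<^esub> y i),
     one = (\<lambda>i. \<one>\<^bsub>A\<^esub>),
     zero = (\<lambda>i. \<zero>\<^bsub>A\<^esub>),
     add = (\<lambda>x y i. x i \<oplus>\<^bsub>A\<^esub> y i),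
     smult = (\<lambda>c x i. c \<odot>\<^bsub>A\<^esub> x i),
     star = (\<lambda>x i. star A (x i)),
     cnorm = (\<lambda>x. SUP i. cnorm A (x i))\<rparr>"

definition ultra_null :: "('a, 'm) cstar_scheme \<Rightarrow> 'i filter \<Rightarrow> ('i \<Rightarrow> 'a) set" where
  "ultra_null A U = {x \<in> carrier (linf A). ((\<lambda>i. cnorm A (x i)) \<longlongrightarrow> 0) U}"

definition ultrapower :: "('a, 'm) cstar_scheme \<Rightarrow> 'i filter \<Rightarrow> ('i \<Rightarrow> 'a) set cstar" where
  "ultrapower A U = (let L = linf A; J = ultra_null A U; Q = L Quot J in \<lparr>
     carrier = carrier Q,
     mult = mult Q,
     one = one Q,
     zero = zero Q,
     add = add Q,
     smult = (\<lambda>c X. \<Union>x\<in>X. J +>\<^bsub>L\<^esub> (c \<odot>\<^bsub>L\<^esub> x)),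
     star = (\<lambda>X. \<Union>x\<in>X. J +>\<^bsub>L\<^esub> star L x),
     cnorm = (\<lambda>X. INF x\<in>X. cnorm L x)\<rparr>)"

definition ultrapower_state ::
    "('a \<Rightarrow> complex) \<Rightarrow> 'i filter \<Rightarrow> ('i \<Rightarrow> 'a) set \<Rightarrow> complex" where
  "ultrapower_state \<rho> U X = (THE z. \<exists>x\<in>X. ((\<lambda>i. \<rho> (x i)) \<longlongrightarrow> z) U)"

definition diagonal_embedding ::
    "('a, 'm) cstar_scheme \<Rightarrow> 'i filter \<Rightarrow> 'a \<Rightarrow> ('i \<Rightarrow> 'a) set" where
  "diagonal_embedding A U a = ultra_null A U +>\<^bsub>linf A\<^esub> (\<lambda>i. a)"

text \<open>
  HOL cannot quantify over all index sets inside a formula. The index type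
  \<open>'b set \<times> nat\<close> entails no loss of generality: given \<open>\<sigma>\<close> for an ultrafilter on any set
  whatsoever, choose for each finite \<open>F \<subseteq> B\<close> and each \<open>n\<close> an index at which
  representatives of the \<open>\<sigma> b\<close>, \<open>b \<in> F\<close>, satisfy all relevant relations up to
  \<open>1/(n+1)\<close>; an ultrafilter on the pairs \<open>(F, n)\<close> containing all tails then serves as well.
\<close>

definition existential ::
    "('a, 'm) cstar_scheme \<Rightarrow> ('a \<Rightarrow> complex) \<Rightarrow> ('b, 'n) cstar_scheme \<Rightarrow> ('b \<Rightarrow> complex)
      \<Rightarrow> ('a \<Rightarrow> 'b) \<Rightarrow> bool" where
  "existential A \<rho> B \<tau> \<theta> \<longleftrightarrow> embedding A \<rho> B \<tau> \<theta> \<and>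
     (\<exists>(U :: ('b set \<times> nat) filter) \<sigma>. ultrafilter U \<and>
        embedding B \<tau> (ultrapower A U) (ultrapower_state \<rho> U) \<sigma> \<and>
        (\<forall>a\<in>carrier A. \<sigma> (\<theta> a) = diagonal_embedding A U a))"


section \<open>Hilbert spaces, completions and bounded operators\<close>

text \<open>
  Complex vector spaces with a semi-inner product, linear in the first argument. The ring
  fields \<open>mult\<close> and \<open>one\<close> inherited from modules play no role.
\<close>

record 'v ip_space = "(complex, 'v) module" +
  ip :: "'v \<Rightarrow> 'v \<Rightarrow> complex"

definition vnorm :: "('v, 'm) ip_space_scheme \<Rightarrow> 'v \<Rightarrow> real" where
  "vnorm V x = sqrt (Re (ip V x x))"

definition cauchy_module :: "('v, 'm) ip_space_scheme \<Rightarrow> (complex, nat \<Rightarrow> 'v) module" where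
  "cauchy_module V = \<lparr>
     carrier = {x. (\<forall>n. x n \<in> carrier V) \<and>
       (\<forall>e>0. \<exists>M. \<forall>m\<ge>M. \<forall>n\<ge>M. vnorm V (x m \<ominus>\<^bsub>V\<^esub> x n) < e)},
     mult = undefined,
     one = undefined,
     zero = (\<lambda>n. \<zero>\<^bsub>V\<^esub>),
     add = (\<lambda>x y n. x n \<oplus>\<^bsub>V\<^esub> y n),
     smult = (\<lambda>c x n. c \<odot>\<^bsub>V\<^esub> x n)\<rparr>"

definition null_sequences :: "('v, 'm) ip_space_scheme \<Rightarrow> (nat \<Rightarrow> 'v) set" where
  "null_sequences V = {x. (\<forall>n. x n \<in> carrier V) \<and> (\<lambda>n. vnorm V (x n)) \<longlonglongrightarrow> 0}"

text \<open>The Hausdorff completion: Cauchy sequences modulo null sequences.\<close>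

definition completion :: "('v, 'm) ip_space_scheme \<Rightarrow> (nat \<Rightarrow> 'v) set ip_space" where
  "completion V = (let C = cauchy_module V; N = null_sequences V in \<lparr>
     carrier = a_rcosets\<^bsub>C\<^esub> N,
     mult = undefined,
     one = undefined,
     zero = N,
     add = set_add C,
     smult = (\<lambda>c X. \<Union>x\<in>X. N +>\<^bsub>C\<^esub> (c \<odot>\<^bsub>C\<^esub> x)),
     ip = (\<lambda>X Y. THE z. \<exists>x\<in>X. \<exists>y\<in>Y. (\<lambda>n. ip V (x n) (y n)) \<longlonglongrightarrow> z)\<rparr>)"

definition completion_vec :: "('v, 'm) ip_space_scheme \<Rightarrow> 'v \<Rightarrow> (nat \<Rightarrow> 'v) set" where
  "completion_vec V v = null_sequences V +>\<^bsub>cauchy_module V\<^esub> (\<lambda>n. v)"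

text \<open>The continuous extension of a bounded linear operator \<open>T\<close> to the completion.\<close>

definition completion_op ::
    "('v, 'm) ip_space_scheme \<Rightarrow> ('v \<Rightarrow> 'v) \<Rightarrow> (nat \<Rightarrow> 'v) set \<Rightarrow> (nat \<Rightarrow> 'v) set" where
  "completion_op V T = (\<lambda>X\<in>carrier (completion V).
     \<Union>x\<in>X. null_sequences V +>\<^bsub>cauchy_module V\<^esub> (\<lambda>n. T (x n)))"

definition bounded_operators :: "('v, 'm) ip_space_scheme \<Rightarrow> ('v \<Rightarrow> 'v) set" where
  "bounded_operators H = {T \<in> carrier H \<rightarrow>\<^sub>E carrier H.
     (\<forall>x\<in>carrier H. \<forall>y\<in>carrier H. T (x \<oplus>\<^bsub>H\<^esub> y) = T x \<oplus>\<^bsub>H\<^esub> T y) \<and>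
     (\<forall>c. \<forall>x\<in>carrier H. T (c \<odot>\<^bsub>H\<^esub> x) = c \<odot>\<^bsub>H\<^esub> T x) \<and>
     (\<exists>K. \<forall>x\<in>carrier H. vnorm H (T x) \<le> K * vnorm H x)}"

definition operator_algebra :: "('v, 'm) ip_space_scheme \<Rightarrow> ('v \<Rightarrow> 'v) cstar" where
  "operator_algebra H = \<lparr>
     carrier = bounded_operators H,
     mult = compose (carrier H),
     one = (\<lambda>x\<in>carrier H. x),
     zero = (\<lambda>x\<in>carrier H. \<zero>\<^bsub>H\<^esub>),
     add = (\<lambda>S T. \<lambda>x\<in>carrier H. S x \<oplus>\<^bsub>H\<^esub> T x),
     smult = (\<lambda>c T. \<lambda>x\<in>carrier H. c \<odot>\<^bsub>H\<^esub> T x),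
     star = (\<lambda>T. THE S. S \<in> bounded_operators H \<and>
       (\<forall>x\<in>carrier H. \<forall>y\<in>carrier H. ip H (T x) y = ip H x (S y))),
     cnorm = (\<lambda>T. SUP x\<in>{x\<in>carrier H. vnorm H x \<le> 1}. vnorm H (T x))\<rparr>"

definition vector_state :: "('v, 'm) ip_space_scheme \<Rightarrow> 'v \<Rightarrow> ('v \<Rightarrow> 'v) \<Rightarrow> complex" where
  "vector_state H \<xi> T = ip H (T \<xi>) \<xi>"

definition ell2 :: "'x set \<Rightarrow> ('x \<Rightarrow> complex) ip_space" where
  "ell2 X = \<lparr>
     carrier = {f. (\<forall>x. x \<notin> X \<longrightarrow> f x = 0) \<and> (\<lambda>x. (cmod (f x))\<^sup>2) summable_on X},
     mult = undefined,
     one = undefined,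
     zero = (\<lambda>x. 0),
     add = (\<lambda>f g x. f x + g x),
     smult = (\<lambda>c f x. c * f x),
     ip = (\<lambda>f g. \<Sum>\<^sub>\<infinity>x\<in>X. f x * cnj (g x))\<rparr>"


section \<open>The GNS representation\<close>

definition gns_prespace :: "('a, 'm) cstar_scheme \<Rightarrow> ('a \<Rightarrow> complex) \<Rightarrow> 'a ip_space" where
  "gns_prespace A \<rho> = \<lparr>
     carrier = carrier A,
     mult = mult A,
     one = one A,
     zero = zero A,
     add = add A,
     smult = smult A,
     ip = (\<lambda>x y. \<rho> (star A y \<otimes>\<^bsub>A\<^esub> x))\<rparr>"

definition gns_rep ::
    "('a, 'm) cstar_scheme \<Rightarrow> ('a \<Rightarrow> complex) \<Rightarrow> 'a \<Rightarrow> (nat \<Rightarrow> 'a) set \<Rightarrow> (nat \<Rightarrow> 'a) set" where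
  "gns_rep A \<rho> a = completion_op (gns_prespace A \<rho>) (\<lambda>x. a \<otimes>\<^bsub>A\<^esub> x)"

definition faithful_gns :: "('a, 'm) cstar_scheme \<Rightarrow> ('a \<Rightarrow> complex) \<Rightarrow> bool" where
  "faithful_gns A \<rho> \<longleftrightarrow> inj_on (gns_rep A \<rho>) (carrier A)"


section \<open>Reduced free products\<close>

text \<open>
  Voiculescu's construction for a family \<open>(A i, \<rho> i)\<close>, \<open>i \<in> I\<close>. The free product Hilbert space
  \[ \mathbb{C}\Omega \oplus \bigoplus_{n \ge 1} \bigoplus_{i_1 \ne i_2 \ne \dots \ne i_n}
     H_{i_1}^\circ \otimes \dots \otimes H_{i_n}^\circ, \]
  where \<open>H\<^sub>i\<close> is the GNS space of \<open>\<rho> i\<close> with cyclic vector \<open>\<xi>\<^sub>i\<close> and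
  \<open>H\<^sub>i\<^sup>\<circ>\<close> the orthogonal complement of \<open>\<xi>\<^sub>i\<close>, is
  the Hausdorff completion of the space of formal linear combinations of words
  \<open>[(i\<^sub>1, a\<^sub>1), \<dots>, (i\<^sub>n, a\<^sub>n)]\<close> with \<open>a\<^sub>k \<in> A i\<^sub>k\<close>, \<open>\<rho> i\<^sub>k a\<^sub>k = 0\<close>; such a word
  represents the elementary tensor of the classes of the \<open>a\<^sub>k\<close> (these classes are dense in
  the \<open>H\<^sub>i\<^sup>\<circ>\<close>), and \<open>[]\<close> represents \<open>\<Omega>\<close>. The relations of the tensor
  product hold modulo vectors of norm zero.
\<close>

definition free_words ::
    "'i set \<Rightarrow> ('i \<Rightarrow> ('a, 'm) cstar_scheme) \<Rightarrow> ('i \<Rightarrow> 'a \<Rightarrow> complex) \<Rightarrow> ('i \<times> 'a) list set" where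
  "free_words I A \<rho> = {w. distinct_adj (map fst w) \<and>
     (\<forall>(i, a)\<in>set w. i \<in> I \<and> a \<in> carrier (A i) \<and> \<rho> i a = 0)}"

fun word_ip ::
    "('i \<Rightarrow> ('a, 'm) cstar_scheme) \<Rightarrow> ('i \<Rightarrow> 'a \<Rightarrow> complex) \<Rightarrow> ('i \<times> 'a) list \<Rightarrow> ('i \<times> 'a) list
      \<Rightarrow> complex" where
  "word_ip A \<rho> [] [] = 1"
| "word_ip A \<rho> ((i, a) # v) ((j, b) # w) =
     (if i = j then \<rho> i (star (A i) b \<otimes>\<^bsub>A i\<^esub> a) * word_ip A \<rho> v w else 0)"
| "word_ip A \<rho> _ _ = 0"

definition free_prespace ::
    "'i set \<Rightarrow> ('i \<Rightarrow> ('a, 'm) cstar_scheme) \<Rightarrow> ('i \<Rightarrow> 'a \<Rightarrow> complex)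
      \<Rightarrow> (('i \<times> 'a) list \<Rightarrow> complex) ip_space" where
  "free_prespace I A \<rho> = \<lparr>
     carrier = {f. finite {w. f w \<noteq> 0} \<and> {w. f w \<noteq> 0} \<subseteq> free_words I A \<rho>},
     mult = undefined,
     one = undefined,
     zero = (\<lambda>w. 0),
     add = (\<lambda>f g w. f w + g w),
     smult = (\<lambda>c f w. c * f w),
     ip = (\<lambda>f g. \<Sum>v | f v \<noteq> 0. \<Sum>w | g w \<noteq> 0. f v * cnj (g w) * word_ip A \<rho> v w)\<rparr>"

definition word_vec :: "('i \<times> 'a) list \<Rightarrow> ('i \<times> 'a) list \<Rightarrow> complex" where
  "word_vec w = (\<lambda>u. if u = w then 1 else 0)"

text \<open>
  The unitary \<open>H \<cong> H\<^sub>i \<otimes> H(i)\<close>, where \<open>H(i)\<close> is spanned by the words not starting with \<open>i\<close>: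
  a word splits into its leading \<open>i\<close>-letter, taken to be the unit if there is none, and the rest.
\<close>

fun split_word :: "('i \<Rightarrow> ('a, 'm) cstar_scheme) \<Rightarrow> 'i \<Rightarrow> ('i \<times> 'a) list \<Rightarrow> 'a \<times> ('i \<times> 'a) list"
where
  "split_word A i [] = (\<one>\<^bsub>A i\<^esub>, [])"
| "split_word A i ((j, b) # v) = (if j = i then (b, v) else (\<one>\<^bsub>A i\<^esub>, (j, b) # v))"

text \<open>
  The action \<open>a \<otimes> 1\<close> on \<open>H\<^sub>i \<otimes> H(i)\<close>: if \<open>w\<close> splits into \<open>b\<close> and \<open>v\<close>, then \<open>w\<close> is sent to
  \<open>(ab)\<^sup>\<circ> \<otimes> v + \<rho>(ab) v\<close> with \<open>x\<^sup>\<circ> = x - \<rho>(x) 1\<close>.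
\<close>

definition free_act_word ::
    "('i \<Rightarrow> ('a, 'm) cstar_scheme) \<Rightarrow> ('i \<Rightarrow> 'a \<Rightarrow> complex) \<Rightarrow> 'i \<Rightarrow> 'a
      \<Rightarrow> ('i \<times> 'a) list \<Rightarrow> ('i \<times> 'a) list \<Rightarrow> complex" where
  "free_act_word A \<rho> i a w = (let (b, v) = split_word A i w; x = a \<otimes>\<^bsub>A i\<^esub> b in
     (\<lambda>u. word_vec ((i, x \<ominus>\<^bsub>A i\<^esub> (\<rho> i x \<odot>\<^bsub>A i\<^esub> \<one>\<^bsub>A i\<^esub>)) # v) u + \<rho> i x * word_vec v u))"

definition free_act ::
    "('i \<Rightarrow> ('a, 'm) cstar_scheme) \<Rightarrow> ('i \<Rightarrow> 'a \<Rightarrow> complex) \<Rightarrow> 'i \<Rightarrow> 'a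
      \<Rightarrow> (('i \<times> 'a) list \<Rightarrow> complex) \<Rightarrow> ('i \<times> 'a) list \<Rightarrow> complex" where
  "free_act A \<rho> i a f = (\<lambda>u. \<Sum>w | f w \<noteq> 0. f w * free_act_word A \<rho> i a w u)"

type_synonym ('i, 'a) free_vec = "(nat \<Rightarrow> ('i \<times> 'a) list \<Rightarrow> complex) set"

definition free_hilbert ::
    "'i set \<Rightarrow> ('i \<Rightarrow> ('a, 'm) cstar_scheme) \<Rightarrow> ('i \<Rightarrow> 'a \<Rightarrow> complex)
      \<Rightarrow> ('i, 'a) free_vec ip_space" where
  "free_hilbert I A \<rho> = completion (free_prespace I A \<rho>)"

definition free_embedding ::
    "'i set \<Rightarrow> ('i \<Rightarrow> ('a, 'm) cstar_scheme) \<Rightarrow> ('i \<Rightarrow> 'a \<Rightarrow> complex) \<Rightarrow> 'i \<Rightarrow> 'a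
      \<Rightarrow> ('i, 'a) free_vec \<Rightarrow> ('i, 'a) free_vec" where
  "free_embedding I A \<rho> i a = completion_op (free_prespace I A \<rho>) (free_act A \<rho> i a)"

definition free_product ::
    "'i set \<Rightarrow> ('i \<Rightarrow> ('a, 'm) cstar_scheme) \<Rightarrow> ('i \<Rightarrow> 'a \<Rightarrow> complex)
      \<Rightarrow> (('i, 'a) free_vec \<Rightarrow> ('i, 'a) free_vec) cstar" where
  "free_product I A \<rho> = cstar_generated (operator_algebra (free_hilbert I A \<rho>))
     (\<Union>i\<in>I. free_embedding I A \<rho> i ` carrier (A i))"

definition free_product_state ::
    "'i set \<Rightarrow> ('i \<Rightarrow> ('a, 'm) cstar_scheme) \<Rightarrow> ('i \<Rightarrow> 'a \<Rightarrow> complex)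
      \<Rightarrow> (('i, 'a) free_vec \<Rightarrow> ('i, 'a) free_vec) \<Rightarrow> complex" where
  "free_product_state I A \<rho> = vector_state (free_hilbert I A \<rho>)
     (completion_vec (free_prespace I A \<rho>) (word_vec []))"

definition selfless :: "('a, 'm) cstar_scheme \<Rightarrow> ('a \<Rightarrow> complex) \<Rightarrow> bool" where
  "selfless A \<rho> \<longleftrightarrow> cstar_prob_space A \<rho> \<and> faithful_gns A \<rho> \<and>
     carrier A \<noteq> range (\<lambda>c. c \<odot>\<^bsub>A\<^esub> \<one>\<^bsub>A\<^esub>) \<and>
     existential A \<rho>
       (free_product {1, 2 :: nat} (\<lambda>_. A) (\<lambda>_. \<rho>))
       (free_product_state {1, 2} (\<lambda>_. A) (\<lambda>_. \<rho>))
       (free_embedding {1, 2} (\<lambda>_. A) (\<lambda>_. \<rho>) 1)"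


section \<open>Reduced group C*-algebras, Toeplitz and Cuntz algebras\<close>

definition left_regular ::
    "('g, 'm) monoid_scheme \<Rightarrow> 'g \<Rightarrow> ('g \<Rightarrow> complex) \<Rightarrow> 'g \<Rightarrow> complex" where
  "left_regular G g = (\<lambda>f\<in>carrier (ell2 (carrier G)).
     (\<lambda>h. if h \<in> carrier G then f (inv\<^bsub>G\<^esub> g \<otimes>\<^bsub>G\<^esub> h) else 0))"

definition reduced_group_cstar :: "('g, 'm) monoid_scheme \<Rightarrow> (('g \<Rightarrow> complex) \<Rightarrow> 'g \<Rightarrow> complex) cstar"
where
  "reduced_group_cstar G =
     cstar_generated (operator_algebra (ell2 (carrier G))) (left_regular G ` carrier G)"

text \<open>
  The free group on \<open>X\<close> as reduced words; the letter \<open>(x, True)\<close> stands for the generator \<open>x\<close>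
  and \<open>(x, False)\<close> for its inverse.
\<close>

definition inv_letter :: "'x \<times> bool \<Rightarrow> 'x \<times> bool" where
  "inv_letter p = (fst p, \<not> snd p)"

fun reduce_cons :: "'x \<times> bool \<Rightarrow> ('x \<times> bool) list \<Rightarrow> ('x \<times> bool) list" where
  "reduce_cons p [] = [p]"
| "reduce_cons p (q # w) = (if q = inv_letter p then w else p # q # w)"

definition free_group :: "'x set \<Rightarrow> ('x \<times> bool) list monoid" where
  "free_group X = \<lparr>
     carrier = {w. fst ` set w \<subseteq> X \<and> successively (\<lambda>p q. q \<noteq> inv_letter p) w},
     mult = foldr reduce_cons,
     one = []\<rparr>"

definition unilateral_shift :: "(nat \<Rightarrow> complex) \<Rightarrow> nat \<Rightarrow> complex" where
  "unilateral_shift = (\<lambda>f\<in>carrier (ell2 UNIV). (\<lambda>n. case n of 0 \<Rightarrow> 0 | Suc m \<Rightarrow> f m))"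

definition toeplitz_algebra :: "((nat \<Rightarrow> complex) \<Rightarrow> nat \<Rightarrow> complex) cstar" where
  "toeplitz_algebra = cstar_generated (operator_algebra (ell2 UNIV)) {unilateral_shift}"

definition toeplitz_state :: "((nat \<Rightarrow> complex) \<Rightarrow> nat \<Rightarrow> complex) \<Rightarrow> complex" where
  "toeplitz_state = vector_state (ell2 UNIV) (\<lambda>n. if n = 0 then 1 else 0)"

text \<open>
  The Cuntz algebra on infinitely many generators, in Cuntz's sense: a C*-algebra generated
  by a sequence of isometries with pairwise orthogonal ranges. All of these are isomorphic.
\<close>

definition cuntz_algebra_infinity :: "('a, 'm) cstar_scheme \<Rightarrow> (nat \<Rightarrow> 'a) \<Rightarrow> bool" where
  "cuntz_algebra_infinity A s \<longleftrightarrow> unital_cstar_algebra A \<and> \<one>\<^bsub>A\<^esub> \<noteq> \<zero>\<^bsub>A\<^esub> \<and> range s \<subseteq> carrier A \<and>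
     (\<forall>m n. star A (s m) \<otimes>\<^bsub>A\<^esub> s n = (if m = n then \<one>\<^bsub>A\<^esub> else \<zero>\<^bsub>A\<^esub>)) \<and>
     carrier (cstar_generated A (range s)) = carrier A"

end

theory Submission
  imports Defs "HOL-Analysis.Convex"
begin

text \<open>
  Let \<open>x\<^sub>0, x\<^sub>1, \<dots>\<close> generate \<open>A\<close>, and suppose that for every injection
  \<open>f : \<nat> \<times> {1, 2} \<rightarrow> \<nat>\<close> the copies of the \<open>x\<^sub>n\<close> in the two factors of \<open>A * A\<close> have the same
  *-moments as the \<open>x\<^bsub>f(n, b)\<^esub>\<close> in \<open>A\<close>. Choose \<open>f\<^sub>k\<close> with \<open>f\<^sub>k(n, 1) = n\<close> for \<open>n < k\<close>.
  The classes of \<open>(x\<^bsub>f\<^sub>k(n, b)\<^esub>)\<^sub>k\<close> in an ultrapower of \<open>A\<close> then again have the *-moments of the copies.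
  As the norm is determined by the *-moments when the GNS representation is isometric, this defines an
  embedding of \<open>A * A\<close>, which is the diagonal embedding on the first factor.

  For the free group the *-moments are given by reduction of words, once Powers' averaging argument has
  identified \<open>\<tau>\<close> with the canonical trace. For \<open>\<O>\<^sub>\<infinity>\<close> the *-moments of the shifts are determined by
  \<open>s\<^sub>m\<^sup>* s\<^sub>n = \<delta>\<^sub>m\<^sub>n\<close> and \<open>\<phi>(s\<^sub>n s\<^sub>n\<^sup>*) = 0\<close>, relations that persist in \<open>A * A\<close> because elements
  with \<open>\<rho>(aa\<^sup>*) = 0\<close> in different factors have orthogonal ranges.
\<close>

section \<open>Complex vector spaces and seminorms\<close>

text \<open>The delicate point is that norms must be read off from moments. Passing from a faithful
  GNS representation to an isometric one is spectral theory; here the isometric property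
  \<open>norming\<close> is carried instead and is obtained for each concrete algebra from a cyclic
  vector. The only substitute for functional calculus is a square root of \<open>1 - h\<close> for
  self-adjoint \<open>h\<close> of norm below 1. It yields contractivity of *-homomorphisms, the GNS
  bound for states, and boundedness of representations on spaces with null vectors. Since
  \<open>norming\<close> tests an operator against the whole algebra, the letters compared must
  generate it; hence the index maps that build the embedding are bijections. The free product
  Hilbert space starts from formal combinations of words, where positivity of the form is not
  visible. It comes from the Schur product theorem, applied letter by letter. In Powers' argument n
  conjugates by fresh generators have a sum of norm at most 2 sqrt n, while the trace of the sum
  grows like n.\<close>

lemma complex_ring_simps [simp]:
  "carrier complex_ring = UNIV" "mult complex_ring = (*)" "one complex_ring = 1"
  "zero complex_ring = 0" "add complex_ring = (+)"
  by (simp_all add: complex_ring_def)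

lemma cring_complex_ring: "cring complex_ring"
proof (rule cringI)
  show "abelian_group complex_ring"
    by (rule abelian_groupI) (auto simp: algebra_simps intro: exI[of _ "- x" for x])
  show "comm_monoid complex_ring"
    by (rule comm_monoidI) (auto simp: algebra_simps)
qed (auto simp: algebra_simps)

lemma complex_ring_a_inv [simp]: "\<ominus>\<^bsub>complex_ring\<^esub> c = - c"
proof -
  interpret cring complex_ring by (rule cring_complex_ring)
  show ?thesis by (rule minus_equality) auto
qed

text \<open>All complex numbers are scalars, so the membership conditions on scalars are trivial;
  the laws below restate the module axioms without them.\<close>

locale cvec = Module.module complex_ring V for V :: "(complex, 'v, 'm) module_scheme" (structure)
begin

lemmas vec_simprules [algebra abelian_group "zero V" "add V" "a_inv V" "a_minus V"] =
  M.a_closed M.zero_closed M.a_inv_closed M.minus_closed M.a_assoc M.l_zero M.l_neg M.a_comm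
  M.minus_eq M.r_zero M.r_neg M.r_neg2 M.r_neg1 M.minus_add M.minus_minus M.add.inv_one M.a_lcomm

lemma sm_closed [simp, intro]: "x \<in> carrier V \<Longrightarrow> c \<odot> x \<in> carrier V"
  by (rule smult_closed) auto

lemma sm_add_left: "x \<in> carrier V \<Longrightarrow> (c + d) \<odot> x = c \<odot> x \<oplus> d \<odot> x"
  using smult_l_distr[of c d x] by simp

lemma sm_add_right: "x \<in> carrier V \<Longrightarrow> y \<in> carrier V \<Longrightarrow> c \<odot> (x \<oplus> y) = c \<odot> x \<oplus> c \<odot> y"
  using smult_r_distr[of c x y] by simp

lemma sm_assoc: "x \<in> carrier V \<Longrightarrow> c \<odot> (d \<odot> x) = (c * d) \<odot> x"
  using smult_assoc1[of c d x] by simp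

lemma sm_one [simp]: "x \<in> carrier V \<Longrightarrow> 1 \<odot> x = x"
  using smult_one[of x] by simp

lemma sm_zero_left [simp]: "x \<in> carrier V \<Longrightarrow> 0 \<odot> x = \<zero>"
  using smult_l_null[of x] by simp

lemma sm_zero_right [simp]: "c \<odot> \<zero> = \<zero>"
  using smult_r_null[of c] by simp

lemma sm_minus_one: "x \<in> carrier V \<Longrightarrow> \<ominus> x = (- 1) \<odot> x"
  using smult_l_minus[of 1 x] by simp

lemma sm_uminus_left: "x \<in> carrier V \<Longrightarrow> (- c) \<odot> x = \<ominus> (c \<odot> x)"
  using smult_l_minus[of c x] by simp

lemma sm_uminus_right: "x \<in> carrier V \<Longrightarrow> c \<odot> (\<ominus> x) = \<ominus> (c \<odot> x)"
  using smult_r_minus[of c x] by simp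

lemma sm_diff_right:
  "x \<in> carrier V \<Longrightarrow> y \<in> carrier V \<Longrightarrow> c \<odot> (x \<ominus> y) = c \<odot> x \<ominus> c \<odot> y"
  by (simp add: M.minus_eq sm_add_right sm_uminus_right)

lemma diff_self [simp]: "x \<in> carrier V \<Longrightarrow> x \<ominus> x = \<zero>"
  by (simp add: M.minus_eq M.r_neg)

lemma diff_eq_zero: "x \<in> carrier V \<Longrightarrow> y \<in> carrier V \<Longrightarrow> x \<ominus> y = \<zero> \<Longrightarrow> x = y"
  by (simp add: M.minus_eq M.minus_equality M.add.inv_solve_right')

end

lemma complex_moduleI:
  fixes V (structure)
  assumes "abelian_group V"
    and "\<And>c x. x \<in> carrier V \<Longrightarrow> c \<odot> x \<in> carrier V"
    and "\<And>c d x. x \<in> carrier V \<Longrightarrow> (c + d) \<odot> x = c \<odot> x \<oplus> d \<odot> x"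
    and "\<And>c x y. x \<in> carrier V \<Longrightarrow> y \<in> carrier V \<Longrightarrow> c \<odot> (x \<oplus> y) = c \<odot> x \<oplus> c \<odot> y"
    and "\<And>c d x. x \<in> carrier V \<Longrightarrow> (c * d) \<odot> x = c \<odot> (d \<odot> x)"
    and "\<And>x. x \<in> carrier V \<Longrightarrow> 1 \<odot> x = x"
  shows "Module.module complex_ring V"
  by (rule moduleI) (simp_all add: assms cring_complex_ring)

text \<open>Common ground of C*-norms and of the seminorms of semi-inner products. The latter may
  vanish on nonzero vectors, so limits are unique only up to seminorm zero.\<close>

locale seminormed = cvec V for V :: "(complex, 'v, 'm) module_scheme" (structure) +
  fixes nrm :: "'v \<Rightarrow> real"
  assumes nrm_nonneg: "x \<in> carrier V \<Longrightarrow> 0 \<le> nrm x"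
    and nrm_triangle: "x \<in> carrier V \<Longrightarrow> y \<in> carrier V \<Longrightarrow> nrm (x \<oplus> y) \<le> nrm x + nrm y"
    and nrm_smult: "x \<in> carrier V \<Longrightarrow> nrm (c \<odot> x) = cmod c * nrm x"
begin

lemma nrm_zero [simp]: "nrm \<zero> = 0"
  using nrm_smult[of \<zero> 0] by simp

lemma nrm_uminus [simp]: "x \<in> carrier V \<Longrightarrow> nrm (\<ominus> x) = nrm x"
  using nrm_smult[of x "- 1"] by (simp add: sm_minus_one)

lemma nrm_diff_commute: "x \<in> carrier V \<Longrightarrow> y \<in> carrier V \<Longrightarrow> nrm (x \<ominus> y) = nrm (y \<ominus> x)"
  using nrm_uminus[of "x \<ominus> y"] by (simp add: M.minus_eq M.minus_add M.a_comm)

lemma nrm_diff_triangle: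
  assumes "x \<in> carrier V" "y \<in> carrier V" "z \<in> carrier V"
  shows "nrm (x \<ominus> z) \<le> nrm (x \<ominus> y) + nrm (y \<ominus> z)"
proof -
  have "x \<ominus> z = (x \<ominus> y) \<oplus> (y \<ominus> z)" using assms by algebra
  then show ?thesis using nrm_triangle[of "x \<ominus> y" "y \<ominus> z"] assms by simp
qed

lemma nrm_le_diff:
  assumes "x \<in> carrier V" "y \<in> carrier V"
  shows "nrm x \<le> nrm y + nrm (x \<ominus> y)"
proof -
  have "x = y \<oplus> (x \<ominus> y)" using assms by algebra
  then show ?thesis using nrm_triangle[of y "x \<ominus> y"] assms by simp
qed

lemma nrm_abs_diff:
  assumes "x \<in> carrier V" "y \<in> carrier V"
  shows "\<bar>nrm x - nrm y\<bar> \<le> nrm (x \<ominus> y)"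
  using nrm_le_diff[of x y] nrm_le_diff[of y x] nrm_diff_commute[of x y] assms by auto

lemma nrm_diff_add:
  assumes "x \<in> carrier V" "y \<in> carrier V" "x' \<in> carrier V" "y' \<in> carrier V"
  shows "nrm ((x \<oplus> y) \<ominus> (x' \<oplus> y')) \<le> nrm (x \<ominus> x') + nrm (y \<ominus> y')"
proof -
  have "(x \<oplus> y) \<ominus> (x' \<oplus> y') = (x \<ominus> x') \<oplus> (y \<ominus> y')" using assms by algebra
  then show ?thesis using nrm_triangle[of "x \<ominus> x'" "y \<ominus> y'"] assms by simp
qed

lemma nrm_diff_smult:
  assumes "x \<in> carrier V" "y \<in> carrier V"
  shows "nrm (c \<odot> x \<ominus> c \<odot> y) = cmod c * nrm (x \<ominus> y)"
  using assms by (simp add: sm_diff_right[symmetric] nrm_smult)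

definition lim_to :: "(nat \<Rightarrow> 'v) \<Rightarrow> 'v \<Rightarrow> bool" where
  "lim_to x l \<longleftrightarrow> (\<lambda>n. nrm (x n \<ominus> l)) \<longlonglongrightarrow> 0"

definition cauchy_seq :: "(nat \<Rightarrow> 'v) \<Rightarrow> bool" where
  "cauchy_seq x \<longleftrightarrow> (\<forall>e>0. \<exists>M. \<forall>m\<ge>M. \<forall>n\<ge>M. nrm (x m \<ominus> x n) < e)"

lemma lim_to_const [simp]: "l \<in> carrier V \<Longrightarrow> lim_to (\<lambda>_. l) l"
  by (simp add: lim_to_def)

lemma lim_to_bound:
  assumes "\<And>n. nrm (x n \<ominus> l) \<le> b n" "b \<longlonglongrightarrow> 0" "\<And>n. x n \<in> carrier V" "l \<in> carrier V"
  shows "lim_to x l"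
  unfolding lim_to_def
  by (rule tendsto_sandwich[of "\<lambda>_. 0" _ _ b]) (auto intro!: nrm_nonneg assms eventuallyI)

lemma lim_to_add:
  assumes "lim_to x l" "lim_to y k" "\<And>n. x n \<in> carrier V" "\<And>n. y n \<in> carrier V"
    "l \<in> carrier V" "k \<in> carrier V"
  shows "lim_to (\<lambda>n. x n \<oplus> y n) (l \<oplus> k)"
  by (rule lim_to_bound[where b="\<lambda>n. nrm (x n \<ominus> l) + nrm (y n \<ominus> k)"])
    (use assms tendsto_add[of "\<lambda>n. nrm (x n \<ominus> l)" 0 sequentially "\<lambda>n. nrm (y n \<ominus> k)" 0]
      in \<open>auto simp: lim_to_def nrm_diff_add\<close>)

lemma lim_to_smult:
  assumes "lim_to x l" "\<And>n. x n \<in> carrier V" "l \<in> carrier V"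
  shows "lim_to (\<lambda>n. c \<odot> x n) (c \<odot> l)"
  using assms tendsto_mult_left[of "\<lambda>n. nrm (x n \<ominus> l)" 0 sequentially "cmod c"]
  by (simp add: lim_to_def nrm_diff_smult)

lemma lim_to_nrm:
  assumes "lim_to x l" "\<And>n. x n \<in> carrier V" "l \<in> carrier V"
  shows "(\<lambda>n. nrm (x n)) \<longlonglongrightarrow> nrm l"
proof -
  have "(\<lambda>n. \<bar>nrm (x n) - nrm l\<bar>) \<longlonglongrightarrow> 0"
    by (rule tendsto_sandwich[where f="\<lambda>_. 0" and h="\<lambda>n. nrm (x n \<ominus> l)"])
      (use assms nrm_abs_diff in \<open>auto simp: lim_to_def\<close>)
  then have "(\<lambda>n. nrm (x n) - nrm l) \<longlonglongrightarrow> 0" by (rule tendsto_rabs_zero_cancel)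
  then show ?thesis by (simp add: LIM_zero_iff)
qed

lemma lim_to_unique:
  assumes "lim_to x l" "lim_to x k" "\<And>n. x n \<in> carrier V" "l \<in> carrier V" "k \<in> carrier V"
  shows "nrm (l \<ominus> k) = 0"
proof -
  have "(\<lambda>n. nrm (x n \<ominus> l) + nrm (x n \<ominus> k)) \<longlonglongrightarrow> 0"
    using assms tendsto_add[of "\<lambda>n. nrm (x n \<ominus> l)" 0 sequentially "\<lambda>n. nrm (x n \<ominus> k)" 0]
    by (simp add: lim_to_def)
  moreover have "nrm (l \<ominus> k) \<le> nrm (x n \<ominus> l) + nrm (x n \<ominus> k)" for n
    using nrm_diff_triangle[of l "x n" k] assms nrm_diff_commute[of l "x n"] by simp
  ultimately have "nrm (l \<ominus> k) \<le> 0"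
    by (intro LIMSEQ_le_const) auto
  then show ?thesis using nrm_nonneg[of "l \<ominus> k"] assms by simp
qed

lemma lim_to_cauchy:
  assumes "lim_to x l" "\<And>n. x n \<in> carrier V" "l \<in> carrier V"
  shows "cauchy_seq x"
  unfolding cauchy_seq_def
proof (intro allI impI)
  fix e :: real assume "e > 0"
  then obtain M where M: "\<forall>n\<ge>M. nrm (x n \<ominus> l) < e / 2"
    using order_tendstoD(2)[OF assms(1)[unfolded lim_to_def], of "e / 2"]
    by (auto simp: eventually_sequentially)
  have "nrm (x m \<ominus> x n) < e" if "m \<ge> M" "n \<ge> M" for m n
    using nrm_diff_triangle[of "x m" l "x n"] nrm_diff_commute[of l "x n"] assms
      M[rule_format, OF that(1)] M[rule_format, OF that(2)]
    by simp
  then show "\<exists>M. \<forall>m\<ge>M. \<forall>n\<ge>M. nrm (x m \<ominus> x n) < e" by blast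
qed

lemma cauchy_bounded:
  assumes "cauchy_seq x" "\<And>n. x n \<in> carrier V"
  obtains B where "0 < B" "\<And>n. nrm (x n) \<le> B"
proof -
  obtain M where M: "\<forall>m\<ge>M. \<forall>n\<ge>M. nrm (x m \<ominus> x n) < 1"
    using assms(1) unfolding cauchy_seq_def by (meson zero_less_one)
  define B where "B = Max ((\<lambda>n. nrm (x n)) ` {..M}) + 1"
  have le: "nrm (x n) \<le> Max ((\<lambda>n. nrm (x n)) ` {..M})" if "n \<le> M" for n
    by (rule Max_ge) (use that in auto)
  have "nrm (x n) \<le> B" for n
  proof (cases "n \<le> M")
    case True then show ?thesis using le[OF True] unfolding B_def by linarith
  next
    case False
    then have "nrm (x n \<ominus> x M) < 1" using M by auto
    moreover have "nrm (x n) \<le> nrm (x M) + nrm (x n \<ominus> x M)" by (rule nrm_le_diff) (rule assms)+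
    ultimately show ?thesis using le[OF order_refl] unfolding B_def by linarith
  qed
  moreover have "0 < B" using le[OF le0] nrm_nonneg[OF assms(2), of 0] unfolding B_def by linarith
  ultimately show ?thesis using that by blast
qed

text \<open>Telescoping bounds the distance from term \<open>n\<close> to every later term by
  \<open>C * r ^ n / (1 - r)\<close>. This serves the fixed point iteration behind the square
  root.\<close>

lemma geometric_cauchy:
  assumes "\<And>n. x n \<in> carrier V" "0 \<le> r" "r < 1"
    and step: "\<And>n. nrm (x (Suc n) \<ominus> x n) \<le> C * r ^ n"
  shows "cauchy_seq x"
proof -
  have C: "0 \<le> C" using step[of 0] nrm_nonneg[of "x 1 \<ominus> x 0"] assms by simp
  have tail: "nrm (x (n + k) \<ominus> x n) \<le> C * (\<Sum>j<k. r ^ (n + j))" for n k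
  proof (induction k)
    case (Suc k)
    have "nrm (x (n + Suc k) \<ominus> x n)
        \<le> nrm (x (Suc (n + k)) \<ominus> x (n + k)) + nrm (x (n + k) \<ominus> x n)"
      using nrm_diff_triangle[of "x (Suc (n + k))" "x (n + k)" "x n"] assms(1) by simp
    also have "\<dots> \<le> C * r ^ (n + k) + C * (\<Sum>j<k. r ^ (n + j))"
      using step[of "n + k"] Suc by simp
    finally show ?case by (simp add: algebra_simps)
  qed (simp add: assms(1))
  have bound: "nrm (x (n + k) \<ominus> x n) \<le> C * r ^ n / (1 - r)" for n k
  proof -
    have "(\<Sum>j<k. r ^ (n + j)) = r ^ n * (\<Sum>j<k. r ^ j)"
      by (simp add: power_add sum_distrib_left)
    also have "\<dots> \<le> r ^ n * (1 / (1 - r))"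
      using assms by (intro mult_left_mono) (auto simp: sum_gp_strict divide_simps)
    finally show ?thesis
      using tail[of n k] C mult_left_mono[of "(\<Sum>j<k. r ^ (n + j))" "r ^ n * (1 / (1 - r))" C]
      by simp
  qed
  have "(\<lambda>n. C / (1 - r) * r ^ n) \<longlonglongrightarrow> C / (1 - r) * 0"
    using assms by (intro tendsto_mult_left LIMSEQ_realpow_zero) auto
  then have lim0: "(\<lambda>n. C * r ^ n / (1 - r)) \<longlonglongrightarrow> 0" by simp
  show ?thesis unfolding cauchy_seq_def
  proof (intro allI impI)
    fix e :: real assume "e > 0"
    then obtain M where M: "C * r ^ M / (1 - r) < e / 2"
      using order_tendstoD(2)[OF lim0, of "e / 2"] by (auto simp: eventually_sequentially)
    have "nrm (x m \<ominus> x n) < e" if m: "m \<ge> M" and n: "n \<ge> M" for m n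
    proof -
      obtain i j where "m = M + i" "n = M + j"
        using le_Suc_ex[OF m] le_Suc_ex[OF n] by auto
      then have "nrm (x m \<ominus> x n) \<le> nrm (x (M + i) \<ominus> x M) + nrm (x (M + j) \<ominus> x M)"
        using nrm_diff_triangle[of "x m" "x M" "x n"] nrm_diff_commute[of "x M" "x n"] assms(1)
        by simp
      then show ?thesis using bound[of M i] bound[of M j] M by linarith
    qed
    then show "\<exists>M. \<forall>m\<ge>M. \<forall>n\<ge>M. nrm (x m \<ominus> x n) < e" by blast
  qed
qed

end

section \<open>Semi-inner products\<close>

lemma LIMSEQ_zero_bound:
  fixes f g :: "nat \<Rightarrow> real"
  assumes "\<And>n. 0 \<le> f n" "\<And>n. f n \<le> g n" "g \<longlonglongrightarrow> 0"
  shows "f \<longlonglongrightarrow> 0"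
  by (rule tendsto_sandwich[of "\<lambda>_. 0" _ _ g]) (auto simp: assms)

lemma mult_cnj_self: "z * cnj z = (complex_of_real (cmod z))\<^sup>2"
  using complex_norm_square[of z] by simp

text \<open>Null vectors are allowed because both the GNS form and the form on words have them;
  definiteness is gained by passing to the completion.\<close>

locale semi_ip = cvec V for V :: "('v, 'm) ip_space_scheme" (structure) +
  assumes ip_add_left:
      "x \<in> carrier V \<Longrightarrow> y \<in> carrier V \<Longrightarrow> z \<in> carrier V \<Longrightarrow> ip V (x \<oplus> y) z = ip V x z + ip V y z"
    and ip_smult_left: "x \<in> carrier V \<Longrightarrow> y \<in> carrier V \<Longrightarrow> ip V (c \<odot> x) y = c * ip V x y"
    and ip_cnj: "x \<in> carrier V \<Longrightarrow> y \<in> carrier V \<Longrightarrow> ip V y x = cnj (ip V x y)"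
    and ip_pos: "x \<in> carrier V \<Longrightarrow> 0 \<le> Re (ip V x x)"
begin

lemma ip_add_right:
  "x \<in> carrier V \<Longrightarrow> y \<in> carrier V \<Longrightarrow> z \<in> carrier V \<Longrightarrow> ip V z (x \<oplus> y) = ip V z x + ip V z y"
  using ip_cnj[of "x \<oplus> y" z] ip_cnj[of x z] ip_cnj[of y z] by (simp add: ip_add_left)

lemma ip_smult_right:
  "x \<in> carrier V \<Longrightarrow> y \<in> carrier V \<Longrightarrow> ip V x (c \<odot> y) = cnj c * ip V x y"
  using ip_cnj[of "c \<odot> y" x] ip_cnj[of y x] by (simp add: ip_smult_left)

lemma ip_uminus_left: "x \<in> carrier V \<Longrightarrow> y \<in> carrier V \<Longrightarrow> ip V (\<ominus> x) y = - ip V x y"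
  using ip_smult_left[of x y "- 1"] by (simp add: sm_minus_one)

lemma ip_uminus_right: "x \<in> carrier V \<Longrightarrow> y \<in> carrier V \<Longrightarrow> ip V x (\<ominus> y) = - ip V x y"
  using ip_smult_right[of x y "- 1"] by (simp add: sm_minus_one)

lemma ip_diff_left:
  "x \<in> carrier V \<Longrightarrow> y \<in> carrier V \<Longrightarrow> z \<in> carrier V \<Longrightarrow> ip V (x \<ominus> y) z = ip V x z - ip V y z"
  by (simp add: M.minus_eq ip_add_left ip_uminus_left)

lemma ip_diff_right:
  "x \<in> carrier V \<Longrightarrow> y \<in> carrier V \<Longrightarrow> z \<in> carrier V \<Longrightarrow> ip V z (x \<ominus> y) = ip V z x - ip V z y"
  by (simp add: M.minus_eq ip_add_right ip_uminus_right)

lemma ip_zero_left [simp]: "x \<in> carrier V \<Longrightarrow> ip V \<zero> x = 0"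
  using ip_smult_left[of \<zero> x 0] by simp

lemma ip_zero_right [simp]: "x \<in> carrier V \<Longrightarrow> ip V x \<zero> = 0"
  using ip_smult_right[of x \<zero> 0] by simp

lemma ip_self_real: "x \<in> carrier V \<Longrightarrow> ip V x x = of_real (Re (ip V x x))"
  using ip_cnj[of x x] by (simp add: complex_eq_iff)

lemma vnorm_sq: "x \<in> carrier V \<Longrightarrow> (vnorm V x)\<^sup>2 = Re (ip V x x)"
  by (simp add: vnorm_def ip_pos)

lemma ip_self: "x \<in> carrier V \<Longrightarrow> ip V x x = of_real ((vnorm V x)\<^sup>2)"
  using ip_self_real[of x] by (simp add: vnorm_sq)

lemma vnorm_nonneg: "x \<in> carrier V \<Longrightarrow> 0 \<le> vnorm V x"
  by (simp add: vnorm_def ip_pos)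

lemma vnorm_add_smult_sq:
  assumes "x \<in> carrier V" "y \<in> carrier V"
  shows "(vnorm V (x \<oplus> c \<odot> y))\<^sup>2
    = (vnorm V x)\<^sup>2 + 2 * Re (cnj c * ip V x y) + (cmod c)\<^sup>2 * (vnorm V y)\<^sup>2"
proof -
  have "ip V (x \<oplus> c \<odot> y) (x \<oplus> c \<odot> y)
      = ip V x x + cnj c * ip V x y + c * cnj (ip V x y) + c * cnj c * ip V y y"
    using assms ip_cnj[of x y]
    by (simp add: ip_add_left ip_add_right ip_smult_left ip_smult_right algebra_simps)
  also have "\<dots> = of_real ((vnorm V x)\<^sup>2) + (cnj c * ip V x y + cnj (cnj c * ip V x y))
      + of_real ((cmod c)\<^sup>2 * (vnorm V y)\<^sup>2)"
    using assms by (simp add: ip_self mult_cnj_self)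
  also have "Re \<dots> = (vnorm V x)\<^sup>2 + 2 * Re (cnj c * ip V x y) + (cmod c)\<^sup>2 * (vnorm V y)\<^sup>2"
    by simp
  finally show ?thesis using assms by (simp add: vnorm_sq)
qed

lemma cauchy_schwarz:
  assumes "x \<in> carrier V" "y \<in> carrier V"
  shows "cmod (ip V x y) \<le> vnorm V x * vnorm V y"
proof -
  define p where "p = ip V x y"
  \<comment> \<open>Positivity of the squared norm of \<open>x - t p y\<close> for real
    \<open>t\<close>; the factor \<open>p\<close> cancels the phase of the inner product and leaves
    a real quadratic in \<open>t\<close>.\<close>
  have ineq: "2 * t * (cmod p)\<^sup>2 \<le> (vnorm V x)\<^sup>2 + t\<^sup>2 * (cmod p)\<^sup>2 * (vnorm V y)\<^sup>2" for t
  proof -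
    have "cnj (- of_real t * p) * p = of_real (- t * (cmod p)\<^sup>2)"
      using mult_cnj_self[of p] by (simp add: mult_ac)
    then have "Re (cnj (- of_real t * p) * p) = - t * (cmod p)\<^sup>2"
      by (metis Re_complex_of_real)
    then have "(vnorm V (x \<oplus> (- of_real t * p) \<odot> y))\<^sup>2
        = (vnorm V x)\<^sup>2 + 2 * (- t * (cmod p)\<^sup>2) + t\<^sup>2 * (cmod p)\<^sup>2 * (vnorm V y)\<^sup>2"
      unfolding vnorm_add_smult_sq[OF assms] p_def[symmetric]
      by (simp only: norm_mult norm_minus_cancel norm_of_real power_mult_distrib power2_abs)
    moreover have "0 \<le> (vnorm V (x \<oplus> (- of_real t * p) \<odot> y))\<^sup>2" by simp
    ultimately show ?thesis by linarith
  qed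
  have "(cmod p)\<^sup>2 \<le> (vnorm V x)\<^sup>2 * (vnorm V y)\<^sup>2"
  proof (cases "vnorm V y = 0")
    case True
    have "(cmod p)\<^sup>2 = 0"
    proof (rule ccontr)
      assume "(cmod p)\<^sup>2 \<noteq> 0"
      \<comment> \<open>If \<open>y\<close> is null, this value of \<open>t\<close> turns
        \<open>ineq\<close> into \<open>N + 1 <= N\<close> for the squared norm \<open>N\<close> of
        \<open>x\<close>.\<close>
      then show False
        using ineq[of "((vnorm V x)\<^sup>2 + 1) / (2 * (cmod p)\<^sup>2)"] True by (simp add: field_simps)
    qed
    then show ?thesis by simp
  next
    case False
    then have pos: "0 < (vnorm V y)\<^sup>2" by simp
    define s where "s = (vnorm V y)\<^sup>2"
    \<comment> \<open>\<open>t = 1 / s\<close> minimises the quadratic.\<close>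
    have "2 * (1 / s) * (cmod p)\<^sup>2 \<le> (vnorm V x)\<^sup>2 + (1 / s)\<^sup>2 * (cmod p)\<^sup>2 * s"
      using ineq[of "1 / s"] by (simp add: s_def)
    moreover have "(1 / s)\<^sup>2 * (cmod p)\<^sup>2 * s = (cmod p)\<^sup>2 / s"
      using pos by (simp add: power2_eq_square s_def)
    ultimately have "(cmod p)\<^sup>2 / s \<le> (vnorm V x)\<^sup>2" by simp
    then show ?thesis using pos by (simp add: s_def divide_simps)
  qed
  then have "(cmod p)\<^sup>2 \<le> (vnorm V x * vnorm V y)\<^sup>2" by (simp add: power_mult_distrib)
  then show ?thesis
    unfolding p_def by (rule power2_le_imp_le) (simp add: assms vnorm_nonneg)
qed

lemma vnorm_seminormed: "seminormed V (vnorm V)"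
proof unfold_locales
  fix x y assume xy: "x \<in> carrier V" "y \<in> carrier V"
  have "(vnorm V (x \<oplus> y))\<^sup>2 = (vnorm V x)\<^sup>2 + 2 * Re (ip V x y) + (vnorm V y)\<^sup>2"
    using vnorm_add_smult_sq[OF xy, of 1] xy by simp
  also have "\<dots> \<le> (vnorm V x + vnorm V y)\<^sup>2"
    using cauchy_schwarz[OF xy] complex_Re_le_cmod[of "ip V x y"]
    by (simp add: power2_sum)
  finally show "vnorm V (x \<oplus> y) \<le> vnorm V x + vnorm V y"
    by (rule power2_le_imp_le) (simp add: xy vnorm_nonneg)
next
  fix x c assume x: "x \<in> carrier V"
  have "ip V (c \<odot> x) (c \<odot> x) = c * cnj c * ip V x x"
    using x by (simp add: ip_smult_left ip_smult_right)
  also have "\<dots> = of_real ((cmod c * vnorm V x)\<^sup>2)"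
    using x by (simp add: ip_self mult_cnj_self power_mult_distrib)
  finally have "(vnorm V (c \<odot> x))\<^sup>2 = (cmod c * vnorm V x)\<^sup>2"
    using x by (simp add: vnorm_sq)
  then show "vnorm V (c \<odot> x) = cmod c * vnorm V x"
    using vnorm_nonneg[of "c \<odot> x"] vnorm_nonneg[OF x] x
    by (auto intro: power2_eq_imp_eq)
qed (rule vnorm_nonneg)

end

sublocale semi_ip \<subseteq> seminormed V "vnorm V" by (rule vnorm_seminormed)

context semi_ip begin

lemma ip_null_left:
  "x \<in> carrier V \<Longrightarrow> y \<in> carrier V \<Longrightarrow> vnorm V x = 0 \<Longrightarrow> ip V x y = 0"
  using cauchy_schwarz[of x y] by simp

end

section \<open>C*-algebras\<close>

sublocale unital_cstar_algebra \<subseteq> seminormed A "cnorm A"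
  by unfold_locales (auto intro: cnorm_nonneg cnorm_triangle cnorm_smult)

context unital_cstar_algebra begin

lemma mult_one_right [algebra ring "zero A" "add A" "a_inv A" "a_minus A" "one A" "mult A"]:
  "x \<in> carrier A \<Longrightarrow> x \<otimes> \<one> = x"
  by simp

lemma mult_assoc:
  "x \<in> carrier A \<Longrightarrow> y \<in> carrier A \<Longrightarrow> z \<in> carrier A \<Longrightarrow> x \<otimes> y \<otimes> z = x \<otimes> (y \<otimes> z)"
  and distrib_l:
  "x \<in> carrier A \<Longrightarrow> y \<in> carrier A \<Longrightarrow> z \<in> carrier A \<Longrightarrow> (x \<oplus> y) \<otimes> z = x \<otimes> z \<oplus> y \<otimes> z"
  and distrib_r:
  "x \<in> carrier A \<Longrightarrow> y \<in> carrier A \<Longrightarrow> z \<in> carrier A \<Longrightarrow> z \<otimes> (x \<oplus> y) = z \<otimes> x \<oplus> z \<otimes> y"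
  by (algebra, algebra, algebra)

lemma mult_uminus_l: "x \<in> carrier A \<Longrightarrow> y \<in> carrier A \<Longrightarrow> (\<ominus> x) \<otimes> y = \<ominus> (x \<otimes> y)"
  and mult_uminus_r: "x \<in> carrier A \<Longrightarrow> y \<in> carrier A \<Longrightarrow> x \<otimes> (\<ominus> y) = \<ominus> (x \<otimes> y)"
  by (algebra, algebra)

lemma lim_to_eq: "cstar_tendsto A x l \<longleftrightarrow> lim_to x l"
  by (simp add: cstar_tendsto_def lim_to_def)

lemma lim_to_unique_eq:
  "lim_to x l \<Longrightarrow> lim_to x k \<Longrightarrow> (\<And>n. x n \<in> carrier A) \<Longrightarrow> l \<in> carrier A \<Longrightarrow> k \<in> carrier A \<Longrightarrow> l = k"
  by (rule diff_eq_zero) (simp_all add: cnorm_eq_0 lim_to_unique)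

lemma cauchy_converges:
  assumes "cauchy_seq x" "\<And>n. x n \<in> carrier A"
  obtains l where "l \<in> carrier A" "lim_to x l"
proof -
  have "\<exists>l\<in>carrier A. cstar_tendsto A x l"
    by (rule complete[OF assms(2)], rule assms(1)[unfolded cauchy_seq_def, rule_format])
  then show ?thesis using that unfolding lim_to_eq by blast
qed

lemma star_one [simp]: "star A \<one> = \<one>"
  using star_mult[of "star A \<one>" \<one>] star_star[of \<one>] star_closed[of \<one>] by simp

lemma star_zero [simp]: "star A \<zero> = \<zero>"
  using star_smult[of \<zero> 0] star_closed[of \<zero>] by simp

lemma star_uminus: "x \<in> carrier A \<Longrightarrow> star A (\<ominus> x) = \<ominus> star A x"
  using star_smult[of x "- 1"] by (simp add: sm_minus_one star_closed)

lemma star_diff: "x \<in> carrier A \<Longrightarrow> y \<in> carrier A \<Longrightarrow> star A (x \<ominus> y) = star A x \<ominus> star A y"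
  by (simp add: a_minus_def star_add star_uminus star_closed)

text \<open>By the C*-identity and submultiplicativity the squared norm of \<open>y\<close> is at
  most the product of the norms of \<open>star A y\<close> and \<open>y\<close>. Cancelling gives
  one inequality, and \<open>star A x\<close> in place of \<open>x\<close> gives the other.\<close>

lemma cnorm_star:
  assumes "x \<in> carrier A"
  shows "cnorm A (star A x) = cnorm A x"
proof -
  have le: "cnorm A y \<le> cnorm A (star A y)" if y: "y \<in> carrier A" for y
  proof (cases "cnorm A y = 0")
    case False
    have "cnorm A y * cnorm A y \<le> cnorm A (star A y) * cnorm A y"
      using cstar_identity[OF y] cnorm_mult[of "star A y" y] y
      by (simp add: star_closed power2_eq_square)
    then show ?thesis using False cnorm_nonneg[OF y] by simp
  qed (use y in \<open>simp add: cnorm_nonneg star_closed\<close>)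
  show ?thesis using le[OF assms] le[of "star A x"] assms by (simp add: star_closed star_star)
qed

text \<open>The C*-identity makes this norm an idempotent real number, so it is 0 or 1; the value 0
  belongs to the zero algebra, which the locale admits.\<close>

lemma cnorm_one_le: "cnorm A \<one> \<le> 1"
proof -
  have "cnorm A \<one> * cnorm A \<one> = cnorm A \<one>"
    using cstar_identity[of \<one>] by (simp add: power2_eq_square)
  then show ?thesis by (auto simp: mult_cancel_left2)
qed

lemma cnorm_mult_diff:
  assumes "x \<in> carrier A" "y \<in> carrier A" "x' \<in> carrier A" "y' \<in> carrier A"
  shows "cnorm A (x \<otimes> y \<ominus> x' \<otimes> y')
    \<le> cnorm A (x \<ominus> x') * cnorm A y + cnorm A x' * cnorm A (y \<ominus> y')"
proof -
  have "x \<otimes> y \<ominus> x' \<otimes> y' = (x \<ominus> x') \<otimes> y \<oplus> x' \<otimes> (y \<ominus> y')"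
    using assms by algebra
  then show ?thesis
    using cnorm_triangle[of "(x \<ominus> x') \<otimes> y" "x' \<otimes> (y \<ominus> y')"]
      cnorm_mult[of "x \<ominus> x'" y] cnorm_mult[of x' "y \<ominus> y'"] assms by simp
qed

lemma lim_to_mult:
  assumes "lim_to x l" "lim_to y k" "\<And>n. x n \<in> carrier A" "\<And>n. y n \<in> carrier A"
    "l \<in> carrier A" "k \<in> carrier A"
  shows "lim_to (\<lambda>n. x n \<otimes> y n) (l \<otimes> k)"
proof (rule lim_to_bound)
  have "(\<lambda>n. cnorm A (x n \<ominus> l) * cnorm A (y n) + cnorm A l * cnorm A (y n \<ominus> k))
      \<longlonglongrightarrow> 0 * cnorm A k + cnorm A l * 0"
    using assms lim_to_nrm[of y k] unfolding lim_to_def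
    by (intro tendsto_add tendsto_mult tendsto_const) auto
  then show "(\<lambda>n. cnorm A (x n \<ominus> l) * cnorm A (y n) + cnorm A l * cnorm A (y n \<ominus> k)) \<longlonglongrightarrow> 0"
    by simp
qed (use assms in \<open>auto intro: cnorm_mult_diff\<close>)

lemma lim_to_star:
  assumes "lim_to x l" "\<And>n. x n \<in> carrier A" "l \<in> carrier A"
  shows "lim_to (\<lambda>n. star A (x n)) (star A l)"
  using assms by (simp add: lim_to_def star_diff[symmetric] cnorm_star)

text \<open>The limit \<open>l\<close> of the contraction \<open>y \<mapsto> (h + y\<^sup>2) / 2\<close> satisfies \<open>(1 - l)\<^sup>2 = 1 - h\<close>.\<close>

lemma sqrt_one_minus:
  assumes h: "h \<in> carrier A" "star A h = h" and h1: "cnorm A h < 1"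
  obtains k where "k \<in> carrier A" "star A k = k" "k \<otimes> k = \<one> \<ominus> h"
    "\<And>z. z \<in> carrier A \<Longrightarrow> z \<otimes> h = h \<otimes> z \<Longrightarrow> z \<otimes> k = k \<otimes> z"
proof -
  define r where "r = cnorm A h"
  have r: "0 \<le> r" "r < 1" using h h1 by (auto simp: r_def cnorm_nonneg)
  \<comment> \<open>The iteration for the fixed point \<open>l = (h + l^2) / 2\<close>, started at
    0. The iterates are real polynomials in \<open>h\<close> and stay in the ball of radius
    \<open>r\<close>, where the map contracts by the factor \<open>r < 1\<close>.\<close>
  define y where "y = rec_nat \<zero> (\<lambda>_ z. (1 / 2) \<odot> (h \<oplus> z \<otimes> z))"
  have y0: "y 0 = \<zero>" and yS: "y (Suc n) = (1 / 2) \<odot> (h \<oplus> y n \<otimes> y n)" for n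
    by (simp_all add: y_def)
  have yc [simp]: "y n \<in> carrier A" for n by (induction n) (use h in \<open>auto simp: y0 yS\<close>)
  have ys: "star A (y n) = y n" for n
    by (induction n) (use h in \<open>auto simp: y0 yS star_smult star_add star_mult\<close>)
  have yr: "cnorm A (y n) \<le> r" for n
  proof (induction n)
    case (Suc n)
    have "cnorm A (y n \<otimes> y n) \<le> r * r"
      using cnorm_mult[of "y n" "y n"] Suc mult_mono[of "cnorm A (y n)" r "cnorm A (y n)" r] r
      by (simp add: cnorm_nonneg)
    also have "\<dots> \<le> r" using r mult_left_le[of r r] by simp
    finally show ?case
      using cnorm_triangle[of h "y n \<otimes> y n"] h by (simp add: yS cnorm_smult r_def)
  qed (use r in \<open>simp add: y0\<close>)
  have step: "cnorm A (y (Suc n) \<ominus> y n) \<le> r * r ^ n" for n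
  proof (induction n)
    case (Suc n)
    have "y (Suc (Suc n)) \<ominus> y (Suc n)
        = (1 / 2) \<odot> ((h \<oplus> y (Suc n) \<otimes> y (Suc n)) \<ominus> (h \<oplus> y n \<otimes> y n))"
      unfolding yS[of "Suc n"] yS[of n] using h yS[of n, symmetric] by (subst sm_diff_right) auto
    also have "(h \<oplus> y (Suc n) \<otimes> y (Suc n)) \<ominus> (h \<oplus> y n \<otimes> y n)
        = y (Suc n) \<otimes> y (Suc n) \<ominus> y n \<otimes> y n"
      using h yc[of n] yc[of "Suc n"] by algebra
    finally have "cnorm A (y (Suc (Suc n)) \<ominus> y (Suc n))
        = 1 / 2 * cnorm A (y (Suc n) \<otimes> y (Suc n) \<ominus> y n \<otimes> y n)"
      by (simp add: cnorm_smult)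
    \<comment> \<open>A difference of squares splits into two terms, each a difference times a
      factor of norm at most \<open>r\<close>; the factor 1/2 then leaves exactly
      \<open>r\<close>.\<close>
    also have "\<dots> \<le> 1 / 2 * (cnorm A (y (Suc n) \<ominus> y n) * r + r * cnorm A (y (Suc n) \<ominus> y n))"
      using cnorm_mult_diff[of "y (Suc n)" "y (Suc n)" "y n" "y n"]
        mult_left_mono[OF yr[of "Suc n"], of "cnorm A (y (Suc n) \<ominus> y n)"]
        mult_right_mono[OF yr[of n], of "cnorm A (y (Suc n) \<ominus> y n)"]
      by (simp add: cnorm_nonneg mult.commute[of _ r])
    also have "\<dots> = r * cnorm A (y (Suc n) \<ominus> y n)" by simp
    also have "\<dots> \<le> r * (r * r ^ n)" using Suc r by (intro mult_left_mono) auto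
    finally show ?case by simp
  next
    case 0
    have "y (Suc 0) \<ominus> y 0 = (1 / 2) \<odot> h" using h by (simp add: yS y0 a_minus_def)
    then show ?case using h r by (simp add: cnorm_smult r_def)
  qed
  then obtain l where l: "l \<in> carrier A" "lim_to y l"
    using cauchy_converges[OF geometric_cauchy[of y r r]] r by auto
  have lS: "lim_to (\<lambda>n. y (Suc n)) l"
    using l(2) unfolding lim_to_def by (rule LIMSEQ_Suc)
  have "lim_to (\<lambda>n. y (Suc n)) ((1 / 2) \<odot> (h \<oplus> l \<otimes> l))"
    unfolding yS by (intro lim_to_smult lim_to_add lim_to_mult) (use l h in auto)
  then have fix_l: "l = (1 / 2) \<odot> (h \<oplus> l \<otimes> l)"
    by (rule lim_to_unique_eq[OF lS]) (use l h in auto)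
  have "l \<oplus> l = (1 / 2) \<odot> (h \<oplus> l \<otimes> l) \<oplus> (1 / 2) \<odot> (h \<oplus> l \<otimes> l)"
    using fix_l by simp
  also have "\<dots> = (1 / 2 + 1 / 2) \<odot> (h \<oplus> l \<otimes> l)"
    using l h by (subst sm_add_left) auto
  finally have ll: "l \<oplus> l = h \<oplus> l \<otimes> l" using l h by simp
  have "lim_to (\<lambda>n. star A (y n)) (star A l)"
    by (rule lim_to_star) (use l in auto)
  then have sl: "star A l = l"
    using lim_to_unique_eq[OF l(2), of "star A l"] l by (simp add: ys star_closed)
  show ?thesis
  proof (rule that[of "\<one> \<ominus> l"])
    show "\<one> \<ominus> l \<in> carrier A" using l by simp
    show "star A (\<one> \<ominus> l) = \<one> \<ominus> l" using l sl by (simp add: star_diff)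
    have "(\<one> \<ominus> l) \<otimes> (\<one> \<ominus> l) = \<one> \<ominus> (l \<oplus> l) \<oplus> l \<otimes> l" using l(1) by algebra
    also have "\<dots> = \<one> \<ominus> h" unfolding ll using l(1) h(1) by algebra
    finally show "(\<one> \<ominus> l) \<otimes> (\<one> \<ominus> l) = \<one> \<ominus> h" .
    fix z assume z: "z \<in> carrier A" "z \<otimes> h = h \<otimes> z"
    \<comment> \<open>Whatever commutes with \<open>h\<close> commutes with the iterates and hence
      with their limit. Contractivity of *-homomorphisms needs this for the root of
      \<open>1 - h^2\<close> and \<open>h\<close> itself.\<close>
    have zy: "z \<otimes> y n = y n \<otimes> z" for n
    proof (induction n)
      case (Suc n)
      have "z \<otimes> (y n \<otimes> y n) = y n \<otimes> y n \<otimes> z"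
        using Suc z mult_assoc[of z "y n" "y n"] mult_assoc[of "y n" z "y n"]
          mult_assoc[of "y n" "y n" z]
        by simp
      then show ?case using z h by (simp add: yS smult_mult_right smult_mult_left distrib_l distrib_r)
    qed (use z in \<open>simp add: y0\<close>)
    have "lim_to (\<lambda>n. z \<otimes> y n) (z \<otimes> l)" "lim_to (\<lambda>n. y n \<otimes> z) (l \<otimes> z)"
      by (intro lim_to_mult; use l z in simp)+
    then have "z \<otimes> l = l \<otimes> z"
      using lim_to_unique_eq[of "\<lambda>n. z \<otimes> y n"] z l by (simp add: zy)
    then show "z \<otimes> (\<one> \<ominus> l) = (\<one> \<ominus> l) \<otimes> z"
      using z l by (simp add: a_minus_def distrib_l distrib_r mult_uminus_l mult_uminus_r)
  qed
qed

end

lemma unital_star_homD: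
  assumes "unital_star_hom A B \<theta>"
  shows "x \<in> carrier A \<Longrightarrow> \<theta> x \<in> carrier B"
    and "x \<in> carrier A \<Longrightarrow> y \<in> carrier A \<Longrightarrow> \<theta> (x \<otimes>\<^bsub>A\<^esub> y) = \<theta> x \<otimes>\<^bsub>B\<^esub> \<theta> y"
    and "x \<in> carrier A \<Longrightarrow> y \<in> carrier A \<Longrightarrow> \<theta> (x \<oplus>\<^bsub>A\<^esub> y) = \<theta> x \<oplus>\<^bsub>B\<^esub> \<theta> y"
    and "\<theta> \<one>\<^bsub>A\<^esub> = \<one>\<^bsub>B\<^esub>"
    and "x \<in> carrier A \<Longrightarrow> \<theta> (c \<odot>\<^bsub>A\<^esub> x) = c \<odot>\<^bsub>B\<^esub> \<theta> x"
    and "x \<in> carrier A \<Longrightarrow> \<theta> (star A x) = star B (\<theta> x)"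
  using assms unfolding unital_star_hom_def ring_hom_def by auto

lemma unital_star_homI:
  assumes "\<And>x. x \<in> carrier A \<Longrightarrow> \<theta> x \<in> carrier B"
    and "\<And>x y. x \<in> carrier A \<Longrightarrow> y \<in> carrier A \<Longrightarrow> \<theta> (x \<otimes>\<^bsub>A\<^esub> y) = \<theta> x \<otimes>\<^bsub>B\<^esub> \<theta> y"
    and "\<And>x y. x \<in> carrier A \<Longrightarrow> y \<in> carrier A \<Longrightarrow> \<theta> (x \<oplus>\<^bsub>A\<^esub> y) = \<theta> x \<oplus>\<^bsub>B\<^esub> \<theta> y"
    and "\<theta> \<one>\<^bsub>A\<^esub> = \<one>\<^bsub>B\<^esub>"
    and "\<And>c x. x \<in> carrier A \<Longrightarrow> \<theta> (c \<odot>\<^bsub>A\<^esub> x) = c \<odot>\<^bsub>B\<^esub> \<theta> x"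
    and "\<And>x. x \<in> carrier A \<Longrightarrow> \<theta> (star A x) = star B (\<theta> x)"
  shows "unital_star_hom A B \<theta>"
  using assms unfolding unital_star_hom_def ring_hom_def by auto

lemma star_hom_diff:
  assumes "unital_cstar_algebra A" "unital_cstar_algebra B" "unital_star_hom A B \<theta>"
    "x \<in> carrier A" "y \<in> carrier A"
  shows "\<theta> (x \<ominus>\<^bsub>A\<^esub> y) = \<theta> x \<ominus>\<^bsub>B\<^esub> \<theta> y"
proof -
  interpret A: unital_cstar_algebra A by fact
  interpret B: unital_cstar_algebra B by fact
  note hom = unital_star_homD[OF assms(3)]
  show ?thesis
    using assms(4,5) hom(3)[of x "\<ominus>\<^bsub>A\<^esub> y"] hom(5)[of y "- 1"]
    by (simp add: a_minus_def hom(1) A.sm_minus_one B.sm_minus_one)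
qed

text \<open>A self-adjoint \<open>h\<close> of norm less than one is the real part of the unitary
  \<open>h + \<i> (1 - h\<^sup>2)\<^sup>1\<^sup>/\<^sup>2\<close>, which a unital *-homomorphism maps to a unitary.\<close>

lemma star_hom_contractive:
  assumes A: "unital_cstar_algebra A" and B: "unital_cstar_algebra B"
    and hom: "unital_star_hom A B \<theta>" and x: "x \<in> carrier A"
  shows "cnorm B (\<theta> x) \<le> cnorm A x"
proof -
  interpret A: unital_cstar_algebra A by fact
  interpret B: unital_cstar_algebra B by fact
  note hm = unital_star_homD[OF hom]
  have small: "cnorm B (\<theta> h) \<le> 1" if h: "h \<in> carrier A" "star A h = h" "cnorm A h < 1" for h
  proof -
    have hh: "cnorm A (h \<otimes>\<^bsub>A\<^esub> h) < 1"
    proof -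
      have "cnorm A (h \<otimes>\<^bsub>A\<^esub> h) \<le> cnorm A h * 1"
        using A.cnorm_mult[of h h] h A.cnorm_nonneg[of h]
          mult_left_mono[of "cnorm A h" 1 "cnorm A h"] by simp
      then show ?thesis using h by simp
    qed
    have hsa: "h \<otimes>\<^bsub>A\<^esub> h \<in> carrier A" "star A (h \<otimes>\<^bsub>A\<^esub> h) = h \<otimes>\<^bsub>A\<^esub> h"
      using h by (simp_all add: A.star_mult)
    obtain k where k: "k \<in> carrier A" "star A k = k" "k \<otimes>\<^bsub>A\<^esub> k = \<one>\<^bsub>A\<^esub> \<ominus>\<^bsub>A\<^esub> (h \<otimes>\<^bsub>A\<^esub> h)"
      and com: "\<And>z. z \<in> carrier A \<Longrightarrow> z \<otimes>\<^bsub>A\<^esub> (h \<otimes>\<^bsub>A\<^esub> h) = h \<otimes>\<^bsub>A\<^esub> h \<otimes>\<^bsub>A\<^esub> z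
        \<Longrightarrow> z \<otimes>\<^bsub>A\<^esub> k = k \<otimes>\<^bsub>A\<^esub> z"
      using A.sqrt_one_minus[OF hsa hh] by blast
    \<comment> \<open>With \<open>h\<close> and \<open>k\<close> commuting, the mixed terms of
      \<open>star A u\<close> times \<open>u\<close> cancel and \<open>h^2 + k^2 = 1\<close>
      remains.\<close>
    have comm: "h \<otimes>\<^bsub>A\<^esub> k = k \<otimes>\<^bsub>A\<^esub> h" by (rule com) (use h in \<open>simp_all add: A.mult_assoc\<close>)
    define u where "u = h \<oplus>\<^bsub>A\<^esub> \<i> \<odot>\<^bsub>A\<^esub> k"
    have uc: "u \<in> carrier A" using h k by (simp add: u_def)
    have us: "star A u = h \<ominus>\<^bsub>A\<^esub> \<i> \<odot>\<^bsub>A\<^esub> k"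
      using h k by (simp add: u_def A.star_add A.star_smult a_minus_def A.sm_uminus_left)
    define z where "z = \<i> \<odot>\<^bsub>A\<^esub> k"
    have z: "z \<in> carrier A" "h \<otimes>\<^bsub>A\<^esub> z = z \<otimes>\<^bsub>A\<^esub> h" "z \<otimes>\<^bsub>A\<^esub> z = \<ominus>\<^bsub>A\<^esub> (k \<otimes>\<^bsub>A\<^esub> k)"
      using h k comm
      by (simp_all add: z_def A.smult_mult_left A.smult_mult_right A.sm_assoc A.sm_minus_one)
    have "star A u \<otimes>\<^bsub>A\<^esub> u = (h \<ominus>\<^bsub>A\<^esub> z) \<otimes>\<^bsub>A\<^esub> (h \<oplus>\<^bsub>A\<^esub> z)"
      by (simp add: us u_def[symmetric] z_def[symmetric]) (simp add: u_def z_def)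
    also have "\<dots> = h \<otimes>\<^bsub>A\<^esub> h \<oplus>\<^bsub>A\<^esub> h \<otimes>\<^bsub>A\<^esub> z \<ominus>\<^bsub>A\<^esub> z \<otimes>\<^bsub>A\<^esub> h \<ominus>\<^bsub>A\<^esub> z \<otimes>\<^bsub>A\<^esub> z"
      using h(1) z(1) by algebra
    also have "\<dots> = h \<otimes>\<^bsub>A\<^esub> h \<oplus>\<^bsub>A\<^esub> k \<otimes>\<^bsub>A\<^esub> k"
      unfolding z(2,3) using h(1) z(1) k(1) by algebra
    also have "\<dots> = \<one>\<^bsub>A\<^esub>" unfolding k(3) using h(1) by algebra
    finally have "star B (\<theta> u) \<otimes>\<^bsub>B\<^esub> \<theta> u = \<one>\<^bsub>B\<^esub>"
      using hm(2)[of "star A u" u] hm(4,6) uc A.star_closed by metis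
    then have "(cnorm B (\<theta> u))\<^sup>2 \<le> 1"
      using B.cstar_identity[of "\<theta> u"] B.cnorm_one_le hm(1) uc by simp
    then have nu: "cnorm B (\<theta> u) \<le> 1" by (simp add: power2_le_imp_le[of _ 1])
    have "h = (1 / 2) \<odot>\<^bsub>A\<^esub> (h \<oplus>\<^bsub>A\<^esub> h)"
      using h A.sm_add_left[of h "1 / 2" "1 / 2"] by (simp add: A.sm_add_right)
    also have "h \<oplus>\<^bsub>A\<^esub> h = u \<oplus>\<^bsub>A\<^esub> star A u"
    proof -
      have "h \<oplus>\<^bsub>A\<^esub> h = (h \<oplus>\<^bsub>A\<^esub> z) \<oplus>\<^bsub>A\<^esub> (h \<ominus>\<^bsub>A\<^esub> z)" using h(1) z(1) by algebra
      then show ?thesis unfolding us by (simp only: u_def z_def)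
    qed
    finally have "\<theta> h = (1 / 2) \<odot>\<^bsub>B\<^esub> (\<theta> u \<oplus>\<^bsub>B\<^esub> star B (\<theta> u))"
      using uc hm(3)[of u "star A u"] hm(5)[of "u \<oplus>\<^bsub>A\<^esub> star A u" "1 / 2"] hm(6)
      by (simp add: A.star_closed)
    then show ?thesis
      using B.cnorm_triangle[of "\<theta> u" "star B (\<theta> u)"] nu uc hm(1)
      by (simp add: B.cnorm_smult B.star_closed B.cnorm_star)
  qed
  have sa: "cnorm B (\<theta> h) \<le> cnorm A h" if h: "h \<in> carrier A" "star A h = h" for h
  \<comment> \<open>\<open>small\<close> asks for norm strictly below 1, so \<open>h\<close> is
    divided by an arbitrary \<open>c\<close> above its norm.\<close>
  proof (rule dense_ge)
    fix c assume c: "cnorm A h < c"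
    then have c0: "0 < c" using A.cnorm_nonneg[OF h(1)] by simp
    have "cnorm B (\<theta> (of_real (1 / c) \<odot>\<^bsub>A\<^esub> h)) \<le> 1"
      using small[of "of_real (1 / c) \<odot>\<^bsub>A\<^esub> h"] h c c0
      by (simp add: A.star_smult A.cnorm_smult norm_divide divide_simps)
    then show "cnorm B (\<theta> h) \<le> c"
      using h c0 by (simp add: hm(5) hm(1) B.cnorm_smult norm_divide divide_simps)
  qed
  \<comment> \<open>The C*-identity in both algebras reduces the general case to the self-adjoint
    element \<open>star A x\<close> times \<open>x\<close>.\<close>
  have "(cnorm B (\<theta> x))\<^sup>2 = cnorm B (\<theta> (star A x \<otimes>\<^bsub>A\<^esub> x))"
    using x hm B.cstar_identity[of "\<theta> x"] by (simp add: A.star_closed)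
  also have "\<dots> \<le> cnorm A (star A x \<otimes>\<^bsub>A\<^esub> x)"
    using x by (intro sa) (auto simp: A.star_closed A.star_mult A.star_star)
  finally show ?thesis
    using x by (intro power2_le_imp_le[OF _ A.cnorm_nonneg]) (simp_all add: A.cstar_identity)
qed

section \<open>Subspaces and subalgebras\<close>

lemma cvec_subspace:
  assumes V: "Module.module complex_ring V"
    and sub: "carrier W \<subseteq> carrier V" "zero W \<in> carrier W"
    and ops: "add W = add V" "zero W = zero V" "smult W = smult V"
    and add: "\<And>x y. x \<in> carrier W \<Longrightarrow> y \<in> carrier W \<Longrightarrow> x \<oplus>\<^bsub>V\<^esub> y \<in> carrier W"
    and smult: "\<And>c x. x \<in> carrier W \<Longrightarrow> c \<odot>\<^bsub>V\<^esub> x \<in> carrier W"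
  shows "Module.module complex_ring W"
proof -
  interpret cvec V using V by (simp add: cvec_def)
  note [simp] = ops
  have sub': "x \<in> carrier V" if "x \<in> carrier W" for x using sub that by auto
  show ?thesis
  proof (rule complex_moduleI)
    show "abelian_group W"
    proof (rule abelian_groupI)
      fix x assume x: "x \<in> carrier W"
      have "((- 1) \<odot>\<^bsub>V\<^esub> x) \<oplus>\<^bsub>V\<^esub> x = \<zero>\<^bsub>V\<^esub>"
        using sub'[OF x] by (simp add: sm_minus_one[symmetric] M.l_neg)
      then show "\<exists>y\<in>carrier W. y \<oplus>\<^bsub>W\<^esub> x = \<zero>\<^bsub>W\<^esub>" using smult[OF x] by auto
    qed (use sub' add sub in \<open>auto simp: M.a_assoc M.a_comm M.a_lcomm\<close>)
  qed (use sub' smult in \<open>auto simp: sm_add_left sm_add_right sm_assoc\<close>)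
qed

text \<open>Additive inverses are chosen by description inside the carrier, so subtraction in a
  substructure is not literally the ambient one. Both are expressed through scalar multiplication by
  -1.\<close>

lemma cvec_diff_cong:
  assumes "Module.module complex_ring V" "Module.module complex_ring W"
    and "carrier W \<subseteq> carrier V" "add W = add V" "smult W = smult V"
    and "x \<in> carrier W" "y \<in> carrier W"
  shows "x \<ominus>\<^bsub>W\<^esub> y = x \<ominus>\<^bsub>V\<^esub> y"
proof -
  interpret V: cvec V using assms(1) by (simp add: cvec_def)
  interpret W: cvec W using assms(2) by (simp add: cvec_def)
  have "y \<in> carrier V" using assms by auto
  then show ?thesis
    using assms by (simp add: a_minus_def V.sm_minus_one W.sm_minus_one)
qed

context unital_cstar_algebra begin

lemma cvec_module: "Module.module complex_ring A"
  using cvec_axioms by (simp add: cvec_def)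

lemma cstar_subalgebraI:
  assumes "C \<subseteq> carrier A" "\<one> \<in> C"
    and "\<And>x y. x \<in> C \<Longrightarrow> y \<in> C \<Longrightarrow> x \<oplus> y \<in> C"
    and "\<And>x y. x \<in> C \<Longrightarrow> y \<in> C \<Longrightarrow> x \<otimes> y \<in> C"
    and smult: "\<And>c x. x \<in> C \<Longrightarrow> c \<odot> x \<in> C"
    and "\<And>x. x \<in> C \<Longrightarrow> star A x \<in> C"
    and "\<And>x l. (\<And>n. x n \<in> C) \<Longrightarrow> l \<in> carrier A \<Longrightarrow> lim_to x l \<Longrightarrow> l \<in> C"
  shows "cstar_subalgebra C A"
proof -
  have neg: "\<ominus> x \<in> C" if "x \<in> C" for x
    using smult[OF that, of "- 1"] that assms(1) sm_minus_one[of x] by auto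
  have "subring C A"
    by (rule ring.subringI[OF unital_cstar_algebra.axioms(1)[OF unital_cstar_algebra_axioms]
      assms(1,2) neg assms(4,3)])
  moreover have "\<forall>x l. (\<forall>n. x n \<in> C) \<and> l \<in> carrier A \<and> lim_to x l \<longrightarrow> l \<in> C"
    using assms(7) by blast
  ultimately show ?thesis
    unfolding cstar_subalgebra_def lim_to_eq using smult assms(6) by auto
qed

lemma cstar_subalgebraD:
  assumes "cstar_subalgebra C A"
  shows "x \<in> C \<Longrightarrow> x \<in> carrier A" "\<one> \<in> C" "\<zero> \<in> C"
    and "x \<in> C \<Longrightarrow> y \<in> C \<Longrightarrow> x \<oplus> y \<in> C"
    and "x \<in> C \<Longrightarrow> y \<in> C \<Longrightarrow> x \<otimes> y \<in> C"
    and "x \<in> C \<Longrightarrow> c \<odot> x \<in> C"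
    and "x \<in> C \<Longrightarrow> star A x \<in> C"
proof -
  have "subring C A" using assms by (simp add: cstar_subalgebra_def)
  note sub = subringE[OF this]
  show "x \<in> C \<Longrightarrow> x \<in> carrier A" "\<one> \<in> C" "\<zero> \<in> C"
    "x \<in> C \<Longrightarrow> y \<in> C \<Longrightarrow> x \<oplus> y \<in> C" "x \<in> C \<Longrightarrow> y \<in> C \<Longrightarrow> x \<otimes> y \<in> C"
    by (rule subsetD[OF sub(1)] sub(2,3,6,7); assumption)+
qed (use assms in \<open>simp_all add: cstar_subalgebra_def\<close>)

lemma cstar_subalgebra_limit:
  assumes "cstar_subalgebra C A" "\<And>n. z n \<in> C" "l \<in> carrier A" "lim_to z l"
  shows "l \<in> C"
  using assms unfolding cstar_subalgebra_def lim_to_eq by blast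

lemma subalgebra_module:
  assumes "cstar_subalgebra C A"
  shows "Module.module complex_ring (A\<lparr>carrier := C\<rparr>)"
  by (rule cvec_subspace[OF cvec_module]) (use cstar_subalgebraD[OF assms] in auto)

lemma subalgebra_diff:
  assumes "cstar_subalgebra C A" "x \<in> C" "y \<in> C"
  shows "x \<ominus>\<^bsub>A\<lparr>carrier := C\<rparr>\<^esub> y = x \<ominus> y"
  by (rule cvec_diff_cong[OF cvec_module subalgebra_module]) (use assms cstar_subalgebraD in auto)

lemma subalgebra_is_cstar_algebra:
  assumes C: "cstar_subalgebra C A"
  shows "unital_cstar_algebra (A\<lparr>carrier := C\<rparr>)"
proof -
  note D = cstar_subalgebraD[OF C]
  have "ring (A\<lparr>carrier := C\<rparr>)"
    using C unfolding cstar_subalgebra_def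
    by (intro ring.subring_is_ring unital_cstar_algebra.axioms(1) unital_cstar_algebra_axioms) auto
  moreover have "\<exists>l\<in>C. cstar_tendsto (A\<lparr>carrier := C\<rparr>) z l"
    if z: "\<And>n. z n \<in> C"
      and cau: "\<And>e. 0 < e \<Longrightarrow> \<exists>M. \<forall>m\<ge>M. \<forall>n\<ge>M. cnorm A (z m \<ominus>\<^bsub>A\<lparr>carrier := C\<rparr>\<^esub> z n) < e" for z
  proof -
    have "cauchy_seq z" using cau z by (simp add: cauchy_seq_def subalgebra_diff[OF C])
    moreover have "\<And>n. z n \<in> carrier A" using z D(1) by auto
    ultimately obtain l where l: "l \<in> carrier A" "lim_to z l" by (rule cauchy_converges)
    then have "l \<in> C" using cstar_subalgebra_limit[OF C z] by auto
    then show ?thesis using l z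
      by (auto simp: cstar_tendsto_def lim_to_def subalgebra_diff[OF C])
  qed
  ultimately show ?thesis
    by (intro unital_cstar_algebra.intro unital_cstar_algebra_axioms.intro subalgebra_module[OF C])
      (auto simp: D smult_mult_left smult_mult_right star_star star_add star_smult star_mult
        cnorm_nonneg cnorm_eq_0 cnorm_triangle cnorm_smult cnorm_mult cstar_identity)
qed

lemma carrier_subalgebra: "cstar_subalgebra (carrier A) A"
  by (rule cstar_subalgebraI) (auto simp: star_closed)

text \<open>A limit in \<open>A\<close> of elements of \<open>D\<close> already lies in the closed
  set \<open>C\<close>, so closedness of \<open>D\<close> relative to \<open>C\<close> is
  enough.\<close>

lemma subalgebra_of_subalgebra:
  assumes C: "cstar_subalgebra C A" and D: "cstar_subalgebra D (A\<lparr>carrier := C\<rparr>)"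
  shows "cstar_subalgebra D A"
proof -
  interpret C: unital_cstar_algebra "A\<lparr>carrier := C\<rparr>"
    by (rule subalgebra_is_cstar_algebra) fact
  have DC: "x \<in> C" if "x \<in> D" for x using C.cstar_subalgebraD(1)[OF D that] by simp
  show ?thesis
  proof (rule cstar_subalgebraI)
    fix x l assume x: "\<And>n. x n \<in> D" and l: "l \<in> carrier A" "lim_to x l"
    then have lC: "l \<in> C" using cstar_subalgebra_limit[OF C, of x l] DC by auto
    then have "C.lim_to x l"
      using l x DC unfolding C.lim_to_def by (simp add: lim_to_def subalgebra_diff[OF C])
    then show "l \<in> D" using C.cstar_subalgebra_limit[OF D, of x l] x lC by simp
  qed (use DC cstar_subalgebraD[OF C] C.cstar_subalgebraD[OF D] in auto)
qed

end

text \<open>Shaped as an induction principle: a property that holds on \<open>S\<close> and cuts out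
  a C*-subalgebra holds everywhere.\<close>

definition generates :: "('a, 'm) cstar_scheme \<Rightarrow> 'a set \<Rightarrow> bool" where
  "generates A S \<longleftrightarrow> S \<subseteq> carrier A \<and> (\<forall>C. cstar_subalgebra C A \<and> S \<subseteq> C \<longrightarrow> carrier A \<subseteq> C)"

lemma cstar_generated_simps [simp]:
  "mult (cstar_generated A S) = mult A" "one (cstar_generated A S) = one A"
  "zero (cstar_generated A S) = zero A" "add (cstar_generated A S) = add A"
  "smult (cstar_generated A S) = smult A" "star (cstar_generated A S) = star A"
  "cnorm (cstar_generated A S) = cnorm A"
  by (simp_all add: cstar_generated_def)

context unital_cstar_algebra begin

lemma cstar_generated_subalgebra:
  assumes "S \<subseteq> carrier A"
  shows "cstar_subalgebra (carrier (cstar_generated A S)) A"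
proof -
  let ?F = "{C. cstar_subalgebra C A \<and> S \<subseteq> C}"
  have ne: "carrier A \<in> ?F" using carrier_subalgebra assms by simp
  show ?thesis
  proof (rule cstar_subalgebraI)
    fix x l assume x: "\<And>n. x n \<in> carrier (cstar_generated A S)" and l: "l \<in> carrier A" "lim_to x l"
    then show "l \<in> carrier (cstar_generated A S)"
      using cstar_subalgebra_limit[of _ x l] by (auto simp: cstar_generated_def)
  qed (use ne in \<open>auto simp: cstar_generated_def cstar_subalgebraD\<close>)
qed

lemma cstar_generated_eq: "cstar_generated A S = A\<lparr>carrier := carrier (cstar_generated A S)\<rparr>"
  by (simp add: cstar_generated_def)

lemma cstar_generated_algebra:
  assumes "S \<subseteq> carrier A"
  shows "unital_cstar_algebra (cstar_generated A S)"
  using subalgebra_is_cstar_algebra[OF cstar_generated_subalgebra[OF assms]]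
    cstar_generated_eq[of S] by simp

lemma cstar_generated_contains: "S \<subseteq> carrier (cstar_generated A S)"
  by (auto simp: cstar_generated_def)

lemma generates_cstar_generated:
  assumes S: "S \<subseteq> carrier A"
  shows "generates (cstar_generated A S) S"
proof -
  have "carrier (cstar_generated A S) \<subseteq> C"
    if "cstar_subalgebra C (cstar_generated A S)" "S \<subseteq> C" for C
  proof -
    have "cstar_subalgebra C A"
      by (rule subalgebra_of_subalgebra[OF cstar_generated_subalgebra[OF S]])
        (use that cstar_generated_eq[of S] in simp)
    then show ?thesis using that by (auto simp: cstar_generated_def)
  qed
  then show ?thesis using cstar_generated_contains by (auto simp: generates_def)
qed

end

text \<open>The algebraic closure properties pull back directly; norm closedness pulls back because
  \<open>\<theta>\<close> is contractive.\<close>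

lemma star_hom_preimage_subalgebra:
  assumes A: "unital_cstar_algebra A" and B: "unital_cstar_algebra B"
    and hom: "unital_star_hom A B \<theta>" and D: "cstar_subalgebra D B"
  shows "cstar_subalgebra {x \<in> carrier A. \<theta> x \<in> D} A"
proof -
  interpret A: unital_cstar_algebra A by fact
  interpret B: unital_cstar_algebra B by fact
  note h = unital_star_homD[OF hom] and d = B.cstar_subalgebraD[OF D]
  show ?thesis
  proof (rule A.cstar_subalgebraI)
    fix x l assume x: "\<And>n. x n \<in> {x \<in> carrier A. \<theta> x \<in> D}" and l: "l \<in> carrier A" "A.lim_to x l"
    have "B.lim_to (\<lambda>n. \<theta> (x n)) (\<theta> l)"
    proof (rule B.lim_to_bound)
      show "cnorm B (\<theta> (x n) \<ominus>\<^bsub>B\<^esub> \<theta> l) \<le> cnorm A (x n \<ominus>\<^bsub>A\<^esub> l)" for n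
        using star_hom_contractive[OF A B hom, of "x n \<ominus>\<^bsub>A\<^esub> l"] x[of n] l(1)
        by (simp add: star_hom_diff[OF A B hom])
    qed (use x l h in \<open>auto simp: A.lim_to_def\<close>)
    then show "l \<in> {x \<in> carrier A. \<theta> x \<in> D}"
      using B.cstar_subalgebra_limit[OF D, of "\<lambda>n. \<theta> (x n)"] x l h(1) by auto
  qed (auto simp: h d A.star_closed)
qed

lemma generates_hom_image:
  assumes "unital_cstar_algebra A" "unital_cstar_algebra B" "unital_star_hom A B \<theta>"
    "cstar_subalgebra D B" "generates A S" "\<theta> ` S \<subseteq> D" "x \<in> carrier A"
  shows "\<theta> x \<in> D"
  using star_hom_preimage_subalgebra[OF assms(1-4)] assms(5-7) unfolding generates_def by blast

section \<open>States\<close>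

lemma gns_prespace_simps [simp]:
  "carrier (gns_prespace A \<rho>) = carrier A" "zero (gns_prespace A \<rho>) = zero A"
  "add (gns_prespace A \<rho>) = add A" "smult (gns_prespace A \<rho>) = smult A"
  "ip (gns_prespace A \<rho>) x y = \<rho> (star A y \<otimes>\<^bsub>A\<^esub> x)"
  by (simp_all add: gns_prespace_def)

locale cstar_state = unital_cstar_algebra A for A :: "('a, 'm) cstar_scheme" (structure) +
  fixes \<rho> :: "'a \<Rightarrow> complex"
  assumes is_state: "state A \<rho>"
begin

lemma rho_add: "x \<in> carrier A \<Longrightarrow> y \<in> carrier A \<Longrightarrow> \<rho> (x \<oplus> y) = \<rho> x + \<rho> y"
  and rho_smult: "x \<in> carrier A \<Longrightarrow> \<rho> (c \<odot> x) = c * \<rho> x"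
  and rho_one [simp]: "\<rho> \<one> = 1"
  using is_state by (auto simp: state_def)

lemma rho_pos:
  assumes "x \<in> carrier A"
  shows "0 \<le> Re (\<rho> (star A x \<otimes> x))" "Im (\<rho> (star A x \<otimes> x)) = 0"
proof -
  have "\<rho> (star A x \<otimes> x) \<in> \<real>\<^sub>\<ge>\<^sub>0" using is_state assms by (auto simp: state_def)
  then show "0 \<le> Re (\<rho> (star A x \<otimes> x))" "Im (\<rho> (star A x \<otimes> x)) = 0"
    by (auto elim!: nonneg_Reals_cases)
qed

text \<open>Polarisation: the state is real on \<open>star A z\<close> times \<open>z\<close> for
  \<open>z = x + y\<close>, which settles the imaginary part, and for \<open>z = x + i y\<close>,
  which settles the real part.\<close>

lemma rho_hermitian:
  assumes "x \<in> carrier A" "y \<in> carrier A"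
  shows "\<rho> (star A x \<otimes> y) = cnj (\<rho> (star A y \<otimes> x))"
proof -
  have expand: "\<rho> (star A (x \<oplus> c \<odot> y) \<otimes> (x \<oplus> c \<odot> y)) = \<rho> (star A x \<otimes> x)
      + c * \<rho> (star A x \<otimes> y) + cnj c * \<rho> (star A y \<otimes> x) + cnj c * c * \<rho> (star A y \<otimes> y)" for c
    using assms
    by (simp add: star_add star_smult star_closed distrib_l distrib_r smult_mult_left
      smult_mult_right sm_add_right rho_add rho_smult algebra_simps)
  have "Im (\<rho> (star A x \<otimes> y) + \<rho> (star A y \<otimes> x)) = 0"
    using expand[of 1] rho_pos(2)[of "x \<oplus> 1 \<odot> y"] rho_pos(2)[of x] rho_pos(2)[of y] assms by simp
  moreover have "Im (\<i> * \<rho> (star A x \<otimes> y) - \<i> * \<rho> (star A y \<otimes> x)) = 0"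
    using expand[of \<i>] rho_pos(2)[of "x \<oplus> \<i> \<odot> y"] rho_pos(2)[of x] rho_pos(2)[of y] assms by simp
  ultimately show ?thesis by (simp add: complex_eq_iff)
qed

lemma gns_semi_ip: "semi_ip (gns_prespace A \<rho>)"
proof -
  have "Module.module complex_ring (gns_prespace A \<rho>)"
    by (rule cvec_subspace[OF cvec_module]) auto
  then show ?thesis
    by (intro semi_ip.intro semi_ip_axioms.intro)
      (auto simp: cvec_def distrib_r smult_mult_right rho_add rho_smult star_closed rho_pos
        intro: rho_hermitian)
qed

sublocale G: semi_ip "gns_prespace A \<rho>" by (rule gns_semi_ip)

abbreviation gnorm :: "'a \<Rightarrow> real" where "gnorm x \<equiv> vnorm (gns_prespace A \<rho>) x"

lemma gnorm_sq: "x \<in> carrier A \<Longrightarrow> (gnorm x)\<^sup>2 = Re (\<rho> (star A x \<otimes> x))"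
  using G.vnorm_sq[of x] by simp

lemma rho_star: "x \<in> carrier A \<Longrightarrow> \<rho> (star A x) = cnj (\<rho> x)"
  using rho_hermitian[of x \<one>] star_closed[of x] by simp

lemma gnorm_one: "gnorm \<one> = 1"
  by (simp add: vnorm_def)

text \<open>For \<open>c\<close> above the norm of \<open>x\<close>, the element
  \<open>1 - h\<close> with \<open>h\<close> the quotient of \<open>star A x\<close> times
  \<open>x\<close> by \<open>c^2\<close> is the square of a self-adjoint \<open>k\<close>.
  Positivity of the state on \<open>k y\<close> then bounds the seminorm of \<open>x y\<close> by
  \<open>c\<close> times that of \<open>y\<close>, and \<open>c\<close> may approach the norm of
  \<open>x\<close>.\<close>

lemma gnorm_mult_le:
  assumes x: "x \<in> carrier A" and y: "y \<in> carrier A"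
  shows "gnorm (x \<otimes> y) \<le> cnorm A x * gnorm y"
proof -
  have le: "gnorm (x \<otimes> y) \<le> c * gnorm y" if c: "cnorm A x < c" for c
  proof -
    have c0: "0 < c" using c cnorm_nonneg[OF x] by simp
    define h where "h = of_real (1 / c\<^sup>2) \<odot> (star A x \<otimes> x)"
    have h: "h \<in> carrier A" "star A h = h"
      using x by (auto simp: h_def star_smult star_mult star_star star_closed)
    have "(cnorm A x)\<^sup>2 < c\<^sup>2" using c cnorm_nonneg[OF x] by (simp add: power_strict_mono)
    then have hn: "cnorm A h < 1"
      using x c0 by (simp add: h_def cnorm_smult cstar_identity star_closed norm_divide norm_power divide_simps)
    obtain k where k: "k \<in> carrier A" "star A k = k" "k \<otimes> k = \<one> \<ominus> h"
      by (rule sqrt_one_minus[OF h hn], rule that)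
    have "star A (k \<otimes> y) \<otimes> (k \<otimes> y) = star A y \<otimes> k \<otimes> (k \<otimes> y)"
      using k y by (simp add: star_mult)
    also have "\<dots> = star A y \<otimes> (k \<otimes> k) \<otimes> y"
    proof -
      have "star A y \<in> carrier A" using y by (rule star_closed)
      then show ?thesis using y k(1) by algebra
    qed
    also have "\<dots> = star A y \<otimes> y \<ominus> star A y \<otimes> h \<otimes> y"
    proof -
      have "star A y \<in> carrier A" using y by (rule star_closed)
      then show ?thesis unfolding k(3) using y h(1) by algebra
    qed
    also have "star A y \<otimes> h \<otimes> y = of_real (1 / c\<^sup>2) \<odot> (star A (x \<otimes> y) \<otimes> (x \<otimes> y))"
      using x y by (simp add: h_def smult_mult_left smult_mult_right star_mult star_closed mult_assoc)
    finally have "\<rho> (star A (k \<otimes> y) \<otimes> (k \<otimes> y))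
        = \<rho> (star A y \<otimes> y) - of_real (1 / c\<^sup>2) * \<rho> (star A (x \<otimes> y) \<otimes> (x \<otimes> y))"
      using x y rho_smult[of _ "- 1"]
      by (simp add: a_minus_def sm_minus_one rho_add rho_smult star_closed)
    then have "Re (\<rho> (star A (k \<otimes> y) \<otimes> (k \<otimes> y))) = (gnorm y)\<^sup>2 - (1 / c\<^sup>2) * (gnorm (x \<otimes> y))\<^sup>2"
      using x y by (simp add: gnorm_sq)
    then have "(1 / c\<^sup>2) * (gnorm (x \<otimes> y))\<^sup>2 \<le> (gnorm y)\<^sup>2"
      using rho_pos(1)[of "k \<otimes> y"] k y by simp
    then have "(gnorm (x \<otimes> y))\<^sup>2 \<le> (c * gnorm y)\<^sup>2"
      using c0 by (simp add: divide_simps power_mult_distrib mult.commute)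
    then show ?thesis
      by (rule power2_le_imp_le) (use c0 y G.vnorm_nonneg[of y] in simp)
  qed
  show ?thesis
  proof (rule field_le_epsilon)
    fix e :: real assume "0 < e"
    \<comment> \<open>The excess over the norm of \<open>x\<close> is divided by
      \<open>gnorm y + 1\<close>, so it contributes at most \<open>e\<close> even when
      \<open>gnorm y = 0\<close>.\<close>
    have "gnorm (x \<otimes> y) \<le> (cnorm A x + e / (gnorm y + 1)) * gnorm y"
      using \<open>0 < e\<close> G.vnorm_nonneg[of y] y by (intro le) simp
    also have "\<dots> \<le> cnorm A x * gnorm y + e"
    proof -
      have "e / (gnorm y + 1) * gnorm y \<le> e"
        using \<open>0 < e\<close> G.vnorm_nonneg[of y] y by (simp add: divide_simps)
      then show ?thesis by (simp add: distrib_right)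
    qed
    finally show "gnorm (x \<otimes> y) \<le> cnorm A x * gnorm y + e" .
  qed
qed

text \<open>\<open>\<rho> x\<close> is the GNS inner product of \<open>x\<close> with the unit
  vector given by the unit of \<open>A\<close>.\<close>

lemma rho_bound: "x \<in> carrier A \<Longrightarrow> cmod (\<rho> x) \<le> cnorm A x"
  using G.cauchy_schwarz[of x \<one>] gnorm_mult_le[of x \<one>] by (simp add: gnorm_one)

lemma rho_tendsto:
  assumes "lim_to x l" "\<And>n. x n \<in> carrier A" "l \<in> carrier A"
  shows "(\<lambda>n. \<rho> (x n)) \<longlonglongrightarrow> \<rho> l"
proof -
  have "cmod (\<rho> (x n) - \<rho> l) \<le> cnorm A (x n \<ominus> l)" for n
    using rho_bound[of "x n \<ominus> l"] assms rho_smult[of l "- 1"]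
    by (simp add: a_minus_def sm_minus_one rho_add)
  then have "(\<lambda>n. cmod (\<rho> (x n) - \<rho> l)) \<longlonglongrightarrow> 0"
    using assms(1) unfolding lim_to_def by (intro LIMSEQ_zero_bound[OF norm_ge_zero]) auto
  then show ?thesis by (simp add: tendsto_norm_zero_iff LIM_zero_iff)
qed

end

text \<open>The GNS representation of \<open>\<rho>\<close> is isometric.\<close>

definition norming :: "('a, 'm) cstar_scheme \<Rightarrow> ('a \<Rightarrow> complex) \<Rightarrow> bool" where
  "norming A \<rho> \<longleftrightarrow> (\<forall>a\<in>carrier A. \<forall>K\<ge>0.
     (\<forall>b\<in>carrier A. vnorm (gns_prespace A \<rho>) (a \<otimes>\<^bsub>A\<^esub> b) \<le> K * vnorm (gns_prespace A \<rho>) b)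
       \<longrightarrow> cnorm A a \<le> K)"

section \<open>Operators on a Hilbert space\<close>

locale hilbert = semi_ip V for V :: "('v, 'm) ip_space_scheme" (structure) +
  assumes definite: "x \<in> carrier V \<Longrightarrow> vnorm V x = 0 \<Longrightarrow> x = \<zero>"
    and hilbert_complete: "(\<And>n. z n \<in> carrier V) \<Longrightarrow> cauchy_seq z \<Longrightarrow> \<exists>l\<in>carrier V. lim_to z l"
begin

lemma vnorm_diff_zero: "x \<in> carrier V \<Longrightarrow> y \<in> carrier V \<Longrightarrow> vnorm V (x \<ominus> y) = 0 \<Longrightarrow> x = y"
  by (rule diff_eq_zero) (simp_all add: definite)

lemma ip_eqI:
  assumes "x \<in> carrier V" "y \<in> carrier V" "\<And>z. z \<in> carrier V \<Longrightarrow> ip V z x = ip V z y"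
  shows "x = y"
proof (rule vnorm_diff_zero)
  have "ip V (x \<ominus> y) (x \<ominus> y) = 0"
    using assms by (simp add: ip_diff_right)
  then show "vnorm V (x \<ominus> y) = 0" by (simp add: vnorm_def)
qed (fact assms)+

lemma vlim_unique:
  assumes "lim_to x l" "lim_to x k" "\<And>n. x n \<in> carrier V" "l \<in> carrier V" "k \<in> carrier V"
  shows "l = k"
  by (rule vnorm_diff_zero) (use assms lim_to_unique[of x l k] in auto)

text \<open>The Riesz vector of \<open>f\<close> minimises \<open>\<parallel>x\<parallel>\<^sup>2 - 2 Re f x\<close>.\<close>

lemma riesz:
  assumes f_closed: "\<And>x y. x \<in> carrier V \<Longrightarrow> y \<in> carrier V \<Longrightarrow> f (x \<oplus> y) = f x + f y"
    and f_smult: "\<And>c x. x \<in> carrier V \<Longrightarrow> f (c \<odot> x) = c * f x"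
    and f_bound: "\<And>x. x \<in> carrier V \<Longrightarrow> cmod (f x) \<le> K * vnorm V x"
  shows "\<exists>z\<in>carrier V. \<forall>x\<in>carrier V. f x = ip V x z"
proof -
  define F where "F x = (vnorm V x)\<^sup>2 - 2 * Re (f x)" for x
  \<comment> \<open>Completing the square: with \<open>N\<close> the norm of \<open>x\<close>, the
    bound on \<open>f\<close> gives \<open>F x >= (N - K)^2 - K^2\<close>.\<close>
  have F_lower: "- K\<^sup>2 \<le> F x" if "x \<in> carrier V" for x
  proof -
    have "Re (f x) \<le> K * vnorm V x"
      using f_bound[OF that] complex_Re_le_cmod[of "f x"] by linarith
    moreover have "2 * (K * vnorm V x) \<le> (vnorm V x)\<^sup>2 + K\<^sup>2"
      using zero_le_power2[of "vnorm V x - K"] by (simp add: power2_diff mult_ac)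
    ultimately show ?thesis unfolding F_def by linarith
  qed
  define m where "m = Inf (F ` carrier V)"
  have bdd: "bdd_below (F ` carrier V)"
    using F_lower by (intro bdd_belowI[of _ "- K\<^sup>2"]) auto
  have m_le: "m \<le> F x" if "x \<in> carrier V" for x
    unfolding m_def using bdd that by (intro cInf_lower) auto
  have "\<exists>x\<in>carrier V. F x < m + 1 / (real n + 1)" for n
  proof -
    have "\<exists>y\<in>F ` carrier V. y < m + 1 / (real n + 1)"
      using cInf_less_iff[of "F ` carrier V" "m + 1 / (real n + 1)"] bdd M.zero_closed
      unfolding m_def by (auto simp: field_simps)
    then show ?thesis by auto
  qed
  then obtain x where x: "\<And>n. x n \<in> carrier V" "\<And>n. F (x n) < m + 1 / (real n + 1)"
    by metis
  \<comment> \<open>The parallelogram law writes the squared distance through \<open>F\<close> at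
    both points and at their midpoint, where \<open>F\<close> is at least \<open>m\<close>; hence a
    minimising sequence is Cauchy.\<close>
  have dist: "(vnorm V (x i \<ominus> x j))\<^sup>2 \<le> 2 * (1 / (real i + 1)) + 2 * (1 / (real j + 1))" for i j
  proof -
    have "F ((1 / 2) \<odot> (x i \<oplus> x j))
        = (vnorm V (x i \<oplus> x j))\<^sup>2 / 4 - (Re (f (x i)) + Re (f (x j)))"
      using x(1) by (simp add: F_def nrm_smult f_closed f_smult power_divide norm_divide add_divide_distrib)
    moreover have "(vnorm V (x i \<oplus> x j))\<^sup>2 + (vnorm V (x i \<ominus> x j))\<^sup>2
        = 2 * (vnorm V (x i))\<^sup>2 + 2 * (vnorm V (x j))\<^sup>2"
      using vnorm_add_smult_sq[OF x(1)[of i] x(1)[of j], of 1]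
        vnorm_add_smult_sq[OF x(1)[of i] x(1)[of j], of "- 1"] x(1)
      by (simp add: a_minus_def sm_minus_one)
    ultimately have "(vnorm V (x i \<ominus> x j))\<^sup>2
        = 2 * F (x i) + 2 * F (x j) - 4 * F ((1 / 2) \<odot> (x i \<oplus> x j))"
      by (simp add: F_def)
    moreover have "m \<le> F ((1 / 2) \<odot> (x i \<oplus> x j))" by (rule m_le) (simp add: x)
    ultimately show ?thesis using x(2)[of i] x(2)[of j] by linarith
  qed
  have "cauchy_seq x" unfolding cauchy_seq_def
  proof (intro allI impI)
    fix e :: real assume e: "0 < e"
    then have "0 < e\<^sup>2 / 4" by simp
    then obtain N where N: "1 / (real N + 1) < e\<^sup>2 / 4"
      using reals_Archimedean[of "e\<^sup>2 / 4"] by (auto simp: inverse_eq_divide add.commute)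
    have le: "1 / (real i + 1) < e\<^sup>2 / 4" if "i \<ge> N" for i
    proof -
      have "1 / (real i + 1) \<le> 1 / (real N + 1)" using that by (intro divide_left_mono) auto
      then show ?thesis using N by linarith
    qed
    have "vnorm V (x i \<ominus> x j) < e" if "i \<ge> N" "j \<ge> N" for i j
    proof -
      have "(vnorm V (x i \<ominus> x j))\<^sup>2 < e\<^sup>2"
        using dist[of i j] le[OF that(1)] le[OF that(2)] by linarith
      then show ?thesis by (rule power2_less_imp_less) (use e in simp)
    qed
    then show "\<exists>M. \<forall>m\<ge>M. \<forall>n\<ge>M. vnorm V (x m \<ominus> x n) < e" by blast
  qed
  then obtain z where z: "z \<in> carrier V" "lim_to x z"
    using hilbert_complete[of x] x(1) by blast
  have f_diff: "f (u \<ominus> v) = f u - f v" if "u \<in> carrier V" "v \<in> carrier V" for u v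
    using that by (simp add: a_minus_def sm_minus_one f_closed f_smult)
  have "(\<lambda>n. K * vnorm V (x n \<ominus> z)) \<longlonglongrightarrow> K * 0"
    using z(2) unfolding lim_to_def by (intro tendsto_mult_left) simp
  then have "(\<lambda>n. K * vnorm V (x n \<ominus> z)) \<longlonglongrightarrow> 0" by simp
  then have "(\<lambda>n. cmod (f (x n) - f z)) \<longlonglongrightarrow> 0"
    by (rule LIMSEQ_zero_bound[OF norm_ge_zero, rotated])
      (use f_bound[of "x n \<ominus> z" for n] x(1) z(1) f_diff in auto)
  then have "(\<lambda>n. f (x n)) \<longlonglongrightarrow> f z" by (simp add: tendsto_norm_zero_iff LIM_zero_iff)
  then have "(\<lambda>n. F (x n)) \<longlonglongrightarrow> F z"
    unfolding F_def using lim_to_nrm[OF z(2) x(1) z(1)] by (intro tendsto_intros)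
  moreover have "(\<lambda>n. m + 1 / (real n + 1)) \<longlonglongrightarrow> m + 0"
    using LIMSEQ_inverse_real_of_nat by (intro tendsto_add) (auto simp: inverse_eq_divide add.commute)
  ultimately have Fz: "F z \<le> m"
    using x(2) by (intro LIMSEQ_le[of "\<lambda>n. F (x n)" _ "\<lambda>n. m + 1 / (real n + 1)"])
      (auto intro: less_imp_le)
  have "f h = ip V h z" if h: "h \<in> carrier V" for h
  proof (rule ccontr)
    assume ne: "f h \<noteq> ip V h z"
    \<comment> \<open>If \<open>z\<close> failed to represent \<open>f\<close> at \<open>h\<close>,
      a step from \<open>z\<close> along \<open>h\<close> against the defect \<open>d\<close> would
      push \<open>F\<close> below its infimum; \<open>t\<close> is small enough that the quadratic
      term cannot compensate the linear gain.\<close>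
    define d where "d = ip V h z - f h"
    define t where "t = 1 / ((vnorm V h)\<^sup>2 + 1)"
    have "0 < (vnorm V h)\<^sup>2 + 1" by (simp add: add_nonneg_pos)
    then have t: "0 < t" "t * (vnorm V h)\<^sup>2 < 1" by (simp_all add: t_def divide_simps)
    define c where "c = - (of_real t * cnj d)"
    have re1: "Re (cnj c * ip V z h) = Re (c * ip V h z)" unfolding ip_cnj[OF h z(1)] by simp
    have "F (z \<oplus> c \<odot> h) = F z + 2 * Re (c * d) + (cmod c)\<^sup>2 * (vnorm V h)\<^sup>2"
      unfolding F_def vnorm_add_smult_sq[OF z(1) h] re1
      using z(1) h by (simp add: f_closed f_smult d_def algebra_simps)
    moreover have "c * d = of_real (- t * (cmod d)\<^sup>2)"
      using mult_cnj_self[of d] by (simp add: c_def mult_ac)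
    moreover have "(cmod c)\<^sup>2 = t\<^sup>2 * (cmod d)\<^sup>2"
      by (simp add: c_def norm_mult power_mult_distrib)
    ultimately have "F (z \<oplus> c \<odot> h)
        = F z - 2 * t * (cmod d)\<^sup>2 + t\<^sup>2 * (cmod d)\<^sup>2 * (vnorm V h)\<^sup>2"
      by simp
    moreover have "m \<le> F (z \<oplus> c \<odot> h)" using z(1) h by (intro m_le) simp
    ultimately have "2 * t * (cmod d)\<^sup>2 \<le> t\<^sup>2 * (cmod d)\<^sup>2 * (vnorm V h)\<^sup>2"
      using Fz by linarith
    also have "\<dots> = t * (cmod d)\<^sup>2 * (t * (vnorm V h)\<^sup>2)" by (simp add: power2_eq_square)
    also have "\<dots> \<le> t * (cmod d)\<^sup>2 * 1" using t by (intro mult_left_mono) auto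
    finally have "t * (cmod d)\<^sup>2 \<le> 0" by simp
    then show False using t(1) ne by (simp add: mult_le_0_iff d_def)
  qed
  then show ?thesis using z(1) by blast
qed

section \<open>The C*-algebra of bounded operators\<close>

lemma bopD:
  assumes "T \<in> bounded_operators V"
  shows "x \<in> carrier V \<Longrightarrow> T x \<in> carrier V"
    and "x \<in> carrier V \<Longrightarrow> y \<in> carrier V \<Longrightarrow> T (x \<oplus> y) = T x \<oplus> T y"
    and "x \<in> carrier V \<Longrightarrow> T (c \<odot> x) = c \<odot> T x"
  using assms unfolding bounded_operators_def by auto

lemma bop_zero: "T \<in> bounded_operators V \<Longrightarrow> T \<zero> = \<zero>"
  using bopD(3)[of T \<zero> 0] bopD(1)[of T \<zero>] by simp

lemma bop_diff:
  "T \<in> bounded_operators V \<Longrightarrow> x \<in> carrier V \<Longrightarrow> y \<in> carrier V \<Longrightarrow> T (x \<ominus> y) = T x \<ominus> T y"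
  by (simp add: a_minus_def sm_minus_one bopD)

lemma bop_bound:
  assumes "T \<in> bounded_operators V"
  obtains K where "0 \<le> K" "\<And>x. x \<in> carrier V \<Longrightarrow> vnorm V (T x) \<le> K * vnorm V x"
proof -
  obtain K where K: "\<And>x. x \<in> carrier V \<Longrightarrow> vnorm V (T x) \<le> K * vnorm V x"
  proof -
    have "\<exists>K. \<forall>x\<in>carrier V. vnorm V (T x) \<le> K * vnorm V x"
      using assms by (simp add: bounded_operators_def)
    then show ?thesis using that by blast
  qed
  have "vnorm V (T x) \<le> \<bar>K\<bar> * vnorm V x" if "x \<in> carrier V" for x
    using K[OF that] mult_right_mono[of K "\<bar>K\<bar>" "vnorm V x"] vnorm_nonneg[OF that] by linarith
  then show ?thesis using that[of "\<bar>K\<bar>"] by simp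
qed

lemma bopI:
  assumes "\<And>x. x \<in> carrier V \<Longrightarrow> t x \<in> carrier V"
    and "\<And>x y. x \<in> carrier V \<Longrightarrow> y \<in> carrier V \<Longrightarrow> t (x \<oplus> y) = t x \<oplus> t y"
    and "\<And>c x. x \<in> carrier V \<Longrightarrow> t (c \<odot> x) = c \<odot> t x"
    and "\<And>x. x \<in> carrier V \<Longrightarrow> vnorm V (t x) \<le> K * vnorm V x"
  shows "(\<lambda>x\<in>carrier V. t x) \<in> bounded_operators V"
  unfolding bounded_operators_def using assms by (auto intro!: exI[of _ K])

lemma bop_eqI:
  assumes "S \<in> bounded_operators V" "T \<in> bounded_operators V" "\<And>x. x \<in> carrier V \<Longrightarrow> S x = T x"
  shows "S = T"
proof -
  have "S \<in> carrier V \<rightarrow>\<^sub>E carrier V" "T \<in> carrier V \<rightarrow>\<^sub>E carrier V"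
    using assms by (auto simp: bounded_operators_def)
  then show ?thesis using assms(3) by (auto intro: PiE_ext)
qed

abbreviation "\<B> \<equiv> operator_algebra V"

lemma carrier_op: "carrier \<B> = bounded_operators V"
  by (simp add: operator_algebra_def)

lemma op_apply [simp]:
  assumes "x \<in> carrier V"
  shows "(S \<otimes>\<^bsub>\<B>\<^esub> T) x = S (T x)" "\<one>\<^bsub>\<B>\<^esub> x = x" "\<zero>\<^bsub>\<B>\<^esub> x = \<zero>"
    "(S \<oplus>\<^bsub>\<B>\<^esub> T) x = S x \<oplus> T x" "(c \<odot>\<^bsub>\<B>\<^esub> T) x = c \<odot> T x"
  using assms by (simp_all add: operator_algebra_def compose_def)

lemma op_mult_closed:
  assumes S: "S \<in> bounded_operators V" and T: "T \<in> bounded_operators V"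
  shows "S \<otimes>\<^bsub>\<B>\<^esub> T \<in> bounded_operators V"
proof -
  obtain K L where K: "0 \<le> K" "\<And>x. x \<in> carrier V \<Longrightarrow> vnorm V (S x) \<le> K * vnorm V x"
    and L: "\<And>x. x \<in> carrier V \<Longrightarrow> vnorm V (T x) \<le> L * vnorm V x"
    using bop_bound[OF S] bop_bound[OF T] by metis
  have "(\<lambda>x\<in>carrier V. S (T x)) \<in> bounded_operators V"
  proof (rule bopI)
    fix x assume x: "x \<in> carrier V"
    show "vnorm V (S (T x)) \<le> (K * L) * vnorm V x"
      using K(2)[of "T x"] mult_left_mono[OF L[OF x] K(1)] x bopD(1)[OF T] by simp
  qed (use bopD[OF S] bopD[OF T] in auto)
  then show ?thesis by (simp add: operator_algebra_def compose_def)
qed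

lemma op_one_closed: "\<one>\<^bsub>\<B>\<^esub> \<in> bounded_operators V"
  using bopI[of "\<lambda>x. x" 1] by (simp add: operator_algebra_def)

lemma op_zero_closed: "\<zero>\<^bsub>\<B>\<^esub> \<in> bounded_operators V"
  using bopI[of "\<lambda>x. \<zero>" 0] by (simp add: operator_algebra_def)

lemma op_add_closed:
  assumes S: "S \<in> bounded_operators V" and T: "T \<in> bounded_operators V"
  shows "S \<oplus>\<^bsub>\<B>\<^esub> T \<in> bounded_operators V"
proof -
  obtain K L where K: "\<And>x. x \<in> carrier V \<Longrightarrow> vnorm V (S x) \<le> K * vnorm V x"
    and L: "\<And>x. x \<in> carrier V \<Longrightarrow> vnorm V (T x) \<le> L * vnorm V x"
    using bop_bound[OF S] bop_bound[OF T] by metis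
  have "(\<lambda>x\<in>carrier V. S x \<oplus> T x) \<in> bounded_operators V"
  proof (rule bopI)
    fix x assume x: "x \<in> carrier V"
    show "vnorm V (S x \<oplus> T x) \<le> (K + L) * vnorm V x"
      using K[OF x] L[OF x] nrm_triangle[of "S x" "T x"] x bopD(1)[OF T] bopD(1)[OF S]
      by (simp add: distrib_right)
  next
    fix x y assume xy: "x \<in> carrier V" "y \<in> carrier V"
    then have "S x \<in> carrier V" "S y \<in> carrier V" "T x \<in> carrier V" "T y \<in> carrier V"
      using bopD[OF S] bopD[OF T] by auto
    then have "(S x \<oplus> S y) \<oplus> (T x \<oplus> T y) = (S x \<oplus> T x) \<oplus> (S y \<oplus> T y)" by algebra
    then show "S (x \<oplus> y) \<oplus> T (x \<oplus> y) = (S x \<oplus> T x) \<oplus> (S y \<oplus> T y)"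
      using xy bopD[OF S] bopD[OF T] by simp
  qed (use bopD[OF S] bopD[OF T] in \<open>auto simp: sm_add_right\<close>)
  then show ?thesis by (simp add: operator_algebra_def)
qed

lemma op_smult_closed:
  assumes T: "T \<in> bounded_operators V"
  shows "c \<odot>\<^bsub>\<B>\<^esub> T \<in> bounded_operators V"
proof -
  obtain L where L: "\<And>x. x \<in> carrier V \<Longrightarrow> vnorm V (T x) \<le> L * vnorm V x"
    using bop_bound[OF T] by metis
  have "(\<lambda>x\<in>carrier V. c \<odot> T x) \<in> bounded_operators V"
  proof (rule bopI)
    fix x assume x: "x \<in> carrier V"
    show "vnorm V (c \<odot> T x) \<le> (cmod c * L) * vnorm V x"
      using mult_left_mono[OF L[OF x], of "cmod c"] x bopD(1)[OF T] by (simp add: nrm_smult mult.assoc)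
  qed (use bopD[OF T] in \<open>auto simp: sm_add_right sm_assoc mult.commute\<close>)
  then show ?thesis by (simp add: operator_algebra_def)
qed

lemma op_module: "Module.module complex_ring \<B>"
proof (rule complex_moduleI)
  show "abelian_group \<B>"
  proof (rule abelian_groupI, unfold carrier_op)
    fix T assume T: "T \<in> bounded_operators V"
    have "((- 1) \<odot>\<^bsub>\<B>\<^esub> T) \<oplus>\<^bsub>\<B>\<^esub> T = \<zero>\<^bsub>\<B>\<^esub>"
      by (rule bop_eqI) (auto simp: T op_add_closed op_smult_closed op_zero_closed bopD(1)[OF T]
        sm_minus_one[symmetric] M.l_neg)
    then show "\<exists>S\<in>bounded_operators V. S \<oplus>\<^bsub>\<B>\<^esub> T = \<zero>\<^bsub>\<B>\<^esub>" using op_smult_closed[OF T] by blast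
  next
    fix R S T assume RST: "R \<in> bounded_operators V" "S \<in> bounded_operators V" "T \<in> bounded_operators V"
    show "R \<oplus>\<^bsub>\<B>\<^esub> S \<oplus>\<^bsub>\<B>\<^esub> T = R \<oplus>\<^bsub>\<B>\<^esub> (S \<oplus>\<^bsub>\<B>\<^esub> T)"
      by (rule bop_eqI) (auto simp: RST op_add_closed bopD(1)[OF RST(1)] bopD(1)[OF RST(2)]
        bopD(1)[OF RST(3)] M.a_assoc)
  next
    fix S T assume RST: "S \<in> bounded_operators V" "T \<in> bounded_operators V"
    show "S \<oplus>\<^bsub>\<B>\<^esub> T = T \<oplus>\<^bsub>\<B>\<^esub> S"
      by (rule bop_eqI) (auto simp: RST op_add_closed bopD(1)[OF RST(1)] bopD(1)[OF RST(2)] M.a_comm)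
  next
    fix T assume T: "T \<in> bounded_operators V"
    show "\<zero>\<^bsub>\<B>\<^esub> \<oplus>\<^bsub>\<B>\<^esub> T = T"
      by (rule bop_eqI) (auto simp: T op_add_closed op_zero_closed bopD(1)[OF T])
  qed (auto simp: op_add_closed op_zero_closed)
next
  fix c d T assume "T \<in> carrier \<B>"
  then have T: "T \<in> bounded_operators V" by (simp add: carrier_op)
  show "(c + d) \<odot>\<^bsub>\<B>\<^esub> T = c \<odot>\<^bsub>\<B>\<^esub> T \<oplus>\<^bsub>\<B>\<^esub> d \<odot>\<^bsub>\<B>\<^esub> T"
    by (rule bop_eqI) (auto simp: T op_add_closed op_smult_closed bopD(1)[OF T] sm_add_left)
  show "(c * d) \<odot>\<^bsub>\<B>\<^esub> T = c \<odot>\<^bsub>\<B>\<^esub> (d \<odot>\<^bsub>\<B>\<^esub> T)"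
    by (rule bop_eqI) (auto simp: T op_smult_closed bopD(1)[OF T] sm_assoc)
next
  fix c S T assume "S \<in> carrier \<B>" "T \<in> carrier \<B>"
  then have RST: "S \<in> bounded_operators V" "T \<in> bounded_operators V" by (simp_all add: carrier_op)
  show "c \<odot>\<^bsub>\<B>\<^esub> (S \<oplus>\<^bsub>\<B>\<^esub> T) = c \<odot>\<^bsub>\<B>\<^esub> S \<oplus>\<^bsub>\<B>\<^esub> c \<odot>\<^bsub>\<B>\<^esub> T"
    by (rule bop_eqI) (auto simp: RST op_add_closed op_smult_closed bopD(1)[OF RST(1)]
      bopD(1)[OF RST(2)] sm_add_right)
next
  fix T assume "T \<in> carrier \<B>"
  then have T: "T \<in> bounded_operators V" by (simp add: carrier_op)
  show "1 \<odot>\<^bsub>\<B>\<^esub> T = T"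
    by (rule bop_eqI) (auto simp: T op_smult_closed bopD(1)[OF T])
qed (auto simp: carrier_op op_smult_closed)

lemma op_ring: "ring \<B>"
proof (rule ringI)
  interpret B: cvec \<B> using op_module by (simp add: cvec_def)
  show "abelian_group \<B>" ..
  show "monoid \<B>"
  proof (rule monoidI, unfold carrier_op)
    fix R S T assume RST: "R \<in> bounded_operators V" "S \<in> bounded_operators V" "T \<in> bounded_operators V"
    show "R \<otimes>\<^bsub>\<B>\<^esub> S \<otimes>\<^bsub>\<B>\<^esub> T = R \<otimes>\<^bsub>\<B>\<^esub> (S \<otimes>\<^bsub>\<B>\<^esub> T)"
      by (rule bop_eqI) (auto simp: RST op_mult_closed bopD(1)[OF RST(3)])
  next
    fix T assume T: "T \<in> bounded_operators V"
    show "\<one>\<^bsub>\<B>\<^esub> \<otimes>\<^bsub>\<B>\<^esub> T = T" "T \<otimes>\<^bsub>\<B>\<^esub> \<one>\<^bsub>\<B>\<^esub> = T"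
      by (rule bop_eqI; auto simp: T op_mult_closed op_one_closed bopD(1)[OF T])+
  qed (auto simp: op_mult_closed op_one_closed)
next
  fix R S T assume "R \<in> carrier \<B>" "S \<in> carrier \<B>" "T \<in> carrier \<B>"
  then have RST: "R \<in> bounded_operators V" "S \<in> bounded_operators V" "T \<in> bounded_operators V"
    by (simp_all add: carrier_op)
  show "(R \<oplus>\<^bsub>\<B>\<^esub> S) \<otimes>\<^bsub>\<B>\<^esub> T = R \<otimes>\<^bsub>\<B>\<^esub> T \<oplus>\<^bsub>\<B>\<^esub> S \<otimes>\<^bsub>\<B>\<^esub> T"
    by (rule bop_eqI) (auto simp: RST op_mult_closed op_add_closed bopD(1)[OF RST(3)])
  show "T \<otimes>\<^bsub>\<B>\<^esub> (R \<oplus>\<^bsub>\<B>\<^esub> S) = T \<otimes>\<^bsub>\<B>\<^esub> R \<oplus>\<^bsub>\<B>\<^esub> T \<otimes>\<^bsub>\<B>\<^esub> S"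
    by (rule bop_eqI) (auto simp: RST op_mult_closed op_add_closed bopD[OF RST(3)]
      bopD(1)[OF RST(1)] bopD(1)[OF RST(2)])
qed

lemma op_diff_apply:
  assumes "S \<in> bounded_operators V" "T \<in> bounded_operators V" "x \<in> carrier V"
  shows "(S \<ominus>\<^bsub>\<B>\<^esub> T) x = S x \<ominus> T x"
proof -
  interpret B: cvec \<B> using op_module by (simp add: cvec_def)
  have "S \<ominus>\<^bsub>\<B>\<^esub> T = S \<oplus>\<^bsub>\<B>\<^esub> (- 1) \<odot>\<^bsub>\<B>\<^esub> T"
    using assms by (simp add: a_minus_def B.sm_minus_one carrier_op)
  then show ?thesis using assms by (simp add: a_minus_def sm_minus_one bopD)
qed

lemma op_diff_closed:
  assumes "S \<in> bounded_operators V" "T \<in> bounded_operators V"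
  shows "S \<ominus>\<^bsub>\<B>\<^esub> T \<in> bounded_operators V"
proof -
  interpret B: cvec \<B> using op_module by (simp add: cvec_def)
  show ?thesis using assms B.M.minus_closed[of S T] by (simp add: carrier_op)
qed

lemma cnorm_op: "cnorm \<B> T = (SUP x\<in>{x \<in> carrier V. vnorm V x \<le> 1}. vnorm V (T x))"
  by (simp add: operator_algebra_def)

lemma op_norm_bound:
  assumes T: "T \<in> bounded_operators V" and x: "x \<in> carrier V"
  shows "vnorm V (T x) \<le> cnorm \<B> T * vnorm V x"
proof (cases "vnorm V x = 0")
  case True
  then show ?thesis using definite[OF x] bop_zero[OF T] by simp
next
  case False
  then have pos: "0 < vnorm V x" using vnorm_nonneg[OF x] by simp
  obtain K where K: "0 \<le> K" "\<And>x. x \<in> carrier V \<Longrightarrow> vnorm V (T x) \<le> K * vnorm V x"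
    by (rule bop_bound[OF T], rule that)
  have "bdd_above ((\<lambda>x. vnorm V (T x)) ` {x \<in> carrier V. vnorm V x \<le> 1})"
  proof (rule bdd_aboveI2)
    fix y assume "y \<in> {x \<in> carrier V. vnorm V x \<le> 1}"
    then show "vnorm V (T y) \<le> K" using K(2)[of y] mult_left_mono[of "vnorm V y" 1 K] K(1) by simp
  qed
  moreover have "of_real (1 / vnorm V x) \<odot> x \<in> {x \<in> carrier V. vnorm V x \<le> 1}"
    using x pos by (simp add: nrm_smult norm_divide)
  ultimately have "vnorm V (T (of_real (1 / vnorm V x) \<odot> x)) \<le> cnorm \<B> T"
    unfolding cnorm_op by (intro cSUP_upper)
  then show ?thesis
    using x pos bopD[OF T] by (simp add: nrm_smult norm_divide divide_simps)
qed

lemma op_norm_le: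
  assumes "0 \<le> K" "\<And>x. x \<in> carrier V \<Longrightarrow> vnorm V (T x) \<le> K * vnorm V x"
  shows "cnorm \<B> T \<le> K"
  unfolding cnorm_op
proof (rule cSUP_least)
  have "\<zero> \<in> {x \<in> carrier V. vnorm V x \<le> 1}" by simp
  then show "{x \<in> carrier V. vnorm V x \<le> 1} \<noteq> {}" by blast
  fix y assume "y \<in> {x \<in> carrier V. vnorm V x \<le> 1}"
  then show "vnorm V (T y) \<le> K"
    using assms(2)[of y] mult_left_mono[of "vnorm V y" 1 K] assms(1) by simp
qed

lemma op_norm_nonneg:
  assumes T: "T \<in> bounded_operators V"
  shows "0 \<le> cnorm \<B> T"
proof -
  obtain K where K: "0 \<le> K" "\<And>x. x \<in> carrier V \<Longrightarrow> vnorm V (T x) \<le> K * vnorm V x"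
    by (rule bop_bound[OF T], rule that)
  have "bdd_above ((\<lambda>x. vnorm V (T x)) ` {x \<in> carrier V. vnorm V x \<le> 1})"
  proof (rule bdd_aboveI2)
    fix y assume "y \<in> {x \<in> carrier V. vnorm V x \<le> 1}"
    then show "vnorm V (T y) \<le> K" using K(2)[of y] mult_left_mono[of "vnorm V y" 1 K] K(1) by simp
  qed
  then have "vnorm V (T \<zero>) \<le> cnorm \<B> T"
    unfolding cnorm_op by (intro cSUP_upper) auto
  then show ?thesis using bop_zero[OF T] by simp
qed

text \<open>The value of the adjoint at \<open>y\<close> is the Riesz vector of the functional
  pairing \<open>T x\<close> with \<open>y\<close>. Linearity follows from uniqueness of that
  vector, and the bound \<open>K\<close> from pairing it with itself and cancelling one factor of
  its norm.\<close>

lemma adjoint_exists: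
  assumes T: "T \<in> bounded_operators V"
  shows "\<exists>S\<in>bounded_operators V. \<forall>x\<in>carrier V. \<forall>y\<in>carrier V. ip V (T x) y = ip V x (S y)"
proof -
  obtain K where K: "0 \<le> K" "\<And>x. x \<in> carrier V \<Longrightarrow> vnorm V (T x) \<le> K * vnorm V x"
    by (rule bop_bound[OF T], rule that)
  note D = bopD[OF T]
  have "\<exists>z\<in>carrier V. \<forall>x\<in>carrier V. ip V (T x) y = ip V x z" if y: "y \<in> carrier V" for y
  proof (rule riesz)
    fix x assume x: "x \<in> carrier V"
    show "cmod (ip V (T x) y) \<le> (K * vnorm V y) * vnorm V x"
      using cauchy_schwarz[OF D(1)[OF x] y] mult_right_mono[OF K(2)[OF x] vnorm_nonneg[OF y]]
      by (simp add: mult_ac)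
  qed (use y in \<open>simp_all add: D ip_add_left ip_smult_left\<close>)
  then obtain s where s: "\<And>y. y \<in> carrier V \<Longrightarrow> s y \<in> carrier V"
    "\<And>x y. x \<in> carrier V \<Longrightarrow> y \<in> carrier V \<Longrightarrow> ip V (T x) y = ip V x (s y)"
    by metis
  have "(\<lambda>y\<in>carrier V. s y) \<in> bounded_operators V"
  proof (rule bopI)
    fix x y assume xy: "x \<in> carrier V" "y \<in> carrier V"
    show "s (x \<oplus> y) = s x \<oplus> s y"
      by (rule ip_eqI) (use xy s in \<open>simp_all add: s(2)[symmetric] ip_add_right D\<close>)
  next
    fix c x assume x: "x \<in> carrier V"
    show "s (c \<odot> x) = c \<odot> s x"
      by (rule ip_eqI) (use x s in \<open>simp_all add: s(2)[symmetric] ip_smult_right D\<close>)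
  next
    fix y assume y: "y \<in> carrier V"
    have "(vnorm V (s y))\<^sup>2 = Re (ip V (T (s y)) y)"
      using s y by (simp add: vnorm_sq)
    also have "\<dots> \<le> vnorm V (T (s y)) * vnorm V y"
      using cauchy_schwarz[of "T (s y)" y] complex_Re_le_cmod[of "ip V (T (s y)) y"] D(1) s y by simp
    also have "\<dots> \<le> (K * vnorm V (s y)) * vnorm V y"
      using K(2)[of "s y"] s y by (intro mult_right_mono) (auto simp: vnorm_nonneg)
    finally have *: "vnorm V (s y) * vnorm V (s y) \<le> vnorm V (s y) * (K * vnorm V y)"
      by (simp add: power2_eq_square mult_ac)
    show "vnorm V (s y) \<le> K * vnorm V y"
    proof (cases "vnorm V (s y) = 0")
      case True
      then show ?thesis using K(1) y by (simp add: vnorm_nonneg)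
    next
      case False
      then have "0 < vnorm V (s y)" using vnorm_nonneg[OF s(1)[OF y]] by simp
      then show ?thesis using * by (simp only: mult_le_cancel_left_pos)
    qed
  qed (rule s(1))
  moreover have "\<forall>x\<in>carrier V. \<forall>y\<in>carrier V. ip V (T x) y = ip V x ((\<lambda>y\<in>carrier V. s y) y)"
    using s(2) by simp
  ultimately show ?thesis by blast
qed

text \<open>The adjoint is introduced by a definite description; it is computed by exhibiting one
  bounded operator that satisfies the adjoint relation.\<close>

lemma star_unique:
  assumes "S \<in> bounded_operators V"
    and "\<And>x y. x \<in> carrier V \<Longrightarrow> y \<in> carrier V \<Longrightarrow> ip V (T x) y = ip V x (S y)"
  shows "star \<B> T = S"
proof -
  have "(THE S. S \<in> bounded_operators V \<and> (\<forall>x\<in>carrier V. \<forall>y\<in>carrier V. ip V (T x) y = ip V x (S y))) = S"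
  proof (rule the_equality)
    fix R assume R: "R \<in> bounded_operators V \<and> (\<forall>x\<in>carrier V. \<forall>y\<in>carrier V. ip V (T x) y = ip V x (R y))"
    show "R = S"
    proof (rule bop_eqI)
      fix y assume y: "y \<in> carrier V"
      show "R y = S y"
      proof (rule ip_eqI)
        show "R y \<in> carrier V" "S y \<in> carrier V" using R y assms(1) by (auto intro: bopD(1))
        fix z assume z: "z \<in> carrier V"
        have "ip V (T z) y = ip V z (R y)" using R z y by blast
        then show "ip V z (R y) = ip V z (S y)" using assms(2)[OF z y] by simp
      qed
    qed (use R assms(1) in auto)
  next
    show "S \<in> bounded_operators V \<and> (\<forall>x\<in>carrier V. \<forall>y\<in>carrier V. ip V (T x) y = ip V x (S y))"
      using assms by blast
  qed
  then show ?thesis by (simp add: operator_algebra_def)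
qed

lemma op_star:
  assumes "T \<in> bounded_operators V"
  shows "star \<B> T \<in> bounded_operators V"
    and "x \<in> carrier V \<Longrightarrow> y \<in> carrier V \<Longrightarrow> ip V (T x) y = ip V x (star \<B> T y)"
proof -
  obtain S where S: "S \<in> bounded_operators V"
    "\<And>x y. x \<in> carrier V \<Longrightarrow> y \<in> carrier V \<Longrightarrow> ip V (T x) y = ip V x (S y)"
    using adjoint_exists[OF assms] by blast
  have "star \<B> T = S" by (rule star_unique[OF S])
  then show "star \<B> T \<in> bounded_operators V"
    "x \<in> carrier V \<Longrightarrow> y \<in> carrier V \<Longrightarrow> ip V (T x) y = ip V x (star \<B> T y)" using S by auto
qed

lemma op_star_right:
  assumes "T \<in> bounded_operators V" "x \<in> carrier V" "y \<in> carrier V"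
  shows "ip V x (T y) = ip V (star \<B> T x) y"
  using op_star[OF assms(1)] bopD(1)[OF assms(1)] bopD(1)[OF op_star(1)[OF assms(1)]]
    ip_cnj[of "T y" x] ip_cnj[of y "star \<B> T x"] assms by simp

text \<open>The limit is taken pointwise. Letting \<open>n\<close> tend to infinity in the Cauchy
  estimate gives \<open>tail\<close>, which is uniform in \<open>x\<close>: it shows both that the
  limit is bounded and that convergence holds in operator norm.\<close>

lemma op_complete:
  assumes z: "\<And>n. z n \<in> bounded_operators V"
    and cau: "\<And>e. 0 < e \<Longrightarrow> \<exists>M. \<forall>m\<ge>M. \<forall>n\<ge>M. cnorm \<B> (z m \<ominus>\<^bsub>\<B>\<^esub> z n) < e"
  shows "\<exists>l\<in>bounded_operators V. cstar_tendsto \<B> z l"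
proof -
  have dist: "vnorm V (z m x \<ominus> z n x) \<le> cnorm \<B> (z m \<ominus>\<^bsub>\<B>\<^esub> z n) * vnorm V x"
    if "x \<in> carrier V" for m n x
    using op_norm_bound[OF op_diff_closed[OF z z], of x m n] that
    by (simp add: op_diff_apply[OF z z])
  have zc: "z n x \<in> carrier V" if "x \<in> carrier V" for n x using bopD(1)[OF z that] .
  have "\<exists>l\<in>carrier V. lim_to (\<lambda>n. z n x) l" if x: "x \<in> carrier V" for x
  proof (rule hilbert_complete)
    show "cauchy_seq (\<lambda>n. z n x)" unfolding cauchy_seq_def
    proof (intro allI impI)
      fix e :: real assume e: "0 < e"
      have xn: "0 \<le> vnorm V x" using x by (rule vnorm_nonneg)
      then obtain M where M: "\<forall>m\<ge>M. \<forall>n\<ge>M. cnorm \<B> (z m \<ominus>\<^bsub>\<B>\<^esub> z n) < e / (vnorm V x + 1)"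
        using cau[of "e / (vnorm V x + 1)"] e by auto
      have "vnorm V (z m x \<ominus> z n x) < e" if "m \<ge> M" "n \<ge> M" for m n
      proof -
        have "vnorm V (z m x \<ominus> z n x) \<le> e / (vnorm V x + 1) * vnorm V x"
          using dist[OF x, of m n] M[rule_format, OF that] mult_right_mono[OF less_imp_le xn] by fastforce
        also have "\<dots> < e" using e xn by (simp add: divide_simps)
        finally show ?thesis .
      qed
      then show "\<exists>M. \<forall>m\<ge>M. \<forall>n\<ge>M. vnorm V (z m x \<ominus> z n x) < e" by blast
    qed
  qed (rule zc[OF x])
  then obtain l where l: "\<And>x. x \<in> carrier V \<Longrightarrow> l x \<in> carrier V"
    "\<And>x. x \<in> carrier V \<Longrightarrow> lim_to (\<lambda>n. z n x) (l x)" by metis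
  have tail: "vnorm V (z m x \<ominus> l x) \<le> e * vnorm V x"
    if M: "\<forall>m\<ge>M. \<forall>n\<ge>M. cnorm \<B> (z m \<ominus>\<^bsub>\<B>\<^esub> z n) < e" and m: "m \<ge> M" and x: "x \<in> carrier V"
    for e M m x
  proof -
    have "(\<lambda>n. e * vnorm V x + vnorm V (z n x \<ominus> l x)) \<longlonglongrightarrow> e * vnorm V x + 0"
      using l(2)[OF x] unfolding lim_to_def by (intro tendsto_add) auto
    moreover have "vnorm V (z m x \<ominus> l x) \<le> e * vnorm V x + vnorm V (z n x \<ominus> l x)" if "n \<ge> M" for n
    proof -
      have "cnorm \<B> (z m \<ominus>\<^bsub>\<B>\<^esub> z n) * vnorm V x \<le> e * vnorm V x"
        using M m that x by (intro mult_right_mono) (auto simp: vnorm_nonneg less_imp_le)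
      then show ?thesis
        using nrm_diff_triangle[of "z m x" "z n x" "l x"] dist[OF x, of m n] zc[OF x] l(1)[OF x]
        by fastforce
    qed
    ultimately show ?thesis
      by (intro LIMSEQ_le_const[of "\<lambda>n. e * vnorm V x + vnorm V (z n x \<ominus> l x)"]) auto
  qed
  have lb: "(\<lambda>x\<in>carrier V. l x) \<in> bounded_operators V"
  proof -
    obtain M where M: "\<forall>m\<ge>M. \<forall>n\<ge>M. cnorm \<B> (z m \<ominus>\<^bsub>\<B>\<^esub> z n) < 1" using cau[of 1] by auto
    show ?thesis
    proof (rule bopI)
      fix x y assume xy: "x \<in> carrier V" "y \<in> carrier V"
      have "lim_to (\<lambda>n. z n x \<oplus> z n y) (l x \<oplus> l y)"
        by (intro lim_to_add) (use xy l zc in auto)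
      then show "l (x \<oplus> y) = l x \<oplus> l y"
        by (intro vlim_unique[OF l(2)]) (use xy l zc bopD(2)[OF z] in auto)
    next
      fix c x assume x: "x \<in> carrier V"
      have "lim_to (\<lambda>n. c \<odot> z n x) (c \<odot> l x)"
        by (intro lim_to_smult) (use x l zc in auto)
      then show "l (c \<odot> x) = c \<odot> l x"
        by (intro vlim_unique[OF l(2)]) (use x l zc bopD(3)[OF z] in auto)
    next
      fix x assume x: "x \<in> carrier V"
      show "vnorm V (l x) \<le> (cnorm \<B> (z M) + 1) * vnorm V x"
        using tail[OF M order_refl x] op_norm_bound[OF z x, of M] nrm_le_diff[of "l x" "z M x"]
          nrm_diff_commute[of "l x" "z M x"] l(1)[OF x] zc[OF x, of M] by (simp add: distrib_right)
    qed (rule l(1))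
  qed
  have "(\<lambda>n. cnorm \<B> (z n \<ominus>\<^bsub>\<B>\<^esub> (\<lambda>x\<in>carrier V. l x))) \<longlonglongrightarrow> 0"
  proof (rule LIMSEQ_I)
    fix e :: real assume e: "0 < e"
    then obtain M where M: "\<forall>m\<ge>M. \<forall>n\<ge>M. cnorm \<B> (z m \<ominus>\<^bsub>\<B>\<^esub> z n) < e / 2" using cau[of "e / 2"] by auto
    have "norm (cnorm \<B> (z m \<ominus>\<^bsub>\<B>\<^esub> (\<lambda>x\<in>carrier V. l x)) - 0) < e" if "m \<ge> M" for m
    proof -
      have "cnorm \<B> (z m \<ominus>\<^bsub>\<B>\<^esub> (\<lambda>x\<in>carrier V. l x)) \<le> e / 2"
        by (rule op_norm_le) (use e tail[OF M that] op_diff_apply[OF z lb] in auto)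
      then show ?thesis using e op_norm_nonneg[OF op_diff_closed[OF z lb], of m] by simp
    qed
    then show "\<exists>no. \<forall>n\<ge>no. norm (cnorm \<B> (z n \<ominus>\<^bsub>\<B>\<^esub> (\<lambda>x\<in>carrier V. l x)) - 0) < e" by blast
  qed
  then show ?thesis using lb by (auto simp: cstar_tendsto_def)
qed

lemma op_norm_triangle:
  assumes "S \<in> bounded_operators V" "T \<in> bounded_operators V"
  shows "cnorm \<B> (S \<oplus>\<^bsub>\<B>\<^esub> T) \<le> cnorm \<B> S + cnorm \<B> T"
proof (rule op_norm_le)
  fix x assume x: "x \<in> carrier V"
  show "vnorm V ((S \<oplus>\<^bsub>\<B>\<^esub> T) x) \<le> (cnorm \<B> S + cnorm \<B> T) * vnorm V x"
    using op_norm_bound[OF assms(1) x] op_norm_bound[OF assms(2) x] nrm_triangle[of "S x" "T x"]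
      bopD(1)[OF assms(1) x] bopD(1)[OF assms(2) x] x by (simp add: distrib_right)
qed (simp add: op_norm_nonneg assms)

lemma op_norm_smult_le:
  assumes T: "T \<in> bounded_operators V"
  shows "cnorm \<B> (c \<odot>\<^bsub>\<B>\<^esub> T) \<le> cmod c * cnorm \<B> T"
proof (rule op_norm_le)
  fix x assume x: "x \<in> carrier V"
  show "vnorm V ((c \<odot>\<^bsub>\<B>\<^esub> T) x) \<le> cmod c * cnorm \<B> T * vnorm V x"
    using mult_left_mono[OF op_norm_bound[OF T x], of "cmod c"] bopD(1)[OF T x] x
    by (simp add: nrm_smult mult.assoc)
qed (simp add: op_norm_nonneg T)

lemma op_norm_smult:
  assumes T: "T \<in> bounded_operators V"
  shows "cnorm \<B> (c \<odot>\<^bsub>\<B>\<^esub> T) = cmod c * cnorm \<B> T"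
proof (cases "c = 0")
  case True
  then show ?thesis
    using op_norm_smult_le[OF T, of 0] op_norm_nonneg[OF op_smult_closed[OF T], of 0] by simp
next
  case False
  interpret B: cvec \<B> using op_module by (simp add: cvec_def)
  have "(1 / c) \<odot>\<^bsub>\<B>\<^esub> (c \<odot>\<^bsub>\<B>\<^esub> T) = T"
    using T False by (simp add: B.sm_assoc carrier_op)
  then have "cnorm \<B> T \<le> cmod (1 / c) * cnorm \<B> (c \<odot>\<^bsub>\<B>\<^esub> T)"
    using op_norm_smult_le[OF op_smult_closed[OF T], of "1 / c" c] by simp
  then have "cmod c * cnorm \<B> T \<le> cnorm \<B> (c \<odot>\<^bsub>\<B>\<^esub> T)"
    using False by (simp add: norm_divide divide_simps mult.commute)
  then show ?thesis using op_norm_smult_le[OF T, of c] by simp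
qed

lemma op_norm_mult:
  assumes "S \<in> bounded_operators V" "T \<in> bounded_operators V"
  shows "cnorm \<B> (S \<otimes>\<^bsub>\<B>\<^esub> T) \<le> cnorm \<B> S * cnorm \<B> T"
proof (rule op_norm_le)
  fix x assume x: "x \<in> carrier V"
  show "vnorm V ((S \<otimes>\<^bsub>\<B>\<^esub> T) x) \<le> cnorm \<B> S * cnorm \<B> T * vnorm V x"
    using op_norm_bound[OF assms(1) bopD(1)[OF assms(2) x]] x
      mult_left_mono[OF op_norm_bound[OF assms(2) x] op_norm_nonneg[OF assms(1)]]
    by (simp add: mult.assoc)
qed (simp add: op_norm_nonneg assms)

lemma op_star_star:
  assumes T: "T \<in> bounded_operators V"
  shows "star \<B> (star \<B> T) = T"
  by (rule star_unique[OF T]) (simp add: op_star_right[OF T])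

lemma op_norm_star_le:
  assumes T: "T \<in> bounded_operators V"
  shows "cnorm \<B> (star \<B> T) \<le> cnorm \<B> T"
proof (rule op_norm_le[OF op_norm_nonneg[OF T]])
  note S = op_star(1)[OF T]
  fix y assume y: "y \<in> carrier V"
  let ?s = "star \<B> T y"
  have s: "?s \<in> carrier V" using bopD(1)[OF S y] .
  have "(vnorm V ?s)\<^sup>2 = Re (ip V (T ?s) y)"
    using s y op_star(2)[OF T s y] by (simp add: vnorm_sq)
  also have "\<dots> \<le> vnorm V (T ?s) * vnorm V y"
    using cauchy_schwarz[of "T ?s" y] complex_Re_le_cmod[of "ip V (T ?s) y"] bopD(1)[OF T s] y by simp
  also have "\<dots> \<le> (cnorm \<B> T * vnorm V ?s) * vnorm V y"
    by (rule mult_right_mono[OF op_norm_bound[OF T s] vnorm_nonneg[OF y]])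
  finally have *: "vnorm V ?s * vnorm V ?s \<le> vnorm V ?s * (cnorm \<B> T * vnorm V y)"
    by (simp add: power2_eq_square mult_ac)
  show "vnorm V ?s \<le> cnorm \<B> T * vnorm V y"
  proof (cases "vnorm V ?s = 0")
    case True
    then show ?thesis using op_norm_nonneg[OF T] y by (simp add: vnorm_nonneg)
  next
    case False
    then have "0 < vnorm V ?s" using vnorm_nonneg[OF s] by simp
    then show ?thesis using * by (simp only: mult_le_cancel_left_pos)
  qed
qed

text \<open>The nontrivial inequality rests on the squared norm of \<open>T x\<close> being the
  inner product of \<open>star \<B> T (T x)\<close> with \<open>x\<close>, at most \<open>?q\<close>
  times the squared norm of \<open>x\<close>.\<close>

lemma op_cstar_identity:
  assumes T: "T \<in> bounded_operators V"
  shows "cnorm \<B> (star \<B> T \<otimes>\<^bsub>\<B>\<^esub> T) = (cnorm \<B> T)\<^sup>2"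
proof (rule antisym)
  note S = op_star(1)[OF T]
  show "cnorm \<B> (star \<B> T \<otimes>\<^bsub>\<B>\<^esub> T) \<le> (cnorm \<B> T)\<^sup>2"
    using op_norm_mult[OF S T] mult_right_mono[OF op_norm_star_le[OF T] op_norm_nonneg[OF T]]
    by (simp add: power2_eq_square)
  let ?q = "cnorm \<B> (star \<B> T \<otimes>\<^bsub>\<B>\<^esub> T)"
  have ST: "star \<B> T \<otimes>\<^bsub>\<B>\<^esub> T \<in> bounded_operators V" by (rule op_mult_closed[OF S T])
  have q: "0 \<le> ?q" by (rule op_norm_nonneg[OF ST])
  have "cnorm \<B> T \<le> sqrt ?q"
  proof (rule op_norm_le)
    fix x assume x: "x \<in> carrier V"
    note Tx = bopD(1)[OF T x]
    have "(vnorm V (T x))\<^sup>2 = Re (ip V (star \<B> T (T x)) x)"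
      using op_star_right[OF T Tx x] Tx by (simp add: vnorm_sq)
    also have "\<dots> \<le> vnorm V (star \<B> T (T x)) * vnorm V x"
      using cauchy_schwarz[of "star \<B> T (T x)" x] complex_Re_le_cmod[of "ip V (star \<B> T (T x)) x"]
        bopD(1)[OF S Tx] x by simp
    also have "\<dots> \<le> ?q * vnorm V x * vnorm V x"
      using op_norm_bound[OF ST x] x by (intro mult_right_mono) (auto simp: vnorm_nonneg)
    also have "\<dots> = (sqrt ?q * vnorm V x)\<^sup>2"
      using q by (simp add: power_mult_distrib power2_eq_square[of "vnorm V x"])
    finally show "vnorm V (T x) \<le> sqrt ?q * vnorm V x"
      by (rule power2_le_imp_le) (simp add: q vnorm_nonneg[OF x])
  qed (simp add: q)
  then have "(cnorm \<B> T)\<^sup>2 \<le> (sqrt ?q)\<^sup>2"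
    using op_norm_nonneg[OF T] by (intro power_mono) auto
  then show "(cnorm \<B> T)\<^sup>2 \<le> ?q" using q by simp
qed

theorem operator_algebra_cstar: "unital_cstar_algebra \<B>"
proof (rule unital_cstar_algebra.intro[OF op_ring op_module], rule unital_cstar_algebra_axioms.intro,
    unfold carrier_op)
  fix S T and c :: complex
  assume S: "S \<in> bounded_operators V" and T: "T \<in> bounded_operators V"
  note sd = bopD[OF S] and td = bopD[OF T] and ss = op_star[OF S] and ts = op_star[OF T]
  show "(c \<odot>\<^bsub>\<B>\<^esub> S) \<otimes>\<^bsub>\<B>\<^esub> T = c \<odot>\<^bsub>\<B>\<^esub> (S \<otimes>\<^bsub>\<B>\<^esub> T)"
    by (rule bop_eqI) (auto simp: S T op_smult_closed op_mult_closed sd td)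
  show "S \<otimes>\<^bsub>\<B>\<^esub> (c \<odot>\<^bsub>\<B>\<^esub> T) = c \<odot>\<^bsub>\<B>\<^esub> (S \<otimes>\<^bsub>\<B>\<^esub> T)"
    by (rule bop_eqI) (auto simp: S T op_smult_closed op_mult_closed sd td)
  show "star \<B> (S \<oplus>\<^bsub>\<B>\<^esub> T) = star \<B> S \<oplus>\<^bsub>\<B>\<^esub> star \<B> T"
    by (rule star_unique) (simp_all add: op_add_closed ss(1) ts(1) ip_add_left ip_add_right sd td
      bopD(1)[OF ss(1)] bopD(1)[OF ts(1)] ss(2) ts(2))
  show "star \<B> (S \<otimes>\<^bsub>\<B>\<^esub> T) = star \<B> T \<otimes>\<^bsub>\<B>\<^esub> star \<B> S"
    by (rule star_unique) (simp_all add: op_mult_closed ss(1) ts(1) sd td bopD(1)[OF ss(1)] ss(2) ts(2))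
  show "cnorm \<B> (S \<oplus>\<^bsub>\<B>\<^esub> T) \<le> cnorm \<B> S + cnorm \<B> T" by (rule op_norm_triangle[OF S T])
  show "cnorm \<B> (S \<otimes>\<^bsub>\<B>\<^esub> T) \<le> cnorm \<B> S * cnorm \<B> T" by (rule op_norm_mult[OF S T])
next
  fix T and c :: complex assume T: "T \<in> bounded_operators V"
  note td = bopD[OF T] and ts = op_star[OF T]
  show "star \<B> T \<in> bounded_operators V" by (rule ts)
  show "star \<B> (star \<B> T) = T" by (rule op_star_star[OF T])
  show "star \<B> (c \<odot>\<^bsub>\<B>\<^esub> T) = cnj c \<odot>\<^bsub>\<B>\<^esub> star \<B> T"
    by (rule star_unique) (simp_all add: op_smult_closed ts(1) ip_smult_left ip_smult_right td
      bopD(1)[OF ts(1)] ts(2))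
  show "0 \<le> cnorm \<B> T" by (rule op_norm_nonneg[OF T])
  show "cnorm \<B> (c \<odot>\<^bsub>\<B>\<^esub> T) = cmod c * cnorm \<B> T" by (rule op_norm_smult[OF T])
  show "cnorm \<B> (star \<B> T \<otimes>\<^bsub>\<B>\<^esub> T) = (cnorm \<B> T)\<^sup>2" by (rule op_cstar_identity[OF T])
  assume 0: "cnorm \<B> T = 0"
  show "T = \<zero>\<^bsub>\<B>\<^esub>"
  proof (rule bop_eqI[OF T op_zero_closed])
    fix x assume x: "x \<in> carrier V"
    have "vnorm V (T x) = 0"
      using op_norm_bound[OF T x] 0 vnorm_nonneg[OF td(1)[OF x]] by simp
    then show "T x = \<zero>\<^bsub>\<B>\<^esub> x" using definite[OF td(1)[OF x]] x by simp
  qed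
qed (rule op_complete)

end

sublocale hilbert \<subseteq> OA: unital_cstar_algebra "operator_algebra V"
  by (rule operator_algebra_cstar)

section \<open>Vector states and cyclic vectors\<close>

context hilbert begin

text \<open>Moving the adjoint across the inner product turns the state of \<open>star x\<close>
  times \<open>x\<close> into the squared norm of \<open>x \<xi>\<close>. So the GNS seminorm is the
  norm along the orbit of \<open>\<xi>\<close>, and norms in the GNS space can be computed inside
  \<open>V\<close>.\<close>

lemma vector_state_gns:
  assumes C: "cstar_subalgebra C \<B>" and \<xi>: "\<xi> \<in> carrier V" "vnorm V \<xi> = 1"
  shows "cstar_state (\<B>\<lparr>carrier := C\<rparr>) (vector_state V \<xi>)"
    and "a \<in> C \<Longrightarrow> vnorm (gns_prespace (\<B>\<lparr>carrier := C\<rparr>) (vector_state V \<xi>)) a = vnorm V (a \<xi>)"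
proof -
  have CB: "x \<in> bounded_operators V" if "x \<in> C" for x
    using OA.cstar_subalgebraD(1)[OF C that] by (simp add: carrier_op)
  have pos: "vector_state V \<xi> (star \<B> x \<otimes>\<^bsub>\<B>\<^esub> x) = of_real ((vnorm V (x \<xi>))\<^sup>2)" if "x \<in> C" for x
    using op_star_right[OF CB[OF that], of "x \<xi>" \<xi>] bopD(1)[OF CB[OF that] \<xi>(1)] \<xi>
    by (simp add: vector_state_def ip_self)
  have [simp]: "(complex_of_real r)\<^sup>2 \<in> \<real>\<^sub>\<ge>\<^sub>0" for r
    using nonneg_Reals_of_real_iff[of "r\<^sup>2"] by (simp del: nonneg_Reals_of_real_iff)
  have "state (\<B>\<lparr>carrier := C\<rparr>) (vector_state V \<xi>)"
    unfolding state_def using \<xi> bopD(1)[OF CB \<xi>(1)] pos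
    by (auto simp: vector_state_def ip_add_left ip_smult_left ip_self)
  then show "cstar_state (\<B>\<lparr>carrier := C\<rparr>) (vector_state V \<xi>)"
    by (intro cstar_state.intro cstar_state_axioms.intro OA.subalgebra_is_cstar_algebra[OF C])
  show "vnorm (gns_prespace (\<B>\<lparr>carrier := C\<rparr>) (vector_state V \<xi>)) a = vnorm V (a \<xi>)" if "a \<in> C"
    using pos[OF that] bopD(1)[OF CB[OF that] \<xi>(1)]
    by (simp add: vnorm_def[of "gns_prespace _ _"] vnorm_nonneg)
qed

text \<open>A bound on GNS vectors is a bound for \<open>a\<close> on the orbit of
  \<open>\<xi>\<close>; since the orbit is dense, it extends to all of \<open>V\<close> and bounds
  the operator norm. This is the source of \<open>norming\<close> for the concrete algebras.\<close>

lemma cyclic_norming: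
  assumes C: "cstar_subalgebra C \<B>" and \<xi>: "\<xi> \<in> carrier V" "vnorm V \<xi> = 1"
    and dense: "\<And>x e. x \<in> carrier V \<Longrightarrow> 0 < e \<Longrightarrow> \<exists>b\<in>C. vnorm V (x \<ominus> b \<xi>) < e"
  shows "norming (\<B>\<lparr>carrier := C\<rparr>) (vector_state V \<xi>)"
  unfolding norming_def
proof (intro ballI allI impI)
  fix a and K :: real assume "a \<in> carrier (\<B>\<lparr>carrier := C\<rparr>)" and K: "0 \<le> K"
  then have aC: "a \<in> C" by simp
  then have a: "a \<in> bounded_operators V" using OA.cstar_subalgebraD(1)[OF C aC] by (simp add: carrier_op)
  assume H: "\<forall>b\<in>carrier (\<B>\<lparr>carrier := C\<rparr>).
    vnorm (gns_prespace (\<B>\<lparr>carrier := C\<rparr>) (vector_state V \<xi>)) (a \<otimes>\<^bsub>\<B>\<lparr>carrier := C\<rparr>\<^esub> b)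
      \<le> K * vnorm (gns_prespace (\<B>\<lparr>carrier := C\<rparr>) (vector_state V \<xi>)) b"
  have bound: "vnorm V (a (b \<xi>)) \<le> K * vnorm V (b \<xi>)" if "b \<in> C" for b
    using that H[rule_format, of b] vector_state_gns(2)[OF C \<xi> that] aC
      vector_state_gns(2)[OF C \<xi> OA.cstar_subalgebraD(5)[OF C aC that]] \<xi> by simp
  have "cnorm \<B> a \<le> K"
  proof (rule op_norm_le[OF K])
    fix x assume x: "x \<in> carrier V"
    \<comment> \<open>Replacing \<open>x\<close> by an orbit vector at distance \<open>d\<close>
      costs \<open>cnorm \<B> a * d\<close> on the left and \<open>K * d\<close> on the
      right.\<close>
    let ?L = "cnorm \<B> a + K"
    have L: "0 \<le> ?L" using op_norm_nonneg[OF a] K by simp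
    show "vnorm V (a x) \<le> K * vnorm V x"
    proof (rule field_le_epsilon)
      fix e :: real assume e: "0 < e"
      obtain b where b: "b \<in> C" "vnorm V (x \<ominus> b \<xi>) < e / (?L + 1)"
        using dense[OF x, of "e / (?L + 1)"] e L by auto
      have bc: "b \<xi> \<in> carrier V"
        using OA.cstar_subalgebraD(1)[OF C b(1)] bopD(1) \<xi>(1) by (simp add: carrier_op)
      have "vnorm V (a x) \<le> vnorm V (a (b \<xi>)) + vnorm V (a (x \<ominus> b \<xi>))"
        using nrm_le_diff[of "a x" "a (b \<xi>)"] bopD(1)[OF a] x bc by (simp add: bop_diff[OF a])
      also have "\<dots> \<le> K * vnorm V (b \<xi>) + cnorm \<B> a * vnorm V (x \<ominus> b \<xi>)"
        using bound[OF b(1)] op_norm_bound[OF a, of "x \<ominus> b \<xi>"] x bc by simp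
      also have "\<dots> \<le> K * (vnorm V x + vnorm V (x \<ominus> b \<xi>)) + cnorm \<B> a * vnorm V (x \<ominus> b \<xi>)"
        using nrm_le_diff[of "b \<xi>" x] nrm_diff_commute[of x "b \<xi>"] x bc K
        by (intro add_right_mono mult_left_mono) auto
      also have "\<dots> = K * vnorm V x + ?L * vnorm V (x \<ominus> b \<xi>)" by (simp add: algebra_simps)
      also have "?L * vnorm V (x \<ominus> b \<xi>) \<le> ?L * (e / (?L + 1))"
        by (rule mult_left_mono[OF less_imp_le[OF b(2)] L])
      also have "\<dots> \<le> e" using e L by (simp add: divide_simps)
      finally show "vnorm V (a x) \<le> K * vnorm V x + e" by simp
    qed
  qed
  then show "cnorm (\<B>\<lparr>carrier := C\<rparr>) a \<le> K" by simp
qed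

end

section \<open>Completions\<close>

context semi_ip begin

lemma uminus_zero [simp]: "\<ominus> \<zero> = \<zero>"
  using M.add.inv_one unfolding a_inv_def .

definition cau :: "(nat \<Rightarrow> 'v) \<Rightarrow> bool" where
  "cau x \<longleftrightarrow> (\<forall>n. x n \<in> carrier V) \<and> cauchy_seq x"

definition equi :: "(nat \<Rightarrow> 'v) \<Rightarrow> (nat \<Rightarrow> 'v) \<Rightarrow> bool" where
  "equi x y \<longleftrightarrow> (\<lambda>n. vnorm V (x n \<ominus> y n)) \<longlonglongrightarrow> 0"

text \<open>The coset of the null sequences through \<open>x\<close>, written out
  (\<open>coset_eq_cls\<close>); all further work with the completion goes through such
  representatives.\<close>

definition cls :: "(nat \<Rightarrow> 'v) \<Rightarrow> (nat \<Rightarrow> 'v) set" where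
  "cls x = {y. cau y \<and> equi y x}"

lemma cauD: "cau x \<Longrightarrow> x n \<in> carrier V"
  by (simp add: cau_def)

lemma cau_bound:
  assumes "\<And>n. y n \<in> carrier V" "cau x" "0 \<le> K"
    and le: "\<And>m n. vnorm V (y m \<ominus> y n) \<le> K * vnorm V (x m \<ominus> x n)"
  shows "cau y"
  unfolding cau_def cauchy_seq_def
proof (intro conjI allI impI)
  fix e :: real assume e: "0 < e"
  then have "0 < e / (K + 1)" using assms(3) by simp
  then obtain M where M: "\<forall>m\<ge>M. \<forall>n\<ge>M. vnorm V (x m \<ominus> x n) < e / (K + 1)"
    using assms(2) unfolding cau_def cauchy_seq_def by meson
  have "vnorm V (y m \<ominus> y n) < e" if "m \<ge> M" "n \<ge> M" for m n
  proof -
    have "vnorm V (y m \<ominus> y n) \<le> K * (e / (K + 1))"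
      using le[of m n] mult_left_mono[OF less_imp_le[OF M[rule_format, OF that]] assms(3)] by linarith
    also have "\<dots> < e" using e assms(3) by (simp add: divide_simps)
    finally show ?thesis .
  qed
  then show "\<exists>M. \<forall>m\<ge>M. \<forall>n\<ge>M. vnorm V (y m \<ominus> y n) < e" by blast
qed (fact assms)

lemma cau_const: "v \<in> carrier V \<Longrightarrow> cau (\<lambda>_. v)"
  by (auto simp: cau_def cauchy_seq_def)

lemma cau_smult: "cau x \<Longrightarrow> cau (\<lambda>n. c \<odot> x n)"
  by (rule cau_bound[where K = "cmod c" and x = x]) (auto simp: cauD nrm_diff_smult)

lemma cau_add:
  assumes x: "cau x" and y: "cau y"
  shows "cau (\<lambda>n. x n \<oplus> y n)"
  unfolding cau_def cauchy_seq_def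
proof (intro conjI allI impI)
  fix e :: real assume e: "0 < e"
  obtain M where M: "\<forall>m\<ge>M. \<forall>n\<ge>M. vnorm V (x m \<ominus> x n) < e / 2"
    using x e unfolding cau_def cauchy_seq_def by (meson half_gt_zero)
  obtain N where N: "\<forall>m\<ge>N. \<forall>n\<ge>N. vnorm V (y m \<ominus> y n) < e / 2"
    using y e unfolding cau_def cauchy_seq_def by (meson half_gt_zero)
  have "vnorm V ((x m \<oplus> y m) \<ominus> (x n \<oplus> y n)) < e" if "m \<ge> max M N" "n \<ge> max M N" for m n
  proof -
    have "vnorm V (x m \<ominus> x n) < e / 2" "vnorm V (y m \<ominus> y n) < e / 2" using M N that by auto
    then show ?thesis
      using nrm_diff_add[OF cauD[OF x] cauD[OF y] cauD[OF x] cauD[OF y], of m m n n] by linarith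
  qed
  then show "\<exists>M. \<forall>m\<ge>M. \<forall>n\<ge>M. vnorm V ((x m \<oplus> y m) \<ominus> (x n \<oplus> y n)) < e" by blast
qed (use x y cauD in auto)

lemma cau_diff: "cau x \<Longrightarrow> cau y \<Longrightarrow> cau (\<lambda>n. x n \<ominus> y n)"
  using cau_add[of x "\<lambda>n. (- 1) \<odot> y n"] cau_smult[of y "- 1"]
  by (simp add: a_minus_def sm_minus_one cauD)

lemma equi_refl: "cau x \<Longrightarrow> equi x x"
  by (simp add: equi_def cauD)

lemma equi_sym: "cau x \<Longrightarrow> cau y \<Longrightarrow> equi x y \<Longrightarrow> equi y x"
  by (simp add: equi_def nrm_diff_commute[of "x _" "y _"] cauD)

lemma equi_bound:
  assumes "\<And>n. x n \<in> carrier V" "\<And>n. y n \<in> carrier V"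
    "\<And>n. vnorm V (x n \<ominus> y n) \<le> b n" "b \<longlonglongrightarrow> 0"
  shows "equi x y"
  unfolding equi_def by (rule LIMSEQ_zero_bound[OF _ assms(3,4)]) (simp add: vnorm_nonneg assms)

lemma equi_trans:
  assumes "cau x" "cau y" "cau z" "equi x y" "equi y z"
  shows "equi x z"
proof (rule equi_bound)
  show "(\<lambda>n. vnorm V (x n \<ominus> y n) + vnorm V (y n \<ominus> z n)) \<longlonglongrightarrow> 0"
    using tendsto_add[OF assms(4,5)[unfolded equi_def]] by simp
qed (use assms nrm_diff_triangle cauD in auto)

lemma equi_add:
  assumes "cau x" "cau y" "cau x'" "cau y'" "equi x x'" "equi y y'"
  shows "equi (\<lambda>n. x n \<oplus> y n) (\<lambda>n. x' n \<oplus> y' n)"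
proof (rule equi_bound)
  show "(\<lambda>n. vnorm V (x n \<ominus> x' n) + vnorm V (y n \<ominus> y' n)) \<longlonglongrightarrow> 0"
    using tendsto_add[OF assms(5,6)[unfolded equi_def]] by simp
qed (use assms nrm_diff_add cauD in auto)

lemma equi_smult:
  assumes "cau x" "cau x'" "equi x x'"
  shows "equi (\<lambda>n. c \<odot> x n) (\<lambda>n. c \<odot> x' n)"
  unfolding equi_def
  using tendsto_mult_left[OF assms(3)[unfolded equi_def], of "cmod c"] assms
  by (simp add: nrm_diff_smult cauD)

lemma cls_eq_iff:
  assumes "cau x" "cau y"
  shows "cls x = cls y \<longleftrightarrow> equi x y"
proof
  assume "cls x = cls y"
  then have "x \<in> cls y" using assms equi_refl[of x] by (auto simp: cls_def)
  then show "equi x y" by (simp add: cls_def)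
next
  assume "equi x y"
  then show "cls x = cls y"
    unfolding cls_def using assms equi_trans equi_sym by blast
qed

lemma mem_cls: "cau x \<Longrightarrow> x \<in> cls x"
  by (simp add: cls_def equi_refl)

lemma carrier_cauchy: "x \<in> carrier (cauchy_module V) \<longleftrightarrow> cau x"
  by (simp add: cauchy_module_def cau_def cauchy_seq_def)

lemma null_iff: "x \<in> null_sequences V \<longleftrightarrow> cau x \<and> equi x (\<lambda>_. \<zero>)"
proof
  assume x: "x \<in> null_sequences V"
  then have xc: "x n \<in> carrier V" for n by (simp add: null_sequences_def)
  have "lim_to x \<zero>" using x xc by (simp add: lim_to_def null_sequences_def a_minus_def)
  then have "cauchy_seq x" using xc by (intro lim_to_cauchy) auto
  then show "cau x \<and> equi x (\<lambda>_. \<zero>)"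
    using x xc by (simp add: cau_def equi_def null_sequences_def a_minus_def)
qed (auto simp: cau_def equi_def null_sequences_def a_minus_def)

lemma null_eq_cls: "null_sequences V = cls (\<lambda>_. \<zero>)"
  by (auto simp: null_iff cls_def)

lemma coset_eq_cls:
  assumes x: "cau x"
  shows "null_sequences V +>\<^bsub>cauchy_module V\<^esub> x = cls x"
proof (rule Set.set_eqI)
  fix y
  have z: "cau (\<lambda>_. \<zero>)" by (rule cau_const) simp
  have "y \<in> null_sequences V +>\<^bsub>cauchy_module V\<^esub> x
      \<longleftrightarrow> (\<exists>h. cau h \<and> equi h (\<lambda>_. \<zero>) \<and> y = (\<lambda>n. h n \<oplus> x n))"
    by (auto simp: a_r_coset_def' null_iff cauchy_module_def)
  also have "\<dots> \<longleftrightarrow> y \<in> cls x"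
  proof
    assume "\<exists>h. cau h \<and> equi h (\<lambda>_. \<zero>) \<and> y = (\<lambda>n. h n \<oplus> x n)"
    then obtain h where h: "cau h" "equi h (\<lambda>_. \<zero>)" "y = (\<lambda>n. h n \<oplus> x n)" by blast
    have "equi (\<lambda>n. h n \<oplus> x n) (\<lambda>n. \<zero> \<oplus> x n)"
      by (rule equi_add[OF h(1) x z x h(2) equi_refl[OF x]])
    then show "y \<in> cls x" using h cau_add[OF h(1) x] x by (simp add: cls_def cauD)
  next
    assume "y \<in> cls x"
    then have y: "cau y" "equi y x" by (auto simp: cls_def)
    have "y = (\<lambda>n. (y n \<ominus> x n) \<oplus> x n)"
    proof
      fix n
      have "y n \<in> carrier V" "x n \<in> carrier V" using x y cauD by auto
      then show "y n = (y n \<ominus> x n) \<oplus> x n" by algebra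
    qed
    moreover have "equi (\<lambda>n. y n \<ominus> x n) (\<lambda>_. \<zero>)"
      using y x by (simp add: equi_def a_minus_def cauD)
    ultimately show "\<exists>h. cau h \<and> equi h (\<lambda>_. \<zero>) \<and> y = (\<lambda>n. h n \<oplus> x n)"
      using cau_diff[OF y(1) x] by blast
  qed
  finally show "y \<in> null_sequences V +>\<^bsub>cauchy_module V\<^esub> x \<longleftrightarrow> y \<in> cls x" .
qed

abbreviation "\<H> \<equiv> completion V"

lemma carrier_completion: "carrier \<H> = cls ` {x. cau x}"
proof -
  have "carrier \<H> = (\<Union>x\<in>{x. cau x}. {null_sequences V +>\<^bsub>cauchy_module V\<^esub> x})"
    by (simp add: completion_def Let_def A_RCOSETS_def' carrier_cauchy[symmetric])
  then show ?thesis by (auto simp: coset_eq_cls)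
qed

lemma completion_cases:
  assumes "X \<in> carrier \<H>"
  obtains x where "cau x" "X = cls x"
  using assms by (auto simp: carrier_completion)

lemma cls_carrier [simp]: "cau x \<Longrightarrow> cls x \<in> carrier \<H>"
  by (auto simp: carrier_completion)

lemma zero_completion: "\<zero>\<^bsub>\<H>\<^esub> = cls (\<lambda>_. \<zero>)"
  by (simp add: completion_def Let_def null_eq_cls)

lemma add_completion:
  assumes x: "cau x" and y: "cau y"
  shows "cls x \<oplus>\<^bsub>\<H>\<^esub> cls y = cls (\<lambda>n. x n \<oplus> y n)"
proof -
  have "cls x \<oplus>\<^bsub>\<H>\<^esub> cls y = (\<Union>h\<in>cls x. \<Union>k\<in>cls y. {\<lambda>n. h n \<oplus> k n})"
    by (simp add: completion_def Let_def set_add_def' cauchy_module_def)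
  also have "\<dots> = cls (\<lambda>n. x n \<oplus> y n)"
  proof (intro equalityI subsetI)
    fix z assume "z \<in> (\<Union>h\<in>cls x. \<Union>k\<in>cls y. {\<lambda>n. h n \<oplus> k n})"
    then obtain h k where "cau h" "equi h x" "cau k" "equi k y" "z = (\<lambda>n. h n \<oplus> k n)"
      by (auto simp: cls_def)
    then show "z \<in> cls (\<lambda>n. x n \<oplus> y n)"
      using equi_add[of h k x y] cau_add[of h k] x y by (simp add: cls_def)
  next
    fix z assume "z \<in> cls (\<lambda>n. x n \<oplus> y n)"
    then have z: "cau z" "equi z (\<lambda>n. x n \<oplus> y n)" by (auto simp: cls_def)
    have eq1: "(z n \<ominus> x n) \<ominus> y n = z n \<ominus> (x n \<oplus> y n)" "x n \<oplus> (z n \<ominus> x n) = z n" for n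
    proof -
      have "z n \<in> carrier V" "x n \<in> carrier V" "y n \<in> carrier V" using x y z cauD by auto
      then show "(z n \<ominus> x n) \<ominus> y n = z n \<ominus> (x n \<oplus> y n)" "x n \<oplus> (z n \<ominus> x n) = z n"
        by (algebra, algebra)
    qed
    have "(\<lambda>n. z n \<ominus> x n) \<in> cls y"
      using cau_diff[OF z(1) x] z(2) by (simp add: cls_def equi_def eq1)
    moreover have "z = (\<lambda>n. x n \<oplus> (z n \<ominus> x n))" by (simp add: eq1)
    ultimately show "z \<in> (\<Union>h\<in>cls x. \<Union>k\<in>cls y. {\<lambda>n. h n \<oplus> k n})"
      using mem_cls[OF x] by blast
  qed
  finally show ?thesis .
qed

lemma smult_completion:
  assumes x: "cau x"
  shows "c \<odot>\<^bsub>\<H>\<^esub> cls x = cls (\<lambda>n. c \<odot> x n)"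
proof -
  have "c \<odot>\<^bsub>\<H>\<^esub> cls x = (\<Union>y\<in>cls x. null_sequences V +>\<^bsub>cauchy_module V\<^esub> (\<lambda>n. c \<odot> y n))"
    by (simp add: completion_def Let_def cauchy_module_def)
  also have "\<dots> = (\<Union>y\<in>cls x. cls (\<lambda>n. c \<odot> x n))"
  proof (rule SUP_cong[OF refl])
    fix y assume "y \<in> cls x"
    then have y: "cau y" "equi y x" by (auto simp: cls_def)
    then show "null_sequences V +>\<^bsub>cauchy_module V\<^esub> (\<lambda>n. c \<odot> y n) = cls (\<lambda>n. c \<odot> x n)"
      using x by (simp add: coset_eq_cls cau_smult cls_eq_iff equi_smult)
  qed
  also have "\<dots> = cls (\<lambda>n. c \<odot> x n)" using mem_cls[OF x] by auto
  finally show ?thesis .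
qed

text \<open>One argument is changed at a time, with Cauchy-Schwarz for each change. Both convergence
  of inner products along Cauchy sequences and independence of representatives rest on it.\<close>

lemma ip_diff_bound:
  assumes "x \<in> carrier V" "y \<in> carrier V" "x' \<in> carrier V" "y' \<in> carrier V"
  shows "cmod (ip V x y - ip V x' y')
    \<le> vnorm V (x \<ominus> x') * vnorm V y + vnorm V x' * vnorm V (y \<ominus> y')"
proof -
  have "ip V x y - ip V x' y' = ip V (x \<ominus> x') y + ip V x' (y \<ominus> y')"
    using assms by (simp add: ip_diff_left ip_diff_right)
  then show ?thesis
    using cauchy_schwarz[of "x \<ominus> x'" y] cauchy_schwarz[of x' "y \<ominus> y'"] assms
      norm_triangle_ineq[of "ip V (x \<ominus> x') y" "ip V x' (y \<ominus> y')"] by simp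
qed

lemma ip_convergent:
  assumes x: "cau x" and y: "cau y"
  shows "convergent (\<lambda>n. ip V (x n) (y n))"
proof -
  obtain B C where B: "0 < B" "\<And>n. vnorm V (x n) \<le> B" and C: "0 < C" "\<And>n. vnorm V (y n) \<le> C"
    using cauchy_bounded[of x] cauchy_bounded[of y] x y unfolding cau_def by metis
  have "Cauchy (\<lambda>n. ip V (x n) (y n))"
  proof (rule CauchyI)
    fix e :: real assume e: "0 < e"
    then have "0 < e / (2 * C)" "0 < e / (2 * B)" using B C by auto
    then obtain M N where M: "\<forall>m\<ge>M. \<forall>n\<ge>M. vnorm V (x m \<ominus> x n) < e / (2 * C)"
      and N: "\<forall>m\<ge>N. \<forall>n\<ge>N. vnorm V (y m \<ominus> y n) < e / (2 * B)"
      using x y unfolding cau_def cauchy_seq_def by meson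
    have "cmod (ip V (x m) (y m) - ip V (x n) (y n)) < e" if mn: "m \<ge> max M N" "n \<ge> max M N" for m n
    proof -
      have m1: "vnorm V (x m \<ominus> x n) < e / (2 * C)" and n1: "vnorm V (y m \<ominus> y n) < e / (2 * B)"
        using M N mn by auto
      have "vnorm V (x m \<ominus> x n) * vnorm V (y m) \<le> vnorm V (x m \<ominus> x n) * C"
        using C x by (intro mult_left_mono) (auto simp: vnorm_nonneg cauD)
      also have "\<dots> < e / 2" using m1 C by (simp add: field_simps)
      finally have 1: "vnorm V (x m \<ominus> x n) * vnorm V (y m) < e / 2" .
      have "vnorm V (x n) * vnorm V (y m \<ominus> y n) \<le> B * vnorm V (y m \<ominus> y n)"
        using B y by (intro mult_right_mono) (auto simp: vnorm_nonneg cauD)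
      also have "\<dots> < e / 2" using n1 B by (simp add: field_simps)
      finally have 2: "vnorm V (x n) * vnorm V (y m \<ominus> y n) < e / 2" .
      show ?thesis using ip_diff_bound[OF cauD[OF x] cauD[OF y] cauD[OF x] cauD[OF y], of m m n n] 1 2
        by linarith
    qed
    then show "\<exists>M. \<forall>m\<ge>M. \<forall>n\<ge>M. norm (ip V (x m) (y m) - ip V (x n) (y n)) < e" by blast
  qed
  then show ?thesis by (simp add: Cauchy_convergent_iff)
qed

lemma ip_equi:
  assumes x: "cau x" "cau x'" "equi x' x" and y: "cau y" "cau y'" "equi y' y"
    and lim: "(\<lambda>n. ip V (x n) (y n)) \<longlonglongrightarrow> l"
  shows "(\<lambda>n. ip V (x' n) (y' n)) \<longlonglongrightarrow> l"
proof -
  obtain B C where B: "0 < B" "\<And>n. vnorm V (x n) \<le> B" and C: "0 < C" "\<And>n. vnorm V (y' n) \<le> C"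
    using cauchy_bounded[of x] cauchy_bounded[of y'] x y unfolding cau_def by metis
  have "(\<lambda>n. vnorm V (x' n \<ominus> x n) * C + B * vnorm V (y' n \<ominus> y n)) \<longlonglongrightarrow> 0 * C + B * 0"
    using x(3) y(3) unfolding equi_def by (intro tendsto_intros)
  then have lim0: "(\<lambda>n. vnorm V (x' n \<ominus> x n) * C + B * vnorm V (y' n \<ominus> y n)) \<longlonglongrightarrow> 0" by simp
  have "cmod (ip V (x' n) (y' n) - ip V (x n) (y n))
      \<le> vnorm V (x' n \<ominus> x n) * C + B * vnorm V (y' n \<ominus> y n)" for n
  proof -
    have "vnorm V (x' n \<ominus> x n) * vnorm V (y' n) \<le> vnorm V (x' n \<ominus> x n) * C"
      "vnorm V (x n) * vnorm V (y' n \<ominus> y n) \<le> B * vnorm V (y' n \<ominus> y n)"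
      using B C x y by (auto intro!: mult_left_mono mult_right_mono simp: vnorm_nonneg cauD)
    then show ?thesis using ip_diff_bound[of "x' n" "y' n" "x n" "y n"] x y by (simp add: cauD)
  qed
  then have "(\<lambda>n. cmod (ip V (x' n) (y' n) - ip V (x n) (y n))) \<longlonglongrightarrow> 0"
    by (rule LIMSEQ_zero_bound[OF norm_ge_zero _ lim0])
  then have "(\<lambda>n. ip V (x' n) (y' n) - ip V (x n) (y n)) \<longlonglongrightarrow> 0" by (simp add: tendsto_norm_zero_iff)
  from tendsto_add[OF this lim] show ?thesis by simp
qed

text \<open>The inner product of two classes is a definite description. It is well defined because
  inner products of Cauchy sequences converge (\<open>ip_convergent\<close>) and the limit ignores
  null sequences (\<open>ip_equi\<close>).\<close>

lemma ip_completion: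
  assumes x: "cau x" and y: "cau y"
  shows "(\<lambda>n. ip V (x n) (y n)) \<longlonglongrightarrow> ip \<H> (cls x) (cls y)"
proof -
  obtain l where l: "(\<lambda>n. ip V (x n) (y n)) \<longlonglongrightarrow> l"
    using ip_convergent[OF x y] by (auto simp: convergent_def)
  have "ip \<H> (cls x) (cls y) = (THE z. \<exists>x'\<in>cls x. \<exists>y'\<in>cls y. (\<lambda>n. ip V (x' n) (y' n)) \<longlonglongrightarrow> z)"
    by (simp add: completion_def Let_def)
  also have "\<dots> = l"
  proof (rule the_equality)
    show "\<exists>x'\<in>cls x. \<exists>y'\<in>cls y. (\<lambda>n. ip V (x' n) (y' n)) \<longlonglongrightarrow> l"
      using mem_cls[OF x] mem_cls[OF y] l by blast
    fix z assume "\<exists>x'\<in>cls x. \<exists>y'\<in>cls y. (\<lambda>n. ip V (x' n) (y' n)) \<longlonglongrightarrow> z"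
    then obtain x' y' where *: "cau x'" "equi x' x" "cau y'" "equi y' y"
      "(\<lambda>n. ip V (x' n) (y' n)) \<longlonglongrightarrow> z" by (auto simp: cls_def)
    show "z = l"
      by (rule LIMSEQ_unique[OF *(5) ip_equi[OF x *(1,2) y *(3,4) l]])
  qed
  finally show ?thesis using l by simp
qed

lemma ip_completion_eqI:
  "cau x \<Longrightarrow> cau y \<Longrightarrow> (\<lambda>n. ip V (x n) (y n)) \<longlonglongrightarrow> l \<Longrightarrow> ip \<H> (cls x) (cls y) = l"
  by (rule LIMSEQ_unique[OF ip_completion])

lemma vnorm_completion:
  assumes "cau x"
  shows "(\<lambda>n. vnorm V (x n)) \<longlonglongrightarrow> vnorm \<H> (cls x)"
  unfolding vnorm_def using ip_completion[OF assms assms] by (intro tendsto_intros)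

lemma completion_module: "Module.module complex_ring \<H>"
proof (rule complex_moduleI)
  have z: "cau (\<lambda>_. \<zero>)" by (rule cau_const) simp
  show "abelian_group \<H>"
  proof (rule abelian_groupI)
    fix X Y assume "X \<in> carrier \<H>" "Y \<in> carrier \<H>"
    then obtain x y where *: "cau x" "X = cls x" "cau y" "Y = cls y" by (metis completion_cases)
    then show "X \<oplus>\<^bsub>\<H>\<^esub> Y \<in> carrier \<H>" by (simp add: add_completion cau_add)
    show "X \<oplus>\<^bsub>\<H>\<^esub> Y = Y \<oplus>\<^bsub>\<H>\<^esub> X"
      using * by (simp add: add_completion M.a_comm[OF cauD cauD])
    fix Z assume "Z \<in> carrier \<H>"
    then obtain w where "cau w" "Z = cls w" by (rule completion_cases)
    then show "X \<oplus>\<^bsub>\<H>\<^esub> Y \<oplus>\<^bsub>\<H>\<^esub> Z = X \<oplus>\<^bsub>\<H>\<^esub> (Y \<oplus>\<^bsub>\<H>\<^esub> Z)"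
      using * by (simp add: add_completion cau_add M.a_assoc[OF cauD cauD cauD])
  next
    fix X assume "X \<in> carrier \<H>"
    then obtain x where x: "cau x" "X = cls x" by (rule completion_cases)
    then show "\<zero>\<^bsub>\<H>\<^esub> \<oplus>\<^bsub>\<H>\<^esub> X = X" by (simp add: zero_completion add_completion z cauD)
    have "(\<lambda>n. (- 1) \<odot> x n \<oplus> x n) = (\<lambda>_. \<zero>)"
      using cauD[OF x(1)] by (simp add: sm_minus_one[symmetric] M.l_neg)
    then have "cls (\<lambda>n. (- 1) \<odot> x n) \<oplus>\<^bsub>\<H>\<^esub> X = \<zero>\<^bsub>\<H>\<^esub>"
      using x cau_smult[OF x(1), of "- 1"] by (simp add: zero_completion add_completion)
    then show "\<exists>Y\<in>carrier \<H>. Y \<oplus>\<^bsub>\<H>\<^esub> X = \<zero>\<^bsub>\<H>\<^esub>"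
      using cls_carrier[OF cau_smult[OF x(1), of "- 1"]] by (rule bexI)
  qed (simp add: zero_completion z)
next
  fix c d X assume "X \<in> carrier \<H>"
  then obtain x where x: "cau x" "X = cls x" by (rule completion_cases)
  then show "c \<odot>\<^bsub>\<H>\<^esub> X \<in> carrier \<H>" "1 \<odot>\<^bsub>\<H>\<^esub> X = X"
    "(c + d) \<odot>\<^bsub>\<H>\<^esub> X = c \<odot>\<^bsub>\<H>\<^esub> X \<oplus>\<^bsub>\<H>\<^esub> d \<odot>\<^bsub>\<H>\<^esub> X"
    "(c * d) \<odot>\<^bsub>\<H>\<^esub> X = c \<odot>\<^bsub>\<H>\<^esub> (d \<odot>\<^bsub>\<H>\<^esub> X)"
    by (simp_all add: smult_completion add_completion cau_smult sm_add_left sm_assoc cauD)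
next
  fix c X Y assume "X \<in> carrier \<H>" "Y \<in> carrier \<H>"
  then obtain x y where "cau x" "X = cls x" "cau y" "Y = cls y" by (metis completion_cases)
  then show "c \<odot>\<^bsub>\<H>\<^esub> (X \<oplus>\<^bsub>\<H>\<^esub> Y) = c \<odot>\<^bsub>\<H>\<^esub> X \<oplus>\<^bsub>\<H>\<^esub> c \<odot>\<^bsub>\<H>\<^esub> Y"
    by (simp add: smult_completion add_completion cau_smult cau_add sm_add_right cauD)
qed

lemma completion_semi_ip: "semi_ip \<H>"
proof (intro semi_ip.intro semi_ip_axioms.intro)
  show "cvec \<H>" using completion_module by (simp add: cvec_def)
next
  fix X Y Z assume "X \<in> carrier \<H>" "Y \<in> carrier \<H>" "Z \<in> carrier \<H>"
  then obtain x y z where *: "cau x" "X = cls x" "cau y" "Y = cls y" "cau z" "Z = cls z"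
    by (metis completion_cases)
  have "(\<lambda>n. ip V (x n \<oplus> y n) (z n)) \<longlonglongrightarrow> ip \<H> X Z + ip \<H> Y Z"
    using tendsto_add[OF ip_completion[OF *(1,5)] ip_completion[OF *(3,5)]] *
    by (simp add: ip_add_left cauD)
  then show "ip \<H> (X \<oplus>\<^bsub>\<H>\<^esub> Y) Z = ip \<H> X Z + ip \<H> Y Z"
    using * by (simp add: add_completion ip_completion_eqI cau_add)
next
  fix c X Y assume "X \<in> carrier \<H>" "Y \<in> carrier \<H>"
  then obtain x y where *: "cau x" "X = cls x" "cau y" "Y = cls y" by (metis completion_cases)
  have "(\<lambda>n. ip V (c \<odot> x n) (y n)) \<longlonglongrightarrow> c * ip \<H> X Y"
    using tendsto_mult_left[OF ip_completion[OF *(1,3)], of c] * by (simp add: ip_smult_left cauD)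
  then show "ip \<H> (c \<odot>\<^bsub>\<H>\<^esub> X) Y = c * ip \<H> X Y"
    using * by (simp add: smult_completion ip_completion_eqI cau_smult)
  have "(\<lambda>n. ip V (y n) (x n)) \<longlonglongrightarrow> cnj (ip \<H> X Y)"
    using tendsto_cnj[OF ip_completion[OF *(1,3)]] * by (simp add: ip_cnj[OF cauD cauD, symmetric])
  then show "ip \<H> Y X = cnj (ip \<H> X Y)" using * by (simp add: ip_completion_eqI)
next
  fix X assume "X \<in> carrier \<H>"
  then obtain x where *: "cau x" "X = cls x" by (rule completion_cases)
  have "(\<lambda>n. Re (ip V (x n) (x n))) \<longlonglongrightarrow> Re (ip \<H> X X)"
    using ip_completion[OF *(1,1)] * by (intro tendsto_intros) simp
  then show "0 \<le> Re (ip \<H> X X)"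
    by (rule LIMSEQ_le_const) (use * ip_pos cauD in auto)
qed

lemma diff_completion:
  assumes "cau x" "cau y"
  shows "cls x \<ominus>\<^bsub>\<H>\<^esub> cls y = cls (\<lambda>n. x n \<ominus> y n)"
proof -
  interpret H: cvec \<H> using completion_module by (simp add: cvec_def)
  show ?thesis using assms
    by (simp add: a_minus_def H.sm_minus_one sm_minus_one smult_completion add_completion cau_smult cauD)
qed

lemma completion_vec_cls: "v \<in> carrier V \<Longrightarrow> completion_vec V v = cls (\<lambda>_. v)"
  unfolding completion_vec_def by (rule coset_eq_cls) (rule cau_const)

lemma completion_vec_carrier [simp]: "v \<in> carrier V \<Longrightarrow> completion_vec V v \<in> carrier \<H>"
  by (simp add: completion_vec_cls cau_const)

lemma completion_vec_ip:
  "v \<in> carrier V \<Longrightarrow> w \<in> carrier V \<Longrightarrow> ip \<H> (completion_vec V v) (completion_vec V w) = ip V v w"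
  by (simp add: completion_vec_cls ip_completion_eqI cau_const)

lemma completion_vec_norm: "v \<in> carrier V \<Longrightarrow> vnorm \<H> (completion_vec V v) = vnorm V v"
  by (simp add: vnorm_def completion_vec_ip)

lemma completion_vec_diff:
  "v \<in> carrier V \<Longrightarrow> w \<in> carrier V \<Longrightarrow>
    completion_vec V v \<ominus>\<^bsub>\<H>\<^esub> completion_vec V w = completion_vec V (v \<ominus> w)"
  by (simp add: completion_vec_cls diff_completion cau_const)

lemma completion_vec_add:
  "v \<in> carrier V \<Longrightarrow> w \<in> carrier V \<Longrightarrow>
    completion_vec V (v \<oplus> w) = completion_vec V v \<oplus>\<^bsub>\<H>\<^esub> completion_vec V w"
  by (simp add: completion_vec_cls add_completion cau_const)

lemma completion_vec_smult:
  "v \<in> carrier V \<Longrightarrow> completion_vec V (c \<odot> v) = c \<odot>\<^bsub>\<H>\<^esub> completion_vec V v"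
  by (simp add: completion_vec_cls smult_completion cau_const)

text \<open>The distance from the class of \<open>x\<close> to the constant sequence
  \<open>x n\<close> is the limit over \<open>m\<close> of the distances from \<open>x m\<close> to
  \<open>x n\<close>.\<close>

lemma completion_tail:
  assumes x: "cau x" and M: "\<forall>m\<ge>M. \<forall>n\<ge>M. vnorm V (x m \<ominus> x n) < e" and n: "n \<ge> M"
  shows "vnorm \<H> (cls x \<ominus>\<^bsub>\<H>\<^esub> completion_vec V (x n)) \<le> e"
proof -
  have "(\<lambda>m. vnorm V (x m \<ominus> x n)) \<longlonglongrightarrow> vnorm \<H> (cls x \<ominus>\<^bsub>\<H>\<^esub> completion_vec V (x n))"
    using vnorm_completion[OF cau_diff[OF x cau_const[OF cauD[OF x, of n]]]] x
    by (simp add: completion_vec_cls diff_completion cau_const cauD)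
  then show ?thesis
    by (rule LIMSEQ_le_const2) (use M n in \<open>auto intro!: exI[of _ M] less_imp_le\<close>)
qed

lemma completion_dense:
  assumes "X \<in> carrier \<H>" "0 < e"
  shows "\<exists>v\<in>carrier V. vnorm \<H> (X \<ominus>\<^bsub>\<H>\<^esub> completion_vec V v) < e"
proof -
  obtain x where x: "cau x" "X = cls x" using assms(1) by (rule completion_cases)
  obtain M where "\<forall>m\<ge>M. \<forall>n\<ge>M. vnorm V (x m \<ominus> x n) < e / 2"
    using x(1) assms(2) unfolding cau_def cauchy_seq_def by (meson half_gt_zero)
  from completion_tail[OF x(1) this order_refl]
  show ?thesis using x assms(2) cauD[OF x(1), of M] by (intro bexI[of _ "x M"]) auto
qed

text \<open>For completeness each \<open>Z n\<close> is approximated by a vector \<open>v n\<close>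
  of \<open>V\<close> up to \<open>1 / (n + 1)\<close>. The sequence \<open>v\<close> is then Cauchy
  in \<open>V\<close>, and its class is the limit of \<open>Z\<close>.\<close>

theorem completion_hilbert: "hilbert \<H>"
proof -
  interpret H: semi_ip \<H> by (rule completion_semi_ip)
  show ?thesis
  proof
    fix X assume "X \<in> carrier \<H>" and 0: "vnorm \<H> X = 0"
    then obtain x where x: "cau x" "X = cls x" by (metis completion_cases)
    then have "(\<lambda>n. vnorm V (x n)) \<longlonglongrightarrow> 0" using vnorm_completion[OF x(1)] 0 by simp
    then have "equi x (\<lambda>_. \<zero>)" using x by (simp add: equi_def a_minus_def cauD)
    then show "X = \<zero>\<^bsub>\<H>\<^esub>" using x by (simp add: zero_completion cls_eq_iff cau_const)
  next
    fix Z assume Z: "\<And>n. Z n \<in> carrier \<H>" and cZ: "H.cauchy_seq Z"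
    have "\<exists>v\<in>carrier V. vnorm \<H> (Z n \<ominus>\<^bsub>\<H>\<^esub> completion_vec V v) < inverse (real (Suc n))" for n
      by (rule completion_dense[OF Z]) simp
    then obtain v where v: "\<And>n. v n \<in> carrier V"
      "\<And>n. vnorm \<H> (Z n \<ominus>\<^bsub>\<H>\<^esub> completion_vec V (v n)) < inverse (real (Suc n))" by metis
    have inv: "\<exists>M. \<forall>n\<ge>M. inverse (real (Suc n)) < e" if "0 < e" for e :: real
      using order_tendstoD(2)[OF LIMSEQ_inverse_real_of_nat that] by (simp add: eventually_sequentially)
    have "cau v" unfolding cau_def cauchy_seq_def
    proof (intro conjI allI impI v(1))
      fix e :: real assume "0 < e"
      then have e3: "0 < e / 3" by simp
      obtain M N where M: "\<forall>m\<ge>M. \<forall>n\<ge>M. vnorm \<H> (Z m \<ominus>\<^bsub>\<H>\<^esub> Z n) < e / 3"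
        and N: "\<forall>n\<ge>N. inverse (real (Suc n)) < e / 3"
        using cZ inv[OF e3] e3 unfolding H.cauchy_seq_def by meson
      have "vnorm V (v m \<ominus> v n) < e" if mn: "m \<ge> max M N" "n \<ge> max M N" for m n
      proof -
        have "vnorm V (v m \<ominus> v n) = vnorm \<H> (completion_vec V (v m) \<ominus>\<^bsub>\<H>\<^esub> completion_vec V (v n))"
          using v(1) by (simp add: completion_vec_diff completion_vec_norm)
        also have "\<dots> \<le> vnorm \<H> (completion_vec V (v m) \<ominus>\<^bsub>\<H>\<^esub> Z m)
            + vnorm \<H> (Z m \<ominus>\<^bsub>\<H>\<^esub> completion_vec V (v n))"
          using v(1) Z by (intro H.nrm_diff_triangle) auto
        also have "vnorm \<H> (Z m \<ominus>\<^bsub>\<H>\<^esub> completion_vec V (v n))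
            \<le> vnorm \<H> (Z m \<ominus>\<^bsub>\<H>\<^esub> Z n) + vnorm \<H> (Z n \<ominus>\<^bsub>\<H>\<^esub> completion_vec V (v n))"
          using v(1) Z by (intro H.nrm_diff_triangle) auto
        also have "vnorm \<H> (completion_vec V (v m) \<ominus>\<^bsub>\<H>\<^esub> Z m)
            = vnorm \<H> (Z m \<ominus>\<^bsub>\<H>\<^esub> completion_vec V (v m))"
          using v(1) Z by (intro H.nrm_diff_commute) auto
        finally have le: "vnorm V (v m \<ominus> v n) \<le> vnorm \<H> (Z m \<ominus>\<^bsub>\<H>\<^esub> completion_vec V (v m))
          + (vnorm \<H> (Z m \<ominus>\<^bsub>\<H>\<^esub> Z n) + vnorm \<H> (Z n \<ominus>\<^bsub>\<H>\<^esub> completion_vec V (v n)))" by simp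
        have "vnorm \<H> (Z m \<ominus>\<^bsub>\<H>\<^esub> Z n) < e / 3" "inverse (real (Suc m)) < e / 3"
          "inverse (real (Suc n)) < e / 3" using M N mn by auto
        then show ?thesis using le v(2)[of m] v(2)[of n] by linarith
      qed
      then show "\<exists>M. \<forall>m\<ge>M. \<forall>n\<ge>M. vnorm V (v m \<ominus> v n) < e" by blast
    qed
    moreover have "H.lim_to Z (cls v)" unfolding H.lim_to_def
    proof (rule LIMSEQ_I)
      fix e :: real assume "0 < e"
      then have e3: "0 < e / 3" by simp
      obtain M N where M: "\<forall>m\<ge>M. \<forall>n\<ge>M. vnorm V (v m \<ominus> v n) < e / 3"
        and N: "\<forall>n\<ge>N. inverse (real (Suc n)) < e / 3"
        using \<open>cau v\<close> inv[OF e3] e3 unfolding cau_def cauchy_seq_def by meson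
      have "norm (vnorm \<H> (Z n \<ominus>\<^bsub>\<H>\<^esub> cls v) - 0) < e" if n: "n \<ge> max M N" for n
      proof -
        have "vnorm \<H> (Z n \<ominus>\<^bsub>\<H>\<^esub> cls v)
            \<le> vnorm \<H> (Z n \<ominus>\<^bsub>\<H>\<^esub> completion_vec V (v n)) + vnorm \<H> (completion_vec V (v n) \<ominus>\<^bsub>\<H>\<^esub> cls v)"
          using v(1) Z \<open>cau v\<close> by (intro H.nrm_diff_triangle) auto
        also have "vnorm \<H> (completion_vec V (v n) \<ominus>\<^bsub>\<H>\<^esub> cls v)
            = vnorm \<H> (cls v \<ominus>\<^bsub>\<H>\<^esub> completion_vec V (v n))"
          using v(1) \<open>cau v\<close> by (intro H.nrm_diff_commute) auto
        also have "\<dots> \<le> e / 3" using completion_tail[OF \<open>cau v\<close> M] n by simp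
        finally have le: "vnorm \<H> (Z n \<ominus>\<^bsub>\<H>\<^esub> cls v)
          \<le> vnorm \<H> (Z n \<ominus>\<^bsub>\<H>\<^esub> completion_vec V (v n)) + e / 3" by simp
        have "inverse (real (Suc n)) < e / 3" using N n by auto
        then have "vnorm \<H> (Z n \<ominus>\<^bsub>\<H>\<^esub> cls v) < e" using le v(2)[of n] e3 by linarith
        then show ?thesis
          using H.vnorm_nonneg[of "Z n \<ominus>\<^bsub>\<H>\<^esub> cls v"] Z \<open>cau v\<close> by simp
      qed
      then show "\<exists>no. \<forall>n\<ge>no. norm (vnorm \<H> (Z n \<ominus>\<^bsub>\<H>\<^esub> cls v) - 0) < e" by blast
    qed
    ultimately show "\<exists>L\<in>carrier \<H>. H.lim_to Z L" by (intro bexI[of _ "cls v"]) auto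
  qed
qed

text \<open>\<open>completion_op\<close> is a union of cosets over all representatives; boundedness
  of \<open>T\<close> makes these cosets coincide, so that any representative may be used.\<close>

lemma linear_bounded_cau:
  assumes T: "\<And>x. x \<in> carrier V \<Longrightarrow> T x \<in> carrier V"
    "\<And>x y. x \<in> carrier V \<Longrightarrow> y \<in> carrier V \<Longrightarrow> T (x \<oplus> y) = T x \<oplus> T y"
    "\<And>c x. x \<in> carrier V \<Longrightarrow> T (c \<odot> x) = c \<odot> T x"
    and K: "0 \<le> K" "\<And>x. x \<in> carrier V \<Longrightarrow> vnorm V (T x) \<le> K * vnorm V x"
    and x: "cau x"
  shows "cau (\<lambda>n. T (x n))" "completion_op V T (cls x) = cls (\<lambda>n. T (x n))"
proof -
  have Tdiff: "T (x \<ominus> y) = T x \<ominus> T y" if "x \<in> carrier V" "y \<in> carrier V" for x y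
    using that by (simp add: a_minus_def sm_minus_one T)
  have cT: "cau (\<lambda>n. T (x n))" if "cau x" for x
    by (rule cau_bound[OF _ that K(1)])
      (use cauD[OF that] T(1) K(2)[of "x m \<ominus> x n" for m n] in \<open>simp_all add: Tdiff\<close>)
  then show "cau (\<lambda>n. T (x n))" using x .
  have "completion_op V T (cls x) = (\<Union>y\<in>cls x. null_sequences V +>\<^bsub>cauchy_module V\<^esub> (\<lambda>n. T (y n)))"
    using x by (simp add: completion_op_def)
  also have "\<dots> = (\<Union>y\<in>cls x. cls (\<lambda>n. T (x n)))"
  proof (rule SUP_cong[OF refl])
    fix y assume "y \<in> cls x"
    then have y: "cau y" "equi y x" by (auto simp: cls_def)
    have "equi (\<lambda>n. T (y n)) (\<lambda>n. T (x n))"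
    proof (rule equi_bound)
      show "vnorm V (T (y n) \<ominus> T (x n)) \<le> K * vnorm V (y n \<ominus> x n)" for n
        using K(2)[of "y n \<ominus> x n"] cauD[OF x] cauD[OF y(1)] by (simp add: Tdiff)
      show "(\<lambda>n. K * vnorm V (y n \<ominus> x n)) \<longlonglongrightarrow> 0"
        using tendsto_mult_left[OF y(2)[unfolded equi_def], of K] by simp
    qed (use T(1) cauD[OF x] cauD[OF y(1)] in auto)
    then show "null_sequences V +>\<^bsub>cauchy_module V\<^esub> (\<lambda>n. T (y n)) = cls (\<lambda>n. T (x n))"
      by (simp add: coset_eq_cls cls_eq_iff cT x y)
  qed
  also have "\<dots> = cls (\<lambda>n. T (x n))" using mem_cls[OF x] by auto
  finally show "completion_op V T (cls x) = cls (\<lambda>n. T (x n))" .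
qed

lemma completion_op_bounded:
  assumes T: "\<And>x. x \<in> carrier V \<Longrightarrow> T x \<in> carrier V"
    "\<And>x y. x \<in> carrier V \<Longrightarrow> y \<in> carrier V \<Longrightarrow> T (x \<oplus> y) = T x \<oplus> T y"
    "\<And>c x. x \<in> carrier V \<Longrightarrow> T (c \<odot> x) = c \<odot> T x"
    and K: "0 \<le> K" "\<And>x. x \<in> carrier V \<Longrightarrow> vnorm V (T x) \<le> K * vnorm V x"
  shows "completion_op V T \<in> bounded_operators \<H>"
proof -
  interpret H: hilbert \<H> by (rule completion_hilbert)
  have TT: "cau (\<lambda>n. T (x n))" "completion_op V T (cls x) = cls (\<lambda>n. T (x n))" if "cau x" for x
    by (rule linear_bounded_cau[where K = K]; (fact T K that))+
  have "(\<lambda>X\<in>carrier \<H>. completion_op V T X) \<in> bounded_operators \<H>"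
  proof (rule H.bopI)
    fix X assume "X \<in> carrier \<H>"
    then obtain x where x: "cau x" "X = cls x" by (rule completion_cases)
    then show "completion_op V T X \<in> carrier \<H>" using TT by simp
    have "(\<lambda>n. K * vnorm V (x n)) \<longlonglongrightarrow> K * vnorm \<H> X"
      using vnorm_completion[OF x(1)] x by (intro tendsto_intros) simp
    then show "vnorm \<H> (completion_op V T X) \<le> K * vnorm \<H> X"
      unfolding x(2) TT(2)[OF x(1)]
      by (rule LIMSEQ_le[OF vnorm_completion[OF TT(1)[OF x(1)]]]) (use K(2) cauD[OF x(1)] in auto)
  next
    fix X Y assume "X \<in> carrier \<H>" "Y \<in> carrier \<H>"
    then obtain x y where *: "cau x" "X = cls x" "cau y" "Y = cls y" by (metis completion_cases)
    show "completion_op V T (X \<oplus>\<^bsub>\<H>\<^esub> Y) = completion_op V T X \<oplus>\<^bsub>\<H>\<^esub> completion_op V T Y"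
      using * TT by (simp add: add_completion cau_add T(2) cauD)
  next
    fix c X assume "X \<in> carrier \<H>"
    then obtain x where x: "cau x" "X = cls x" by (rule completion_cases)
    then show "completion_op V T (c \<odot>\<^bsub>\<H>\<^esub> X) = c \<odot>\<^bsub>\<H>\<^esub> completion_op V T X"
      using TT by (simp add: smult_completion cau_smult T(3) cauD)
  qed
  moreover have "(\<lambda>X\<in>carrier \<H>. completion_op V T X) = completion_op V T"
    by (rule ext) (simp add: completion_op_def restrict_def)
  ultimately show ?thesis by simp
qed

end

text \<open>A *-representation on a semi-inner product space, where all relations are only required
  modulo vectors of norm zero, is bounded and extends to the completion.\<close>

locale pre_rep = A: unital_cstar_algebra A + semi_ip V
  for A :: "('a, 'm) cstar_scheme" and V :: "('v, 'n) ip_space_scheme" (structure) +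
  fixes \<pi> :: "'a \<Rightarrow> 'v \<Rightarrow> 'v"
  assumes pi_closed: "a \<in> carrier A \<Longrightarrow> f \<in> carrier V \<Longrightarrow> \<pi> a f \<in> carrier V"
    and pi_add: "a \<in> carrier A \<Longrightarrow> f \<in> carrier V \<Longrightarrow> g \<in> carrier V \<Longrightarrow> \<pi> a (f \<oplus> g) = \<pi> a f \<oplus> \<pi> a g"
    and pi_smult: "a \<in> carrier A \<Longrightarrow> f \<in> carrier V \<Longrightarrow> \<pi> a (c \<odot> f) = c \<odot> \<pi> a f"
    and form_add: "a \<in> carrier A \<Longrightarrow> b \<in> carrier A \<Longrightarrow> f \<in> carrier V \<Longrightarrow> g \<in> carrier V \<Longrightarrow>
      ip V (\<pi> (a \<oplus>\<^bsub>A\<^esub> b) f) g = ip V (\<pi> a f) g + ip V (\<pi> b f) g"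
    and form_smult: "a \<in> carrier A \<Longrightarrow> f \<in> carrier V \<Longrightarrow> g \<in> carrier V \<Longrightarrow>
      ip V (\<pi> (c \<odot>\<^bsub>A\<^esub> a) f) g = c * ip V (\<pi> a f) g"
    and form_one: "f \<in> carrier V \<Longrightarrow> g \<in> carrier V \<Longrightarrow> ip V (\<pi> \<one>\<^bsub>A\<^esub> f) g = ip V f g"
    and form_mult: "a \<in> carrier A \<Longrightarrow> b \<in> carrier A \<Longrightarrow> f \<in> carrier V \<Longrightarrow> g \<in> carrier V \<Longrightarrow>
      ip V (\<pi> (a \<otimes>\<^bsub>A\<^esub> b) f) g = ip V (\<pi> b f) (\<pi> (star A a) g)"
begin

lemma form_star:
  assumes "a \<in> carrier A" "f \<in> carrier V" "g \<in> carrier V"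
  shows "ip V (\<pi> a f) g = ip V f (\<pi> (star A a) g)"
  using form_mult[of a "\<one>\<^bsub>A\<^esub>" f g] form_one[of f "\<pi> (star A a) g"] assms
  by (simp add: A.star_closed pi_closed)

text \<open>Boundedness is automatic: \<open>1 - star A b b\<close> is the square of a self-adjoint
  \<open>k\<close>, and the form at \<open>\<pi> k f\<close> is nonnegative, which says that the
  squared norm of \<open>f\<close> minus that of \<open>\<pi> b f\<close> is nonnegative.\<close>

lemma pi_contractive:
  assumes b: "b \<in> carrier A" "cnorm A b < 1" and f: "f \<in> carrier V"
  shows "vnorm V (\<pi> b f) \<le> vnorm V f"
proof -
  let ?h = "star A b \<otimes>\<^bsub>A\<^esub> b"
  have h: "?h \<in> carrier A" "star A ?h = ?h"
    using b by (auto simp: A.star_mult A.star_star A.star_closed)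
  have hn: "cnorm A ?h < 1"
    using b A.cnorm_nonneg[OF b(1)] by (simp add: A.cstar_identity power_less_one_iff)
  obtain k where k: "k \<in> carrier A" "star A k = k" "k \<otimes>\<^bsub>A\<^esub> k = \<one>\<^bsub>A\<^esub> \<ominus>\<^bsub>A\<^esub> ?h"
    by (rule A.sqrt_one_minus[OF h hn], rule that)
  have "ip V (\<pi> (k \<otimes>\<^bsub>A\<^esub> k) f) f = ip V (\<pi> k f) (\<pi> k f)"
    using form_mult[OF k(1) k(1) f f] k(2) by simp
  then have "0 \<le> Re (ip V (\<pi> (k \<otimes>\<^bsub>A\<^esub> k) f) f)" using ip_pos pi_closed k(1) f by simp
  moreover have "ip V (\<pi> (k \<otimes>\<^bsub>A\<^esub> k) f) f = ip V f f - ip V (\<pi> ?h f) f"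
    unfolding k(3) using f h
    by (simp add: a_minus_def A.sm_minus_one form_add form_smult form_one)
  moreover have "ip V (\<pi> ?h f) f = ip V (\<pi> b f) (\<pi> b f)"
    using form_mult[of "star A b" b f f] b f by (simp add: A.star_closed A.star_star)
  ultimately have "(vnorm V (\<pi> b f))\<^sup>2 \<le> (vnorm V f)\<^sup>2"
    using f b by (simp add: vnorm_sq pi_closed)
  then show ?thesis by (rule power2_le_imp_le) (rule vnorm_nonneg[OF f])
qed

lemma pi_bound:
  assumes a: "a \<in> carrier A" and f: "f \<in> carrier V"
  shows "vnorm V (\<pi> a f) \<le> (cnorm A a + 1) * vnorm V f"
proof -
  have pos: "0 < cnorm A a + 1" using A.cnorm_nonneg[OF a] by simp
  \<comment> \<open>The summand 1 keeps the denominator positive and the scaled element strictly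
    below norm 1.\<close>
  define r where "r = 1 / (cnorm A a + 1)"
  have r: "0 < r" using pos by (simp add: r_def)
  let ?b = "of_real r \<odot>\<^bsub>A\<^esub> a"
  have b: "?b \<in> carrier A" "cnorm A ?b < 1"
  proof -
    have "cnorm A ?b = r * cnorm A a" using a r by (simp add: A.cnorm_smult)
    also have "\<dots> < 1" using pos by (simp add: r_def divide_simps)
    finally show "cnorm A ?b < 1" .
  qed (use a in simp)
  \<comment> \<open>The vectors \<open>\<pi> ?b f\<close> and \<open>r\<close> times
    \<open>\<pi> a f\<close> need not be equal, as scalars are respected only under the form; hence
    \<open>r\<close> is pulled out of the two slots one after the other.\<close>
  have "ip V (\<pi> ?b f) (\<pi> ?b f) = of_real r * ip V (\<pi> a f) (\<pi> ?b f)"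
    using a b f by (simp add: form_smult pi_closed)
  also have "ip V (\<pi> a f) (\<pi> ?b f) = cnj (of_real r * ip V (\<pi> a f) (\<pi> a f))"
    using form_smult[OF a f pi_closed[OF a f], of "of_real r"]
      ip_cnj[OF pi_closed[OF b(1) f] pi_closed[OF a f]] by simp
  finally have "Re (ip V (\<pi> ?b f) (\<pi> ?b f)) = r * (r * Re (ip V (\<pi> a f) (\<pi> a f)))" by simp
  then have "(r * vnorm V (\<pi> a f))\<^sup>2 = (vnorm V (\<pi> ?b f))\<^sup>2"
    using vnorm_sq[OF pi_closed[OF a f]] vnorm_sq[OF pi_closed[OF b(1) f]]
    by (simp add: power_mult_distrib power2_eq_square)
  then have "r * vnorm V (\<pi> a f) = vnorm V (\<pi> ?b f)"
    by (rule power2_eq_imp_eq) (use r a b f in \<open>simp_all add: vnorm_nonneg pi_closed\<close>)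
  then have "r * vnorm V (\<pi> a f) \<le> vnorm V f" using pi_contractive[OF b f] by simp
  then show ?thesis using pos by (simp add: r_def divide_simps mult.commute)
qed

abbreviation "\<Theta> a \<equiv> completion_op V (\<pi> a)"

lemma Pi_bounded: "a \<in> carrier A \<Longrightarrow> \<Theta> a \<in> bounded_operators (completion V)"
  by (rule completion_op_bounded[where K = "cnorm A a + 1"])
    (simp_all add: pi_closed pi_add pi_smult pi_bound A.cnorm_nonneg)

lemma Pi_cls:
  assumes "a \<in> carrier A" "cau x"
  shows "cau (\<lambda>n. \<pi> a (x n))" "\<Theta> a (cls x) = cls (\<lambda>n. \<pi> a (x n))"
  using linear_bounded_cau[where T = "\<pi> a" and K = "cnorm A a + 1" and x = x] assms
  by (simp_all add: pi_closed pi_add pi_smult pi_bound A.cnorm_nonneg)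

lemma Pi_vec:
  "a \<in> carrier A \<Longrightarrow> v \<in> carrier V \<Longrightarrow> \<Theta> a (completion_vec V v) = completion_vec V (\<pi> a v)"
  by (simp add: completion_vec_cls Pi_cls cau_const pi_closed)

text \<open>Relations of a \<open>pre_rep\<close> hold only inside inner products, so operators on
  the completion are compared weakly; definiteness there turns this into equality.\<close>

lemma Pi_eqI:
  assumes S: "S \<in> bounded_operators (completion V)" and T: "T \<in> bounded_operators (completion V)"
    and eq: "\<And>x y. cau x \<Longrightarrow> cau y \<Longrightarrow> ip (completion V) (S (cls x)) (cls y) = ip (completion V) (T (cls x)) (cls y)"
  shows "S = T"
proof -
  interpret H: hilbert "completion V" by (rule completion_hilbert)
  show ?thesis
  proof (rule H.bop_eqI[OF S T])
    fix X assume X: "X \<in> carrier (completion V)"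
    then obtain x where x: "cau x" "X = cls x" by (rule completion_cases)
    have c: "S X \<in> carrier (completion V)" "T X \<in> carrier (completion V)"
      using H.bopD(1)[OF S X] H.bopD(1)[OF T X] by auto
    show "S X = T X"
    proof (rule H.ip_eqI[OF c])
      fix Z assume Z: "Z \<in> carrier (completion V)"
      then obtain z where z: "cau z" "Z = cls z" by (rule completion_cases)
      show "ip (completion V) Z (S X) = ip (completion V) Z (T X)"
        using eq[OF x(1) z(1)] x z H.ip_cnj[OF c(1) Z] H.ip_cnj[OF c(2) Z] by simp
    qed
  qed
qed

lemma Pi_ip:
  assumes "a \<in> carrier A" "cau x" "cau y"
  shows "(\<lambda>n. ip V (\<pi> a (x n)) (y n)) \<longlonglongrightarrow> ip (completion V) (\<Theta> a (cls x)) (cls y)"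
  using ip_completion[OF Pi_cls(1)[OF assms(1,2)] assms(3)] Pi_cls(2)[OF assms(1,2)] by simp

lemma Pi_star:
  assumes a: "a \<in> carrier A"
  shows "\<Theta> (star A a) = star (operator_algebra (completion V)) (\<Theta> a)"
proof -
  interpret H: hilbert "completion V" by (rule completion_hilbert)
  note sa = A.star_closed[OF a]
  show ?thesis
  proof (rule H.star_unique[OF Pi_bounded[OF sa], symmetric])
    fix X Y assume X: "X \<in> carrier (completion V)" and Y: "Y \<in> carrier (completion V)"
    obtain x y where xy: "cau x" "X = cls x" "cau y" "Y = cls y"
      using completion_cases[OF X] completion_cases[OF Y] by metis
    have "(\<lambda>n. ip V (\<pi> a (x n)) (y n)) \<longlonglongrightarrow> ip (completion V) (cls x) (\<Theta> (star A a) (cls y))"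
      using ip_completion[OF xy(1) Pi_cls(1)[OF sa xy(3)]] xy
      by (simp add: Pi_cls(2)[OF sa] form_star[OF a] cauD)
    then show "ip (completion V) (\<Theta> a X) Y = ip (completion V) X (\<Theta> (star A a) Y)"
      unfolding xy(2,4) by (rule LIMSEQ_unique[OF Pi_ip[OF a xy(1,3)]])
  qed
qed

text \<open>Each relation holds for the inner products of representatives and passes to the limit;
  uniqueness of limits then gives it weakly on the completion, and \<open>Pi_eqI\<close>
  finishes.\<close>

theorem Pi_hom: "unital_star_hom A (operator_algebra (completion V)) \<Theta>"
proof -
  interpret H: hilbert "completion V" by (rule completion_hilbert)
  show ?thesis
  proof (rule unital_star_homI)
    fix a assume a: "a \<in> carrier A"
    show "\<Theta> a \<in> carrier (operator_algebra (completion V))"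
      by (simp add: H.carrier_op Pi_bounded a)
    show "\<Theta> (star A a) = star (operator_algebra (completion V)) (\<Theta> a)" by (rule Pi_star[OF a])
    fix c
    show "\<Theta> (c \<odot>\<^bsub>A\<^esub> a) = c \<odot>\<^bsub>operator_algebra (completion V)\<^esub> \<Theta> a"
    proof (rule Pi_eqI)
      fix x y assume x: "cau x" and y: "cau y"
      have "(\<lambda>n. ip V (\<pi> (c \<odot>\<^bsub>A\<^esub> a) (x n)) (y n)) \<longlonglongrightarrow> c * ip (completion V) (\<Theta> a (cls x)) (cls y)"
        using tendsto_mult_left[OF Pi_ip[OF a x y], of c] a x y by (simp add: form_smult cauD)
      from LIMSEQ_unique[OF Pi_ip[OF _ x y] this]
      show "ip (completion V) (\<Theta> (c \<odot>\<^bsub>A\<^esub> a) (cls x)) (cls y)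
        = ip (completion V) ((c \<odot>\<^bsub>operator_algebra (completion V)\<^esub> \<Theta> a) (cls x)) (cls y)"
        using a x y by (simp add: H.ip_smult_left H.bopD(1)[OF Pi_bounded])
    qed (simp_all add: Pi_bounded a H.op_smult_closed)
  next
    fix a b assume a: "a \<in> carrier A" and b: "b \<in> carrier A"
    show "\<Theta> (a \<oplus>\<^bsub>A\<^esub> b) = \<Theta> a \<oplus>\<^bsub>operator_algebra (completion V)\<^esub> \<Theta> b"
    proof (rule Pi_eqI)
      fix x y assume x: "cau x" and y: "cau y"
      have "(\<lambda>n. ip V (\<pi> (a \<oplus>\<^bsub>A\<^esub> b) (x n)) (y n))
          \<longlonglongrightarrow> ip (completion V) (\<Theta> a (cls x)) (cls y) + ip (completion V) (\<Theta> b (cls x)) (cls y)"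
        using tendsto_add[OF Pi_ip[OF a x y] Pi_ip[OF b x y]] a b x y by (simp add: form_add cauD)
      from LIMSEQ_unique[OF Pi_ip[OF _ x y] this]
      show "ip (completion V) (\<Theta> (a \<oplus>\<^bsub>A\<^esub> b) (cls x)) (cls y)
        = ip (completion V) ((\<Theta> a \<oplus>\<^bsub>operator_algebra (completion V)\<^esub> \<Theta> b) (cls x)) (cls y)"
        using a b x y by (simp add: H.ip_add_left H.bopD(1)[OF Pi_bounded])
    qed (simp_all add: Pi_bounded a b H.op_add_closed)
    show "\<Theta> (a \<otimes>\<^bsub>A\<^esub> b) = \<Theta> a \<otimes>\<^bsub>operator_algebra (completion V)\<^esub> \<Theta> b"
    proof (rule Pi_eqI)
      fix x y assume x: "cau x" and y: "cau y"
      note sa = A.star_closed[OF a]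
      have "(\<lambda>n. ip V (\<pi> (a \<otimes>\<^bsub>A\<^esub> b) (x n)) (y n))
          \<longlonglongrightarrow> ip (completion V) (\<Theta> b (cls x)) (\<Theta> (star A a) (cls y))"
        using Pi_ip[OF b x Pi_cls(1)[OF sa y]] a b x y by (simp add: form_mult cauD Pi_cls(2)[OF sa])
      from LIMSEQ_unique[OF Pi_ip[OF _ x y] this]
      show "ip (completion V) (\<Theta> (a \<otimes>\<^bsub>A\<^esub> b) (cls x)) (cls y)
        = ip (completion V) ((\<Theta> a \<otimes>\<^bsub>operator_algebra (completion V)\<^esub> \<Theta> b) (cls x)) (cls y)"
        using a b x y H.op_star(2)[OF Pi_bounded[OF a], of "\<Theta> b (cls x)" "cls y"]
        by (simp add: H.bopD(1)[OF Pi_bounded] Pi_star[OF a])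
    qed (simp_all add: Pi_bounded a b H.op_mult_closed)
  next
    show "\<Theta> \<one>\<^bsub>A\<^esub> = \<one>\<^bsub>operator_algebra (completion V)\<^esub>"
    proof (rule Pi_eqI)
      fix x y assume x: "cau x" and y: "cau y"
      have "(\<lambda>n. ip V (\<pi> \<one>\<^bsub>A\<^esub> (x n)) (y n)) \<longlonglongrightarrow> ip (completion V) (cls x) (cls y)"
        using ip_completion[OF x y] x y by (simp add: form_one cauD)
      from LIMSEQ_unique[OF Pi_ip[OF _ x y] this]
      show "ip (completion V) (\<Theta> \<one>\<^bsub>A\<^esub> (cls x)) (cls y)
        = ip (completion V) (\<one>\<^bsub>operator_algebra (completion V)\<^esub> (cls x)) (cls y)"
        using x by simp
    qed (simp_all add: Pi_bounded H.op_one_closed)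
  qed
qed

end

section \<open>Positive semidefinite kernels\<close>

definition qform :: "'x set \<Rightarrow> ('x \<Rightarrow> 'x \<Rightarrow> complex) \<Rightarrow> ('x \<Rightarrow> complex) \<Rightarrow> complex" where
  "qform S K f = (\<Sum>x\<in>S. \<Sum>y\<in>S. f x * cnj (f y) * K x y)"

definition psd :: "'x set \<Rightarrow> ('x \<Rightarrow> 'x \<Rightarrow> complex) \<Rightarrow> bool" where
  "psd S K \<longleftrightarrow> (\<forall>x\<in>S. \<forall>y\<in>S. K y x = cnj (K x y)) \<and> (\<forall>f. 0 \<le> Re (qform S K f))"

lemma qform_insert:
  assumes "finite S" "p \<notin> S"
  shows "qform (insert p S) K f = qform S K f + f p * (\<Sum>y\<in>S. cnj (f y) * K p y)
    + cnj (f p) * (\<Sum>x\<in>S. f x * K x p) + f p * cnj (f p) * K p p"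
proof -
  have 1: "(\<Sum>y\<in>S. f p * cnj (f y) * K p y) = f p * (\<Sum>y\<in>S. cnj (f y) * K p y)"
    by (simp add: sum_distrib_left mult.assoc)
  have 2: "(\<Sum>x\<in>S. f x * cnj (f p) * K x p) = cnj (f p) * (\<Sum>x\<in>S. f x * K x p)"
    unfolding sum_distrib_left by (intro sum.cong refl) (simp only: mult_ac)
  show ?thesis
    unfolding qform_def sum.insert[OF assms] sum.distrib 1 2 by (simp only: add_ac)
qed

lemma psd_herm: "psd S K \<Longrightarrow> x \<in> S \<Longrightarrow> y \<in> S \<Longrightarrow> K y x = cnj (K x y)"
  unfolding psd_def by blast

lemma psd_nonneg: "psd S K \<Longrightarrow> 0 \<le> Re (qform S K f)"
  by (simp add: psd_def)

text \<open>If \<open>K x p\<close> were nonzero, test vectors supported on \<open>x\<close> and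
  \<open>p\<close> would make the form negative, because no diagonal term at \<open>p\<close> grows
  with the coefficient there.\<close>

lemma psd_insert_zero:
  assumes fin: "finite S" "p \<notin> S" and psd: "psd (insert p S) K" and 0: "K p p = 0" and x: "x \<in> S"
  shows "K x p = 0"
proof (rule ccontr)
  assume ne: "K x p \<noteq> 0"
  define k where "k = K x p"
  have herm: "K p x = cnj k" "K x x = cnj (K x x)" using psd_herm[OF psd, of x p] psd_herm[OF psd, of x x] x by (simp_all add: k_def)
  define r where "r = Re (K x x)"
  have Kxx: "K x x = of_real r" using herm(2) by (simp add: complex_eq_iff r_def)
  \<comment> \<open>Chosen so that the form becomes \<open>r - \<bar>r\<bar> - 1\<close>, which is
    negative.\<close>
  define t where "t = - (\<bar>r\<bar> + 1) / (2 * (cmod k)\<^sup>2)"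
  define f where "f = (\<lambda>y. if y = x then 1 else if y = p then of_real t * k else 0)"
  have xp: "x \<noteq> p" using x fin by auto
  have sums: "(\<Sum>y\<in>S. cnj (f y) * K p y) = K p x" "(\<Sum>y\<in>S. f y * K y p) = K x p"
    "qform S K f = K x x"
  proof -
    have *: "(\<Sum>y\<in>S. (if y = x then g y else 0)) = g x" for g :: "'a \<Rightarrow> complex"
      using x fin by simp
    have f_S: "f y = (if y = x then 1 else 0)" if "y \<in> S" for y using that fin by (auto simp: f_def)
    have "(\<Sum>y\<in>S. cnj (f y) * K p y) = (\<Sum>y\<in>S. (if y = x then K p y else 0))"
      "(\<Sum>y\<in>S. f y * K y p) = (\<Sum>y\<in>S. (if y = x then K y p else 0))"
      by (rule sum.cong; simp add: f_S)+
    then show "(\<Sum>y\<in>S. cnj (f y) * K p y) = K p x" "(\<Sum>y\<in>S. f y * K y p) = K x p"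
      unfolding * by auto
    have "qform S K f = (\<Sum>z\<in>S. \<Sum>y\<in>S. (if y = x then (if z = x then K z y else 0) else 0))"
      unfolding qform_def by (intro sum.cong refl) (simp add: f_S)
    then show "qform S K f = K x x" unfolding * by simp
  qed
  have fp: "f p = of_real t * k" using xp by (simp add: f_def)
  have "qform (insert p S) K f = of_real r + of_real t * (k * cnj k) + of_real t * (cnj k * k)"
    unfolding qform_insert[OF fin] sums 0 fp herm(1) Kxx k_def[symmetric] by simp
  also have "\<dots> = of_real (r + 2 * t * (cmod k)\<^sup>2)"
    using mult_cnj_self[of k] by (simp add: mult.commute[of "cnj k"])
  finally have "0 \<le> r + 2 * t * (cmod k)\<^sup>2"
    using psd_nonneg[OF psd, of f] by (simp only: Re_complex_of_real)
  moreover have "2 * t * (cmod k)\<^sup>2 = - (\<bar>r\<bar> + 1)" using ne by (simp add: t_def k_def)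
  ultimately show False by linarith
qed

text \<open>A Cholesky factorisation, one point at a time: with pivot \<open>K p p > 0\<close> the
  Schur complement is positive semidefinite on the remaining points; with pivot 0 the row and column
  of \<open>p\<close> vanish.\<close>

lemma psd_rank_one_sum:
  fixes S :: "'x set"
  assumes "finite S" "psd S K"
  shows "\<exists>n (c :: nat \<Rightarrow> 'x \<Rightarrow> complex). \<forall>x\<in>S. \<forall>y\<in>S. K x y = (\<Sum>k<n. c k x * cnj (c k y))"
  using assms
proof (induction S arbitrary: K)
  case empty
  then show ?case by simp
next
  case (insert p S)
  have herm: "\<And>x y. x \<in> insert p S \<Longrightarrow> y \<in> insert p S \<Longrightarrow> K y x = cnj (K x y)"
    and pos: "\<And>f. 0 \<le> Re (qform (insert p S) K f)"
    using psd_herm[OF insert.prems] psd_nonneg[OF insert.prems] by blast+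
  define d where "d = Re (K p p)"
  have Kpp: "K p p = of_real d" using herm[of p p] by (simp add: complex_eq_iff d_def)
  have "qform (insert p S) K (\<lambda>x. if x = p then 1 else 0) = K p p"
  proof -
    have "(\<Sum>x\<in>S. g x * (if x = p then 1 else 0)) = 0" for g :: "'x \<Rightarrow> complex"
      using insert.hyps by (intro sum.neutral) auto
    moreover have "qform S K (\<lambda>x. if x = p then 1 else 0) = 0"
      using insert.hyps unfolding qform_def by (intro sum.neutral ballI) auto
    moreover have "(\<Sum>y\<in>S. cnj (if y = p then 1 else 0) * K p y) = 0"
      "(\<Sum>y\<in>S. (if y = p then 1 else 0) * K y p) = 0"
      using insert.hyps by (auto intro!: sum.neutral)
    ultimately show ?thesis unfolding qform_insert[OF insert.hyps(1,2)] by simp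
  qed
  then have d0: "0 \<le> d" using pos[of "\<lambda>x. if x = p then 1 else 0"] by (simp add: d_def)
  show ?case
  proof (cases "d = 0")
    case True
    have zero: "K x p = 0" "K p x = 0" if "x \<in> S" for x
    proof -
      show "K x p = 0"
        by (rule psd_insert_zero[OF insert.hyps(1,2) insert.prems _ that]) (simp add: Kpp True)
      then show "K p x = 0" using herm[of x p] that by simp
    qed
    have "psd S K" unfolding psd_def
    proof (intro conjI allI)
      fix f
      have "qform (insert p S) K f = qform S K f"
        unfolding qform_insert[OF insert.hyps(1,2)] using zero True Kpp by simp
      then show "0 \<le> Re (qform S K f)" using pos[of f] by simp
    qed (use herm in blast)
    from insert.IH[OF this]
    obtain n and c :: "nat \<Rightarrow> 'x \<Rightarrow> complex" where c: "\<forall>x\<in>S. \<forall>y\<in>S. K x y = (\<Sum>k<n. c k x * cnj (c k y))"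
      by blast
    define c' where "c' k x = (if x = p then 0 else c k x)" for k x
    have c': "c' k p = 0" "x \<in> S \<Longrightarrow> c' k x = c k x" for k x
      using insert.hyps by (auto simp: c'_def)
    have "K x y = (\<Sum>k<n. c' k x * cnj (c' k y))" if "x \<in> insert p S" "y \<in> insert p S" for x y
    proof (cases "x = p \<or> y = p")
      case True
      then show ?thesis using zero that \<open>d = 0\<close> Kpp c'(1) by auto
    next
      case False
      then show ?thesis using c c'(2) that by simp
    qed
    then show ?thesis by blast
  next
    case False
    with d0 have d: "0 < d" by simp
    \<comment> \<open>The Schur complement of the pivot \<open>p\<close>.\<close>
    define K' where "K' x y = K x y - K x p * cnj (K y p) / of_real d" for x y
    have "psd S K'" unfolding psd_def
    proof (intro conjI allI ballI)
      fix x y assume "x \<in> S" "y \<in> S"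
      then show "K' y x = cnj (K' x y)" using herm[of x y] by (simp add: K'_def mult.commute)
    next
      fix f
      define s where "s = (\<Sum>x\<in>S. f x * K x p)"
      \<comment> \<open>The value at \<open>p\<close> minimises the form of \<open>K\<close> with
        the other coefficients held fixed; the minimum is the form of the Schur complement at
        \<open>f\<close>.\<close>
      define g where "g x = (if x = p then - s / of_real d else f x)" for x
      have gS: "g x = f x" if "x \<in> S" for x using that insert.hyps by (auto simp: g_def)
      have "(\<Sum>y\<in>S. cnj (g y) * K p y) = (\<Sum>y\<in>S. cnj (f y * K y p))"
      proof (rule sum.cong[OF refl])
        fix y assume y: "y \<in> S"
        show "cnj (g y) * K p y = cnj (f y * K y p)"
          unfolding gS[OF y] herm[OF insertI2[OF y] insertI1] by simp
      qed
      then have s1: "(\<Sum>y\<in>S. cnj (g y) * K p y) = cnj s" by (simp add: s_def)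
      have s2: "(\<Sum>y\<in>S. g y * K y p) = s" unfolding s_def by (rule sum.cong) (use gS in auto)
      have s3: "qform S K g = qform S K f" unfolding qform_def by (intro sum.cong refl) (simp add: gS)
      have gp: "g p = - s / of_real d" by (simp add: g_def)
      have "qform (insert p S) K g = qform S K f - s * cnj s / of_real d"
        unfolding qform_insert[OF insert.hyps(1,2)] s1 s2 s3 gp Kpp using d by (simp add: field_simps)
      also have "\<dots> = qform S K' f"
      proof -
        have "qform S K' f = qform S K f - (\<Sum>x\<in>S. \<Sum>y\<in>S. (f x * K x p) * (cnj (f y * K y p) / of_real d))"
          unfolding qform_def K'_def by (simp add: sum_subtractf[symmetric] algebra_simps)
        also have "(\<Sum>x\<in>S. \<Sum>y\<in>S. (f x * K x p) * (cnj (f y * K y p) / of_real d))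
            = s * (\<Sum>y\<in>S. cnj (f y * K y p) / of_real d)"
          unfolding s_def by (simp only: sum_product)
        also have "(\<Sum>y\<in>S. cnj (f y * K y p) / of_real d) = cnj s / of_real d"
          unfolding s_def by (simp add: sum_divide_distrib)
        finally show ?thesis by simp
      qed
      finally show "0 \<le> Re (qform S K' f)" using pos[of g] by simp
    qed
    from insert.IH[OF this]
    obtain n and c :: "nat \<Rightarrow> 'x \<Rightarrow> complex" where c: "\<forall>x\<in>S. \<forall>y\<in>S. K' x y = (\<Sum>k<n. c k x * cnj (c k y))"
      by blast
    \<comment> \<open>The term with index \<open>n\<close> restores what the Schur complement
      subtracted: the column of \<open>p\<close> divided by the root of the pivot.\<close>
    define c' where "c' k x = (if k = n then K x p / of_real (sqrt d) else if x = p then 0 else c k x)" for k x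
    have sq: "complex_of_real (sqrt d) * complex_of_real (sqrt d) = of_real d"
      using d by (simp add: of_real_mult[symmetric] del: of_real_mult)
    have c'S: "c' k x = c k x" if "x \<in> S" "k < n" for k x using that insert.hyps by (auto simp: c'_def)
    have c'p: "c' k p = 0" if "k < n" for k using that by (simp add: c'_def)
    have last: "c' n x * cnj (c' n y) = K x p * cnj (K y p) / of_real d" for x y
      using sq by (simp add: c'_def)
    have "K x y = (\<Sum>k<Suc n. c' k x * cnj (c' k y))" if xy: "x \<in> insert p S" "y \<in> insert p S" for x y
    proof (cases "x = p \<or> y = p")
      case True
      then have "(\<Sum>k<n. c' k x * cnj (c' k y)) = 0" using c'p by (auto intro!: sum.neutral)
      then have "(\<Sum>k<Suc n. c' k x * cnj (c' k y)) = K x p * cnj (K y p) / of_real d"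
        using last[of x y] by simp
      also have "\<dots> = K x y"
        using True
      proof
        assume "y = p"
        then show ?thesis using Kpp d by simp
      next
        assume "x = p"
        then show ?thesis using Kpp d herm[OF xy(2) insertI1] by simp
      qed
      finally show ?thesis ..
    next
      case False
      then have S: "x \<in> S" "y \<in> S" using xy by auto
      have "(\<Sum>k<n. c' k x * cnj (c' k y)) = K' x y"
        using c S by (auto intro!: sum.cong simp: c'S)
      then show ?thesis using last[of x y] by (simp add: K'_def)
    qed
    then show ?thesis by blast
  qed
qed

text \<open>The Schur product theorem. Writing \<open>L\<close> as a sum of rank-one kernels turns
  the form of the product at \<open>f\<close> into the sum of the forms of \<open>K\<close> at
  \<open>f\<close> times each factor.\<close>

lemma psd_mult:
  fixes S :: "'x set"
  assumes fin: "finite S" and K: "psd S K" and L: "psd S L"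
  shows "psd S (\<lambda>x y. K x y * L x y)"
  unfolding psd_def
proof (intro conjI allI ballI)
  fix x y assume "x \<in> S" "y \<in> S"
  then show "K y x * L y x = cnj (K x y * L x y)"
    by (simp only: psd_herm[OF K, of x y] psd_herm[OF L, of x y] complex_cnj_mult)
next
  fix f
  obtain n and c :: "nat \<Rightarrow> 'x \<Rightarrow> complex" where c: "\<forall>x\<in>S. \<forall>y\<in>S. L x y = (\<Sum>k<n. c k x * cnj (c k y))"
    using psd_rank_one_sum[OF fin L] by blast
  have "qform S (\<lambda>x y. K x y * L x y) f
      = (\<Sum>x\<in>S. \<Sum>y\<in>S. \<Sum>k<n. (f x * c k x) * cnj (f y * c k y) * K x y)"
    unfolding qform_def
  proof (intro sum.cong refl)
    fix x y assume "x \<in> S" "y \<in> S"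
    then have L: "L x y = (\<Sum>k<n. c k x * cnj (c k y))" using c by blast
    have "f x * cnj (f y) * (K x y * L x y) = (f x * cnj (f y) * K x y) * L x y"
      by (simp only: mult.assoc)
    also have "\<dots> = (\<Sum>k<n. f x * c k x * cnj (f y * c k y) * K x y)"
      unfolding L sum_distrib_left
      by (intro sum.cong refl) (simp only: complex_cnj_mult mult_ac)
    finally show "f x * cnj (f y) * (K x y * L x y)
      = (\<Sum>k<n. f x * c k x * cnj (f y * c k y) * K x y)" .
  qed
  also have "\<dots> = (\<Sum>x\<in>S. \<Sum>k<n. \<Sum>y\<in>S. (f x * c k x) * cnj (f y * c k y) * K x y)"
    by (intro sum.cong refl sum.swap)
  also have "\<dots> = (\<Sum>k<n. \<Sum>x\<in>S. \<Sum>y\<in>S. (f x * c k x) * cnj (f y * c k y) * K x y)"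
    by (rule sum.swap)
  also have "\<dots> = (\<Sum>k<n. qform S K (\<lambda>x. f x * c k x))" by (simp add: qform_def)
  finally show "0 \<le> Re (qform S (\<lambda>x y. K x y * L x y) f)"
    using psd_nonneg[OF K] by (simp add: sum_nonneg)
qed

text \<open>Entries between different values of \<open>t\<close> vanish, so the form is the sum of
  the forms of the blocks.\<close>

lemma psd_blocks:
  assumes fin: "finite S" and herm: "\<And>x y. x \<in> S \<Longrightarrow> y \<in> S \<Longrightarrow> K y x = cnj (K x y)"
    and zero: "\<And>x y. x \<in> S \<Longrightarrow> y \<in> S \<Longrightarrow> t x \<noteq> t y \<Longrightarrow> K x y = 0"
    and blocks: "\<And>b. b \<in> t ` S \<Longrightarrow> psd {x \<in> S. t x = b} K"
  shows "psd S K"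
  unfolding psd_def
proof (intro conjI allI ballI herm)
  fix f
  have "qform S K f = (\<Sum>b\<in>t ` S. \<Sum>x\<in>{x \<in> S. t x = b}. \<Sum>y\<in>S. f x * cnj (f y) * K x y)"
    unfolding qform_def by (rule sum.image_gen[OF fin])
  also have "\<dots> = (\<Sum>b\<in>t ` S. qform {x \<in> S. t x = b} K f)"
    unfolding qform_def
  proof (rule sum.cong[OF refl], rule sum.cong[OF refl])
    fix b x assume x: "x \<in> {x \<in> S. t x = b}"
    show "(\<Sum>y\<in>S. f x * cnj (f y) * K x y) = (\<Sum>y\<in>{x \<in> S. t x = b}. f x * cnj (f y) * K x y)"
    proof (rule sum.mono_neutral_right[OF fin])
      show "\<forall>y\<in>S - {x \<in> S. t x = b}. f x * cnj (f y) * K x y = 0"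
      proof
        fix y assume y: "y \<in> S - {x \<in> S. t x = b}"
        have "K x y = 0" by (rule zero) (use y x in auto)
        then show "f x * cnj (f y) * K x y = 0" by simp
      qed
    qed auto
  qed
  finally show "0 \<le> Re (qform S K f)" using psd_nonneg[OF blocks] by (simp add: sum_nonneg)
qed

lemma psd_const_one: "psd S (\<lambda>x y. 1)"
proof -
  have "qform S (\<lambda>x y. 1) f = (\<Sum>x\<in>S. f x) * cnj (\<Sum>x\<in>S. f x)" for f
    by (simp add: qform_def sum_product)
  then have "qform S (\<lambda>x y. 1) f = of_real ((cmod (\<Sum>x\<in>S. f x))\<^sup>2)" for f
    by (simp only: mult_cnj_self of_real_power)
  then show ?thesis by (simp add: psd_def)
qed

lemma psd_cong: "psd S K \<Longrightarrow> (\<And>x y. x \<in> S \<Longrightarrow> y \<in> S \<Longrightarrow> K x y = L x y) \<Longrightarrow> psd S L"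
proof -
  assume K: "psd S K" and eq: "\<And>x y. x \<in> S \<Longrightarrow> y \<in> S \<Longrightarrow> K x y = L x y"
  have "qform S L f = qform S K f" for f
    unfolding qform_def by (intro sum.cong refl) (simp only: eq)
  moreover have "L y x = cnj (L x y)" if "x \<in> S" "y \<in> S" for x y
    using psd_herm[OF K that] eq[OF that] eq[OF that(2,1)] by simp
  ultimately show ?thesis using psd_nonneg[OF K] unfolding psd_def by metis
qed

lemma (in semi_ip) psd_gram:
  assumes fin: "finite S" and g: "\<And>x. x \<in> S \<Longrightarrow> g x \<in> carrier V"
  shows "psd S (\<lambda>x y. ip V (g x) (g y))"
  unfolding psd_def
proof (intro conjI allI ballI)
  fix f
  \<comment> \<open>\<open>z\<close> is the linear combination of the \<open>g x\<close> with
    coefficients \<open>f x\<close>, built by induction and characterised only by its inner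
    products; the form at \<open>f\<close> is then the inner product of \<open>z\<close> with
    itself.\<close>
  have "\<exists>z\<in>carrier V. \<forall>y\<in>carrier V. ip V z y = (\<Sum>x\<in>S. f x * ip V (g x) y)"
    using fin g
  proof (induction S)
    case empty
    then show ?case by (intro bexI[of _ \<zero>]) auto
  next
    case (insert p S)
    then obtain z where "z \<in> carrier V" "\<forall>y\<in>carrier V. ip V z y = (\<Sum>x\<in>S. f x * ip V (g x) y)" by auto
    then show ?case using insert.prems insert.hyps
      by (intro bexI[of _ "z \<oplus> f p \<odot> g p"]) (auto simp: ip_add_left ip_smult_left)
  qed
  then obtain z where z: "z \<in> carrier V" "\<And>y. y \<in> carrier V \<Longrightarrow> ip V z y = (\<Sum>x\<in>S. f x * ip V (g x) y)"
    by auto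
  have "qform S (\<lambda>x y. ip V (g x) (g y)) f = (\<Sum>y\<in>S. \<Sum>x\<in>S. f x * cnj (f y) * ip V (g x) (g y))"
    unfolding qform_def by (rule sum.swap)
  also have "\<dots> = (\<Sum>y\<in>S. cnj (f y) * ip V z (g y))"
  proof (rule sum.cong[OF refl])
    fix y assume "y \<in> S"
    show "(\<Sum>x\<in>S. f x * cnj (f y) * ip V (g x) (g y)) = cnj (f y) * ip V z (g y)"
      unfolding z(2)[OF g[OF \<open>y \<in> S\<close>]] sum_distrib_left
      by (intro sum.cong refl) (simp only: mult_ac)
  qed
  also have "\<dots> = cnj (\<Sum>y\<in>S. f y * ip V (g y) z)"
    unfolding cnj_sum complex_cnj_mult
    by (intro sum.cong refl) (simp only: ip_cnj[OF g z(1)])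
  also have "(\<Sum>y\<in>S. f y * ip V (g y) z) = ip V z z" using z by simp
  finally show "0 \<le> Re (qform S (\<lambda>x y. ip V (g x) (g y)) f)" using ip_pos[OF z(1)] by simp
qed (use g ip_cnj in blast)

section \<open>The free product Hilbert space\<close>

lemma free_prespace_simps [simp]:
  "carrier (free_prespace I A \<rho>) = {f. finite {w. f w \<noteq> 0} \<and> {w. f w \<noteq> 0} \<subseteq> free_words I A \<rho>}"
  "zero (free_prespace I A \<rho>) = (\<lambda>w. 0)"
  "add (free_prespace I A \<rho>) = (\<lambda>f g w. f w + g w)"
  "smult (free_prespace I A \<rho>) = (\<lambda>c f w. c * f w)"
  by (simp_all add: free_prespace_def)

declare free_prespace_simps [simp del]

locale free_family =
  fixes I :: "'i set" and A :: "'i \<Rightarrow> ('a, 'm) cstar_scheme" and \<rho> :: "'i \<Rightarrow> 'a \<Rightarrow> complex"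
  assumes family: "i \<in> I \<Longrightarrow> cstar_state (A i) (\<rho> i)"
begin

abbreviation "W \<equiv> free_words I A \<rho>"
abbreviation "V \<equiv> free_prespace I A \<rho>"
abbreviation "wip \<equiv> word_ip A \<rho>"

lemma alg: "i \<in> I \<Longrightarrow> unital_cstar_algebra (A i)"
  using family cstar_state.axioms(1) by blast

lemma Nil_word [simp]: "[] \<in> W"
  by (simp add: free_words_def)

lemma Cons_word: "(i, a) # w \<in> W \<longleftrightarrow> i \<in> I \<and> a \<in> carrier (A i) \<and> \<rho> i a = 0 \<and> w \<in> W
    \<and> (w = [] \<or> fst (hd w) \<noteq> i)"
  by (cases w) (auto simp: free_words_def)

definition headed :: "'i \<Rightarrow> ('i \<times> 'a) list \<Rightarrow> bool" where
  "headed i w \<longleftrightarrow> w \<noteq> [] \<and> fst (hd w) = i"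

lemma Cons_wordI: "i \<in> I \<Longrightarrow> a \<in> carrier (A i) \<Longrightarrow> \<rho> i a = 0 \<Longrightarrow> w \<in> W \<Longrightarrow> \<not> headed i w \<Longrightarrow> (i, a) # w \<in> W"
  by (auto simp: Cons_word headed_def)

lemma wip_headed: "\<not> headed i w \<Longrightarrow> wip ((i, a) # v) w = 0" "\<not> headed i w \<Longrightarrow> wip w ((i, a) # v) = 0"
  by (cases w; auto simp: headed_def)+

lemma wip_hermitian: "v \<in> W \<Longrightarrow> w \<in> W \<Longrightarrow> wip w v = cnj (wip v w)"
proof (induction v arbitrary: w)
  case Nil
  then show ?case by (cases w) auto
next
  case (Cons p v)
  obtain i a where p: "p = (i, a)" by (cases p)
  show ?case
  proof (cases w)
    case (Cons q w')
    obtain j b where q: "q = (j, b)" by (cases q)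
    show ?thesis
    proof (cases "i = j")
      case True
      have w: "i \<in> I" "a \<in> carrier (A i)" "b \<in> carrier (A i)" "v \<in> W" "w' \<in> W"
        using Cons.prems p q Cons True by (auto simp: Cons_word)
      interpret S: cstar_state "A i" "\<rho> i" by (rule family[OF w(1)])
      show ?thesis using Cons.IH[OF w(4,5)] S.rho_hermitian[OF w(2,3)] True Cons p q by simp
    qed (use Cons p q in auto)
  qed (use p in auto)
qed

text \<open>Induction on word length. Words are sorted by the index of their first letter; within
  one class the kernel is the GNS Gram kernel of the first letters times the word kernel of the
  tails, so \<open>psd_mult\<close> applies. An arbitrary map \<open>g\<close> into words is allowed
  because different words may have the same tail.\<close>

lemma psd_wip: "finite S \<Longrightarrow> g ` S \<subseteq> W \<Longrightarrow> (\<And>x. x \<in> S \<Longrightarrow> length (g x) \<le> n) \<Longrightarrow>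
    psd S (\<lambda>x y. wip (g x) (g y))" for g :: "'x \<Rightarrow> ('i \<times> 'a) list"
proof (induction n arbitrary: S g)
  case 0
  then have "wip (g x) (g y) = 1" if "x \<in> S" "y \<in> S" for x y using that by auto
  then show ?case by (intro psd_cong[OF psd_const_one]) auto
next
  case (Suc n)
  \<comment> \<open>\<open>None\<close> collects the empty word, whose block is the constant kernel
    1.\<close>
  define t where "t x = (case g x of [] \<Rightarrow> None | p # w \<Rightarrow> Some (fst p))" for x
  have gW: "g x \<in> W" if "x \<in> S" for x using Suc.prems that by auto
  show ?case
  proof (rule psd_blocks[where t = t, OF Suc.prems(1)])
    fix x y assume xy: "x \<in> S" "y \<in> S"
    then show "wip (g y) (g x) = cnj (wip (g x) (g y))" by (intro wip_hermitian gW)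
    show "wip (g x) (g y) = 0" if "t x \<noteq> t y"
      using that by (cases "g x"; cases "g y") (auto simp: t_def)
  next
    fix b assume "b \<in> t ` S"
    let ?B = "{x \<in> S. t x = b}"
    have fin: "finite ?B" using Suc.prems(1) by simp
    show "psd ?B (\<lambda>x y. wip (g x) (g y))"
    proof (cases b)
      case None
      then have "\<And>x. x \<in> ?B \<Longrightarrow> g x = []" by (auto simp: t_def split: list.splits)
      then show ?thesis by (intro psd_cong[OF psd_const_one]) auto
    next
      case (Some i)
      have dec: "g x = (i, snd (hd (g x))) # tl (g x)" if "x \<in> ?B" for x
        using that Some by (auto simp: t_def split: list.splits)
      have mem: "i \<in> I \<and> snd (hd (g x)) \<in> carrier (A i) \<and> tl (g x) \<in> W \<and> length (tl (g x)) \<le> n"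
        if "x \<in> ?B" for x
        using gW[of x] dec[OF that] that Suc.prems(3)[of x] Cons_word by (metis (lifting) length_tl mem_Collect_eq diff_le_mono diff_Suc_1)
      have psdB: "psd ?B (\<lambda>x y. \<rho> i (star (A i) (snd (hd (g y))) \<otimes>\<^bsub>A i\<^esub> snd (hd (g x))) * wip (tl (g x)) (tl (g y)))"
      proof (cases "?B = {}")
        case True
        show ?thesis unfolding True by (simp add: psd_def qform_def)
      next
        case False
        then have "i \<in> I" using mem by blast
        then interpret S: cstar_state "A i" "\<rho> i" by (rule family)
        show ?thesis
        proof (rule psd_mult[OF fin])
          show "psd ?B (\<lambda>x y. \<rho> i (star (A i) (snd (hd (g y))) \<otimes>\<^bsub>A i\<^esub> snd (hd (g x))))"
            using S.G.psd_gram[OF fin, of "\<lambda>x. snd (hd (g x))"] mem by simp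
          show "psd ?B (\<lambda>x y. wip (tl (g x)) (tl (g y)))"
            by (rule Suc.IH[OF fin]) (use mem in auto)
        qed
      qed
      have eqw: "wip (g x) (g y)
          = \<rho> i (star (A i) (snd (hd (g y))) \<otimes>\<^bsub>A i\<^esub> snd (hd (g x))) * wip (tl (g x)) (tl (g y))"
        if "x \<in> ?B" "y \<in> ?B" for x y
      proof -
        have "wip (g x) (g y)
            = wip ((i, snd (hd (g x))) # tl (g x)) ((i, snd (hd (g y))) # tl (g y))"
          by (rule arg_cong2[OF dec[OF that(1)] dec[OF that(2)]])
        then show ?thesis by (simp only: word_ip.simps if_True simp_thms)
      qed
      show ?thesis by (rule psd_cong[OF psdB]) (simp only: eqw)
    qed
  qed
qed

lemma fin_supp: "f \<in> carrier V \<Longrightarrow> finite {w. f w \<noteq> 0}" "f \<in> carrier V \<Longrightarrow> f w \<noteq> 0 \<Longrightarrow> w \<in> W"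
  by (auto simp: free_prespace_simps)

text \<open>Each inner product sums over its own supports; enlarging them to one common finite set
  makes additivity a termwise statement.\<close>

lemma ip_superset:
  assumes "finite U" "{w. f w \<noteq> 0} \<subseteq> U" "{w. g w \<noteq> 0} \<subseteq> U"
  shows "ip V f g = (\<Sum>v\<in>U. \<Sum>w\<in>U. f v * cnj (g w) * wip v w)"
proof -
  have "ip V f g = (\<Sum>v\<in>{w. f w \<noteq> 0}. \<Sum>w\<in>{w. g w \<noteq> 0}. f v * cnj (g w) * wip v w)"
    by (simp add: free_prespace_def)
  also have "\<dots> = (\<Sum>v\<in>{w. f w \<noteq> 0}. \<Sum>w\<in>U. f v * cnj (g w) * wip v w)"
    using assms by (intro sum.cong refl sum.mono_neutral_left) auto
  also have "\<dots> = (\<Sum>v\<in>U. \<Sum>w\<in>U. f v * cnj (g w) * wip v w)"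
    using assms by (intro sum.mono_neutral_left) auto
  finally show ?thesis .
qed

lemma free_module: "Module.module complex_ring V"
proof (rule complex_moduleI)
  have sub: "{w. f w + g w \<noteq> 0} \<subseteq> {w. f w \<noteq> 0} \<union> {w. g w \<noteq> 0}" for f g :: "('i \<times> 'a) list \<Rightarrow> complex"
    by auto
  show "abelian_group V"
  proof (rule abelian_groupI)
    fix f g assume "f \<in> carrier V" "g \<in> carrier V"
    then show "f \<oplus>\<^bsub>V\<^esub> g \<in> carrier V"
      using finite_subset[OF sub, of f g] sub[of f g] by (auto simp: free_prespace_simps)
  next
    fix f assume "f \<in> carrier V"
    then show "\<exists>g\<in>carrier V. g \<oplus>\<^bsub>V\<^esub> f = \<zero>\<^bsub>V\<^esub>" by (intro bexI[of _ "\<lambda>w. - f w"]) (auto simp: free_prespace_simps)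
  qed (auto simp: free_prespace_simps algebra_simps)
qed (auto simp: free_prespace_simps algebra_simps elim: finite_subset[rotated])

sublocale cvec V using free_module by (simp add: cvec_def)

lemma free_semi_ip: "semi_ip V"
proof (intro semi_ip.intro semi_ip_axioms.intro cvec_axioms)
  fix f g h assume *: "f \<in> carrier V" "g \<in> carrier V" "h \<in> carrier V"
  define U where "U = {w. f w \<noteq> 0} \<union> {w. g w \<noteq> 0} \<union> {w. h w \<noteq> 0}"
  have U: "finite U" "{w. f w \<noteq> 0} \<subseteq> U" "{w. g w \<noteq> 0} \<subseteq> U" "{w. h w \<noteq> 0} \<subseteq> U"
    "{w. (f \<oplus>\<^bsub>V\<^esub> g) w \<noteq> 0} \<subseteq> U"
    using fin_supp(1)[OF *(1)] fin_supp(1)[OF *(2)] fin_supp(1)[OF *(3)]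
    by (auto simp: U_def free_prespace_simps)
  show "ip V (f \<oplus>\<^bsub>V\<^esub> g) h = ip V f h + ip V g h"
    unfolding ip_superset[OF U(1,5,4)] ip_superset[OF U(1,2,4)] ip_superset[OF U(1,3,4)]
    unfolding sum.distrib[symmetric] by (simp only: free_prespace_simps distrib_right)
next
  fix f g c assume *: "f \<in> carrier V" "g \<in> carrier V"
  define U where "U = {w. f w \<noteq> 0} \<union> {w. g w \<noteq> 0}"
  have U: "finite U" "{w. f w \<noteq> 0} \<subseteq> U" "{w. g w \<noteq> 0} \<subseteq> U"  "{w. (c \<odot>\<^bsub>V\<^esub> f) w \<noteq> 0} \<subseteq> U"
    using fin_supp(1)[OF *(1)] fin_supp(1)[OF *(2)] by (auto simp: U_def free_prespace_simps)
  have UW: "w \<in> W" if "w \<in> U" for w using that fin_supp(2)[OF *(1)] fin_supp(2)[OF *(2)] by (auto simp: U_def)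
  show "ip V (c \<odot>\<^bsub>V\<^esub> f) g = c * ip V f g"
    unfolding ip_superset[OF U(1,4,3)] ip_superset[OF U(1,2,3)]
    unfolding sum_distrib_left by (simp only: free_prespace_simps mult.assoc)
  have "ip V g f = (\<Sum>w\<in>U. \<Sum>v\<in>U. g v * cnj (f w) * wip v w)"
    unfolding ip_superset[OF U(1,3,2)] by (rule sum.swap)
  also have "\<dots> = (\<Sum>v\<in>U. \<Sum>w\<in>U. cnj (f v * cnj (g w) * wip v w))"
  proof (intro sum.cong refl)
    fix x y assume x: "x \<in> U" and y: "y \<in> U"
    show "g y * cnj (f x) * wip y x = cnj (f x * cnj (g y) * wip x y)"
      unfolding wip_hermitian[OF UW[OF x] UW[OF y]] by (simp add: mult_ac)
  qed
  finally show "ip V g f = cnj (ip V f g)"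
    unfolding ip_superset[OF U(1,2,3)] by simp
next
  fix f assume *: "f \<in> carrier V"
  let ?U = "{w. f w \<noteq> 0}"
  have U: "finite ?U" using fin_supp(1)[OF *] .
  have "psd ?U (\<lambda>v w. wip (id v) (id w))"
  proof (rule psd_wip[OF U])
    show "id ` ?U \<subseteq> W" using fin_supp(2)[OF *] by auto
    show "length (id w) \<le> Max (length ` ?U)" if "w \<in> ?U" for w
      using U that by (auto intro: Max_ge)
  qed
  then show "0 \<le> Re (ip V f f)"
    unfolding ip_superset[OF U subset_refl subset_refl] using psd_nonneg[of ?U _ f] by (simp add: qform_def)
qed

sublocale semi_ip V by (rule free_semi_ip)

lemma word_vec_carrier [simp]: "w \<in> W \<Longrightarrow> word_vec w \<in> carrier V"
  by (auto simp: word_vec_def free_prespace_simps)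

lemma ip_word_vec: "v \<in> W \<Longrightarrow> w \<in> W \<Longrightarrow> ip V (word_vec v) (word_vec w) = wip v w"
  using ip_superset[of "{v, w}" "word_vec v" "word_vec w"]
  by (cases "v = w") (auto simp: word_vec_def)

lemma free_induct [consumes 1, case_names zero step]:
  assumes f: "f \<in> carrier V" and zero: "P \<zero>\<^bsub>V\<^esub>"
    and step: "\<And>f c w. f \<in> carrier V \<Longrightarrow> P f \<Longrightarrow> w \<in> W \<Longrightarrow> P (f \<oplus>\<^bsub>V\<^esub> c \<odot>\<^bsub>V\<^esub> word_vec w)"
  shows "P f"
proof -
  have "P f" if "finite U" "{w. f w \<noteq> 0} \<subseteq> U" "U \<subseteq> W" for U f
    using that
  proof (induction U arbitrary: f)
    case empty
    then have "f = \<zero>\<^bsub>V\<^esub>" by (auto simp: free_prespace_simps)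
    then show ?case using zero by simp
  next
    case (insert w U)
    define g where "g = f(w := 0)"
    have g: "{w. g w \<noteq> 0} \<subseteq> U" using insert.prems by (auto simp: g_def)
    then have "P g" using insert by auto
    moreover have "g \<in> carrier V" using g insert by (auto simp: free_prespace_simps intro: finite_subset)
    moreover have "f = g \<oplus>\<^bsub>V\<^esub> f w \<odot>\<^bsub>V\<^esub> word_vec w"
      by (auto simp: g_def word_vec_def free_prespace_simps)
    ultimately show ?case using step[of g w "f w"] insert.prems by auto
  qed
  then show ?thesis using f by (auto simp: free_prespace_simps)
qed

definition sesq :: "((('i \<times> 'a) list \<Rightarrow> complex) \<Rightarrow> (('i \<times> 'a) list \<Rightarrow> complex) \<Rightarrow> complex) \<Rightarrow> bool" where
  "sesq F \<longleftrightarrow> (\<forall>f\<in>carrier V. \<forall>g\<in>carrier V. \<forall>h\<in>carrier V. \<forall>c.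
     F (f \<oplus>\<^bsub>V\<^esub> c \<odot>\<^bsub>V\<^esub> g) h = F f h + c * F g h \<and> F h (f \<oplus>\<^bsub>V\<^esub> c \<odot>\<^bsub>V\<^esub> g) = F h f + cnj c * F h g)"

lemma sesq_zero:
  assumes "sesq F" "f \<in> carrier V"
  shows "F \<zero>\<^bsub>V\<^esub> f = 0" "F f \<zero>\<^bsub>V\<^esub> = 0"
proof -
  have z: "\<zero>\<^bsub>V\<^esub> \<in> carrier V" by (rule M.zero_closed)
  have "\<zero>\<^bsub>V\<^esub> \<oplus>\<^bsub>V\<^esub> 1 \<odot>\<^bsub>V\<^esub> \<zero>\<^bsub>V\<^esub> = \<zero>\<^bsub>V\<^esub>" by simp
  then show "F \<zero>\<^bsub>V\<^esub> f = 0" "F f \<zero>\<^bsub>V\<^esub> = 0"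
    using assms(1)[unfolded sesq_def, rule_format, OF z z assms(2), of 1] by auto
qed

text \<open>Identities between sesquilinear expressions only have to be checked on pairs of words;
  \<open>free_induct\<close> is used once in each argument.\<close>

lemma sesq_eq:
  assumes F: "sesq F" and G: "sesq G" and eq: "\<And>v w. v \<in> W \<Longrightarrow> w \<in> W \<Longrightarrow> F (word_vec v) (word_vec w) = G (word_vec v) (word_vec w)"
    and f: "f \<in> carrier V" and g: "g \<in> carrier V"
  shows "F f g = G f g"
proof -
  have word: "F (word_vec v) g = G (word_vec v) g" if v: "v \<in> W" for v
    using g
  proof (induction rule: free_induct)
    case zero
    then show ?case
      by (simp only: sesq_zero[OF F word_vec_carrier[OF v]] sesq_zero[OF G word_vec_carrier[OF v]])
  next
    case (step f c w)
    then show ?case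
      using F[unfolded sesq_def, rule_format, OF step.hyps(1) word_vec_carrier[OF step.hyps(2)] word_vec_carrier[OF v], of c]
        G[unfolded sesq_def, rule_format, OF step.hyps(1) word_vec_carrier[OF step.hyps(2)] word_vec_carrier[OF v], of c]
        eq[OF v step.hyps(2)] step.IH by (simp only:)
  qed
  show ?thesis
    using f
  proof (induction rule: free_induct)
    case zero
    then show ?case by (simp only: sesq_zero[OF F g] sesq_zero[OF G g])
  next
    case (step f c w)
    then show ?case
      using F[unfolded sesq_def, rule_format, OF step.hyps(1) word_vec_carrier[OF step.hyps(2)] g, of c]
        G[unfolded sesq_def, rule_format, OF step.hyps(1) word_vec_carrier[OF step.hyps(2)] g, of c]
        word[OF step.hyps(2)] step.IH by (simp only:)
  qed
qed

section \<open>The action of a single factor on words\<close>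

lemma free_act_superset:
  assumes "finite U" "{w. f w \<noteq> 0} \<subseteq> U"
  shows "free_act A \<rho> i a f u = (\<Sum>w\<in>U. f w * free_act_word A \<rho> i a w u)"
  unfolding free_act_def using assms by (intro sum.mono_neutral_left) auto

lemma free_act_linear:
  assumes "f \<in> carrier V" "g \<in> carrier V"
  shows "free_act A \<rho> i a (f \<oplus>\<^bsub>V\<^esub> g) = free_act A \<rho> i a f \<oplus>\<^bsub>V\<^esub> free_act A \<rho> i a g"
    and "free_act A \<rho> i a (c \<odot>\<^bsub>V\<^esub> f) = c \<odot>\<^bsub>V\<^esub> free_act A \<rho> i a f"
proof -
  define U where "U = {w. f w \<noteq> 0} \<union> {w. g w \<noteq> 0}"
  have U: "finite U" "{w. f w \<noteq> 0} \<subseteq> U" "{w. g w \<noteq> 0} \<subseteq> U" "{w. (f \<oplus>\<^bsub>V\<^esub> g) w \<noteq> 0} \<subseteq> U"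
    "{w. (c \<odot>\<^bsub>V\<^esub> f) w \<noteq> 0} \<subseteq> U"
    using fin_supp(1)[OF assms(1)] fin_supp(1)[OF assms(2)] by (auto simp: U_def free_prespace_simps)
  show "free_act A \<rho> i a (f \<oplus>\<^bsub>V\<^esub> g) = free_act A \<rho> i a f \<oplus>\<^bsub>V\<^esub> free_act A \<rho> i a g"
  proof (rule ext)
    fix u
    show "free_act A \<rho> i a (f \<oplus>\<^bsub>V\<^esub> g) u = (free_act A \<rho> i a f \<oplus>\<^bsub>V\<^esub> free_act A \<rho> i a g) u"
      unfolding free_act_superset[OF U(1,4)] unfolding free_prespace_simps
        free_act_superset[OF U(1,2)] free_act_superset[OF U(1,3)] sum.distrib[symmetric] distrib_right ..
  qed
  show "free_act A \<rho> i a (c \<odot>\<^bsub>V\<^esub> f) = c \<odot>\<^bsub>V\<^esub> free_act A \<rho> i a f"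
  proof (rule ext)
    fix u
    show "free_act A \<rho> i a (c \<odot>\<^bsub>V\<^esub> f) u = (c \<odot>\<^bsub>V\<^esub> free_act A \<rho> i a f) u"
      unfolding free_act_superset[OF U(1,5)] unfolding free_prespace_simps
        free_act_superset[OF U(1,2)] sum_distrib_left mult.assoc ..
  qed
qed

lemma free_act_word_vec: "free_act A \<rho> i a (word_vec w) = free_act_word A \<rho> i a w"
  by (rule ext) (subst free_act_superset[of "{w}"]; auto simp: word_vec_def)

text \<open>The vector \<open>b \<otimes> v\<close> of \<open>H\<^sub>i \<otimes> H(i)\<close>.\<close>

definition tens :: "'i \<Rightarrow> 'a \<Rightarrow> ('i \<times> 'a) list \<Rightarrow> ('i \<times> 'a) list \<Rightarrow> complex" where
  "tens i b v = (\<lambda>u. word_vec ((i, b \<ominus>\<^bsub>A i\<^esub> (\<rho> i b \<odot>\<^bsub>A i\<^esub> \<one>\<^bsub>A i\<^esub>)) # v) u + \<rho> i b * word_vec v u)"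

lemma free_act_word_tens:
  "free_act_word A \<rho> i a w = tens i (a \<otimes>\<^bsub>A i\<^esub> fst (split_word A i w)) (snd (split_word A i w))"
  by (simp add: free_act_word_def tens_def Let_def split_beta)

lemma split_word_props:
  assumes "w \<in> W" "i \<in> I"
  shows "fst (split_word A i w) \<in> carrier (A i)" "snd (split_word A i w) \<in> W"
    "\<not> headed i (snd (split_word A i w))"
proof -
  interpret S: cstar_state "A i" "\<rho> i" by (rule family) fact
  have "fst (split_word A i w) \<in> carrier (A i) \<and> snd (split_word A i w) \<in> W
      \<and> \<not> headed i (snd (split_word A i w))"
  proof (cases w)
    case (Cons p v)
    obtain j b where "p = (j, b)" by (cases p)
    then show ?thesis using Cons assms by (auto simp: Cons_word headed_def)
  qed (simp add: headed_def)
  then show "fst (split_word A i w) \<in> carrier (A i)" "snd (split_word A i w) \<in> W"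
    "\<not> headed i (snd (split_word A i w))" by auto
qed

context
  fixes i assumes i: "i \<in> I"
begin

interpretation S: cstar_state "A i" "\<rho> i" by (rule family[OF i])

lemma centre:
  assumes "b \<in> carrier (A i)"
  shows "b \<ominus>\<^bsub>A i\<^esub> (\<rho> i b \<odot>\<^bsub>A i\<^esub> \<one>\<^bsub>A i\<^esub>) \<in> carrier (A i)"
    "\<rho> i (b \<ominus>\<^bsub>A i\<^esub> (\<rho> i b \<odot>\<^bsub>A i\<^esub> \<one>\<^bsub>A i\<^esub>)) = 0"
proof -
  show "b \<ominus>\<^bsub>A i\<^esub> (\<rho> i b \<odot>\<^bsub>A i\<^esub> \<one>\<^bsub>A i\<^esub>) \<in> carrier (A i)" using assms by simp
  show "\<rho> i (b \<ominus>\<^bsub>A i\<^esub> (\<rho> i b \<odot>\<^bsub>A i\<^esub> \<one>\<^bsub>A i\<^esub>)) = 0"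
    using assms by (simp add: a_minus_def S.sm_minus_one S.rho_add S.rho_smult)
qed

lemma tens_eq:
  "tens i b v = word_vec ((i, b \<ominus>\<^bsub>A i\<^esub> (\<rho> i b \<odot>\<^bsub>A i\<^esub> \<one>\<^bsub>A i\<^esub>)) # v) \<oplus>\<^bsub>V\<^esub> \<rho> i b \<odot>\<^bsub>V\<^esub> word_vec v"
  by (simp add: tens_def free_prespace_simps)

lemma tens_words:
  assumes "b \<in> carrier (A i)" "v \<in> W" "\<not> headed i v"
  shows "(i, b \<ominus>\<^bsub>A i\<^esub> (\<rho> i b \<odot>\<^bsub>A i\<^esub> \<one>\<^bsub>A i\<^esub>)) # v \<in> W"
  using assms centre[OF assms(1)] i by (intro Cons_wordI)

lemma tens_carrier:
  assumes "b \<in> carrier (A i)" "v \<in> W" "\<not> headed i v"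
  shows "tens i b v \<in> carrier V"
  unfolding tens_eq using word_vec_carrier[OF tens_words[OF assms]] word_vec_carrier[OF assms(2)]
  by (intro M.a_closed sm_closed)

lemma tens_centred:
  assumes "b \<in> carrier (A i)" "\<rho> i b = 0"
  shows "tens i b v = word_vec ((i, b) # v)"
  using assms by (simp add: tens_def a_minus_def S.sm_minus_one S.mult_one_right)

text \<open>The centred parts contribute the covariance, that is the right-hand state value minus
  \<open>\<rho> i b * cnj (\<rho> i c)\<close>, and the scalar parts restore that product. Mixed
  terms vanish, since words headed by \<open>i\<close> are orthogonal to those that are not. Thus
  \<open>tens\<close> is isometric on \<open>H\<^sub>i \<otimes> H(i)\<close> in the notation
  \<open>H(i)\<close> of the construction, up to null vectors.\<close>

lemma ip_tens:
  assumes b: "b \<in> carrier (A i)" "v \<in> W" "\<not> headed i v"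
    and c: "c \<in> carrier (A i)" "w \<in> W" "\<not> headed i w"
  shows "ip V (tens i b v) (tens i c w) = \<rho> i (star (A i) c \<otimes>\<^bsub>A i\<^esub> b) * wip v w"
proof -
  let ?b = "b \<ominus>\<^bsub>A i\<^esub> (\<rho> i b \<odot>\<^bsub>A i\<^esub> \<one>\<^bsub>A i\<^esub>)" and ?c = "c \<ominus>\<^bsub>A i\<^esub> (\<rho> i c \<odot>\<^bsub>A i\<^esub> \<one>\<^bsub>A i\<^esub>)"
  note bw = tens_words[OF b] and cw = tens_words[OF c]
  have sc: "star (A i) ?c = star (A i) c \<ominus>\<^bsub>A i\<^esub> (cnj (\<rho> i c) \<odot>\<^bsub>A i\<^esub> \<one>\<^bsub>A i\<^esub>)"
    using c by (simp add: S.star_diff S.star_smult)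
  have "\<rho> i (star (A i) ?c \<otimes>\<^bsub>A i\<^esub> ?b) = \<rho> i (star (A i) c \<otimes>\<^bsub>A i\<^esub> b) - \<rho> i b * cnj (\<rho> i c)"
    unfolding sc using b c S.star_closed[OF c(1)]
    by (simp add: a_minus_def S.sm_minus_one S.sm_assoc S.distrib_l S.distrib_r S.smult_mult_left
      S.smult_mult_right S.rho_add S.rho_smult S.rho_star)
  then show ?thesis
    unfolding tens_eq
    using word_vec_carrier[OF bw] word_vec_carrier[OF cw] word_vec_carrier[OF b(2)] word_vec_carrier[OF c(2)]
    by (simp only: ip_add_left ip_add_right ip_smult_left ip_smult_right M.a_closed sm_closed
      ip_word_vec bw cw b(2) c(2) wip_headed[OF b(3)] wip_headed[OF c(3)] word_ip.simps)
      (simp add: algebra_simps)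
qed

text \<open>A word with leading \<open>i\<close>-letter is recovered exactly. Otherwise
  \<open>split_word\<close> inserts the unit, whose centred part is zero; the resulting word with a
  zero letter is a null vector that inner products do not see.\<close>

lemma ip_tens_split:
  assumes v: "v \<in> W" and w: "w \<in> W"
  shows "ip V (tens i (fst (split_word A i v)) (snd (split_word A i v))) (word_vec w)
    = ip V (word_vec v) (word_vec w)"
proof (cases "headed i v")
  case True
  then obtain b v' where v': "v = (i, b) # v'" by (cases v) (auto simp: headed_def)
  have "b \<in> carrier (A i)" "\<rho> i b = 0" using v v' by (auto simp: Cons_word)
  then have "tens i b v' = word_vec v" unfolding v' by (rule tens_centred)
  then show ?thesis unfolding v' by simp
next
  case False
  then have split: "split_word A i v = (\<one>\<^bsub>A i\<^esub>, v)" by (cases v) (auto simp: headed_def)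
  have one: "\<one>\<^bsub>A i\<^esub> \<ominus>\<^bsub>A i\<^esub> (\<rho> i \<one>\<^bsub>A i\<^esub> \<odot>\<^bsub>A i\<^esub> \<one>\<^bsub>A i\<^esub>) = \<zero>\<^bsub>A i\<^esub>" by simp
  have "wip ((i, \<zero>\<^bsub>A i\<^esub>) # v) w = 0"
  proof (cases "headed i w")
    case True
    then obtain c w' where w': "w = (i, c) # w'" by (cases w) (auto simp: headed_def)
    have "\<rho> i (star (A i) c \<otimes>\<^bsub>A i\<^esub> \<zero>\<^bsub>A i\<^esub>) = 0"
      using S.G.ip_zero_left[of c] w w' by (simp add: Cons_word)
    then show ?thesis using w' by simp
  qed (simp add: wip_headed)
  then show ?thesis
    using tens_words[OF _ v False, of "\<one>\<^bsub>A i\<^esub>"] word_vec_carrier[OF v] word_vec_carrier[OF w]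
      word_vec_carrier[OF tens_words[OF _ v False, of "\<one>\<^bsub>A i\<^esub>"]]
    unfolding split fst_conv snd_conv tens_eq one
    by (simp only: ip_add_left sm_closed ip_smult_left ip_word_vec v w S.one_closed S.rho_one)
      simp
qed

lemma free_act_closed:
  assumes a: "a \<in> carrier (A i)" and f: "f \<in> carrier V"
  shows "free_act A \<rho> i a f \<in> carrier V"
  using f
proof (induction rule: free_induct)
  case zero
  have "free_act A \<rho> i a \<zero>\<^bsub>V\<^esub> = \<zero>\<^bsub>V\<^esub>" by (rule ext) (simp add: free_act_def free_prespace_simps)
  then show ?case by simp
next
  case (step f c w)
  have "free_act A \<rho> i a (word_vec w) \<in> carrier V"
    unfolding free_act_word_vec free_act_word_tens
    using split_word_props[OF step.hyps(2) i] a by (intro tens_carrier) auto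
  moreover have "free_act A \<rho> i a (f \<oplus>\<^bsub>V\<^esub> c \<odot>\<^bsub>V\<^esub> word_vec w)
      = free_act A \<rho> i a f \<oplus>\<^bsub>V\<^esub> c \<odot>\<^bsub>V\<^esub> free_act A \<rho> i a (word_vec w)"
    using free_act_linear(1)[OF step.hyps(1) sm_closed[OF word_vec_carrier[OF step.hyps(2)]]]
      free_act_linear(2)[OF word_vec_carrier[OF step.hyps(2)] step.hyps(1)] by (simp only:)
  ultimately show ?case using step.IH by (simp only: M.a_closed sm_closed)
qed

lemma sesq_act:
  assumes "a \<in> carrier (A i)" "b \<in> carrier (A i)"
  shows "sesq (\<lambda>f g. ip V (free_act A \<rho> i a f) g)"
    "sesq (\<lambda>f g. ip V (free_act A \<rho> i a f) (free_act A \<rho> i b g))"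
    "sesq (\<lambda>f g. ip V f g)"
  unfolding sesq_def
  by (intro ballI allI conjI; simp only: free_act_linear free_act_closed assms sm_closed M.a_closed
      ip_add_left ip_add_right ip_smult_left ip_smult_right)+

lemma sesq_comb: "sesq F \<Longrightarrow> sesq G \<Longrightarrow> sesq (\<lambda>f g. F f g + G f g)"
  "sesq F \<Longrightarrow> sesq (\<lambda>f g. c * F f g)"
  unfolding sesq_def by (auto simp: algebra_simps)

text \<open>Both arguments are brought to the form \<open>tens\<close>, after which
  \<open>ip_tens\<close> separates the algebra of factor \<open>i\<close> from the remaining
  word.\<close>

lemma ip_act_word:
  assumes a: "a \<in> carrier (A i)" and v: "v \<in> W" and w: "w \<in> W"
  shows "ip V (free_act A \<rho> i a (word_vec v)) (word_vec w)
    = \<rho> i (star (A i) (fst (split_word A i w)) \<otimes>\<^bsub>A i\<^esub> (a \<otimes>\<^bsub>A i\<^esub> fst (split_word A i v)))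
      * wip (snd (split_word A i v)) (snd (split_word A i w))"
proof -
  note sv = split_word_props[OF v i] and sw = split_word_props[OF w i]
  let ?x = "tens i (a \<otimes>\<^bsub>A i\<^esub> fst (split_word A i v)) (snd (split_word A i v))"
  let ?y = "tens i (fst (split_word A i w)) (snd (split_word A i w))"
  have ab: "a \<otimes>\<^bsub>A i\<^esub> fst (split_word A i v) \<in> carrier (A i)" using a sv by simp
  have x: "?x \<in> carrier V" by (rule tens_carrier[OF ab sv(2,3)])
  have y: "?y \<in> carrier V" by (rule tens_carrier[OF sw])
  have wv: "word_vec w \<in> carrier V" by (rule word_vec_carrier[OF w])
  \<comment> \<open>The vector \<open>?y\<close> differs from the word \<open>w\<close> only by a
    null vector, so it may replace \<open>w\<close> in any inner product.\<close>
  have null: "ip V g ?y = ip V g (word_vec w)" if "g \<in> carrier V" for g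
    using that
  proof (induction rule: free_induct)
    case zero
    then show ?case using y wv by (simp only: ip_zero_left)
  next
    case (step f c u)
    have "ip V (word_vec u) ?y = ip V (word_vec u) (word_vec w)"
      using ip_tens_split[OF w step.hyps(2)] ip_cnj[OF y word_vec_carrier[OF step.hyps(2)]]
        ip_cnj[OF wv word_vec_carrier[OF step.hyps(2)]] by simp
    then show ?case
      using step.IH step.hyps y wv word_vec_carrier[OF step.hyps(2)] by (simp only: ip_add_left ip_smult_left sm_closed)
  qed
  have "ip V (free_act A \<rho> i a (word_vec v)) (word_vec w) = ip V ?x ?y"
    unfolding null[OF x] by (simp only: free_act_word_vec free_act_word_tens)
  then show ?thesis unfolding ip_tens[OF ab sv(2,3) sw] .
qed

text \<open>By \<open>sesq_eq\<close> each relation reduces to words, and there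
  \<open>ip_act_word\<close> turns it into an identity inside \<open>A i\<close> under its
  state.\<close>

theorem free_act_pre_rep: "pre_rep (A i) V (free_act A \<rho> i)"
proof (intro pre_rep.intro pre_rep_axioms.intro alg[OF i] semi_ip_axioms free_act_closed)
  fix a b f g and c :: complex
  assume a: "a \<in> carrier (A i)" and b: "b \<in> carrier (A i)" and f: "f \<in> carrier V" and g: "g \<in> carrier V"
  note sq = sesq_act[OF a b] sesq_act[OF b a]
  show "ip V (free_act A \<rho> i (a \<oplus>\<^bsub>A i\<^esub> b) f) g = ip V (free_act A \<rho> i a f) g + ip V (free_act A \<rho> i b f) g"
  proof (rule sesq_eq[OF sesq_act(1) sesq_comb(1)[OF sq(1,4)] _ f g])
    fix v w assume v: "v \<in> W" and w: "w \<in> W"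
    note sv = split_word_props(1)[OF v i] and sw = S.star_closed[OF split_word_props(1)[OF w i]]
    show "ip V (free_act A \<rho> i (a \<oplus>\<^bsub>A i\<^esub> b) (word_vec v)) (word_vec w)
      = ip V (free_act A \<rho> i a (word_vec v)) (word_vec w) + ip V (free_act A \<rho> i b (word_vec v)) (word_vec w)"
      using sv sw a b by (simp add: ip_act_word v w S.distrib_l S.distrib_r S.rho_add distrib_right)
  qed (use a b in auto)
  show "ip V (free_act A \<rho> i (c \<odot>\<^bsub>A i\<^esub> a) f) g = c * ip V (free_act A \<rho> i a f) g"
  proof (rule sesq_eq[OF sesq_act(1) sesq_comb(2)[OF sq(1)] _ f g])
    fix v w assume v: "v \<in> W" and w: "w \<in> W"
    note sv = split_word_props(1)[OF v i] and sw = S.star_closed[OF split_word_props(1)[OF w i]]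
    show "ip V (free_act A \<rho> i (c \<odot>\<^bsub>A i\<^esub> a) (word_vec v)) (word_vec w)
      = c * ip V (free_act A \<rho> i a (word_vec v)) (word_vec w)"
      using sv sw a by (simp add: ip_act_word v w S.smult_mult_left S.smult_mult_right S.rho_smult)
  qed (use a b in auto)
  show "ip V (free_act A \<rho> i (a \<otimes>\<^bsub>A i\<^esub> b) f) g = ip V (free_act A \<rho> i b f) (free_act A \<rho> i (star (A i) a) g)"
  proof (rule sesq_eq[OF sesq_act(1) sesq_act(2) _ f g])
    fix v w assume v: "v \<in> W" and w: "w \<in> W"
    note sv = split_word_props[OF v i] and sw = split_word_props[OF w i]
    note sa = S.star_closed[OF a]
    have "ip V (free_act A \<rho> i b (word_vec v)) (free_act A \<rho> i (star (A i) a) (word_vec w))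
        = \<rho> i (star (A i) (star (A i) a \<otimes>\<^bsub>A i\<^esub> fst (split_word A i w)) \<otimes>\<^bsub>A i\<^esub> (b \<otimes>\<^bsub>A i\<^esub> fst (split_word A i v)))
          * wip (snd (split_word A i v)) (snd (split_word A i w))"
      unfolding free_act_word_vec free_act_word_tens
      using sv sw sa b by (intro ip_tens) auto
    also have "star (A i) (star (A i) a \<otimes>\<^bsub>A i\<^esub> fst (split_word A i w)) \<otimes>\<^bsub>A i\<^esub> (b \<otimes>\<^bsub>A i\<^esub> fst (split_word A i v))
        = star (A i) (fst (split_word A i w)) \<otimes>\<^bsub>A i\<^esub> (a \<otimes>\<^bsub>A i\<^esub> b \<otimes>\<^bsub>A i\<^esub> fst (split_word A i v))"
      using sv sw a b sa by (simp add: S.star_mult S.star_star S.star_closed S.mult_assoc)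
    finally show "ip V (free_act A \<rho> i (a \<otimes>\<^bsub>A i\<^esub> b) (word_vec v)) (word_vec w)
      = ip V (free_act A \<rho> i b (word_vec v)) (free_act A \<rho> i (star (A i) a) (word_vec w))"
      using ip_act_word[OF _ v w, of "a \<otimes>\<^bsub>A i\<^esub> b"] a b by simp
  qed (use a b S.star_closed in auto)
next
  fix f g assume f: "f \<in> carrier V" and g: "g \<in> carrier V"
  show "ip V (free_act A \<rho> i \<one>\<^bsub>A i\<^esub> f) g = ip V f g"
  proof (rule sesq_eq[OF sesq_act(1) sesq_act(3) _ f g])
    fix v w assume v: "v \<in> W" and w: "w \<in> W"
    show "ip V (free_act A \<rho> i \<one>\<^bsub>A i\<^esub> (word_vec v)) (word_vec w) = ip V (word_vec v) (word_vec w)"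
      using ip_tens_split[OF v w] split_word_props(1)[OF v i]
      by (simp only: free_act_word_vec free_act_word_tens S.l_one)
  qed auto
qed (simp_all only: free_act_linear)

end

end

section \<open>The free product algebra\<close>

context free_family begin

sublocale H: hilbert "completion V" by (rule completion_hilbert)

abbreviation "\<P> \<equiv> free_product I A \<rho>"
abbreviation "\<omega> \<equiv> free_product_state I A \<rho>"
abbreviation "emb \<equiv> free_embedding I A \<rho>"
abbreviation "\<Omega> \<equiv> completion_vec V (word_vec [])"

lemma sesq_act2:
  assumes "i \<in> I" "j \<in> I" "a \<in> carrier (A i)" "b \<in> carrier (A j)"
  shows "sesq (\<lambda>f g. ip V (free_act A \<rho> i a f) (free_act A \<rho> j b g))"
  unfolding sesq_def
  by (intro ballI allI conjI; simp only: free_act_linear free_act_closed assms sm_closed M.a_closed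
      ip_add_left ip_add_right ip_smult_left ip_smult_right)+

context
  fixes i assumes i: "i \<in> I"
begin

interpretation S: cstar_state "A i" "\<rho> i" by (rule family[OF i])
interpretation R: pre_rep "A i" V "free_act A \<rho> i" by (rule free_act_pre_rep[OF i])

lemma emb_op_hom: "unital_star_hom (A i) (operator_algebra (completion V)) (emb i)"
  using R.Pi_hom by (simp add: free_embedding_def[abs_def])

lemma emb_vec:
  "a \<in> carrier (A i) \<Longrightarrow> f \<in> carrier V \<Longrightarrow>
    emb i a (completion_vec V f) = completion_vec V (free_act A \<rho> i a f)"
  by (simp add: free_embedding_def R.Pi_vec)

lemma emb_op_closed: "a \<in> carrier (A i) \<Longrightarrow> emb i a \<in> bounded_operators (completion V)"
  by (simp add: free_embedding_def R.Pi_bounded)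

text \<open>A centred element creates a letter: \<open>split_word\<close> supplies the unit, and the
  scalar part of \<open>tens\<close> vanishes.\<close>

lemma act_word_new:
  assumes "a \<in> carrier (A i)" "\<rho> i a = 0" "\<not> headed i v"
  shows "free_act A \<rho> i a (word_vec v) = word_vec ((i, a) # v)"
proof -
  have "split_word A i v = (\<one>\<^bsub>A i\<^esub>, v)" using assms(3) by (cases v) (auto simp: headed_def)
  then show ?thesis
    using assms tens_centred[OF i, of a v]
    by (simp add: free_act_word_vec free_act_word_tens S.mult_one_right)
qed

text \<open>Here the element merges into the leading letter; with the product still centred, no
  shorter word splits off.\<close>

lemma act_word_same:
  assumes "a \<in> carrier (A i)" "b \<in> carrier (A i)" "\<rho> i (a \<otimes>\<^bsub>A i\<^esub> b) = 0"
  shows "free_act A \<rho> i a (word_vec ((i, b) # v)) = word_vec ((i, a \<otimes>\<^bsub>A i\<^esub> b) # v)"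
  using assms tens_centred[OF i, of "a \<otimes>\<^bsub>A i\<^esub> b" v]
  by (simp add: free_act_word_vec free_act_word_tens)

text \<open>\<open>\<rho> i\<close> of the product is the GNS inner product of \<open>b\<close> with
  the adjoint of \<open>a\<close>, and the hypothesis makes that adjoint a null vector.\<close>

lemma rho_left_null:
  assumes "a \<in> carrier (A i)" "b \<in> carrier (A i)" "\<rho> i (a \<otimes>\<^bsub>A i\<^esub> star (A i) a) = 0"
  shows "\<rho> i (a \<otimes>\<^bsub>A i\<^esub> b) = 0"
proof -
  note sa = S.star_closed[OF assms(1)]
  have "S.gnorm (star (A i) a) = 0"
    using assms by (simp add: vnorm_def S.star_star)
  then show ?thesis
    using S.G.cauchy_schwarz[of b "star (A i) a"] assms sa by (simp add: S.star_star)
qed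

end

lemma gens_sub: "(\<Union>i\<in>I. emb i ` carrier (A i)) \<subseteq> carrier (operator_algebra (completion V))"
  using emb_op_closed by (auto simp: H.carrier_op)

lemma free_product_eq:
  "\<P> = cstar_generated (operator_algebra (completion V)) (\<Union>i\<in>I. emb i ` carrier (A i))"
  by (simp add: free_product_def free_hilbert_def)

lemma free_product_sub: "cstar_subalgebra (carrier \<P>) (operator_algebra (completion V))"
  unfolding free_product_eq by (rule H.OA.cstar_generated_subalgebra[OF gens_sub])

lemma free_product_carrier_eq: "\<P> = (operator_algebra (completion V))\<lparr>carrier := carrier \<P>\<rparr>"
  unfolding free_product_eq by (rule H.OA.cstar_generated_eq)

lemma free_product_simps [simp]:
  "mult \<P> = mult (operator_algebra (completion V))" "one \<P> = one (operator_algebra (completion V))"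
  "zero \<P> = zero (operator_algebra (completion V))" "add \<P> = add (operator_algebra (completion V))"
  "smult \<P> = smult (operator_algebra (completion V))" "star \<P> = star (operator_algebra (completion V))"
  "cnorm \<P> = cnorm (operator_algebra (completion V))"
  unfolding free_product_eq by simp_all

lemma emb_closed: "i \<in> I \<Longrightarrow> a \<in> carrier (A i) \<Longrightarrow> emb i a \<in> carrier \<P>"
  unfolding free_product_eq by (rule subsetD[OF H.OA.cstar_generated_contains]) blast

lemma emb_hom: "i \<in> I \<Longrightarrow> unital_star_hom (A i) \<P> (emb i)"
  using unital_star_homD[OF emb_op_hom] emb_closed by (intro unital_star_homI) auto

section \<open>The vacuum vector and its state\<close>

lemma vacuum_carrier: "\<Omega> \<in> carrier (completion V)"
  by (simp add: word_vec_carrier)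

lemma vacuum_norm: "vnorm (completion V) \<Omega> = 1"
proof -
  have "vnorm V (word_vec []) = 1" by (simp add: vnorm_def ip_word_vec)
  then show ?thesis by (simp add: completion_vec_norm word_vec_carrier)
qed

lemma free_state_eq: "\<omega> = vector_state (completion V) \<Omega>"
  by (simp add: free_product_state_def free_hilbert_def)

lemma free_product_cstar_state: "cstar_state \<P> \<omega>"
  using H.vector_state_gns(1)[OF free_product_sub vacuum_carrier vacuum_norm]
    free_product_carrier_eq free_state_eq by simp

lemma emb_state:
  assumes i: "i \<in> I" and a: "a \<in> carrier (A i)"
  shows "\<omega> (emb i a) = \<rho> i a"
proof -
  interpret S: cstar_state "A i" "\<rho> i" by (rule family[OF i])
  have "\<omega> (emb i a) = ip V (free_act A \<rho> i a (word_vec [])) (word_vec [])"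
    unfolding free_state_eq vector_state_def
    using emb_vec[OF i a word_vec_carrier[OF Nil_word]] free_act_closed[OF i a word_vec_carrier[OF Nil_word]]
    by (simp add: completion_vec_ip)
  also have "\<dots> = \<rho> i a"
    using a by (simp add: ip_act_word[OF i a] S.mult_one_right)
  finally show ?thesis .
qed

text \<open>The letters of \<open>w\<close>, applied as operators from right to left, create the
  word out of the vacuum one centred letter at a time.\<close>

lemma word_cyclic: "w \<in> W \<Longrightarrow> \<exists>b\<in>carrier \<P>. b \<Omega> = completion_vec V (word_vec w)"
proof (induction w)
  case Nil
  have "\<one>\<^bsub>\<P>\<^esub> \<in> carrier \<P>" using H.OA.cstar_subalgebraD(2)[OF free_product_sub] by simp
  then show ?case using vacuum_carrier by (intro bexI[of _ "\<one>\<^bsub>\<P>\<^esub>"]) auto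
next
  case (Cons p v)
  obtain i a where p: "p = (i, a)" by (cases p)
  have *: "i \<in> I" "a \<in> carrier (A i)" "\<rho> i a = 0" "v \<in> W" "\<not> headed i v"
    using Cons.prems p by (auto simp: Cons_word headed_def)
  obtain b where b: "b \<in> carrier \<P>" "b \<Omega> = completion_vec V (word_vec v)" using Cons.IH *(4) by blast
  have "emb i a \<otimes>\<^bsub>\<P>\<^esub> b \<in> carrier \<P>"
    using H.OA.cstar_subalgebraD(5)[OF free_product_sub emb_closed[OF *(1,2)] b(1)] by simp
  moreover have "(emb i a \<otimes>\<^bsub>\<P>\<^esub> b) \<Omega> = completion_vec V (word_vec (p # v))"
    using vacuum_carrier b(2) emb_vec[OF *(1,2) word_vec_carrier[OF *(4)]] act_word_new[OF *(1,2,3,5)] p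
    by simp
  ultimately show ?case by blast
qed

lemma vec_cyclic: "f \<in> carrier V \<Longrightarrow> \<exists>b\<in>carrier \<P>. b \<Omega> = completion_vec V f"
proof (induction rule: free_induct)
  case zero
  have "\<zero>\<^bsub>\<P>\<^esub> \<in> carrier \<P>" using H.OA.cstar_subalgebraD(3)[OF free_product_sub] by simp
  moreover have "\<zero>\<^bsub>\<P>\<^esub> \<Omega> = completion_vec V \<zero>\<^bsub>V\<^esub>"
    using vacuum_carrier by (simp add: zero_completion completion_vec_cls)
  ultimately show ?case by blast
next
  case (step f c w)
  obtain b where b: "b \<in> carrier \<P>" "b \<Omega> = completion_vec V f" using step.IH by blast
  obtain d where d: "d \<in> carrier \<P>" "d \<Omega> = completion_vec V (word_vec w)"
    using word_cyclic[OF step.hyps(2)] by blast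
  have "b \<oplus>\<^bsub>\<P>\<^esub> c \<odot>\<^bsub>\<P>\<^esub> d \<in> carrier \<P>"
    using H.OA.cstar_subalgebraD(4,6)[OF free_product_sub] b d by simp
  moreover have "(b \<oplus>\<^bsub>\<P>\<^esub> c \<odot>\<^bsub>\<P>\<^esub> d) \<Omega> = completion_vec V (f \<oplus>\<^bsub>V\<^esub> c \<odot>\<^bsub>V\<^esub> word_vec w)"
    using vacuum_carrier b(2) d(2) step.hyps(1) word_vec_carrier[OF step.hyps(2)]
    by (simp add: completion_vec_add completion_vec_smult)
  ultimately show ?case by blast
qed

text \<open>Words span a dense subspace and all lie in the orbit of the vacuum, so
  \<open>cyclic_norming\<close> applies.\<close>

lemma free_product_norming: "norming \<P> \<omega>"
proof -
  have "norming ((operator_algebra (completion V))\<lparr>carrier := carrier \<P>\<rparr>) (vector_state (completion V) \<Omega>)"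
  proof (rule H.cyclic_norming[OF free_product_sub vacuum_carrier vacuum_norm])
    fix X and e :: real assume X: "X \<in> carrier (completion V)" and e: "0 < e"
    obtain f where f: "f \<in> carrier V" "vnorm (completion V) (X \<ominus>\<^bsub>completion V\<^esub> completion_vec V f) < e"
      using completion_dense[OF X e] by blast
    obtain b where "b \<in> carrier \<P>" "b \<Omega> = completion_vec V f" using vec_cyclic[OF f(1)] by blast
    then show "\<exists>b\<in>carrier \<P>. vnorm (completion V) (X \<ominus>\<^bsub>completion V\<^esub> b \<Omega>) < e"
      using f(2) by (intro bexI[of _ b]) auto
  qed
  then show ?thesis using free_product_carrier_eq free_state_eq by simp
qed

lemma free_product_generates:
  assumes "\<And>i. i \<in> I \<Longrightarrow> generates (A i) (S i)"
  shows "generates \<P> (\<Union>i\<in>I. emb i ` S i)"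
proof -
  have P: "unital_cstar_algebra \<P>" using free_product_cstar_state by (rule cstar_state.axioms(1))
  have gP: "generates \<P> (\<Union>i\<in>I. emb i ` carrier (A i))"
    using H.OA.generates_cstar_generated[OF gens_sub] free_product_eq by simp
  have "carrier \<P> \<subseteq> C" if C: "cstar_subalgebra C \<P>" "(\<Union>i\<in>I. emb i ` S i) \<subseteq> C" for C
  proof -
    have "emb i x \<in> C" if "i \<in> I" "x \<in> carrier (A i)" for i x
      using generates_hom_image[OF alg[OF that(1)] P emb_hom[OF that(1)] C(1) assms[OF that(1)] _ that(2)]
        C(2) that(1) by blast
    then have "(\<Union>i\<in>I. emb i ` carrier (A i)) \<subseteq> C" by blast
    then show ?thesis using gP C(1) unfolding generates_def by blast
  qed
  moreover have "(\<Union>i\<in>I. emb i ` S i) \<subseteq> carrier \<P>"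
    using assms emb_closed unfolding generates_def by blast
  ultimately show ?thesis unfolding generates_def by blast
qed

text \<open>Elements \<open>a\<close> with \<open>\<rho>(aa\<^sup>*) = 0\<close> map every vector into words starting with their letter.\<close>

lemma emb_orthogonal:
  assumes i: "i \<in> I" "a \<in> carrier (A i)" "\<rho> i (a \<otimes>\<^bsub>A i\<^esub> star (A i) a) = 0"
    and j: "j \<in> I" "b \<in> carrier (A j)" "\<rho> j (b \<otimes>\<^bsub>A j\<^esub> star (A j) b) = 0"
    and ij: "i \<noteq> j"
  shows "star \<P> (emb i a) \<otimes>\<^bsub>\<P>\<^esub> emb j b = \<zero>\<^bsub>\<P>\<^esub>"
proof -
  interpret Ri: pre_rep "A i" V "free_act A \<rho> i" by (rule free_act_pre_rep[OF i(1)])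
  interpret Rj: pre_rep "A j" V "free_act A \<rho> j" by (rule free_act_pre_rep[OF j(1)])
  have form0: "ip V (free_act A \<rho> j b f) (free_act A \<rho> i a g) = 0"
    if "f \<in> carrier V" "g \<in> carrier V" for f g
  proof (rule sesq_eq[OF sesq_act2[OF j(1) i(1) j(2) i(2)], of "\<lambda>f g. 0", OF _ _ that])
    show "sesq (\<lambda>f g. 0)" by (simp add: sesq_def)
    fix v w assume v: "v \<in> W" and w: "w \<in> W"
    note sv = split_word_props[OF v j(1)] and sw = split_word_props[OF w i(1)]
    interpret Si: cstar_state "A i" "\<rho> i" by (rule family[OF i(1)])
    interpret Sj: cstar_state "A j" "\<rho> j" by (rule family[OF j(1)])
    let ?b = "b \<otimes>\<^bsub>A j\<^esub> fst (split_word A j v)" and ?a = "a \<otimes>\<^bsub>A i\<^esub> fst (split_word A i w)"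
    \<comment> \<open>\<open>rho_left_null\<close> makes the products centred whatever the leading
      letters are, so no scalar parts survive and the two words start with different
      indices.\<close>
    have b0: "?b \<in> carrier (A j)" "\<rho> j ?b = 0"
      using rho_left_null[OF j(1,2) sv(1) j(3)] j(2) sv(1) by auto
    have a0: "?a \<in> carrier (A i)" "\<rho> i ?a = 0"
      using rho_left_null[OF i(1,2) sw(1) i(3)] i(2) sw(1) by auto
    have "ip V (free_act A \<rho> j b (word_vec v)) (free_act A \<rho> i a (word_vec w))
      = ip V (word_vec ((j, ?b) # snd (split_word A j v))) (word_vec ((i, ?a) # snd (split_word A i w)))"
      by (simp only: free_act_word_vec free_act_word_tens tens_centred[OF j(1) b0] tens_centred[OF i(1) a0])
    also have "\<dots> = 0"
      using Cons_wordI[OF j(1) b0 sv(2,3)] Cons_wordI[OF i(1) a0 sw(2,3)] ij by (simp add: ip_word_vec)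
    finally show "ip V (free_act A \<rho> j b (word_vec v)) (free_act A \<rho> i a (word_vec w)) = 0" .
  qed
  note ea = emb_op_closed[OF i(1,2)] and eb = emb_op_closed[OF j(1,2)]
  note sea = H.op_star(1)[OF ea]
  have "star (operator_algebra (completion V)) (emb i a) \<otimes>\<^bsub>operator_algebra (completion V)\<^esub> emb j b
      = \<zero>\<^bsub>operator_algebra (completion V)\<^esub>"
  proof (rule Ri.Pi_eqI[OF H.op_mult_closed[OF sea eb] H.op_zero_closed])
    fix x y assume x: "cau x" and y: "cau y"
    have "(\<lambda>n. ip V (free_act A \<rho> j b (x n)) (free_act A \<rho> i a (y n)))
        \<longlonglongrightarrow> ip (completion V) (emb j b (cls x)) (emb i a (cls y))"
      using ip_completion[OF Rj.Pi_cls(1)[OF j(2) x] Ri.Pi_cls(1)[OF i(2) y]]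
        Rj.Pi_cls(2)[OF j(2) x] Ri.Pi_cls(2)[OF i(2) y] by (simp add: free_embedding_def)
    then have "(\<lambda>n. 0) \<longlonglongrightarrow> ip (completion V) (emb j b (cls x)) (emb i a (cls y))"
      using form0[OF cauD[OF x] cauD[OF y]] by simp
    then have "ip (completion V) (emb j b (cls x)) (emb i a (cls y)) = 0"
      using LIMSEQ_unique tendsto_const by blast
    moreover have c: "cls x \<in> carrier (completion V)" "cls y \<in> carrier (completion V)"
      using x y by auto
    ultimately show "ip (completion V) ((star (operator_algebra (completion V)) (emb i a)
        \<otimes>\<^bsub>operator_algebra (completion V)\<^esub> emb j b) (cls x)) (cls y)
      = ip (completion V) (\<zero>\<^bsub>operator_algebra (completion V)\<^esub> (cls x)) (cls y)"
      using H.op_star_right[OF ea H.bopD(1)[OF eb c(1)] c(2)] by simp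
  qed
  then show ?thesis by simp
qed

end

section \<open>Algebras with equal *-moments\<close>

text \<open>The letters follow the convention of \<open>free_group\<close>: \<open>True\<close>
  marks the generator, \<open>False\<close> its adjoint. Hence words in unitaries and words in the
  free group are literally the same lists.\<close>

definition cword :: "('a, 'm) cstar_scheme \<Rightarrow> ('i \<Rightarrow> 'a) \<Rightarrow> ('i \<times> bool) list \<Rightarrow> 'a" where
  "cword A x w = foldr (\<lambda>(i, e) a. (if e then x i else star A (x i)) \<otimes>\<^bsub>A\<^esub> a) w \<one>\<^bsub>A\<^esub>"

lemma cword_Nil [simp]: "cword A x [] = \<one>\<^bsub>A\<^esub>"
  and cword_Cons [simp]:
    "cword A x ((i, e) # w) = (if e then x i else star A (x i)) \<otimes>\<^bsub>A\<^esub> cword A x w"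
  by (simp_all add: cword_def)

lemma cword_map: "cword A x (map (map_prod f id) w) = cword A (x \<circ> f) w"
  by (induction w) auto

lemma (in cvec) vec_assoc:
  "x \<in> carrier V \<Longrightarrow> y \<in> carrier V \<Longrightarrow> z \<in> carrier V \<Longrightarrow> (x \<oplus> y) \<oplus> z = x \<oplus> (y \<oplus> z)"
  by (rule M.a_assoc)

context unital_cstar_algebra begin

lemma cword_closed [simp]: "range x \<subseteq> carrier A \<Longrightarrow> cword A x w \<in> carrier A"
proof (induction w)
  case (Cons p w)
  obtain i e where p: "p = (i, e)" by (cases p)
  have "x i \<in> carrier A" using Cons.prems by auto
  then show ?case using Cons p by (simp add: star_closed)
qed simp

lemma cword_append:
  assumes "range x \<subseteq> carrier A"
  shows "cword A x (v @ w) = cword A x v \<otimes> cword A x w"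
proof (induction v)
  case (Cons p v)
  obtain i e where p: "p = (i, e)" by (cases p)
  have "(if e then x i else star A (x i)) \<in> carrier A" using assms by (auto intro: star_closed)
  then show ?case using Cons p assms by (simp add: mult_assoc)
qed (use assms in simp)

lemma cword_star:
  assumes "range x \<subseteq> carrier A"
  shows "star A (cword A x w) = cword A x (rev (map (map_prod id Not) w))"
proof (induction w)
  case (Cons p w)
  obtain i e where p: "p = (i, e)" by (cases p)
  have xi: "x i \<in> carrier A" using assms by auto
  then have "star A (if e then x i else star A (x i)) = (if \<not> e then x i else star A (x i))"
    by (simp add: star_star)
  then show ?case
    using Cons p assms xi
    by (cases e) (simp_all add: star_mult cword_append star_closed mult_one_right)
qed simp

definition adh :: "'a set \<Rightarrow> 'a set" where
  "adh S = {l \<in> carrier A. \<exists>z. (\<forall>n. z n \<in> S) \<and> lim_to z l}"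

text \<open>The operations are continuous along sequences. Closedness is a diagonal argument: each
  \<open>x n\<close> is replaced by an element of \<open>S\<close> within
  \<open>1 / (n + 1)\<close>.\<close>

lemma adh_subalgebra:
  assumes S: "S \<subseteq> carrier A" "\<one> \<in> S" "\<And>a b. a \<in> S \<Longrightarrow> b \<in> S \<Longrightarrow> a \<oplus> b \<in> S"
    "\<And>a b. a \<in> S \<Longrightarrow> b \<in> S \<Longrightarrow> a \<otimes> b \<in> S" "\<And>c a. a \<in> S \<Longrightarrow> c \<odot> a \<in> S"
    "\<And>a. a \<in> S \<Longrightarrow> star A a \<in> S"
  shows "cstar_subalgebra (adh S) A"
proof (rule cstar_subalgebraI)
  have Sc: "z n \<in> carrier A" if "\<forall>n. z n \<in> S" for z :: "nat \<Rightarrow> 'a" and n using that S(1) by auto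
  show "adh S \<subseteq> carrier A" by (auto simp: adh_def)
  show "\<one> \<in> adh S" unfolding adh_def using S(2) by (auto intro!: exI[of _ "\<lambda>_. \<one>"])
  fix a b assume "a \<in> adh S" "b \<in> adh S"
  then obtain y z where yz: "a \<in> carrier A" "b \<in> carrier A" "\<forall>n. y n \<in> S" "lim_to y a"
    "\<forall>n. z n \<in> S" "lim_to z b" by (auto simp: adh_def)
  have "lim_to (\<lambda>n. y n \<oplus> z n) (a \<oplus> b)"
    by (rule lim_to_add[OF yz(4,6)]) (use yz Sc in auto)
  then show "a \<oplus> b \<in> adh S"
    unfolding adh_def using yz S(3) by (auto intro!: exI[of _ "\<lambda>n. y n \<oplus> z n"])
  have "lim_to (\<lambda>n. y n \<otimes> z n) (a \<otimes> b)"
    by (rule lim_to_mult[OF yz(4,6)]) (use yz Sc in auto)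
  then show "a \<otimes> b \<in> adh S"
    unfolding adh_def using yz S(4) by (auto intro!: exI[of _ "\<lambda>n. y n \<otimes> z n"])
next
  have Sc: "z n \<in> carrier A" if "\<forall>n. z n \<in> S" for z :: "nat \<Rightarrow> 'a" and n using that S(1) by auto
  fix a c assume "a \<in> adh S"
  then obtain y where y: "a \<in> carrier A" "\<forall>n. y n \<in> S" "lim_to y a" by (auto simp: adh_def)
  have "lim_to (\<lambda>n. c \<odot> y n) (c \<odot> a)" by (rule lim_to_smult[OF y(3)]) (use y Sc in auto)
  then show "c \<odot> a \<in> adh S" unfolding adh_def using y S(5) by (auto intro!: exI[of _ "\<lambda>n. c \<odot> y n"])
  have "lim_to (\<lambda>n. star A (y n)) (star A a)" by (rule lim_to_star[OF y(3)]) (use y Sc in auto)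
  then show "star A a \<in> adh S"
    unfolding adh_def using y S(6) star_closed by (auto intro!: exI[of _ "\<lambda>n. star A (y n)"])
next
  fix x l assume x: "\<And>n. x n \<in> adh S" and l: "l \<in> carrier A" "lim_to x l"
  have xc: "x n \<in> carrier A" for n using x[of n] by (simp add: adh_def)
  have "\<exists>s\<in>S. cnorm A (s \<ominus> x n) < inverse (real (Suc n))" for n
  proof -
    obtain z where z: "\<forall>k. z k \<in> S" "lim_to z (x n)" using x[of n] by (auto simp: adh_def)
    have "eventually (\<lambda>k. cnorm A (z k \<ominus> x n) < inverse (real (Suc n))) sequentially"
      using z(2) unfolding lim_to_def by (rule order_tendstoD) simp
    then show ?thesis using z(1) by (auto simp: eventually_sequentially)
  qed
  then obtain s where s: "\<And>n. s n \<in> S" "\<And>n. cnorm A (s n \<ominus> x n) < inverse (real (Suc n))" by metis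
  have sc: "s n \<in> carrier A" for n using s(1) S(1) by auto
  have "lim_to s l"
  proof (rule lim_to_bound[where b = "\<lambda>n. inverse (real (Suc n)) + cnorm A (x n \<ominus> l)"])
    show "(\<lambda>n. inverse (real (Suc n)) + cnorm A (x n \<ominus> l)) \<longlonglongrightarrow> 0"
      using tendsto_add[OF LIMSEQ_inverse_real_of_nat l(2)[unfolded lim_to_def]] by simp
    show "cnorm A (s n \<ominus> l) \<le> inverse (real (Suc n)) + cnorm A (x n \<ominus> l)" for n
      using nrm_diff_triangle[OF sc[of n] xc[of n] l(1)] s(2)[of n] by linarith
  qed (use sc l in auto)
  then show "l \<in> adh S" using l(1) s(1) by (auto simp: adh_def)
qed

lemma adh_superset: "S \<subseteq> carrier A \<Longrightarrow> S \<subseteq> adh S"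
  by (auto simp: adh_def intro!: exI[of _ "\<lambda>_. s" for s])

end

lemma (in cstar_state) gnorm_le: "x \<in> carrier A \<Longrightarrow> gnorm x \<le> cnorm A x"
  using gnorm_mult_le[of x \<one>] by (simp add: gnorm_one mult_one_right)

lemma (in cstar_state) gnorm_tendsto:
  assumes "lim_to x l" "\<And>n. x n \<in> carrier A" "l \<in> carrier A"
  shows "(\<lambda>n. gnorm (x n)) \<longlonglongrightarrow> gnorm l"
proof -
  have d: "x n \<ominus>\<^bsub>gns_prespace A \<rho>\<^esub> l = x n \<ominus> l" for n
    by (rule cvec_diff_cong[OF cvec_module]) (use assms G.cvec_axioms in \<open>auto simp: cvec_def\<close>)
  have "\<bar>gnorm (x n) - gnorm l\<bar> \<le> cnorm A (x n \<ominus> l)" for n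
    using G.nrm_abs_diff[of "x n" l] gnorm_le[of "x n \<ominus> l"] assms by (simp add: d)
  then have "(\<lambda>n. \<bar>gnorm (x n) - gnorm l\<bar>) \<longlonglongrightarrow> 0"
    using assms(1) unfolding lim_to_def by (intro LIMSEQ_zero_bound[OF abs_ge_zero]) auto
  then show ?thesis using tendsto_rabs_zero_cancel LIM_zero_iff by blast
qed

text \<open>\<open>norming\<close> is postponed to \<open>moment_pair\<close>: equality of states on
  words is used to prove that a trace is norming, so it must not presuppose it.\<close>

locale word_pair = A: cstar_state A \<alpha> + B: cstar_state B \<beta>
  for A :: "('a, 'm) cstar_scheme" and \<alpha> and B :: "('b, 'n) cstar_scheme" and \<beta> +
  fixes x :: "'i \<Rightarrow> 'a" and y :: "'i \<Rightarrow> 'b"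
  assumes genA: "generates A (range x)" and genB: "generates B (range y)"
    and moments: "\<alpha> (cword A x w) = \<beta> (cword B y w)"
begin

lemma rA: "range x \<subseteq> carrier A" and rB: "range y \<subseteq> carrier B"
  using genA genB by (auto simp: generates_def)

text \<open>The graph that sends a linear combination of words in \<open>x\<close> to the same
  combination in \<open>y\<close>. It is kept as a relation because the combination is not
  determined by its value; well-definedness only follows once norms are compared.\<close>

inductive_set R :: "('a \<times> 'b) set" where
  R_zero: "(\<zero>\<^bsub>A\<^esub>, \<zero>\<^bsub>B\<^esub>) \<in> R"
| R_step: "(a, b) \<in> R \<Longrightarrow> (a \<oplus>\<^bsub>A\<^esub> c \<odot>\<^bsub>A\<^esub> cword A x w, b \<oplus>\<^bsub>B\<^esub> c \<odot>\<^bsub>B\<^esub> cword B y w) \<in> R"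

lemma R_closed: "(a, b) \<in> R \<Longrightarrow> a \<in> carrier A \<and> b \<in> carrier B"
  by (induction rule: R.induct) (auto simp: rA rB)

lemma R_moment: "(a, b) \<in> R \<Longrightarrow> \<alpha> a = \<beta> b"
proof (induction rule: R.induct)
  case R_zero
  then show ?case using A.rho_smult[of "\<zero>\<^bsub>A\<^esub>" 0] B.rho_smult[of "\<zero>\<^bsub>B\<^esub>" 0] by simp
next
  case (R_step a b c w)
  then show ?case using R_closed[OF R_step.hyps]
    by (simp add: A.rho_add B.rho_add A.rho_smult B.rho_smult rA rB moments)
qed

lemma R_add: "(a', b') \<in> R \<Longrightarrow> (a, b) \<in> R \<Longrightarrow> (a \<oplus>\<^bsub>A\<^esub> a', b \<oplus>\<^bsub>B\<^esub> b') \<in> R"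
proof (induction rule: R.induct)
  case R_zero
  then show ?case using R_closed[OF R_zero] by simp
next
  case (R_step a' b' c w)
  note c = R_closed[OF R_step.hyps] R_closed[OF R_step.prems] A.cword_closed[OF rA] B.cword_closed[OF rB]
  define u v where "u = c \<odot>\<^bsub>A\<^esub> cword A x w" and "v = c \<odot>\<^bsub>B\<^esub> cword B y w"
  have uv: "u \<in> carrier A" "v \<in> carrier B" using c by (auto simp: u_def v_def)
  have "(a \<oplus>\<^bsub>A\<^esub> a') \<oplus>\<^bsub>A\<^esub> u = a \<oplus>\<^bsub>A\<^esub> (a' \<oplus>\<^bsub>A\<^esub> u)" "(b \<oplus>\<^bsub>B\<^esub> b') \<oplus>\<^bsub>B\<^esub> v = b \<oplus>\<^bsub>B\<^esub> (b' \<oplus>\<^bsub>B\<^esub> v)"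
    using c(1,2) uv A.cvec_axioms B.cvec_axioms by (auto intro: cvec.vec_assoc)
  then show ?case using R.R_step[OF R_step.IH[OF R_step.prems], of c w] unfolding u_def v_def by simp
qed

lemma R_smult: "(a, b) \<in> R \<Longrightarrow> (d \<odot>\<^bsub>A\<^esub> a, d \<odot>\<^bsub>B\<^esub> b) \<in> R"
proof (induction rule: R.induct)
  case (R_step a b c w)
  then show ?case using R.R_step[OF R_step.IH, of "d * c" w] R_closed[OF R_step.hyps]
    by (simp add: A.sm_add_right B.sm_add_right A.sm_assoc B.sm_assoc rA rB)
qed (simp add: R_zero)

lemma R_word: "(cword A x w, cword B y w) \<in> R"
  using R_step[OF R_zero, of 1 w] by (simp add: rA rB)

lemma R_word_mult: "(a, b) \<in> R \<Longrightarrow> (cword A x v \<otimes>\<^bsub>A\<^esub> a, cword B y v \<otimes>\<^bsub>B\<^esub> b) \<in> R"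
proof (induction rule: R.induct)
  case R_zero
  then show ?case using R.R_zero by (simp add: rA rB)
next
  case (R_step a b c w)
  then show ?case using R.R_step[OF R_step.IH, of c "v @ w"] R_closed[OF R_step.hyps]
    by (simp add: A.distrib_r B.distrib_r A.smult_mult_right B.smult_mult_right rA rB
      A.cword_append B.cword_append)
qed

lemma R_mult: "(a, b) \<in> R \<Longrightarrow> (a', b') \<in> R \<Longrightarrow> (a \<otimes>\<^bsub>A\<^esub> a', b \<otimes>\<^bsub>B\<^esub> b') \<in> R"
proof (induction rule: R.induct)
  case R_zero
  then show ?case using R.R_zero R_closed[OF R_zero] by simp
next
  case (R_step a b c w)
  have "(c \<odot>\<^bsub>A\<^esub> (cword A x w \<otimes>\<^bsub>A\<^esub> a'), c \<odot>\<^bsub>B\<^esub> (cword B y w \<otimes>\<^bsub>B\<^esub> b')) \<in> R"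
    by (rule R_smult[OF R_word_mult[OF R_step.prems]])
  from R_add[OF this R_step.IH[OF R_step.prems]]
  show ?case using R_closed[OF R_step.hyps] R_closed[OF R_step.prems]
    by (simp add: A.distrib_l B.distrib_l A.smult_mult_left B.smult_mult_left rA rB)
qed

lemma R_star: "(a, b) \<in> R \<Longrightarrow> (star A a, star B b) \<in> R"
proof (induction rule: R.induct)
  case (R_step a b c w)
  then show ?case
    using R.R_step[OF R_step.IH, of "cnj c" "rev (map (map_prod id Not) w)"] R_closed[OF R_step.hyps]
    by (simp add: A.star_add B.star_add A.star_smult B.star_smult rA rB A.cword_star B.cword_star)
qed (simp add: R_zero)

lemma R_diff: "(a, b) \<in> R \<Longrightarrow> (a', b') \<in> R \<Longrightarrow> (a \<ominus>\<^bsub>A\<^esub> a', b \<ominus>\<^bsub>B\<^esub> b') \<in> R"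
  using R_add[OF R_smult[of a' b' "- 1"], of a b] R_closed[of a' b']
  by (simp add: a_minus_def A.sm_minus_one B.sm_minus_one)

lemma dense_A: "a \<in> carrier A \<Longrightarrow> a \<in> A.adh (fst ` R)"
  and dense_B: "b \<in> carrier B \<Longrightarrow> b \<in> B.adh (snd ` R)"
proof -
  have one: "(\<one>\<^bsub>A\<^esub>, \<one>\<^bsub>B\<^esub>) \<in> R" using R_word[of "[]"] by simp
  have gen: "(x i, y i) \<in> R" for i
  proof -
    have "x i \<in> carrier A" "y i \<in> carrier B" using rA rB by auto
    then show ?thesis
      using R_word[of "[(i, True)]"] by (simp add: A.mult_one_right B.mult_one_right)
  qed
  have fstI: "a \<in> fst ` R" and sndI: "b \<in> snd ` R" if "(a, b) \<in> R" for a b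
    using that by (auto intro: image_eqI[of _ _ "(a, b)"])
  have fstE: "\<exists>b. (a, b) \<in> R" if "a \<in> fst ` R" for a using that by auto
  have sndE: "\<exists>a. (a, b) \<in> R" if "b \<in> snd ` R" for b using that by auto
  have subA: "fst ` R \<subseteq> carrier A" and subB: "snd ` R \<subseteq> carrier B"
    using R_closed by auto
  have "cstar_subalgebra (A.adh (fst ` R)) A"
  proof (rule A.adh_subalgebra[OF subA fstI[OF one]])
    fix a b assume "a \<in> fst ` R" "b \<in> fst ` R"
    then obtain a' b' where "(a, a') \<in> R" "(b, b') \<in> R" using fstE by meson
    then show "a \<oplus>\<^bsub>A\<^esub> b \<in> fst ` R" "a \<otimes>\<^bsub>A\<^esub> b \<in> fst ` R"
      using fstI[OF R_add] fstI[OF R_mult] by blast+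
  next
    fix c a assume "a \<in> fst ` R"
    then obtain a' where "(a, a') \<in> R" using fstE by meson
    then show "c \<odot>\<^bsub>A\<^esub> a \<in> fst ` R" "star A a \<in> fst ` R"
      using fstI[OF R_smult] fstI[OF R_star] by blast+
  qed
  moreover have "range x \<subseteq> A.adh (fst ` R)" using A.adh_superset[OF subA] fstI[OF gen] by auto
  ultimately have "carrier A \<subseteq> A.adh (fst ` R)" using genA unfolding generates_def by blast
  then show "a \<in> carrier A \<Longrightarrow> a \<in> A.adh (fst ` R)" by blast
  have "cstar_subalgebra (B.adh (snd ` R)) B"
  proof (rule B.adh_subalgebra[OF subB sndI[OF one]])
    fix a b assume "a \<in> snd ` R" "b \<in> snd ` R"
    then obtain a' b' where "(a', a) \<in> R" "(b', b) \<in> R" using sndE by meson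
    then show "a \<oplus>\<^bsub>B\<^esub> b \<in> snd ` R" "a \<otimes>\<^bsub>B\<^esub> b \<in> snd ` R"
      using sndI[OF R_add] sndI[OF R_mult] by blast+
  next
    fix c a assume "a \<in> snd ` R"
    then obtain a' where "(a', a) \<in> R" using sndE by meson
    then show "c \<odot>\<^bsub>B\<^esub> a \<in> snd ` R" "star B a \<in> snd ` R"
      using sndI[OF R_smult] sndI[OF R_star] by blast+
  qed
  moreover have "range y \<subseteq> B.adh (snd ` R)" using B.adh_superset[OF subB] sndI[OF gen] by auto
  ultimately have "carrier B \<subseteq> B.adh (snd ` R)" using genB unfolding generates_def by blast
  then show "b \<in> carrier B \<Longrightarrow> b \<in> B.adh (snd ` R)" by blast
qed

text \<open>GNS seminorms are moments, namely those of \<open>star A a\<close> times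
  \<open>a\<close>.\<close>

lemma R_gnorm: "(a, b) \<in> R \<Longrightarrow> B.gnorm b = A.gnorm a"
  using R_moment[OF R_mult[OF R_star]] by (simp add: vnorm_def)

end

text \<open>The algebra is paired with itself. Then \<open>R\<close> is diagonal with dense range,
  the states agree on it, and both are continuous.\<close>

lemma state_eq_on_words:
  assumes "cstar_state A \<alpha>" "cstar_state A \<beta>" and gen: "generates A (range x)"
    and "\<And>w. \<alpha> (cword A x w) = \<beta> (cword A x w)" and a: "a \<in> carrier A"
  shows "\<alpha> a = \<beta> a"
proof -
  interpret A: cstar_state A \<alpha> by fact
  interpret B: cstar_state A \<beta> by fact
  interpret P: word_pair A \<alpha> A \<beta> x x by unfold_locales (use assms in auto)
  have diag: "(b, c) \<in> P.R \<Longrightarrow> b = c" for b c by (induction rule: P.R.induct) auto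
  obtain z where z: "\<forall>n. z n \<in> fst ` P.R" "A.lim_to z a"
    using P.dense_A[OF a] by (auto simp: A.adh_def)
  have zR: "(z n, z n) \<in> P.R" for n
  proof -
    have "z n \<in> fst ` P.R" using z(1) by blast
    then obtain c where "(z n, c) \<in> P.R" by auto
    then show ?thesis using diag by metis
  qed
  have zc: "z n \<in> carrier A" for n using P.R_closed[OF zR] by blast
  have "(\<lambda>n. \<beta> (z n)) \<longlonglongrightarrow> \<alpha> a"
    using A.rho_tendsto[OF z(2) zc a] P.R_moment[OF zR] by simp
  then show ?thesis using LIMSEQ_unique B.rho_tendsto[OF z(2) zc a] by blast
qed

section \<open>From equal moments to an isometric homomorphism\<close>

locale moment_pair = word_pair A \<alpha> B \<beta> x y
  for A :: "('a, 'm) cstar_scheme" and \<alpha> and B :: "('b, 'n) cstar_scheme" and \<beta>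
    and x :: "'i \<Rightarrow> 'a" and y :: "'i \<Rightarrow> 'b" +
  assumes normA: "norming A \<alpha>" and normB: "norming B \<beta>"
begin

text \<open>Multiplication by \<open>b\<close> on related elements has the same GNS seminorms as
  multiplication by \<open>a\<close>, hence is bounded by the norm of \<open>a\<close>. Density
  extends the bound to all of \<open>B\<close>, and \<open>norming\<close> turns it into a norm
  bound.\<close>

lemma R_norm_le:
  assumes ab: "(a, b) \<in> R"
  shows "cnorm B b \<le> cnorm A a"
proof -
  have a: "a \<in> carrier A" and b: "b \<in> carrier B" using R_closed[OF ab] by auto
  have "B.gnorm (b \<otimes>\<^bsub>B\<^esub> c) \<le> cnorm A a * B.gnorm c" if c: "c \<in> carrier B" for c
  proof -
    obtain z where z: "\<forall>n. z n \<in> snd ` R" "B.lim_to z c"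
      using dense_B[OF c] by (auto simp: B.adh_def)
    have zR: "\<exists>d. (d, z n) \<in> R" for n
    proof -
      have "z n \<in> snd ` R" using z(1) by blast
      then show ?thesis by auto
    qed
    have zc: "z n \<in> carrier B" for n using zR[of n] R_closed by blast
    have le: "B.gnorm (b \<otimes>\<^bsub>B\<^esub> z n) \<le> cnorm A a * B.gnorm (z n)" for n
    proof -
      obtain d where d: "(d, z n) \<in> R" using zR by blast
      then show ?thesis
        using R_gnorm[OF R_mult[OF ab d]] R_gnorm[OF d] A.gnorm_mult_le[OF a, of d] R_closed[OF d] by simp
    qed
    have "B.lim_to (\<lambda>n. b \<otimes>\<^bsub>B\<^esub> z n) (b \<otimes>\<^bsub>B\<^esub> c)"
      by (rule B.lim_to_mult[OF B.lim_to_const z(2)]) (use b c zc in auto)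
    then have "(\<lambda>n. B.gnorm (b \<otimes>\<^bsub>B\<^esub> z n)) \<longlonglongrightarrow> B.gnorm (b \<otimes>\<^bsub>B\<^esub> c)"
      by (rule B.gnorm_tendsto) (use b c zc in auto)
    moreover have "(\<lambda>n. cnorm A a * B.gnorm (z n)) \<longlonglongrightarrow> cnorm A a * B.gnorm c"
      by (intro tendsto_mult_left B.gnorm_tendsto[OF z(2) zc c])
    ultimately show ?thesis by (rule LIMSEQ_le) (use le in auto)
  qed
  then show ?thesis using normB b A.cnorm_nonneg[OF a] unfolding norming_def by blast
qed

end

text \<open>The hypotheses are symmetric; applying \<open>R_norm_le\<close> in both directions makes
  \<open>R\<close> isometric.\<close>

lemma moment_pair_swap: "moment_pair A \<alpha> B \<beta> x y \<Longrightarrow> moment_pair B \<beta> A \<alpha> y x"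
  unfolding moment_pair_def moment_pair_axioms_def word_pair_def word_pair_axioms_def by simp

context moment_pair begin

lemma R_swap: "(a, b) \<in> R \<Longrightarrow> (b, a) \<in> word_pair.R B A y x"
proof -
  interpret S: moment_pair B \<beta> A \<alpha> y x by (rule moment_pair_swap) unfold_locales
  show "(a, b) \<in> R \<Longrightarrow> (b, a) \<in> word_pair.R B A y x"
    by (induction rule: R.induct) (auto intro: S.R.intros)
qed

lemma R_norm: "(a, b) \<in> R \<Longrightarrow> cnorm B b = cnorm A a"
proof -
  interpret S: moment_pair B \<beta> A \<alpha> y x by (rule moment_pair_swap) unfold_locales
  show "(a, b) \<in> R \<Longrightarrow> cnorm B b = cnorm A a"
    using R_norm_le S.R_norm_le[OF R_swap] by (simp add: antisym)
qed

text \<open>The norm closure of the graph \<open>R\<close>, which turns out to be the graph of the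
  homomorphism.\<close>

definition cl :: "'a \<Rightarrow> 'b \<Rightarrow> bool" where
  "cl a b \<longleftrightarrow> a \<in> carrier A \<and> b \<in> carrier B \<and>
     (\<exists>u v. (\<forall>n. (u n, v n) \<in> R) \<and> A.lim_to u a \<and> B.lim_to v b)"

lemma clE:
  assumes "cl a b"
  obtains u v where "a \<in> carrier A" "b \<in> carrier B" "\<And>n. (u n, v n) \<in> R"
    "\<And>n. u n \<in> carrier A" "\<And>n. v n \<in> carrier B" "A.lim_to u a" "B.lim_to v b"
  using assms R_closed unfolding cl_def by meson

lemma cl_norm: "cl a b \<Longrightarrow> cnorm B b = cnorm A a"
proof (erule clE)
  fix u v assume *: "a \<in> carrier A" "b \<in> carrier B" "\<And>n. (u n, v n) \<in> R"
    "\<And>n. u n \<in> carrier A" "\<And>n. v n \<in> carrier B" "A.lim_to u a" "B.lim_to v b"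
  show ?thesis
    using LIMSEQ_unique[OF B.lim_to_nrm[OF *(7,5,2)], of "cnorm A a"] A.lim_to_nrm[OF *(6,4,1)]
    by (simp add: R_norm[OF *(3)])
qed

lemma cl_state: "cl a b \<Longrightarrow> \<beta> b = \<alpha> a"
proof (erule clE)
  fix u v assume *: "a \<in> carrier A" "b \<in> carrier B" "\<And>n. (u n, v n) \<in> R"
    "\<And>n. u n \<in> carrier A" "\<And>n. v n \<in> carrier B" "A.lim_to u a" "B.lim_to v b"
  show ?thesis
    using LIMSEQ_unique[OF B.rho_tendsto[OF *(7,5,2)], of "\<alpha> a"] A.rho_tendsto[OF *(6,4,1)]
    by (simp add: R_moment[OF *(3)])
qed

lemma cl_ops:
  assumes "cl a b" "cl a' b'"
  shows "cl (a \<oplus>\<^bsub>A\<^esub> a') (b \<oplus>\<^bsub>B\<^esub> b')" "cl (a \<otimes>\<^bsub>A\<^esub> a') (b \<otimes>\<^bsub>B\<^esub> b')"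
    "cl (c \<odot>\<^bsub>A\<^esub> a) (c \<odot>\<^bsub>B\<^esub> b)" "cl (star A a) (star B b)"
proof -
  obtain u v where uv: "a \<in> carrier A" "b \<in> carrier B" "\<And>n. (u n, v n) \<in> R"
    "\<And>n. u n \<in> carrier A" "\<And>n. v n \<in> carrier B" "A.lim_to u a" "B.lim_to v b"
    by (rule clE[OF assms(1)], rule that)
  obtain u' v' where uv': "a' \<in> carrier A" "b' \<in> carrier B" "\<And>n. (u' n, v' n) \<in> R"
    "\<And>n. u' n \<in> carrier A" "\<And>n. v' n \<in> carrier B" "A.lim_to u' a'" "B.lim_to v' b'"
    by (rule clE[OF assms(2)], rule that)
  show "cl (a \<oplus>\<^bsub>A\<^esub> a') (b \<oplus>\<^bsub>B\<^esub> b')"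
    unfolding cl_def using uv(1,2) uv'(1,2) R_add[OF uv'(3) uv(3)]
      A.lim_to_add[OF uv(6) uv'(6) uv(4) uv'(4) uv(1) uv'(1)]
      B.lim_to_add[OF uv(7) uv'(7) uv(5) uv'(5) uv(2) uv'(2)]
    by (intro conjI exI[of _ "\<lambda>n. u n \<oplus>\<^bsub>A\<^esub> u' n"] exI[of _ "\<lambda>n. v n \<oplus>\<^bsub>B\<^esub> v' n"]) auto
  show "cl (a \<otimes>\<^bsub>A\<^esub> a') (b \<otimes>\<^bsub>B\<^esub> b')"
    unfolding cl_def using uv(1,2) uv'(1,2) R_mult[OF uv(3) uv'(3)]
      A.lim_to_mult[OF uv(6) uv'(6) uv(4) uv'(4) uv(1) uv'(1)]
      B.lim_to_mult[OF uv(7) uv'(7) uv(5) uv'(5) uv(2) uv'(2)]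
    by (intro conjI exI[of _ "\<lambda>n. u n \<otimes>\<^bsub>A\<^esub> u' n"] exI[of _ "\<lambda>n. v n \<otimes>\<^bsub>B\<^esub> v' n"]) auto
  show "cl (c \<odot>\<^bsub>A\<^esub> a) (c \<odot>\<^bsub>B\<^esub> b)"
    unfolding cl_def using uv(1,2) R_smult[OF uv(3)]
      A.lim_to_smult[OF uv(6) uv(4) uv(1)] B.lim_to_smult[OF uv(7) uv(5) uv(2)]
    by (intro conjI exI[of _ "\<lambda>n. c \<odot>\<^bsub>A\<^esub> u n"] exI[of _ "\<lambda>n. c \<odot>\<^bsub>B\<^esub> v n"]) auto
  show "cl (star A a) (star B b)"
    unfolding cl_def using A.star_closed[OF uv(1)] B.star_closed[OF uv(2)] R_star[OF uv(3)]
      A.lim_to_star[OF uv(6) uv(4) uv(1)] B.lim_to_star[OF uv(7) uv(5) uv(2)]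
    by (intro conjI exI[of _ "\<lambda>n. star A (u n)"] exI[of _ "\<lambda>n. star B (v n)"]) auto
qed

lemma cl_R: "(a, b) \<in> R \<Longrightarrow> cl a b"
  unfolding cl_def using R_closed[of a b]
  by (intro conjI exI[of _ "\<lambda>_. a"] exI[of _ "\<lambda>_. b"]) auto

text \<open>By linearity the difference of two values is related to zero, and related elements have
  equal norms.\<close>

lemma cl_unique:
  assumes "cl a b" "cl a b'"
  shows "b = b'"
proof -
  have c: "a \<in> carrier A" "b \<in> carrier B" "b' \<in> carrier B" using assms by (auto simp: cl_def)
  have "cl (a \<oplus>\<^bsub>A\<^esub> (- 1) \<odot>\<^bsub>A\<^esub> a) (b \<oplus>\<^bsub>B\<^esub> (- 1) \<odot>\<^bsub>B\<^esub> b')"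
    by (rule cl_ops(1)[OF assms(1) cl_ops(3)[OF assms(2,2)]])
  then have "cl \<zero>\<^bsub>A\<^esub> (b \<ominus>\<^bsub>B\<^esub> b')"
    using c A.diff_self[OF c(1)] by (simp add: a_minus_def A.sm_minus_one B.sm_minus_one)
  then have "cnorm B (b \<ominus>\<^bsub>B\<^esub> b') = 0" by (simp add: cl_norm)
  then have "b \<ominus>\<^bsub>B\<^esub> b' = \<zero>\<^bsub>B\<^esub>" using c by (simp add: B.cnorm_eq_0)
  then show ?thesis by (rule B.diff_eq_zero[OF c(2,3)])
qed

text \<open>A sequence of combinations converging to \<open>a\<close> is Cauchy; by isometry the
  corresponding sequence in \<open>B\<close> is Cauchy too, and \<open>B\<close> is
  complete.\<close>

lemma cl_total:
  assumes a: "a \<in> carrier A"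
  shows "\<exists>b. cl a b"
proof -
  obtain u where u: "\<forall>n. u n \<in> fst ` R" "A.lim_to u a" using dense_A[OF a] by (auto simp: A.adh_def)
  have "\<exists>v. (u n, v) \<in> R" for n
  proof -
    have "u n \<in> fst ` R" using u(1) by blast
    then show ?thesis by auto
  qed
  then obtain v where v: "\<And>n. (u n, v n) \<in> R" by metis
  have uc: "u n \<in> carrier A" and vc: "v n \<in> carrier B" for n using R_closed[OF v] by auto
  have "A.cauchy_seq u" by (rule A.lim_to_cauchy[OF u(2) uc a])
  then have "B.cauchy_seq v"
    unfolding A.cauchy_seq_def B.cauchy_seq_def by (simp add: R_norm[OF R_diff[OF v v]])
  then obtain b where b: "b \<in> carrier B" "B.lim_to v b" by (rule B.cauchy_converges[OF _ vc])
  then show ?thesis using a u(2) v unfolding cl_def by blast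
qed

theorem moment_isometry:
  "\<exists>\<phi>. unital_star_hom A B \<phi> \<and> (\<forall>a\<in>carrier A. cnorm B (\<phi> a) = cnorm A a) \<and>
     (\<forall>a\<in>carrier A. \<beta> (\<phi> a) = \<alpha> a) \<and> (\<forall>i. \<phi> (x i) = y i)"
proof -
  define \<phi> where "\<phi> a = (THE b. cl a b)" for a
  have phi: "\<phi> a = b" if "cl a b" for a b
    unfolding \<phi>_def using that cl_unique by blast
  have cl_phi: "cl a (\<phi> a)" if "a \<in> carrier A" for a using cl_total[OF that] phi by metis
  have "unital_star_hom A B \<phi>"
  proof (rule unital_star_homI)
    fix a assume a: "a \<in> carrier A"
    show "\<phi> a \<in> carrier B" using cl_phi[OF a] by (simp add: cl_def)
    show "\<phi> (c \<odot>\<^bsub>A\<^esub> a) = c \<odot>\<^bsub>B\<^esub> \<phi> a" for c by (rule phi[OF cl_ops(3)[OF cl_phi[OF a] cl_phi[OF a]]])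
    show "\<phi> (star A a) = star B (\<phi> a)" by (rule phi[OF cl_ops(4)[OF cl_phi[OF a] cl_phi[OF a]]])
    fix b assume b: "b \<in> carrier A"
    show "\<phi> (a \<otimes>\<^bsub>A\<^esub> b) = \<phi> a \<otimes>\<^bsub>B\<^esub> \<phi> b" by (rule phi[OF cl_ops(2)[OF cl_phi[OF a] cl_phi[OF b]]])
    show "\<phi> (a \<oplus>\<^bsub>A\<^esub> b) = \<phi> a \<oplus>\<^bsub>B\<^esub> \<phi> b" by (rule phi[OF cl_ops(1)[OF cl_phi[OF a] cl_phi[OF b]]])
  next
    show "\<phi> \<one>\<^bsub>A\<^esub> = \<one>\<^bsub>B\<^esub>" using phi[OF cl_R[OF R_word[of "[]"]]] by simp
  qed
  moreover have "\<phi> (x i) = y i" for i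
  proof -
    have "x i \<in> carrier A" "y i \<in> carrier B" using rA rB by auto
    then show ?thesis
      using phi[OF cl_R[OF R_word[of "[(i, True)]"]]] by (simp add: A.mult_one_right B.mult_one_right)
  qed
  ultimately show ?thesis using cl_norm[OF cl_phi] cl_state[OF cl_phi] by blast
qed

end

section \<open>Ultrapowers\<close>

lemma ultrafilter_exists:
  fixes F :: "'i filter"
  assumes "F \<noteq> bot"
  shows "\<exists>U. ultrafilter U \<and> U \<le> F"
proof -
  \<comment> \<open>Filters are encoded by their sets of eventually true predicates. The order
    reverses, so a maximal set is a minimal proper filter.\<close>
  define ev where "ev G = {P :: 'i \<Rightarrow> bool. eventually P G}" for G
  define X where "X = ev ` {G. G \<noteq> bot \<and> G \<le> F}"
  have ev_le: "G \<le> H \<longleftrightarrow> ev H \<subseteq> ev G" for G H by (auto simp: ev_def le_filter_def)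
  have "\<exists>M\<in>X. \<forall>S\<in>X. M \<subseteq> S \<longrightarrow> S = M"
  proof (rule subset_Zorn_nonempty)
    show "X \<noteq> {}" using assms by (auto simp: X_def)
    fix C assume C: "C \<noteq> {}" "subset.chain X C"
    define B where "B = {G. G \<noteq> bot \<and> G \<le> F \<and> ev G \<in> C}"
    have CX: "C \<subseteq> X" using C(2) by (simp add: subset_chain_def)
    have B_ne: "B \<noteq> {}" using C(1) CX by (auto simp: B_def X_def)
    \<comment> \<open>In a chain any two filters have the smaller one below both, so what holds
      eventually for the infimum holds eventually for some member; hence the infimum is
      proper.\<close>
    have base: "eventually P (Inf B) \<longleftrightarrow> (\<exists>G\<in>B. eventually P G)" for P
    proof (rule eventually_Inf_base[OF B_ne])
      fix G H assume "G \<in> B" "H \<in> B"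
      moreover from this have "ev G \<subseteq> ev H \<or> ev H \<subseteq> ev G"
        using C(2) by (auto simp: B_def subset_chain_def)
      ultimately show "\<exists>K\<in>B. K \<le> inf G H" by (auto simp: ev_le[symmetric])
    qed
    have "Inf B \<noteq> bot"
      using base[of "\<lambda>_. False"] by (auto simp: B_def trivial_limit_def[symmetric])
    moreover obtain G where "G \<in> B" using B_ne by blast
    then have "Inf B \<le> F" using Inf_lower[of G B] by (auto simp: B_def)
    ultimately have "ev (Inf B) \<in> X" by (auto simp: X_def)
    moreover have "\<Union>C = ev (Inf B)"
    proof -
      have "P \<in> \<Union>C \<longleftrightarrow> (\<exists>G\<in>B. eventually P G)" for P
        using CX by (force simp: B_def X_def ev_def)
      then show ?thesis by (auto simp: base ev_def)
    qed
    ultimately show "\<Union>C \<in> X" by simp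
  qed
  then obtain U where U: "U \<noteq> bot" "U \<le> F" and max: "\<And>S. S \<in> X \<Longrightarrow> ev U \<subseteq> S \<Longrightarrow> S = ev U"
    by (auto simp: X_def)
  have "eventually P U \<or> eventually (\<lambda>i. \<not> P i) U" for P
  proof (rule ccontr)
    assume *: "\<not> (eventually P U \<or> eventually (\<lambda>i. \<not> P i) U)"
    \<comment> \<open>If \<open>U\<close> decided neither \<open>P\<close> nor its negation, adding
      the negation would give a strictly finer proper filter.\<close>
    define G where "G = inf U (principal {i. \<not> P i})"
    have ev_G: "eventually Q G \<longleftrightarrow> eventually (\<lambda>i. \<not> P i \<longrightarrow> Q i) U" for Q
      by (simp add: G_def eventually_inf_principal)
    have "G \<noteq> bot" using * ev_G[of "\<lambda>_. False"] by (auto simp: trivial_limit_def)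
    moreover have "G \<le> U" by (simp add: G_def)
    ultimately have "ev G \<in> X" "ev U \<subseteq> ev G" using U(2) by (auto simp: X_def ev_le[symmetric])
    then have "ev G = ev U" by (rule max)
    moreover have "(\<lambda>i. \<not> P i) \<in> ev G" using ev_G[of "\<lambda>i. \<not> P i"] by (simp add: ev_def)
    ultimately show False using * by (simp add: ev_def)
  qed
  then show ?thesis using U by (auto simp: ultrafilter_def)
qed

section \<open>Bounded families modulo families with vanishing ultralimit of norms\<close>

lemma linf_simps [simp]:
  "mult (linf A) = (\<lambda>x y i. x i \<otimes>\<^bsub>A\<^esub> y i)" "one (linf A) = (\<lambda>i. \<one>\<^bsub>A\<^esub>)"
  "zero (linf A) = (\<lambda>i. \<zero>\<^bsub>A\<^esub>)" "add (linf A) = (\<lambda>x y i. x i \<oplus>\<^bsub>A\<^esub> y i)"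
  "smult (linf A) = (\<lambda>c x i. c \<odot>\<^bsub>A\<^esub> x i)" "star (linf A) = (\<lambda>x i. star A (x i))"
  by (simp_all add: linf_def)

context unital_cstar_algebra begin

lemma diff_closed: "x \<in> carrier A \<Longrightarrow> y \<in> carrier A \<Longrightarrow> x \<ominus> y \<in> carrier A"
  by simp

lemma linf_carrier: "x \<in> carrier (linf A) \<longleftrightarrow> (\<forall>i. x i \<in> carrier A) \<and> (\<exists>K. \<forall>i. cnorm A (x i) \<le> K)"
  by (auto simp: linf_def bdd_above_def)

lemma linfI: "(\<And>i. x i \<in> carrier A) \<Longrightarrow> (\<And>i. cnorm A (x i) \<le> K) \<Longrightarrow> x \<in> carrier (linf A)"
  by (auto simp: linf_carrier)

lemma linfD: "x \<in> carrier (linf A) \<Longrightarrow> x i \<in> carrier A"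
  by (simp add: linf_carrier)

lemma linf_bound:
  assumes "x \<in> carrier (linf A)"
  obtains K where "0 \<le> K" "\<And>i. cnorm A (x i) \<le> K"
proof -
  obtain K where K: "\<And>i. cnorm A (x i) \<le> K" using assms by (auto simp: linf_carrier)
  \<comment> \<open>\<open>undefined\<close> stands for some index; types are nonempty, and
    \<open>K\<close> dominates a norm there.\<close>
  moreover have "0 \<le> K" using K[of undefined] cnorm_nonneg[OF linfD[OF assms, of undefined]] by linarith
  ultimately show ?thesis using that by blast
qed

lemma linf_add: "x \<in> carrier (linf A) \<Longrightarrow> y \<in> carrier (linf A) \<Longrightarrow> (\<lambda>i. x i \<oplus> y i) \<in> carrier (linf A)"
proof -
  assume x: "x \<in> carrier (linf A)" and y: "y \<in> carrier (linf A)"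
  obtain K L where K: "\<And>i. cnorm A (x i) \<le> K" and L: "\<And>i. cnorm A (y i) \<le> L"
    using linf_bound[OF x] linf_bound[OF y] by metis
  show ?thesis
  proof (rule linfI)
    show "cnorm A (x i \<oplus> y i) \<le> K + L" for i
      using cnorm_triangle[OF linfD[OF x] linfD[OF y], of i i] K[of i] L[of i] by linarith
  qed (use linfD[OF x] linfD[OF y] in simp)
qed

lemma linf_mult: "x \<in> carrier (linf A) \<Longrightarrow> y \<in> carrier (linf A) \<Longrightarrow> (\<lambda>i. x i \<otimes> y i) \<in> carrier (linf A)"
proof -
  assume x: "x \<in> carrier (linf A)" and y: "y \<in> carrier (linf A)"
  obtain K where K: "0 \<le> K" "\<And>i. cnorm A (x i) \<le> K" by (rule linf_bound[OF x], rule that)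
  obtain L where L: "0 \<le> L" "\<And>i. cnorm A (y i) \<le> L" by (rule linf_bound[OF y], rule that)
  show ?thesis
  proof (rule linfI)
    show "cnorm A (x i \<otimes> y i) \<le> K * L" for i
      using cnorm_mult[OF linfD[OF x] linfD[OF y], of i i]
        mult_mono[OF K(2)[of i] L(2)[of i] K(1) cnorm_nonneg[OF linfD[OF y]]] by linarith
  qed (use linfD[OF x] linfD[OF y] in simp)
qed

lemma linf_smult: "x \<in> carrier (linf A) \<Longrightarrow> (\<lambda>i. c \<odot> x i) \<in> carrier (linf A)"
proof -
  assume x: "x \<in> carrier (linf A)"
  obtain K where K: "\<And>i. cnorm A (x i) \<le> K" using linf_bound[OF x] by metis
  show ?thesis
    by (rule linfI[where K = "cmod c * K"])
      (use linfD[OF x] K in \<open>simp_all add: cnorm_smult mult_left_mono\<close>)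
qed

lemma linf_star: "x \<in> carrier (linf A) \<Longrightarrow> (\<lambda>i. star A (x i)) \<in> carrier (linf A)"
  by (auto simp: linf_carrier star_closed cnorm_star)

lemma linf_const: "a \<in> carrier A \<Longrightarrow> (\<lambda>i. a) \<in> carrier (linf A)"
  by (auto simp: linf_carrier)

lemma linf_module: "Module.module complex_ring (linf A :: ('i \<Rightarrow> 'a) cstar)"
proof (rule complex_moduleI)
  show "abelian_group (linf A :: ('i \<Rightarrow> 'a) cstar)"
  proof (rule abelian_groupI)
    fix x :: "'i \<Rightarrow> 'a" assume x: "x \<in> carrier (linf A)"
    have "(\<lambda>i. (- 1) \<odot> x i) \<oplus>\<^bsub>linf A\<^esub> x = \<zero>\<^bsub>linf A\<^esub>"
    proof (rule ext)
      fix i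
      have "\<ominus> x i \<oplus> x i = \<zero>" using linfD[OF x, of i] by algebra
      then show "((\<lambda>i. (- 1) \<odot> x i) \<oplus>\<^bsub>linf A\<^esub> x) i = \<zero>\<^bsub>linf A\<^esub> i"
        using linfD[OF x, of i] by (simp add: sm_minus_one)
    qed
    then show "\<exists>y\<in>carrier (linf A). y \<oplus>\<^bsub>linf A\<^esub> x = \<zero>\<^bsub>linf A\<^esub>" using linf_smult[OF x] by blast
  next
    fix x y :: "'i \<Rightarrow> 'a" assume x: "x \<in> carrier (linf A)" and y: "y \<in> carrier (linf A)"
    show "x \<oplus>\<^bsub>linf A\<^esub> y \<in> carrier (linf A)" using linf_add[OF x y] by simp
    show "x \<oplus>\<^bsub>linf A\<^esub> y = y \<oplus>\<^bsub>linf A\<^esub> x"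
    proof (rule ext)
      fix i
      have "x i \<oplus> y i = y i \<oplus> x i" using linfD[OF x, of i] linfD[OF y, of i] by algebra
      then show "(x \<oplus>\<^bsub>linf A\<^esub> y) i = (y \<oplus>\<^bsub>linf A\<^esub> x) i" by simp
    qed
  qed (auto simp: linf_const vec_assoc linfD)
qed (auto simp: linf_smult sm_add_left sm_add_right sm_assoc linfD intro!: ext)

lemma linf_ring: "ring (linf A :: ('i \<Rightarrow> 'a) cstar)"
proof (rule ringI)
  interpret L: cvec "linf A :: ('i \<Rightarrow> 'a) cstar" using linf_module by (simp add: cvec_def)
  show "abelian_group (linf A :: ('i \<Rightarrow> 'a) cstar)" ..
  show "monoid (linf A :: ('i \<Rightarrow> 'a) cstar)"
    by (rule monoidI) (auto simp: linf_mult linf_const mult_assoc linfD mult_one_right)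
qed (auto simp: distrib_l distrib_r linfD)

lemma linf_diff:
  fixes x y :: "'i \<Rightarrow> 'a"
  assumes "x \<in> carrier (linf A)" "y \<in> carrier (linf A)"
  shows "x \<ominus>\<^bsub>linf A\<^esub> y = (\<lambda>i. x i \<ominus> y i)"
proof -
  interpret L: cvec "linf A :: ('i \<Rightarrow> 'a) cstar" using linf_module by (simp add: cvec_def)
  show ?thesis using assms by (simp add: a_minus_def L.sm_minus_one sm_minus_one linfD)
qed

lemma ultra_null_iff:
  "x \<in> ultra_null A U \<longleftrightarrow> x \<in> carrier (linf A) \<and> ((\<lambda>i. cnorm A (x i)) \<longlongrightarrow> 0) U"
  by (simp add: ultra_null_def)

lemma null_bound:
  assumes "\<And>i. x i \<in> carrier A" "\<And>i. cnorm A (x i) \<le> g i" "(g \<longlongrightarrow> 0) U"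
  shows "((\<lambda>i. cnorm A (x i)) \<longlongrightarrow> 0) U"
  by (rule tendsto_sandwich[of "\<lambda>_. 0" _ _ g]) (auto simp: assms cnorm_nonneg)

lemma ultra_null_ideal:
  fixes U :: "'i filter"
  shows "ideal (ultra_null A U) (linf A)"
proof (rule idealI)
  interpret L: cvec "linf A :: ('i \<Rightarrow> 'a) cstar" using linf_module by (simp add: cvec_def)
  show "ring (linf A :: ('i \<Rightarrow> 'a) cstar)" by (rule linf_ring)
  show "subgroup (ultra_null A U) (add_monoid (linf A))"
  proof (rule L.M.add.subgroupI)
    show "ultra_null A U \<subseteq> carrier (linf A)" by (auto simp: ultra_null_iff)
    have "(\<lambda>i. \<zero>) \<in> ultra_null A U" by (simp add: ultra_null_iff linf_const)
    then show "ultra_null A U \<noteq> {}" by blast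
    fix x :: "'i \<Rightarrow> 'a" assume x: "x \<in> ultra_null A U"
    then have xc: "x \<in> carrier (linf A)" by (simp add: ultra_null_iff)
    have "(\<lambda>i. (- 1) \<odot> x i) \<in> ultra_null A U"
      using x linf_smult[OF xc, of "- 1"] linfD[OF xc] by (simp add: ultra_null_iff cnorm_smult)
    moreover have "\<ominus>\<^bsub>linf A\<^esub> x = (\<lambda>i. (- 1) \<odot> x i)" using xc by (simp add: L.sm_minus_one)
    ultimately show "\<ominus>\<^bsub>linf A\<^esub> x \<in> ultra_null A U" by simp
    fix y :: "'i \<Rightarrow> 'a" assume y: "y \<in> ultra_null A U"
    then have yc: "y \<in> carrier (linf A)" by (simp add: ultra_null_iff)
    have "((\<lambda>i. cnorm A (x i) + cnorm A (y i)) \<longlongrightarrow> 0 + 0) U"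
      using x y by (intro tendsto_add) (auto simp: ultra_null_iff)
    then have "((\<lambda>i. cnorm A (x i \<oplus> y i)) \<longlongrightarrow> 0) U"
      by (intro null_bound[where g = "\<lambda>i. cnorm A (x i) + cnorm A (y i)"])
        (use linfD[OF xc] linfD[OF yc] in \<open>auto simp: cnorm_triangle\<close>)
    then show "x \<oplus>\<^bsub>linf A\<^esub> y \<in> ultra_null A U"
      using linf_add[OF xc yc] by (simp add: ultra_null_iff)
  qed
  fix a x :: "'i \<Rightarrow> 'a" assume a: "a \<in> ultra_null A U" and x: "x \<in> carrier (linf A)"
  then have ac: "a \<in> carrier (linf A)" by (simp add: ultra_null_iff)
  obtain K where K: "0 \<le> K" "\<And>i. cnorm A (x i) \<le> K" by (rule linf_bound[OF x], rule that)
  have lim: "((\<lambda>i. K * cnorm A (a i)) \<longlongrightarrow> 0) U"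
    using tendsto_mult_left[of "\<lambda>i. cnorm A (a i)" 0 U K] a by (simp add: ultra_null_iff)
  have 1: "cnorm A (x i \<otimes> a i) \<le> K * cnorm A (a i)" for i
    using cnorm_mult[OF linfD[OF x] linfD[OF ac], of i i]
      mult_right_mono[OF K(2)[of i] cnorm_nonneg[OF linfD[OF ac, of i]]] by linarith
  have 2: "cnorm A (a i \<otimes> x i) \<le> K * cnorm A (a i)" for i
    using cnorm_mult[OF linfD[OF ac] linfD[OF x], of i i]
      mult_left_mono[OF K(2)[of i] cnorm_nonneg[OF linfD[OF ac, of i]]]
    by (simp add: mult.commute[of K])
  show "x \<otimes>\<^bsub>linf A\<^esub> a \<in> ultra_null A U"
    using linf_mult[OF x ac] null_bound[OF _ 1 lim] linfD[OF x] linfD[OF ac] by (simp add: ultra_null_iff)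
  show "a \<otimes>\<^bsub>linf A\<^esub> x \<in> ultra_null A U"
    using linf_mult[OF ac x] null_bound[OF _ 2 lim] linfD[OF x] linfD[OF ac] by (simp add: ultra_null_iff)
qed

definition qcls :: "'i filter \<Rightarrow> ('i \<Rightarrow> 'a) \<Rightarrow> ('i \<Rightarrow> 'a) set" where
  "qcls U x = ultra_null A U +>\<^bsub>linf A\<^esub> x"

lemma qcls_eq_iff:
  fixes x y :: "'i \<Rightarrow> 'a"
  assumes "x \<in> carrier (linf A)" "y \<in> carrier (linf A)"
  shows "qcls U x = qcls U y \<longleftrightarrow> ((\<lambda>i. cnorm A (x i \<ominus> y i)) \<longlongrightarrow> 0) U"
proof -
  interpret L: cvec "linf A :: ('i \<Rightarrow> 'a) cstar" using linf_module by (simp add: cvec_def)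
  interpret J: ideal "ultra_null A U" "linf A" by (rule ultra_null_ideal)
  have "qcls U x = qcls U y \<longleftrightarrow> x \<ominus>\<^bsub>linf A\<^esub> y \<in> ultra_null A U"
    unfolding qcls_def using J.quotient_eq_iff_same_a_r_cos[OF J.ideal_axioms assms] by simp
  also have "\<dots> \<longleftrightarrow> ((\<lambda>i. cnorm A (x i \<ominus> y i)) \<longlongrightarrow> 0) U"
    using L.M.minus_closed[OF assms] by (simp add: ultra_null_iff linf_diff[OF assms])
  finally show ?thesis .
qed

lemma mem_qcls:
  assumes "x \<in> carrier (linf A)"
  shows "x \<in> qcls U x" "y \<in> qcls U x \<Longrightarrow> y \<in> carrier (linf A) \<and> qcls U y = qcls U x"
proof -
  interpret J: ideal "ultra_null A U" "linf A" by (rule ultra_null_ideal)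
  show "x \<in> qcls U x" unfolding qcls_def by (rule J.a_rcos_self[OF assms])
  assume y: "y \<in> qcls U x"
  then have "y \<in> carrier (linf A)" unfolding qcls_def using J.a_elemrcos_carrier[OF assms] by blast
  moreover have "qcls U x = qcls U y"
    using y unfolding qcls_def by (rule J.a_repr_independence'[OF _ assms])
  ultimately show "y \<in> carrier (linf A) \<and> qcls U y = qcls U x" by simp
qed

lemma ultrapower_fields:
  "carrier (ultrapower A U) = carrier (linf A Quot ultra_null A U)"
  "mult (ultrapower A U) = mult (linf A Quot ultra_null A U)"
  "add (ultrapower A U) = add (linf A Quot ultra_null A U)"
  "one (ultrapower A U) = one (linf A Quot ultra_null A U)"
  by (simp_all add: ultrapower_def Let_def)

lemma qcls_ring_hom: "qcls U \<in> ring_hom (linf A) (ultrapower A U)"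
proof -
  interpret J: ideal "ultra_null A U" "linf A" by (rule ultra_null_ideal)
  have "(+>\<^bsub>linf A\<^esub>) (ultra_null A U) \<in> ring_hom (linf A) (linf A Quot ultra_null A U)"
    by (rule J.rcos_ring_hom)
  then show ?thesis by (auto simp: ring_hom_def ultrapower_fields qcls_def Pi_iff)
qed

text \<open>Operations on the quotient are unions of cosets over all representatives. When
  \<open>t\<close> scales distances by a constant, these cosets coincide and the union is a single
  class; this covers scalar multiplication and adjoint.\<close>

lemma qcls_Union:
  assumes x: "x \<in> carrier (linf A)" and t: "\<And>y. y \<in> carrier (linf A) \<Longrightarrow> t y \<in> carrier (linf A)"
    and lip: "\<And>y i. y \<in> carrier (linf A) \<Longrightarrow> cnorm A (t y i \<ominus> t x i) = K * cnorm A (y i \<ominus> x i)"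
  shows "(\<Union>y\<in>qcls U x. ultra_null A U +>\<^bsub>linf A\<^esub> t y) = qcls U (t x)"
proof -
  have "(\<Union>y\<in>qcls U x. ultra_null A U +>\<^bsub>linf A\<^esub> t y) = (\<Union>y\<in>qcls U x. qcls U (t x))"
  proof (rule SUP_cong[OF refl])
    fix y assume "y \<in> qcls U x"
    then have y: "y \<in> carrier (linf A)" "qcls U y = qcls U x" using mem_qcls(2)[OF x] by auto
    then have "((\<lambda>i. cnorm A (y i \<ominus> x i)) \<longlongrightarrow> 0) U" using qcls_eq_iff[OF y(1) x] by simp
    then have "((\<lambda>i. cnorm A (t y i \<ominus> t x i)) \<longlongrightarrow> 0) U"
      using tendsto_mult_left[of "\<lambda>i. cnorm A (y i \<ominus> x i)" 0 U K] by (simp add: lip[OF y(1)])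
    then show "ultra_null A U +>\<^bsub>linf A\<^esub> t y = qcls U (t x)"
      using qcls_eq_iff[OF t[OF y(1)] t[OF x]] by (simp add: qcls_def)
  qed
  also have "\<dots> = qcls U (t x)" using mem_qcls(1)[OF x] by auto
  finally show ?thesis .
qed

lemma qcls_smult:
  assumes x: "x \<in> carrier (linf A)"
  shows "c \<odot>\<^bsub>ultrapower A U\<^esub> qcls U x = qcls U (\<lambda>i. c \<odot> x i)"
proof -
  have "c \<odot>\<^bsub>ultrapower A U\<^esub> qcls U x = (\<Union>y\<in>qcls U x. ultra_null A U +>\<^bsub>linf A\<^esub> (\<lambda>i. c \<odot> y i))"
    by (simp add: ultrapower_def Let_def)
  also have "\<dots> = qcls U (\<lambda>i. c \<odot> x i)"
    by (rule qcls_Union[OF x, where t = "\<lambda>y i. c \<odot> y i"])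
      (auto simp: linf_smult nrm_diff_smult linfD[OF x] linfD)
  finally show ?thesis .
qed

lemma qcls_star:
  assumes x: "x \<in> carrier (linf A)"
  shows "star (ultrapower A U) (qcls U x) = qcls U (\<lambda>i. star A (x i))"
proof -
  have "star (ultrapower A U) (qcls U x) = (\<Union>y\<in>qcls U x. ultra_null A U +>\<^bsub>linf A\<^esub> (\<lambda>i. star A (y i)))"
    by (simp add: ultrapower_def Let_def)
  also have "\<dots> = qcls U (\<lambda>i. star A (x i))"
    by (rule qcls_Union[OF x, where t = "\<lambda>y i. star A (y i)" and K = 1])
      (auto simp: linf_star star_diff[symmetric] cnorm_star linfD[OF x] linfD)
  finally show ?thesis .
qed

end

lemma (in cstar_state) rho_diff:
  "x \<in> carrier A \<Longrightarrow> y \<in> carrier A \<Longrightarrow> \<rho> (x \<ominus> y) = \<rho> x - \<rho> y"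
  by (simp add: a_minus_def sm_minus_one rho_add rho_smult)

text \<open>The value is a definite description; \<open>\<rho>\<close> is dominated by the norm, so
  all representatives have the same limit along \<open>U\<close>.\<close>

lemma (in cstar_state) ultrapower_state_qcls:
  assumes U: "U \<noteq> bot" and x: "x \<in> carrier (linf A)" and lim: "((\<lambda>i. \<rho> (x i)) \<longlongrightarrow> z) U"
  shows "ultrapower_state \<rho> U (qcls U x) = z"
  unfolding ultrapower_state_def
proof (rule the_equality)
  show "\<exists>y\<in>qcls U x. ((\<lambda>i. \<rho> (y i)) \<longlongrightarrow> z) U" using mem_qcls(1)[OF x] lim by blast
  fix w assume "\<exists>y\<in>qcls U x. ((\<lambda>i. \<rho> (y i)) \<longlongrightarrow> w) U"
  then obtain y where y: "y \<in> qcls U x" "((\<lambda>i. \<rho> (y i)) \<longlongrightarrow> w) U" by blast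
  then have yc: "y \<in> carrier (linf A)" "qcls U y = qcls U x" using mem_qcls(2)[OF x] by auto
  have d: "((\<lambda>i. cnorm A (y i \<ominus> x i)) \<longlongrightarrow> 0) U" using qcls_eq_iff[OF yc(1) x] yc(2) by simp
  have "((\<lambda>i. cmod (\<rho> (y i) - \<rho> (x i))) \<longlongrightarrow> 0) U"
  proof (rule tendsto_sandwich[OF _ _ tendsto_const d])
    show "\<forall>\<^sub>F i in U. cmod (\<rho> (y i) - \<rho> (x i)) \<le> cnorm A (y i \<ominus> x i)"
    proof (rule always_eventually, rule allI)
      fix i
      show "cmod (\<rho> (y i) - \<rho> (x i)) \<le> cnorm A (y i \<ominus> x i)"
        using rho_bound[of "y i \<ominus> x i"] linfD[OF x, of i] linfD[OF yc(1), of i] by (simp add: rho_diff)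
    qed
  qed simp
  then have "((\<lambda>i. \<rho> (y i) - \<rho> (x i)) \<longlongrightarrow> 0) U" by (simp add: tendsto_norm_zero_iff)
  from tendsto_add[OF this lim] have "((\<lambda>i. \<rho> (y i)) \<longlongrightarrow> z) U" by simp
  then show "w = z" using tendsto_unique[OF U y(2)] by blast
qed

section \<open>A criterion for selflessness\<close>

context cstar_state begin

lemma norming_zero:
  assumes "norming A \<rho>" "a \<in> carrier A" "\<And>b. b \<in> carrier A \<Longrightarrow> gnorm (a \<otimes> b) = 0"
  shows "a = \<zero>"
proof -
  have "cnorm A a \<le> 0" using assms unfolding norming_def by auto
  then show ?thesis using cnorm_nonneg[OF assms(2)] cnorm_eq_0[OF assms(2)] by simp
qed

lemma gns_pre_rep: "pre_rep A (gns_prespace A \<rho>) (mult A)"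
  by (intro pre_rep.intro pre_rep_axioms.intro unital_cstar_algebra_axioms gns_semi_ip)
    (simp_all add: distrib_l distrib_r smult_mult_left smult_mult_right rho_add rho_smult star_closed
      star_mult star_star mult_assoc)

text \<open>If two elements act equally on the GNS space, their difference sends every vector to a
  null vector, so \<open>norming\<close> applies to it with the bound 0.\<close>

lemma norming_faithful:
  assumes norming: "norming A \<rho>"
  shows "faithful_gns A \<rho>"
  unfolding faithful_gns_def
proof (rule inj_onI)
  interpret R: pre_rep A "gns_prespace A \<rho>" "mult A" by (rule gns_pre_rep)
  fix a b assume a: "a \<in> carrier A" and b: "b \<in> carrier A" and eq: "gns_rep A \<rho> a = gns_rep A \<rho> b"
  have "gnorm ((a \<ominus> b) \<otimes> z) = 0" if z: "z \<in> carrier A" for z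
  proof -
    interpret H: hilbert "completion (gns_prespace A \<rho>)" by (rule G.completion_hilbert)
    have "completion_vec (gns_prespace A \<rho>) (a \<otimes> z) = completion_vec (gns_prespace A \<rho>) (b \<otimes> z)"
      using fun_cong[OF eq, of "completion_vec (gns_prespace A \<rho>) z"] R.Pi_vec[of a z] R.Pi_vec[of b z] a b z
      by (simp add: gns_rep_def)
    then have "completion_vec (gns_prespace A \<rho>) (a \<otimes> z \<ominus>\<^bsub>gns_prespace A \<rho>\<^esub> b \<otimes> z)
        = \<zero>\<^bsub>completion (gns_prespace A \<rho>)\<^esub>"
      using a b z H.diff_self[OF G.completion_vec_carrier, of "b \<otimes> z"]
      by (simp add: G.completion_vec_diff[symmetric])
    then have "gnorm (a \<otimes> z \<ominus>\<^bsub>gns_prespace A \<rho>\<^esub> b \<otimes> z) = 0"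
      using a b z G.completion_vec_norm[of "a \<otimes> z \<ominus>\<^bsub>gns_prespace A \<rho>\<^esub> b \<otimes> z"]
        G.M.minus_closed[of "a \<otimes> z" "b \<otimes> z"] H.nrm_zero by simp
    moreover have "a \<otimes> z \<ominus>\<^bsub>gns_prespace A \<rho>\<^esub> b \<otimes> z = a \<otimes> z \<ominus> b \<otimes> z"
      by (rule cvec_diff_cong[OF cvec_module]) (use a b z G.cvec_axioms in \<open>auto simp: cvec_def\<close>)
    moreover have "a \<otimes> z \<ominus> b \<otimes> z = (a \<ominus> b) \<otimes> z" using a b z by algebra
    ultimately show ?thesis by simp
  qed
  then have "a \<ominus> b = \<zero>" using a b by (intro norming_zero[OF norming]) auto
  then show "a = b" by (rule diff_eq_zero[OF a b])
qed

text \<open>An element \<open>d\<close> with image zero makes the state vanish on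
  \<open>star A (d z)\<close> times \<open>d z\<close> for every \<open>z\<close>; so
  \<open>d\<close> acts as zero on GNS vectors and \<open>norming\<close> kills it.\<close>

lemma state_hom_inj:
  assumes B: "unital_cstar_algebra B" and hom: "unital_star_hom A B \<theta>"
    and st: "\<And>a. a \<in> carrier A \<Longrightarrow> \<tau> (\<theta> a) = \<rho> a" and norming: "norming A \<rho>"
  shows "inj_on \<theta> (carrier A)"
proof (rule inj_onI)
  interpret B: unital_cstar_algebra B by fact
  note h = unital_star_homD[OF hom]
  fix a b assume a: "a \<in> carrier A" and b: "b \<in> carrier A" and eq: "\<theta> a = \<theta> b"
  let ?d = "a \<ominus> b"
  have d: "?d \<in> carrier A" using a b by simp
  have d0: "\<theta> ?d = \<zero>\<^bsub>B\<^esub>"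
    using star_hom_diff[OF unital_cstar_algebra_axioms B hom a b] eq h(1)[OF b] by simp
  have "gnorm (?d \<otimes> z) = 0" if z: "z \<in> carrier A" for z
  proof -
    have dz: "?d \<otimes> z \<in> carrier A" using d z by simp
    have "\<theta> (star A (?d \<otimes> z) \<otimes> (?d \<otimes> z)) = \<theta> \<zero>"
      using d z dz d0 h(5)[of \<zero> 0] h(1)[OF z] h(1)[of "star A (?d \<otimes> z)"]
      by (simp add: h(2) star_closed B.sm_zero_left h(1))
    then have "\<rho> (star A (?d \<otimes> z) \<otimes> (?d \<otimes> z)) = 0"
      using st[of "star A (?d \<otimes> z) \<otimes> (?d \<otimes> z)"] st[of \<zero>] dz star_closed[OF dz] rho_smult[of \<zero> 0]
      by simp
    then show ?thesis by (simp add: vnorm_def)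
  qed
  then have "?d = \<zero>" by (rule norming_zero[OF norming d])
  then show "a = b" by (rule diff_eq_zero[OF a b])
qed

end

text \<open>The bijection fixes the first \<open>k\<close> indices of the first copy.\<close>

definition shuffle :: "nat \<Rightarrow> nat \<times> bool \<Rightarrow> nat" where
  "shuffle k p = (if snd p then if fst p < k then fst p else k + 2 * (fst p - k) else k + 2 * fst p + 1)"

text \<open>Beyond \<open>k\<close> the even offsets carry the rest of the first copy and the odd
  offsets the whole second copy. Surjectivity matters: the permuted sequence still has to generate
  the algebra.\<close>

lemma bij_shuffle: "bij (shuffle k)"
proof (rule bijI)
  show "inj (shuffle k)"
  proof (rule inj_on_inverseI)
    fix p
    show "(\<lambda>n. if n < k then (n, True) else if even (n - k) then (k + (n - k) div 2, True)
      else ((n - k) div 2, False)) (shuffle k p) = p"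
      by (cases p) (auto simp: shuffle_def)
  qed
  show "surj (shuffle k)"
  proof (rule surjI)
    fix n
    show "shuffle k (if n < k then (n, True) else if even (n - k) then (k + (n - k) div 2, True)
      else ((n - k) div 2, False)) = n"
    proof (cases "n < k")
      case False
      then obtain d where d: "n = k + d" using le_Suc_ex[of k n] by auto
      show ?thesis unfolding d by (cases "even d") (auto simp: shuffle_def elim!: evenE oddE)
    qed (simp add: shuffle_def)
  qed
qed

theorem selfless_criterion:
  fixes A :: "('a, 'm) cstar_scheme" and x :: "nat \<Rightarrow> 'a"
  defines "e \<equiv> \<lambda>b. if b then 1 else 2 :: nat"
  assumes A: "cstar_state A \<rho>" and norming: "norming A \<rho>" and gen: "generates A (range x)"
    and nontrivial: "carrier A \<noteq> range (\<lambda>c. c \<odot>\<^bsub>A\<^esub> \<one>\<^bsub>A\<^esub>)"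
    and moments: "\<And>f w. inj f \<Longrightarrow>
      free_product_state {1, 2} (\<lambda>_. A) (\<lambda>_. \<rho>) (cword (free_product {1, 2} (\<lambda>_. A) (\<lambda>_. \<rho>))
        (\<lambda>p. free_embedding {1, 2} (\<lambda>_. A) (\<lambda>_. \<rho>) (e (snd p)) (x (fst p))) w)
      = \<rho> (cword A (x \<circ> f) w)"
  shows "selfless A \<rho>"
proof -
  \<comment> \<open>The factor index \<open>1\<close> must not be rewritten to \<open>Suc 0\<close>,
    or terms over \<open>{1, 2}\<close> stop matching.\<close>
  note One_nat_def [simp del]
  interpret A: cstar_state A \<rho> by fact
  interpret F: free_family "{1, 2 :: nat}" "\<lambda>_. A" "\<lambda>_. \<rho>" by unfold_locales
  interpret B: cstar_state F.\<P> F.\<omega> by (rule F.free_product_cstar_state)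
  define \<theta> where "\<theta> = F.emb 1"
  define y where "y = (\<lambda>p. F.emb (e (snd p)) (x (fst p)))"
  have e: "e b \<in> {1, 2}" for b by (simp add: e_def)
  have genB: "generates F.\<P> (range y)"
  proof -
    have "(\<Union>i\<in>{1, 2}. F.emb i ` range x) = range y"
    proof (intro equalityI subsetI)
      fix z assume "z \<in> (\<Union>i\<in>{1, 2}. F.emb i ` range x)"
      then obtain i n where i: "i = 1 \<or> i = 2" and z: "z = F.emb i (x n)" by blast
      from i have "z = y (n, i = 1)" unfolding z by (auto simp: y_def e_def)
      then show "z \<in> range y" by simp
    next
      fix z assume "z \<in> range y"
      then obtain p where "z = F.emb (e (snd p)) (x (fst p))" by (auto simp: y_def)
      then show "z \<in> (\<Union>i\<in>{1, 2}. F.emb i ` range x)" using e[of "snd p"] by blast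
    qed
    then show ?thesis using F.free_product_generates[of "\<lambda>_. range x"] gen by simp
  qed
  \<comment> \<open>For each \<open>k\<close> the moments of \<open>y\<close> agree with those of
    the permuted generators, which gives an isometric, state preserving homomorphism from the free
    product into \<open>A\<close>.\<close>
  have "\<exists>\<phi>. unital_star_hom F.\<P> A \<phi> \<and> (\<forall>a\<in>carrier F.\<P>. cnorm A (\<phi> a) = cnorm F.\<P> a) \<and>
     (\<forall>a\<in>carrier F.\<P>. \<rho> (\<phi> a) = F.\<omega> a) \<and> (\<forall>p. \<phi> (y p) = (x \<circ> shuffle k) p)" for k
  proof -
    have "range (x \<circ> shuffle k) = range x"
      using bij_shuffle[of k] by (metis bij_def image_comp)
    then interpret P: moment_pair F.\<P> F.\<omega> A \<rho> y "x \<circ> shuffle k"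
      using moments[OF bij_is_inj[OF bij_shuffle]] genB gen norming F.free_product_norming
      by unfold_locales (simp_all add: y_def)
    show ?thesis by (rule P.moment_isometry)
  qed
  then obtain \<phi> where hom: "\<And>k. unital_star_hom F.\<P> A (\<phi> k)"
    and iso: "\<And>k b. b \<in> carrier F.\<P> \<Longrightarrow> cnorm A (\<phi> k b) = cnorm F.\<P> b"
    and st: "\<And>k b. b \<in> carrier F.\<P> \<Longrightarrow> \<rho> (\<phi> k b) = F.\<omega> b"
    and gens: "\<And>k p. \<phi> k (y p) = x (shuffle k p)"
    by (metis comp_apply)
  note h = unital_star_homD[OF hom]
  have \<theta>: "unital_star_hom A F.\<P> \<theta>" "\<And>a. a \<in> carrier A \<Longrightarrow> F.\<omega> (\<theta> a) = \<rho> a"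
    using F.emb_hom[of 1] F.emb_state[of 1] by (simp_all add: \<theta>_def)
  note ht = unital_star_homD[OF \<theta>(1)]
  have emb: "embedding A \<rho> F.\<P> F.\<omega> \<theta>"
    unfolding embedding_def
    using \<theta> A.state_hom_inj[OF B.unital_cstar_algebra_axioms \<theta>(1), of F.\<omega>] norming by simp
  have close: "(\<lambda>k. cnorm A (\<phi> k (\<theta> a) \<ominus>\<^bsub>A\<^esub> a)) \<longlonglongrightarrow> 0" if a: "a \<in> carrier A" for a
  proof -
    define \<psi> where "\<psi> k a = \<phi> k (\<theta> a)" for k a
    have hp: "unital_star_hom A A (\<psi> k)" for k
      unfolding \<psi>_def
      by (rule unital_star_homI) (simp_all add: ht h del: F.free_product_simps)
    note hpd = unital_star_homD[OF hp]
    \<comment> \<open>The elements on which the compositions with the first factor embedding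
      converge back to the identity form a C*-subalgebra; it suffices that it contains the
      generators.\<close>
    define D where "D = {a \<in> carrier A. (\<lambda>k. cnorm A (\<psi> k a \<ominus>\<^bsub>A\<^esub> a)) \<longlonglongrightarrow> 0}"
    have D_iff: "a \<in> D \<longleftrightarrow> a \<in> carrier A \<and> A.lim_to (\<lambda>k. \<psi> k a) a" for a
      by (auto simp: D_def A.lim_to_def)
    have "cstar_subalgebra D A"
    proof (rule A.cstar_subalgebraI)
      show "D \<subseteq> carrier A" by (auto simp: D_def)
      show "\<one>\<^bsub>A\<^esub> \<in> D" by (simp add: D_iff hpd(4))
      fix a b assume "a \<in> D" "b \<in> D"
      then show "a \<oplus>\<^bsub>A\<^esub> b \<in> D" "a \<otimes>\<^bsub>A\<^esub> b \<in> D"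
        using A.lim_to_add[of "\<lambda>k. \<psi> k a" a "\<lambda>k. \<psi> k b" b] A.lim_to_mult[of "\<lambda>k. \<psi> k a" a "\<lambda>k. \<psi> k b" b]
        by (simp_all add: D_iff hpd)
    next
      fix a c assume "a \<in> D"
      then show "c \<odot>\<^bsub>A\<^esub> a \<in> D" "star A a \<in> D"
        using A.lim_to_smult[of "\<lambda>k. \<psi> k a" a] A.lim_to_star[of "\<lambda>k. \<psi> k a" a]
        by (simp_all add: D_iff hpd A.star_closed)
    next
      fix z l assume z: "\<And>n. z n \<in> D" and l: "l \<in> carrier A" "A.lim_to z l"
      have zc: "z n \<in> carrier A" for n using z[of n] by (simp add: D_def)
      \<comment> \<open>A three-epsilon argument: the maps \<open>\<psi> k\<close> are contractive,
        so approximating \<open>l\<close> by some \<open>z n\<close> is uniform in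
        \<open>k\<close>.\<close>
      have "(\<lambda>k. cnorm A (\<psi> k l \<ominus>\<^bsub>A\<^esub> l)) \<longlonglongrightarrow> 0"
      proof (rule LIMSEQ_I)
        fix \<epsilon> :: real assume "0 < \<epsilon>"
        then have e3: "0 < \<epsilon> / 3" by simp
        obtain n where n: "cnorm A (z n \<ominus>\<^bsub>A\<^esub> l) < \<epsilon> / 3"
          using order_tendstoD(2)[OF l(2)[unfolded A.lim_to_def] e3] by (auto simp: eventually_sequentially)
        have "(\<lambda>k. cnorm A (\<psi> k (z n) \<ominus>\<^bsub>A\<^esub> z n)) \<longlonglongrightarrow> 0" using z[of n] by (simp add: D_def)
        from order_tendstoD(2)[OF this e3]
        obtain N where N: "\<And>k. k \<ge> N \<Longrightarrow> cnorm A (\<psi> k (z n) \<ominus>\<^bsub>A\<^esub> z n) < \<epsilon> / 3"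
          by (auto simp: eventually_sequentially)
        have "cnorm A (\<psi> k l \<ominus>\<^bsub>A\<^esub> l) < \<epsilon>" if "k \<ge> N" for k
        proof -
          have "cnorm A (\<psi> k (z n) \<ominus>\<^bsub>A\<^esub> \<psi> k l) \<le> cnorm A (z n \<ominus>\<^bsub>A\<^esub> l)"
            using star_hom_contractive[OF A.unital_cstar_algebra_axioms A.unital_cstar_algebra_axioms hp,
                of "z n \<ominus>\<^bsub>A\<^esub> l" k] zc l
              star_hom_diff[OF A.unital_cstar_algebra_axioms A.unital_cstar_algebra_axioms hp, of "z n" l k]
            by simp
          then show ?thesis
            using A.nrm_diff_triangle[of "\<psi> k l" "\<psi> k (z n)" l] A.nrm_diff_triangle[of "\<psi> k (z n)" "z n" l]
              A.nrm_diff_commute[of "\<psi> k l" "\<psi> k (z n)"] zc l hpd(1) n N[OF that] by simp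
        qed
        then show "\<exists>no. \<forall>k\<ge>no. norm (cnorm A (\<psi> k l \<ominus>\<^bsub>A\<^esub> l) - 0) < \<epsilon>"
          using A.cnorm_nonneg hpd(1) l by auto
      qed
      then show "l \<in> D" using l by (simp add: D_def)
    qed
    moreover have "range x \<subseteq> D"
    proof
      fix a assume "a \<in> range x"
      then obtain n where n: "a = x n" by blast
      have xc: "x n \<in> carrier A" using gen by (auto simp: generates_def)
      \<comment> \<open>\<open>shuffle k\<close> fixes \<open>(n, True)\<close> once
        \<open>k\<close> exceeds \<open>n\<close>.\<close>
      have "\<psi> k (x n) = x n" if "k > n" for k
        using gens[of k "(n, True)"] that by (simp add: \<psi>_def \<theta>_def y_def e_def shuffle_def)
      then have "\<forall>\<^sub>F k in sequentially. cnorm A (\<psi> k (x n) \<ominus>\<^bsub>A\<^esub> x n) = 0"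
        using xc by (auto simp: eventually_sequentially intro!: exI[of _ "Suc n"])
      then have "(\<lambda>k. cnorm A (\<psi> k (x n) \<ominus>\<^bsub>A\<^esub> x n)) \<longlonglongrightarrow> 0" by (rule tendsto_eventually)
      then show "a \<in> D" using xc n by (simp add: D_def)
    qed
    ultimately have "a \<in> D" using gen a unfolding generates_def by blast
    then show ?thesis by (simp add: D_def \<psi>_def)
  qed
  \<comment> \<open>The index type is prescribed by \<open>existential\<close>. Only its number
    component is used: tails are pulled back along \<open>snd\<close>, so limits in \<open>k\<close>
    become limits along any finer ultrafilter.\<close>
  define F0 where "F0 = filtercomap (snd :: ((nat \<Rightarrow> (nat \<times> 'a) list \<Rightarrow> complex) set
    \<Rightarrow> (nat \<Rightarrow> (nat \<times> 'a) list \<Rightarrow> complex) set) set \<times> nat \<Rightarrow> nat) at_top"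
  have "F0 \<noteq> bot" unfolding F0_def by (rule filtercomap_neq_bot_surj) (auto simp: surj_def)
  then obtain U where U: "ultrafilter U" "U \<le> F0" using ultrafilter_exists by blast
  have U_bot: "U \<noteq> bot" using U(1) by (simp add: ultrafilter_def)
  have snd_lim: "filterlim snd sequentially U"
    using U(2) filterlim_filtercomap[of snd at_top] unfolding F0_def filterlim_def
    by (meson filtermap_mono order_trans)
  define s where "s b = (\<lambda>i :: ((nat \<Rightarrow> (nat \<times> 'a) list \<Rightarrow> complex) set
    \<Rightarrow> (nat \<Rightarrow> (nat \<times> 'a) list \<Rightarrow> complex) set) set \<times> nat. \<phi> (snd i) b)" for b
  have s_linf: "s b \<in> carrier (linf A)" if "b \<in> carrier F.\<P>" for b
    by (rule A.linfI[where K = "cnorm F.\<P> b"]) (use that in \<open>simp_all add: s_def h(1) iso del: F.free_product_simps\<close>)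
  note q = ring_hom_closed[OF A.qcls_ring_hom] ring_hom_mult[OF A.qcls_ring_hom]
    ring_hom_add[OF A.qcls_ring_hom] ring_hom_one[OF A.qcls_ring_hom]
  define \<sigma> where "\<sigma> b = A.qcls U (s b)" for b
  have "embedding F.\<P> F.\<omega> (ultrapower A U) (ultrapower_state \<rho> U) \<sigma>"
    unfolding embedding_def
  proof (intro conjI ballI)
    show "unital_star_hom F.\<P> (ultrapower A U) \<sigma>"
    proof (rule unital_star_homI)
      fix a assume a: "a \<in> carrier F.\<P>"
      show "\<sigma> a \<in> carrier (ultrapower A U)" unfolding \<sigma>_def by (rule q(1)[OF s_linf[OF a]])
      have "s (c \<odot>\<^bsub>F.\<P>\<^esub> a) = (\<lambda>i. c \<odot>\<^bsub>A\<^esub> s a i)" for c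
        unfolding s_def by (rule ext) (rule h(5)[OF a])
      then show "\<sigma> (c \<odot>\<^bsub>F.\<P>\<^esub> a) = c \<odot>\<^bsub>ultrapower A U\<^esub> \<sigma> a" for c
        unfolding \<sigma>_def A.qcls_smult[OF s_linf[OF a]] by simp
      have "s (star F.\<P> a) = (\<lambda>i. star A (s a i))"
        unfolding s_def by (rule ext) (rule h(6)[OF a])
      then show "\<sigma> (star F.\<P> a) = star (ultrapower A U) (\<sigma> a)"
        unfolding \<sigma>_def A.qcls_star[OF s_linf[OF a]] by simp
      fix b assume b: "b \<in> carrier F.\<P>"
      have "s (a \<otimes>\<^bsub>F.\<P>\<^esub> b) = s a \<otimes>\<^bsub>linf A\<^esub> s b" "s (a \<oplus>\<^bsub>F.\<P>\<^esub> b) = s a \<oplus>\<^bsub>linf A\<^esub> s b"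
        unfolding s_def linf_simps by (rule ext, rule h(2)[OF a b], rule ext, rule h(3)[OF a b])
      then show "\<sigma> (a \<otimes>\<^bsub>F.\<P>\<^esub> b) = \<sigma> a \<otimes>\<^bsub>ultrapower A U\<^esub> \<sigma> b"
        "\<sigma> (a \<oplus>\<^bsub>F.\<P>\<^esub> b) = \<sigma> a \<oplus>\<^bsub>ultrapower A U\<^esub> \<sigma> b"
        unfolding \<sigma>_def by (simp_all only: q(2,3)[OF s_linf[OF a] s_linf[OF b]])
    next
      have "s \<one>\<^bsub>F.\<P>\<^esub> = \<one>\<^bsub>linf A\<^esub>" unfolding s_def linf_simps by (rule ext) (rule h(4))
      then show "\<sigma> \<one>\<^bsub>F.\<P>\<^esub> = \<one>\<^bsub>ultrapower A U\<^esub>" unfolding \<sigma>_def by (simp only: q(4))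
    qed
    show "inj_on \<sigma> (carrier F.\<P>)"
    proof (rule inj_onI)
      fix a b assume a: "a \<in> carrier F.\<P>" and b: "b \<in> carrier F.\<P>" and eq: "\<sigma> a = \<sigma> b"
      \<comment> \<open>Every coordinate map is isometric, so the family of differences has constant
        norm; it is null only if that constant is zero.\<close>
      have "cnorm A (s a i \<ominus>\<^bsub>A\<^esub> s b i) = cnorm F.\<P> (a \<ominus>\<^bsub>F.\<P>\<^esub> b)" for i
        using iso[OF B.diff_closed[OF a b], of "snd i"]
          star_hom_diff[OF B.unital_cstar_algebra_axioms A.unital_cstar_algebra_axioms hom a b]
        by (simp only: s_def)
      then have "((\<lambda>i. cnorm F.\<P> (a \<ominus>\<^bsub>F.\<P>\<^esub> b)) \<longlongrightarrow> 0) U"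
        using eq unfolding \<sigma>_def A.qcls_eq_iff[OF s_linf[OF a] s_linf[OF b]] by (simp only:)
      then have "cnorm F.\<P> (a \<ominus>\<^bsub>F.\<P>\<^esub> b) = 0"
        using tendsto_unique[OF U_bot tendsto_const] by metis
      then show "a = b" by (rule B.diff_eq_zero[OF a b B.cnorm_eq_0[OF B.diff_closed[OF a b]]])
    qed
    fix b assume b: "b \<in> carrier F.\<P>"
    show "ultrapower_state \<rho> U (\<sigma> b) = F.\<omega> b"
      unfolding \<sigma>_def
      by (rule A.ultrapower_state_qcls[OF U_bot s_linf[OF b]]) (simp add: s_def st[OF b])
  qed
  moreover have "\<sigma> (\<theta> a) = diagonal_embedding A U a" if a: "a \<in> carrier A" for a
  proof -
    have "((\<lambda>i. cnorm A (s (\<theta> a) i \<ominus>\<^bsub>A\<^esub> a)) \<longlongrightarrow> 0) U"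
      using filterlim_compose[OF close[OF a] snd_lim] by (simp add: s_def)
    then show ?thesis
      using A.qcls_eq_iff[OF s_linf[OF ht(1)[OF a]] A.linf_const[OF a]]
      by (simp add: \<sigma>_def diagonal_embedding_def A.qcls_def)
  qed
  ultimately have "existential A \<rho> F.\<P> F.\<omega> \<theta>"
    unfolding existential_def using emb U(1) by blast
  then show ?thesis
    unfolding selfless_def \<theta>_def cstar_prob_space_def
    using A.unital_cstar_algebra_axioms A.is_state A.norming_faithful[OF norming] nontrivial by simp
qed

section \<open>Square-summable functions\<close>

lemma ell2_simps:
  "carrier (ell2 X) = {f. (\<forall>x. x \<notin> X \<longrightarrow> f x = 0) \<and> (\<lambda>x. (cmod (f x))\<^sup>2) summable_on X}"
  "zero (ell2 X) = (\<lambda>x. 0)" "add (ell2 X) = (\<lambda>f g x. f x + g x)"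
  "smult (ell2 X) = (\<lambda>c f x. c * f x)" "ip (ell2 X) f g = (\<Sum>\<^sub>\<infinity>x\<in>X. f x * cnj (g x))"
  by (simp_all add: ell2_def)

definition nsq :: "'x set \<Rightarrow> ('x \<Rightarrow> complex) \<Rightarrow> real" where
  "nsq X f = (\<Sum>\<^sub>\<infinity>x\<in>X. (cmod (f x))\<^sup>2)"

text \<open>All norm estimates in \<open>ell2\<close> run through finite partial sums, which give
  summability and the bound on the infinite sum together.\<close>

lemma ell2_I:
  assumes "\<And>x. x \<notin> X \<Longrightarrow> f x = 0"
    and b: "\<And>F. finite F \<Longrightarrow> F \<subseteq> X \<Longrightarrow> (\<Sum>x\<in>F. (cmod (f x))\<^sup>2) \<le> b"
  shows "f \<in> carrier (ell2 X)" "nsq X f \<le> b"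
proof -
  have "(\<lambda>x. (cmod (f x))\<^sup>2) summable_on X"
    by (rule nonneg_bdd_above_summable_on) (auto intro!: bdd_aboveI2 b)
  then show "f \<in> carrier (ell2 X)" "nsq X f \<le> b"
    using assms unfolding nsq_def by (auto simp: ell2_simps intro: infsum_le_finite_sums)
qed

lemma ell2_fin:
  assumes "f \<in> carrier (ell2 X)" "finite F" "F \<subseteq> X"
  shows "(\<Sum>x\<in>F. (cmod (f x))\<^sup>2) \<le> nsq X f"
  unfolding nsq_def by (rule finite_sum_le_infsum) (use assms in \<open>auto simp: ell2_simps\<close>)

lemma ell2_prod_summable:
  assumes f: "f \<in> carrier (ell2 X)" and g: "g \<in> carrier (ell2 X)"
  shows "(\<lambda>x. f x * cnj (g x)) summable_on X"
proof (rule abs_summable_summable, rule nonneg_bdd_above_summable_on)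
  show "bdd_above (sum (\<lambda>x. norm (f x * cnj (g x))) ` {F. F \<subseteq> X \<and> finite F})"
  proof (rule bdd_aboveI2)
    fix F assume F: "F \<in> {F. F \<subseteq> X \<and> finite F}"
    have "(\<Sum>x\<in>F. norm (f x * cnj (g x))) \<le> (\<Sum>x\<in>F. (cmod (f x))\<^sup>2 + (cmod (g x))\<^sup>2)"
    proof (rule sum_mono)
      fix x
      have "2 * (cmod (f x) * cmod (g x)) \<le> (cmod (f x))\<^sup>2 + (cmod (g x))\<^sup>2"
        using zero_le_power2[of "cmod (f x) - cmod (g x)"] by (simp add: power2_diff)
      moreover have "0 \<le> cmod (f x) * cmod (g x)" by simp
      ultimately show "norm (f x * cnj (g x)) \<le> (cmod (f x))\<^sup>2 + (cmod (g x))\<^sup>2"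
        by (simp only: norm_mult complex_mod_cnj)
    qed
    also have "\<dots> \<le> nsq X f + nsq X g"
      using ell2_fin[OF f, of F] ell2_fin[OF g, of F] F by (simp add: sum.distrib)
    finally show "(\<Sum>x\<in>F. norm (f x * cnj (g x))) \<le> nsq X f + nsq X g" .
  qed
qed simp

lemma ell2_add:
  assumes f: "f \<in> carrier (ell2 X)" and g: "g \<in> carrier (ell2 X)"
  shows "(\<lambda>x. f x + g x) \<in> carrier (ell2 X)"
proof (rule ell2_I(1))
  fix F assume F: "finite F" "F \<subseteq> X"
  have "(\<Sum>x\<in>F. (cmod (f x + g x))\<^sup>2) \<le> (\<Sum>x\<in>F. 2 * (cmod (f x))\<^sup>2 + 2 * (cmod (g x))\<^sup>2)"
  proof (rule sum_mono)
    fix x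
    have "(cmod (f x + g x))\<^sup>2 \<le> (cmod (f x) + cmod (g x))\<^sup>2"
      by (intro power_mono norm_triangle_ineq) simp
    also have "\<dots> \<le> 2 * (cmod (f x))\<^sup>2 + 2 * (cmod (g x))\<^sup>2"
      using zero_le_power2[of "cmod (f x) - cmod (g x)"] by (simp add: power2_diff power2_sum)
    finally show "(cmod (f x + g x))\<^sup>2 \<le> 2 * (cmod (f x))\<^sup>2 + 2 * (cmod (g x))\<^sup>2" .
  qed
  also have "\<dots> \<le> 2 * nsq X f + 2 * nsq X g"
    using ell2_fin[OF f F] ell2_fin[OF g F] by (simp add: sum.distrib sum_distrib_left[symmetric])
  finally show "(\<Sum>x\<in>F. (cmod (f x + g x))\<^sup>2) \<le> 2 * nsq X f + 2 * nsq X g" .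
qed (use f g in \<open>auto simp: ell2_simps\<close>)

lemma ell2_smult:
  assumes f: "f \<in> carrier (ell2 X)"
  shows "(\<lambda>x. c * f x) \<in> carrier (ell2 X)"
proof (rule ell2_I(1))
  fix F assume F: "finite F" "F \<subseteq> X"
  show "(\<Sum>x\<in>F. (cmod (c * f x))\<^sup>2) \<le> (cmod c)\<^sup>2 * nsq X f"
    using mult_left_mono[OF ell2_fin[OF f F], of "(cmod c)\<^sup>2"]
    by (simp add: norm_mult power_mult_distrib sum_distrib_left)
qed (use f in \<open>auto simp: ell2_simps\<close>)

lemma ell2_module: "Module.module complex_ring (ell2 X)"
proof (rule complex_moduleI)
  show "abelian_group (ell2 X)"
  proof (rule abelian_groupI)
    fix f g assume "f \<in> carrier (ell2 X)" "g \<in> carrier (ell2 X)"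
    then show "f \<oplus>\<^bsub>ell2 X\<^esub> g \<in> carrier (ell2 X)" using ell2_add by (simp add: ell2_simps(3))
  next
    fix f assume "f \<in> carrier (ell2 X)"
    then show "\<exists>g\<in>carrier (ell2 X). g \<oplus>\<^bsub>ell2 X\<^esub> f = \<zero>\<^bsub>ell2 X\<^esub>"
      using ell2_smult[of f X "- 1"] by (intro bexI[of _ "\<lambda>x. - 1 * f x"]) (auto simp: ell2_simps(2-))
  qed (auto simp: ell2_simps)
next
  fix c f assume "f \<in> carrier (ell2 X)"
  then show "c \<odot>\<^bsub>ell2 X\<^esub> f \<in> carrier (ell2 X)" using ell2_smult by (simp add: ell2_simps(4))
qed (auto simp: ell2_simps(2-) algebra_simps)

lemma ell2_ip_self:
  assumes "f \<in> carrier (ell2 X)"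
  shows "ip (ell2 X) f f = of_real (nsq X f)"
proof -
  have "((\<lambda>x. (cmod (f x))\<^sup>2) has_sum nsq X f) X"
    using assms by (simp add: ell2_simps nsq_def)
  then have "((\<lambda>x. complex_of_real ((cmod (f x))\<^sup>2)) has_sum of_real (nsq X f)) X" by (rule has_sum_of_real)
  then show ?thesis by (simp add: ell2_simps mult_cnj_self infsumI)
qed

lemma vnorm_ell2: "f \<in> carrier (ell2 X) \<Longrightarrow> vnorm (ell2 X) f = sqrt (nsq X f)"
  by (simp add: vnorm_def ell2_ip_self)

lemma nsq_nonneg: "0 \<le> nsq X f"
  unfolding nsq_def by (rule infsum_nonneg) simp

lemma ell2_semi_ip: "semi_ip (ell2 X)"
proof (intro semi_ip.intro semi_ip_axioms.intro)
  show "cvec (ell2 X)" using ell2_module by (simp add: cvec_def)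
  fix f g h assume "f \<in> carrier (ell2 X)" "g \<in> carrier (ell2 X)" "h \<in> carrier (ell2 X)"
  then show "ip (ell2 X) (f \<oplus>\<^bsub>ell2 X\<^esub> g) h = ip (ell2 X) f h + ip (ell2 X) g h"
    by (simp add: ell2_simps(2-) distrib_right infsum_add ell2_prod_summable)
next
  fix f g c assume f: "f \<in> carrier (ell2 X)" and g: "g \<in> carrier (ell2 X)"
  show "ip (ell2 X) (c \<odot>\<^bsub>ell2 X\<^esub> f) g = c * ip (ell2 X) f g"
    by (simp add: ell2_simps(2-) mult.assoc infsum_cmult_right')
  have "ip (ell2 X) g f = (\<Sum>\<^sub>\<infinity>x\<in>X. cnj (f x * cnj (g x)))"
    by (simp add: ell2_simps(2-) mult.commute)
  then show "ip (ell2 X) g f = cnj (ip (ell2 X) f g)"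
    unfolding infsum_cnj by (simp only: ell2_simps)
qed (simp add: ell2_ip_self nsq_nonneg)

lemma ell2_diff:
  assumes "f \<in> carrier (ell2 X)" "g \<in> carrier (ell2 X)"
  shows "f \<ominus>\<^bsub>ell2 X\<^esub> g = (\<lambda>x. f x - g x)"
proof -
  interpret E: cvec "ell2 X" using ell2_module by (simp add: cvec_def)
  show ?thesis using assms by (simp add: a_minus_def E.sm_minus_one ell2_simps(2-))
qed

lemma ell2_point:
  assumes f: "f \<in> carrier (ell2 X)"
  shows "cmod (f x) \<le> vnorm (ell2 X) f"
proof (cases "x \<in> X")
  case True
  then have "(cmod (f x))\<^sup>2 \<le> nsq X f" using ell2_fin[OF f, of "{x}"] by simp
  then show ?thesis using f by (simp add: vnorm_ell2 real_le_rsqrt)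
next
  case False
  then show ?thesis using f by (simp add: vnorm_ell2 ell2_simps nsq_nonneg)
qed

text \<open>Coordinates converge by \<open>ell2_point\<close>. In the Cauchy estimate restricted to
  a finite set of coordinates one index tends to infinity; since the bound does not depend on the
  set, it holds for the full norm.\<close>

theorem ell2_hilbert: "hilbert (ell2 X)"
proof -
  interpret E: semi_ip "ell2 X" by (rule ell2_semi_ip)
  show ?thesis
  proof
    fix f assume "f \<in> carrier (ell2 X)" "vnorm (ell2 X) f = 0"
    then show "f = \<zero>\<^bsub>ell2 X\<^esub>" using ell2_point[of f X] by (auto simp: ell2_simps(2))
  next
    fix z assume z: "\<And>n. z n \<in> carrier (ell2 X)" and cau: "E.cauchy_seq z"
    have pt: "cmod (z m x - z n x) \<le> vnorm (ell2 X) (z m \<ominus>\<^bsub>ell2 X\<^esub> z n)" for m n x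
      using ell2_point[OF E.M.minus_closed[OF z z], of m n x] by (simp add: ell2_diff z)
    have "convergent (\<lambda>n. z n x)" for x
    proof -
      have "Cauchy (\<lambda>n. z n x)"
      proof (rule CauchyI)
        fix e :: real assume "0 < e"
        then obtain M where "\<forall>m\<ge>M. \<forall>n\<ge>M. vnorm (ell2 X) (z m \<ominus>\<^bsub>ell2 X\<^esub> z n) < e"
          using cau unfolding E.cauchy_seq_def by blast
        then show "\<exists>M. \<forall>m\<ge>M. \<forall>n\<ge>M. norm (z m x - z n x) < e"
          using pt by (meson order_le_less_trans)
      qed
      then show ?thesis by (simp add: Cauchy_convergent_iff)
    qed
    then obtain l where l: "\<And>x. (\<lambda>n. z n x) \<longlonglongrightarrow> l x" unfolding convergent_def by metis
    have l0: "l x = 0" if "x \<notin> X" for x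
    proof -
      have "z n x = 0" for n using z[of n] that by (simp add: ell2_simps)
      then show ?thesis using l[of x] LIMSEQ_unique tendsto_const by (metis (no_types, lifting) ext)
    qed
    have tail: "(\<lambda>x. z m x - l x) \<in> carrier (ell2 X) \<and> nsq X (\<lambda>x. z m x - l x) \<le> e\<^sup>2"
      if M: "\<forall>m\<ge>M. \<forall>n\<ge>M. vnorm (ell2 X) (z m \<ominus>\<^bsub>ell2 X\<^esub> z n) < e" and m: "m \<ge> M" for e M m
    proof -
      have fin: "(\<Sum>x\<in>F. (cmod (z m x - l x))\<^sup>2) \<le> e\<^sup>2" if F: "finite F" "F \<subseteq> X" for F
      proof (rule LIMSEQ_le_const2)
        show "(\<lambda>n. \<Sum>x\<in>F. (cmod (z m x - z n x))\<^sup>2) \<longlonglongrightarrow> (\<Sum>x\<in>F. (cmod (z m x - l x))\<^sup>2)"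
          by (intro tendsto_intros l)
        have "(\<Sum>x\<in>F. (cmod (z m x - z n x))\<^sup>2) \<le> e\<^sup>2" if "n \<ge> M" for n
        proof -
          have d: "z m \<ominus>\<^bsub>ell2 X\<^esub> z n \<in> carrier (ell2 X)" using z by simp
          have "(\<Sum>x\<in>F. (cmod (z m x - z n x))\<^sup>2) \<le> nsq X (z m \<ominus>\<^bsub>ell2 X\<^esub> z n)"
            using ell2_fin[OF d F] by (simp add: ell2_diff z)
          also have "\<dots> = (vnorm (ell2 X) (z m \<ominus>\<^bsub>ell2 X\<^esub> z n))\<^sup>2" using d by (simp add: vnorm_ell2 nsq_nonneg)
          also have "\<dots> \<le> e\<^sup>2" using M m that d by (intro power_mono) (auto simp: less_imp_le E.vnorm_nonneg)
          finally show ?thesis .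
        qed
        then show "\<exists>N. \<forall>n\<ge>N. (\<Sum>x\<in>F. (cmod (z m x - z n x))\<^sup>2) \<le> e\<^sup>2" by blast
      qed
      have "z m x - l x = 0" if "x \<notin> X" for x using z[of m] l0[OF that] that by (simp add: ell2_simps)
      then show ?thesis using ell2_I[of X "\<lambda>x. z m x - l x" "e\<^sup>2"] fin by blast
    qed
    obtain M where "\<forall>m\<ge>M. \<forall>n\<ge>M. vnorm (ell2 X) (z m \<ominus>\<^bsub>ell2 X\<^esub> z n) < 1"
      using cau unfolding E.cauchy_seq_def by (meson zero_less_one)
    from tail[OF this order_refl] have dM: "(\<lambda>x. z M x - l x) \<in> carrier (ell2 X)" by blast
    \<comment> \<open>\<open>l\<close> is \<open>z M\<close> minus the difference
      \<open>z M - l\<close>, and both are square-summable.\<close>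
    have lc: "l \<in> carrier (ell2 X)"
    proof -
      have "(\<lambda>x. z M x + - 1 * (z M x - l x)) \<in> carrier (ell2 X)"
        by (rule ell2_add[OF z ell2_smult[OF dM]])
      then show ?thesis by simp
    qed
    have "E.lim_to z l" unfolding E.lim_to_def
    proof (rule LIMSEQ_I)
      fix e :: real assume e: "0 < e"
      then have e2: "0 < e / 2" by simp
      obtain M where M: "\<forall>m\<ge>M. \<forall>n\<ge>M. vnorm (ell2 X) (z m \<ominus>\<^bsub>ell2 X\<^esub> z n) < e / 2"
        using cau e2 unfolding E.cauchy_seq_def by blast
      have "norm (vnorm (ell2 X) (z m \<ominus>\<^bsub>ell2 X\<^esub> l) - 0) < e" if "m \<ge> M" for m
      proof -
        note t = tail[OF M that]
        have "vnorm (ell2 X) (z m \<ominus>\<^bsub>ell2 X\<^esub> l) = sqrt (nsq X (\<lambda>x. z m x - l x))"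
          using t by (simp add: ell2_diff z lc vnorm_ell2)
        also have "\<dots> \<le> e / 2" using t e by (intro real_le_lsqrt) (auto simp: nsq_nonneg)
        finally show ?thesis using e E.vnorm_nonneg[OF E.M.minus_closed[OF z lc], of m] by simp
      qed
      then show "\<exists>no. \<forall>m\<ge>no. norm (vnorm (ell2 X) (z m \<ominus>\<^bsub>ell2 X\<^esub> l) - 0) < e" by blast
    qed
    then show "\<exists>l\<in>carrier (ell2 X). E.lim_to z l" using lc by blast
  qed
qed

section \<open>Basis vectors and finitely supported approximation\<close>

definition basis_vec :: "'x \<Rightarrow> 'x \<Rightarrow> complex" where
  "basis_vec x = (\<lambda>y. if y = x then 1 else 0)"

lemma basis_vec_ip:
  assumes "x \<in> X"
  shows "ip (ell2 X) f (basis_vec x) = f x"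
proof -
  have "ip (ell2 X) f (basis_vec x) = (\<Sum>\<^sub>\<infinity>y\<in>{x}. f y * cnj (basis_vec x y))"
    unfolding ell2_simps using assms by (intro infsum_cong_neutral) (auto simp: basis_vec_def)
  then show ?thesis by (simp add: basis_vec_def)
qed

lemma basis_vec_carrier [simp]:
  assumes "x \<in> X"
  shows "basis_vec x \<in> carrier (ell2 X)"
proof (rule ell2_I(1))
  fix F :: "'a set" assume F: "finite F" "F \<subseteq> X"
  have "(\<Sum>y\<in>F. (cmod (basis_vec x y))\<^sup>2) = (\<Sum>y\<in>F. if y = x then 1 else 0)"
    by (intro sum.cong) (auto simp: basis_vec_def)
  also have "\<dots> \<le> 1" using F by simp
  finally show "(\<Sum>y\<in>F. (cmod (basis_vec x y))\<^sup>2) \<le> 1" .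
qed (use assms in \<open>auto simp: basis_vec_def\<close>)

lemma basis_vec_norm: "x \<in> X \<Longrightarrow> vnorm (ell2 X) (basis_vec x) = 1"
  by (simp add: vnorm_def basis_vec_ip) (simp add: basis_vec_def)

lemma ell2_finite_approx:
  assumes f: "f \<in> carrier (ell2 X)" and e: "0 < e"
  shows "\<exists>F. finite F \<and> F \<subseteq> X \<and> (\<lambda>x. if x \<in> F then f x else 0) \<in> carrier (ell2 X) \<and>
    vnorm (ell2 X) (f \<ominus>\<^bsub>ell2 X\<^esub> (\<lambda>x. if x \<in> F then f x else 0)) < e"
proof -
  have sm: "(\<lambda>x. (cmod (f x))\<^sup>2) summable_on X" using f by (simp add: ell2_simps)
  have "0 < e\<^sup>2 / 4" using e by simp
  from infsum_finite_approximation[OF sm this]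
  obtain F where F: "finite F" "F \<subseteq> X" "dist (\<Sum>x\<in>F. (cmod (f x))\<^sup>2) (nsq X f) \<le> e\<^sup>2 / 4"
    unfolding nsq_def by auto
  let ?g = "\<lambda>x. if x \<in> F then f x else 0" and ?d = "\<lambda>x. if x \<in> F then 0 else f x"
  have bound: "(\<Sum>x\<in>G. (cmod (?d x))\<^sup>2) \<le> e\<^sup>2 / 4" if G: "finite G" "G \<subseteq> X" for G
  proof -
    have "(\<Sum>x\<in>G. (cmod (?d x))\<^sup>2) = (\<Sum>x\<in>G - F. (cmod (f x))\<^sup>2)"
      using G by (intro sum.mono_neutral_cong_right) auto
    moreover have "(\<Sum>x\<in>G - F. (cmod (f x))\<^sup>2) + (\<Sum>x\<in>F. (cmod (f x))\<^sup>2) = (\<Sum>x\<in>(G - F) \<union> F. (cmod (f x))\<^sup>2)"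
      using G F by (intro sum.union_disjoint[symmetric]) auto
    moreover have "(\<Sum>x\<in>(G - F) \<union> F. (cmod (f x))\<^sup>2) \<le> nsq X f"
      using G F by (intro ell2_fin[OF f]) auto
    moreover have "nsq X f - (\<Sum>x\<in>F. (cmod (f x))\<^sup>2) \<le> e\<^sup>2 / 4"
      using F(3) unfolding dist_real_def by linarith
    ultimately show ?thesis by linarith
  qed
  have f0: "f x = 0" if "x \<notin> X" for x using f that by (simp add: ell2_simps)
  have d: "?d \<in> carrier (ell2 X)" "nsq X ?d \<le> e\<^sup>2 / 4"
    using ell2_I[of X ?d "e\<^sup>2 / 4"] bound f0 by auto
  have "(\<lambda>x. f x + - 1 * ?d x) \<in> carrier (ell2 X)" by (rule ell2_add[OF f ell2_smult[OF d(1)]])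
  moreover have "(\<lambda>x. f x + - 1 * ?d x) = ?g" by auto
  ultimately have g: "?g \<in> carrier (ell2 X)" by simp
  have "f \<ominus>\<^bsub>ell2 X\<^esub> ?g = ?d" unfolding ell2_diff[OF f g] by auto
  moreover have "vnorm (ell2 X) ?d \<le> e / 2"
    unfolding vnorm_ell2[OF d(1)] using d(2) e by (intro real_le_lsqrt) (auto simp: nsq_nonneg power_divide)
  ultimately show ?thesis using F g e by (intro exI[of _ F]) auto
qed

section \<open>The left regular representation\<close>

locale regular_representation = group G for G :: "('g, 'm) monoid_scheme" (structure)
begin

sublocale L: hilbert "ell2 (carrier G)" by (rule ell2_hilbert)

lemma left_regular_apply:
  "f \<in> carrier (ell2 (carrier G)) \<Longrightarrow> left_regular G g f = (\<lambda>h. if h \<in> carrier G then f (inv g \<otimes> h) else 0)"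
  by (simp add: left_regular_def)

text \<open>Left translation is injective, so a partial sum of a translate is a partial sum of
  \<open>f\<close> over the image set.\<close>

lemma translate_sum:
  assumes f: "f \<in> carrier (ell2 (carrier G))" and g: "g \<in> carrier G" and F: "finite F" "F \<subseteq> carrier G"
  shows "(\<Sum>h\<in>F. (cmod (f (g \<otimes> h)))\<^sup>2) = (\<Sum>h\<in>(\<lambda>h. g \<otimes> h) ` F. (cmod (f h))\<^sup>2)"
    "(\<lambda>h. g \<otimes> h) ` F \<subseteq> carrier G" "(\<Sum>h\<in>F. (cmod (f (g \<otimes> h)))\<^sup>2) \<le> nsq (carrier G) f"
proof -
  have "inj_on (\<lambda>h. g \<otimes> h) F"
    using inj_on_subset[OF inj_on_cmult[OF g] F(2)] .
  then show *: "(\<Sum>h\<in>F. (cmod (f (g \<otimes> h)))\<^sup>2) = (\<Sum>h\<in>(\<lambda>h. g \<otimes> h) ` F. (cmod (f h))\<^sup>2)"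
    by (simp add: sum.reindex)
  show **: "(\<lambda>h. g \<otimes> h) ` F \<subseteq> carrier G" using g F by auto
  show "(\<Sum>h\<in>F. (cmod (f (g \<otimes> h)))\<^sup>2) \<le> nsq (carrier G) f"
    unfolding * by (rule ell2_fin[OF f _ **]) (use F in simp)
qed

lemma left_regular_carrier:
  assumes f: "f \<in> carrier (ell2 (carrier G))" and g: "g \<in> carrier G"
  shows "left_regular G g f \<in> carrier (ell2 (carrier G))" "nsq (carrier G) (left_regular G g f) \<le> nsq (carrier G) f"
proof -
  have fin: "(\<Sum>h\<in>F. (cmod (left_regular G g f h))\<^sup>2) \<le> nsq (carrier G) f" if F: "finite F" "F \<subseteq> carrier G" for F
  proof -
    have "(\<Sum>h\<in>F. (cmod (left_regular G g f h))\<^sup>2) = (\<Sum>h\<in>F. (cmod (f (inv g \<otimes> h)))\<^sup>2)"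
      by (rule sum.cong) (use F in \<open>auto simp: left_regular_apply[OF f]\<close>)
    then show ?thesis using translate_sum(3)[OF f inv_closed[OF g] F] by simp
  qed
  show "left_regular G g f \<in> carrier (ell2 (carrier G))" "nsq (carrier G) (left_regular G g f) \<le> nsq (carrier G) f"
    using ell2_I[of "carrier G" "left_regular G g f" "nsq (carrier G) f"] fin
    by (auto simp: left_regular_apply[OF f])
qed

lemma left_regular_bounded:
  assumes g: "g \<in> carrier G"
  shows "left_regular G g \<in> bounded_operators (ell2 (carrier G))"
proof -
  have "(\<lambda>f\<in>carrier (ell2 (carrier G)). left_regular G g f) \<in> bounded_operators (ell2 (carrier G))"
  proof (rule L.bopI)
    fix f assume f: "f \<in> carrier (ell2 (carrier G))"
    show "left_regular G g f \<in> carrier (ell2 (carrier G))" by (rule left_regular_carrier(1)[OF f g])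
    show "vnorm (ell2 (carrier G)) (left_regular G g f) \<le> 1 * vnorm (ell2 (carrier G)) f"
      using left_regular_carrier[OF f g] f by (simp add: vnorm_ell2)
    show "left_regular G g (c \<odot>\<^bsub>ell2 (carrier G)\<^esub> f) = c \<odot>\<^bsub>ell2 (carrier G)\<^esub> left_regular G g f" for c
      unfolding left_regular_apply[OF f] left_regular_apply[OF L.sm_closed[OF f]]
      by (auto simp: ell2_simps(4))
    fix f' assume f': "f' \<in> carrier (ell2 (carrier G))"
    show "left_regular G g (f \<oplus>\<^bsub>ell2 (carrier G)\<^esub> f')
      = left_regular G g f \<oplus>\<^bsub>ell2 (carrier G)\<^esub> left_regular G g f'"
      unfolding left_regular_apply[OF f] left_regular_apply[OF f'] left_regular_apply[OF L.M.a_closed[OF f f']]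
      by (auto simp: ell2_simps(3))
  qed
  moreover have "(\<lambda>f\<in>carrier (ell2 (carrier G)). left_regular G g f) = left_regular G g"
    by (rule ext) (simp add: left_regular_def restrict_def)
  ultimately show ?thesis by simp
qed

lemma left_regular_mult:
  assumes g: "g \<in> carrier G" and h: "h \<in> carrier G"
  shows "left_regular G g \<otimes>\<^bsub>operator_algebra (ell2 (carrier G))\<^esub> left_regular G h = left_regular G (g \<otimes> h)"
proof (rule L.bop_eqI)
  fix f assume f: "f \<in> carrier (ell2 (carrier G))"
  have "left_regular G g (left_regular G h f) = left_regular G (g \<otimes> h) f"
    unfolding left_regular_apply[OF left_regular_carrier(1)[OF f h]] unfolding left_regular_apply[OF f]
    using g h by (auto simp: inv_mult_group m_assoc)
  then show "(left_regular G g \<otimes>\<^bsub>operator_algebra (ell2 (carrier G))\<^esub> left_regular G h) f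
    = left_regular G (g \<otimes> h) f" using f by simp
qed (use g h in \<open>auto intro: L.op_mult_closed left_regular_bounded\<close>)

lemma left_regular_one: "left_regular G \<one> = \<one>\<^bsub>operator_algebra (ell2 (carrier G))\<^esub>"
proof (rule L.bop_eqI)
  fix f assume f: "f \<in> carrier (ell2 (carrier G))"
  then have "f h = 0" if "h \<notin> carrier G" for h using that by (simp add: ell2_simps)
  then show "left_regular G \<one> f = \<one>\<^bsub>operator_algebra (ell2 (carrier G))\<^esub> f"
    using f unfolding left_regular_apply[OF f] by auto
qed (auto intro: L.op_one_closed left_regular_bounded)

text \<open>Left translation by \<open>g\<close> permutes the group, so the inner product is
  reindexed along it.\<close>

lemma left_regular_star:
  assumes g: "g \<in> carrier G"
  shows "star (operator_algebra (ell2 (carrier G))) (left_regular G g) = left_regular G (inv g)"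
proof (rule L.star_unique)
  show "left_regular G (inv g) \<in> bounded_operators (ell2 (carrier G))" using g by (intro left_regular_bounded) simp
  fix f k assume f: "f \<in> carrier (ell2 (carrier G))" and k: "k \<in> carrier (ell2 (carrier G))"
  have bij: "bij_betw (\<lambda>h. g \<otimes> h) (carrier G) (carrier G)"
    by (rule bij_betw_byWitness[where f' = "\<lambda>h. inv g \<otimes> h"]) (use g in \<open>auto simp: m_assoc[symmetric]\<close>)
  have "ip (ell2 (carrier G)) (left_regular G g f) k
      = (\<Sum>\<^sub>\<infinity>h\<in>carrier G. left_regular G g f (g \<otimes> h) * cnj (k (g \<otimes> h)))"
    unfolding ell2_simps by (rule infsum_reindex_bij_betw[OF bij, symmetric])
  also have "\<dots> = (\<Sum>\<^sub>\<infinity>h\<in>carrier G. f h * cnj (left_regular G (inv g) k h))"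
    by (rule infsum_cong) (use g in \<open>simp add: left_regular_apply[OF f] left_regular_apply[OF k] m_assoc[symmetric]\<close>)
  finally show "ip (ell2 (carrier G)) (left_regular G g f) k = ip (ell2 (carrier G)) f (left_regular G (inv g) k)"
    by (simp add: ell2_simps(5))
qed

lemma left_regular_basis:
  assumes "g \<in> carrier G" "h \<in> carrier G"
  shows "left_regular G g (basis_vec h) = basis_vec (g \<otimes> h)"
proof
  fix k
  have "inv g \<otimes> k = h \<longleftrightarrow> k = g \<otimes> h" if "k \<in> carrier G"
    using assms that by (metis inv_solve_left')
  then show "left_regular G g (basis_vec h) k = basis_vec (g \<otimes> h) k"
    unfolding left_regular_apply[OF basis_vec_carrier[OF assms(2)]]
    using assms by (auto simp: basis_vec_def)
qed

abbreviation "\<R> \<equiv> reduced_group_cstar G"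

lemma left_regular_sub: "left_regular G ` carrier G \<subseteq> carrier (operator_algebra (ell2 (carrier G)))"
  using left_regular_bounded by (auto simp: L.carrier_op)

lemma reduced_sub: "cstar_subalgebra (carrier \<R>) (operator_algebra (ell2 (carrier G)))"
  unfolding reduced_group_cstar_def by (rule L.OA.cstar_generated_subalgebra[OF left_regular_sub])

lemma reduced_eq: "\<R> = (operator_algebra (ell2 (carrier G)))\<lparr>carrier := carrier \<R>\<rparr>"
  unfolding reduced_group_cstar_def by (rule L.OA.cstar_generated_eq)

lemma reduced_simps [simp]:
  "mult \<R> = mult (operator_algebra (ell2 (carrier G)))" "one \<R> = one (operator_algebra (ell2 (carrier G)))"
  "zero \<R> = zero (operator_algebra (ell2 (carrier G)))" "add \<R> = add (operator_algebra (ell2 (carrier G)))"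
  "smult \<R> = smult (operator_algebra (ell2 (carrier G)))" "star \<R> = star (operator_algebra (ell2 (carrier G)))"
  "cnorm \<R> = cnorm (operator_algebra (ell2 (carrier G)))"
  unfolding reduced_group_cstar_def by simp_all

lemma reduced_algebra: "unital_cstar_algebra \<R>"
  unfolding reduced_group_cstar_def by (rule L.OA.cstar_generated_algebra[OF left_regular_sub])

lemma left_regular_closed: "g \<in> carrier G \<Longrightarrow> left_regular G g \<in> carrier \<R>"
  unfolding reduced_group_cstar_def using L.OA.cstar_generated_contains[of "left_regular G ` carrier G"] by blast

lemma reduced_generates: "generates \<R> (left_regular G ` carrier G)"
  unfolding reduced_group_cstar_def by (rule L.OA.generates_cstar_generated[OF left_regular_sub])

lemma basis_one: "basis_vec \<one> \<in> carrier (ell2 (carrier G))" "vnorm (ell2 (carrier G)) (basis_vec \<one>) = 1"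
  by (simp_all add: basis_vec_norm)

lemma canonical_state:
  "cstar_state \<R> (vector_state (ell2 (carrier G)) (basis_vec \<one>))"
  using L.vector_state_gns(1)[OF reduced_sub basis_one] reduced_eq by simp

lemma canonical_state_left_regular:
  assumes "g \<in> carrier G"
  shows "vector_state (ell2 (carrier G)) (basis_vec \<one>) (left_regular G g) = (if g = \<one> then 1 else 0)"
  using assms by (simp add: vector_state_def left_regular_basis basis_vec_ip) (auto simp: basis_vec_def)

text \<open>Linear combinations of translations move the basis vector at the unit to every finitely
  supported function; these are dense, so the vector is cyclic.\<close>

lemma canonical_norming: "norming \<R> (vector_state (ell2 (carrier G)) (basis_vec \<one>))"
proof -
  note D = L.OA.cstar_subalgebraD[OF reduced_sub]
  have fin: "\<exists>b\<in>carrier \<R>. b (basis_vec \<one>) = (\<lambda>x. if x \<in> F then f x else 0)"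
    if "finite F" "F \<subseteq> carrier G" for F and f :: "'g \<Rightarrow> complex"
    using that
  proof (induction F)
    case empty
    then show ?case using D(3) basis_one(1) by (intro bexI[of _ "\<zero>\<^bsub>\<R>\<^esub>"]) (auto simp: ell2_simps(2))
  next
    case (insert g F)
    then obtain b where b: "b \<in> carrier \<R>" "b (basis_vec \<one>) = (\<lambda>x. if x \<in> F then f x else 0)" by auto
    have g: "g \<in> carrier G" using insert by simp
    let ?b = "b \<oplus>\<^bsub>\<R>\<^esub> f g \<odot>\<^bsub>\<R>\<^esub> left_regular G g"
    have "?b \<in> carrier \<R>" using D(4)[OF b(1) D(6)[OF left_regular_closed[OF g]]] by simp
    moreover have "?b (basis_vec \<one>) = (\<lambda>x. if x \<in> insert g F then f x else 0)"
      using basis_one(1) b(2) left_regular_basis[OF g, of \<one>] insert.hyps g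
      by (auto simp: ell2_simps(2-) basis_vec_def)
    ultimately show ?case by blast
  qed
  have "norming ((operator_algebra (ell2 (carrier G)))\<lparr>carrier := carrier \<R>\<rparr>)
    (vector_state (ell2 (carrier G)) (basis_vec \<one>))"
  proof (rule L.cyclic_norming[OF reduced_sub basis_one])
    fix f and e :: real assume f: "f \<in> carrier (ell2 (carrier G))" and e: "0 < e"
    obtain F where F: "finite F" "F \<subseteq> carrier G"
      "vnorm (ell2 (carrier G)) (f \<ominus>\<^bsub>ell2 (carrier G)\<^esub> (\<lambda>x. if x \<in> F then f x else 0)) < e"
      using ell2_finite_approx[OF f e] by blast
    obtain b where "b \<in> carrier \<R>" "b (basis_vec \<one>) = (\<lambda>x. if x \<in> F then f x else 0)"
      using fin[OF F(1,2)] by blast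
    then show "\<exists>b\<in>carrier \<R>. vnorm (ell2 (carrier G)) (f \<ominus>\<^bsub>ell2 (carrier G)\<^esub> b (basis_vec \<one>)) < e"
      using F(3) by (intro bexI[of _ b]) auto
  qed
  then show ?thesis using reduced_eq by simp
qed

end

section \<open>Free groups\<close>

lemma inv_letter_inv [simp]: "inv_letter (inv_letter p) = p"
  by (cases p) (simp add: inv_letter_def)

definition red :: "('x \<times> bool) list \<Rightarrow> bool" where
  "red w \<longleftrightarrow> successively (\<lambda>p q. q \<noteq> inv_letter p) w"

lemma red_Nil [simp]: "red []"
  and red_Cons: "red (p # w) \<longleftrightarrow> red w \<and> (w = [] \<or> hd w \<noteq> inv_letter p)"
  by (auto simp: red_def successively_Cons)

lemma red_reduce_cons: "red w \<Longrightarrow> red (reduce_cons p w)"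
  by (cases w) (auto simp: red_Cons)

lemma red_foldr: "red w \<Longrightarrow> red (foldr reduce_cons v w)"
  by (induction v) (auto simp: red_reduce_cons)

lemma letters_reduce_cons: "fst ` set (reduce_cons p w) \<subseteq> insert (fst p) (fst ` set w)"
  by (cases w) auto

lemma letters_foldr: "fst ` set (foldr reduce_cons v w) \<subseteq> fst ` set v \<union> fst ` set w"
proof (induction v)
  case (Cons p v)
  have "fst ` set (foldr reduce_cons (p # v) w) \<subseteq> insert (fst p) (fst ` set (foldr reduce_cons v w))"
    using letters_reduce_cons[of p "foldr reduce_cons v w"] by simp
  also have "\<dots> \<subseteq> fst ` set (p # v) \<union> fst ` set w" using Cons by (simp add: subset_insertI2)
  finally show ?case .
qed simp

lemma reduce_cons_cancel: "red w \<Longrightarrow> reduce_cons p (reduce_cons (inv_letter p) w) = w"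
proof (cases w)
  case (Cons q v)
  assume "red w"
  then show ?thesis using Cons by (cases v) (auto simp: red_Cons)
qed simp

text \<open>The step behind associativity. Only a cancellation at the head needs an argument, and
  there \<open>reduce_cons_cancel\<close> undoes it.\<close>

lemma foldr_reduce_cons:
  assumes "red y" "red z"
  shows "foldr reduce_cons (reduce_cons p y) z = reduce_cons p (foldr reduce_cons y z)"
proof (cases y)
  case (Cons q y')
  show ?thesis
  proof (cases "q = inv_letter p")
    case True
    then show ?thesis using Cons reduce_cons_cancel[OF red_foldr[OF assms(2)], of p y'] by simp
  qed (use Cons in simp)
qed simp

lemma foldr_assoc:
  assumes "red y" "red z"
  shows "foldr reduce_cons (foldr reduce_cons x y) z = foldr reduce_cons x (foldr reduce_cons y z)"
  by (induction x) (simp_all add: foldr_reduce_cons red_foldr assms)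

lemma reduce_cons_red: "red (p # w) \<Longrightarrow> reduce_cons p w = p # w"
  by (cases w) (auto simp: red_Cons)

lemma foldr_append_red: "red (v @ w) \<Longrightarrow> foldr reduce_cons v w = v @ w"
proof (induction v)
  case (Cons p v)
  then have "red (v @ w)" by (simp add: red_Cons)
  then show ?case using Cons reduce_cons_red[of p "v @ w"] by simp
qed simp

lemma free_group_simps:
  "carrier (free_group X) = {w. fst ` set w \<subseteq> X \<and> red w}"
  "mult (free_group X) = foldr reduce_cons" "one (free_group X) = []"
  by (simp_all add: free_group_def red_def)

lemma foldr_left_inverse: "foldr reduce_cons (map inv_letter (rev x)) x = []"
  by (induction x) simp_all

lemma red_inverse: "red x \<Longrightarrow> red (map inv_letter (rev x))"
  unfolding red_def successively_map successively_rev
  by (erule successively_mono) (metis inv_letter_inv)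

lemma free_group_group: "group (free_group X)"
proof (rule groupI)
  fix x assume "x \<in> carrier (free_group X)"
  then show "\<exists>y\<in>carrier (free_group X). y \<otimes>\<^bsub>free_group X\<^esub> x = \<one>\<^bsub>free_group X\<^esub>"
    using foldr_left_inverse[of x] red_inverse[of x]
    by (intro bexI[of _ "map inv_letter (rev x)"]) (auto simp: free_group_simps inv_letter_def)
next
  fix x y assume "x \<in> carrier (free_group X)" "y \<in> carrier (free_group X)"
  then show "x \<otimes>\<^bsub>free_group X\<^esub> y \<in> carrier (free_group X)"
    using subset_trans[OF letters_foldr[of x y], of X] red_foldr[of y x] by (simp add: free_group_simps)
qed (auto simp: free_group_simps foldr_assoc)

lemma free_group_inv:
  assumes "x \<in> carrier (free_group X)"
  shows "inv\<^bsub>free_group X\<^esub> x = map inv_letter (rev x)"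
proof -
  interpret group "free_group X" by (rule free_group_group)
  show ?thesis
    by (rule inv_equality) (use assms red_inverse[of x] foldr_left_inverse[of x]
      in \<open>auto simp: free_group_simps inv_letter_def\<close>)
qed

section \<open>Words in the free group\<close>

abbreviation "\<F> \<equiv> free_group (UNIV :: nat set)"

interpretation F: regular_representation \<F>
  by (intro regular_representation.intro free_group_group)

definition gen :: "nat \<Rightarrow> ((nat \<times> bool) list \<Rightarrow> complex) \<Rightarrow> (nat \<times> bool) list \<Rightarrow> complex" where
  "gen n = left_regular \<F> [(n, True)]"

lemma F_carrier: "w \<in> carrier \<F> \<longleftrightarrow> red w"
  by (simp add: free_group_simps)

lemma letter_carrier [simp]: "[p] \<in> carrier \<F>"
  by (simp add: F_carrier red_Cons)

text \<open>Injective relabelling of generators neither creates nor destroys cancellations. This is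
  where the criterion's injectivity enters for the free group.\<close>

lemma reduce_cons_map:
  assumes "inj f"
  shows "reduce_cons (map_prod f id p) (map (map_prod f id) w) = map (map_prod f id) (reduce_cons p w)"
proof (cases w)
  case (Cons q v)
  have "map_prod f id q = inv_letter (map_prod f id p) \<longleftrightarrow> q = inv_letter p"
    using inj_eq[OF assms] by (cases p; cases q) (auto simp: inv_letter_def)
  then show ?thesis using Cons by simp
qed simp

lemma reduce_map:
  "inj f \<Longrightarrow> foldr reduce_cons (map (map_prod f id) w) [] = map (map_prod f id) (foldr reduce_cons w [])"
  by (induction w) (simp_all add: reduce_cons_map)

lemma left_regular_letter:
  "(if s then gen n else star F.\<R> (gen n)) = left_regular \<F> [(n, s)]"
  using F.left_regular_star[of "[(n, True)]"] free_group_inv[of "[(n, True)]" UNIV]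
  by (simp add: gen_def free_group_simps red_Cons inv_letter_def)

lemma gen_sub: "range gen \<subseteq> carrier F.\<R>"
  using F.left_regular_closed[OF letter_carrier] by (auto simp: gen_def)

text \<open>Multiplying out the unitaries of the letters is reduction of the word, as the group
  product with the empty word is exactly that.\<close>

lemma cword_gen: "cword F.\<R> gen w = left_regular \<F> (foldr reduce_cons w [])"
proof (induction w)
  case Nil
  then show ?case using F.left_regular_one by (simp add: free_group_simps)
next
  case (Cons p w)
  obtain n s where p: "p = (n, s)" by (cases p)
  have "foldr reduce_cons w [] \<in> carrier \<F>" by (simp add: F_carrier red_foldr)
  from F.left_regular_mult[OF letter_carrier this, of "(n, s)"]
  show ?case unfolding p cword_Cons left_regular_letter Cons.IH by (simp add: free_group_simps)
qed

lemma gen_generates: "generates F.\<R> (range gen)"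
proof -
  interpret A: unital_cstar_algebra F.\<R> by (rule F.reduced_algebra)
  have "carrier F.\<R> \<subseteq> C" if C: "cstar_subalgebra C F.\<R>" "range gen \<subseteq> C" for C
  proof -
    have word: "cword F.\<R> gen w \<in> C" for w
    proof (induction w)
      case (Cons p w)
      obtain n s where p: "p = (n, s)" by (cases p)
      have "gen n \<in> C" using C(2) by auto
      then have "(if s then gen n else star F.\<R> (gen n)) \<in> C" using A.cstar_subalgebraD(7)[OF C(1)] by simp
      then show ?case using A.cstar_subalgebraD(5)[OF C(1) _ Cons] unfolding p cword_Cons by blast
    qed (simp only: cword_Nil A.cstar_subalgebraD(2)[OF C(1)])
    have "left_regular \<F> w \<in> C" if "w \<in> carrier \<F>" for w
      using word[of w] foldr_append_red[of w "[]"] that by (simp add: cword_gen F_carrier)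
    then show ?thesis using F.reduced_generates C(1) unfolding generates_def by blast
  qed
  then show ?thesis using gen_sub by (simp add: generates_def)
qed

section \<open>Uniqueness of the trace\<close>

text \<open>Powers' averaging argument. If \<open>t\<^sub>i w\<close> starts with \<open>h\<^sub>i\<close> whenever \<open>w\<close> does not, then every term of
  \<open>\<Sum>\<^sub>i f (t\<^sub>i w)\<close> but at most one only sees the restriction of \<open>f\<close> to the words starting with \<open>h\<^sub>i\<close>.\<close>

lemma powers_pointwise:
  fixes a :: "nat \<Rightarrow> complex"
  assumes one: "\<And>i j. i < n \<Longrightarrow> j < n \<Longrightarrow> P i \<Longrightarrow> P j \<Longrightarrow> i = j"
    and other: "\<And>i. i < n \<Longrightarrow> \<not> P i \<Longrightarrow> Q i"
  shows "(cmod (\<Sum>i<n. a i))\<^sup>2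
    \<le> 2 * (\<Sum>i<n. (cmod (a i))\<^sup>2) + 2 * real n * (\<Sum>i<n. if Q i then (cmod (a i))\<^sup>2 else 0)"
proof -
  define I J where "I = {i\<in>{..<n}. P i}" and "J = {i\<in>{..<n}. \<not> P i}"
  have IJ: "I \<union> J = {..<n}" "I \<inter> J = {}" "finite I" "finite J" by (auto simp: I_def J_def)
  \<comment> \<open>\<open>I\<close> has at most one element, so no factor \<open>n\<close> is
    lost.\<close>
  have "(cmod (\<Sum>i\<in>I. a i))\<^sup>2 \<le> (\<Sum>i\<in>I. (cmod (a i))\<^sup>2)"
  proof (cases "I = {}")
    case False
    then obtain i where "i \<in> I" by blast
    then have "I = {i}" using one by (auto simp: I_def)
    then show ?thesis by simp
  qed simp
  also have "\<dots> \<le> (\<Sum>i<n. (cmod (a i))\<^sup>2)" by (rule sum_mono2) (auto simp: I_def)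
  finally have I: "(cmod (\<Sum>i\<in>I. a i))\<^sup>2 \<le> (\<Sum>i<n. (cmod (a i))\<^sup>2)" .
  \<comment> \<open>On \<open>J\<close> the Cauchy-Schwarz inequality costs a factor
    \<open>n\<close>, but only terms satisfying \<open>Q\<close> occur, and those will sum to at
    most one norm of \<open>f\<close>.\<close>
  have "(cmod (\<Sum>i\<in>J. a i))\<^sup>2 \<le> (\<Sum>i\<in>J. cmod (a i))\<^sup>2" by (intro power_mono norm_sum) simp
  also have "\<dots> \<le> (\<Sum>i\<in>J. (cmod (a i))\<^sup>2) * real (card J)"
    using sum_squared_le_sum_of_squares[of "\<lambda>i. cmod (a i)" J] IJ by simp
  also have "\<dots> \<le> (\<Sum>i\<in>J. (cmod (a i))\<^sup>2) * real n"
    using card_mono[of "{..<n}" J] by (intro mult_left_mono sum_nonneg) (auto simp: J_def)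
  also have "(\<Sum>i\<in>J. (cmod (a i))\<^sup>2) = (\<Sum>i\<in>J. if Q i then (cmod (a i))\<^sup>2 else 0)"
    using other by (intro sum.cong) (auto simp: J_def)
  also have "(\<Sum>i\<in>J. if Q i then (cmod (a i))\<^sup>2 else 0) * real n
      \<le> (\<Sum>i<n. if Q i then (cmod (a i))\<^sup>2 else 0) * real n"
    by (intro mult_right_mono sum_mono2) (auto simp: J_def)
  finally have J: "(cmod (\<Sum>i\<in>J. a i))\<^sup>2 \<le> (\<Sum>i<n. if Q i then (cmod (a i))\<^sup>2 else 0) * real n" .
  have "(\<Sum>i<n. a i) = (\<Sum>i\<in>I. a i) + (\<Sum>i\<in>J. a i)"
    using sum.union_disjoint[OF IJ(3,4,2), of a] IJ(1) by simp
  then have "(cmod (\<Sum>i<n. a i))\<^sup>2 \<le> (cmod (\<Sum>i\<in>I. a i) + cmod (\<Sum>i\<in>J. a i))\<^sup>2"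
    by (simp add: power_mono norm_triangle_ineq)
  also have "\<dots> \<le> 2 * (cmod (\<Sum>i\<in>I. a i))\<^sup>2 + 2 * (cmod (\<Sum>i\<in>J. a i))\<^sup>2"
    using zero_le_power2[of "cmod (\<Sum>i\<in>I. a i) - cmod (\<Sum>i\<in>J. a i)"] by (simp add: power2_diff power2_sum)
  finally show ?thesis using I J by (simp add: mult_ac)
qed

context regular_representation begin

text \<open>Summing \<open>powers_pointwise\<close> over \<open>w\<close>: the first part is a sum
  of \<open>n\<close> translates, at most \<open>2 n\<close> squared norms of \<open>f\<close>. In
  the second part the terms range over the disjoint sets \<open>D i\<close>, so together they give
  one squared norm, times \<open>2 n\<close>.\<close>

lemma powers_norm:
  assumes t: "\<And>i. i < n \<Longrightarrow> t i \<in> carrier G"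
    and D: "\<And>i j. i < n \<Longrightarrow> j < n \<Longrightarrow> i \<noteq> j \<Longrightarrow> D i \<inter> D j = {}"
    and paradox: "\<And>i w. i < n \<Longrightarrow> w \<in> carrier G \<Longrightarrow> w \<notin> D i \<Longrightarrow> t i \<otimes> w \<in> D i"
    and T: "T \<in> bounded_operators (ell2 (carrier G))"
    and Tf: "\<And>f w. f \<in> carrier (ell2 (carrier G)) \<Longrightarrow> w \<in> carrier G \<Longrightarrow> T f w = (\<Sum>i<n. f (t i \<otimes> w))"
  shows "(cnorm (operator_algebra (ell2 (carrier G))) T)\<^sup>2 \<le> 4 * real n"
proof -
  have bound: "nsq (carrier G) (T f) \<le> 4 * real n * nsq (carrier G) f"
    if f: "f \<in> carrier (ell2 (carrier G))" for f
  proof (rule ell2_I(2))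
    show "T f x = 0" if "x \<notin> carrier G" for x
      using L.bopD(1)[OF T f] that by (simp add: ell2_simps)
    fix F assume F: "finite F" "F \<subseteq> carrier G"
    define E where "E i = (\<lambda>w. t i \<otimes> w) ` F \<inter> D i" for i
    have "(\<Sum>w\<in>F. (cmod (T f w))\<^sup>2) \<le> (\<Sum>w\<in>F. 2 * (\<Sum>i<n. (cmod (f (t i \<otimes> w)))\<^sup>2)
        + 2 * real n * (\<Sum>i<n. if t i \<otimes> w \<in> D i then (cmod (f (t i \<otimes> w)))\<^sup>2 else 0))"
    proof (rule sum_mono)
      fix w assume w: "w \<in> F"
      then have wc: "w \<in> carrier G" using F by auto
      show "(cmod (T f w))\<^sup>2 \<le> 2 * (\<Sum>i<n. (cmod (f (t i \<otimes> w)))\<^sup>2)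
        + 2 * real n * (\<Sum>i<n. if t i \<otimes> w \<in> D i then (cmod (f (t i \<otimes> w)))\<^sup>2 else 0)"
        unfolding Tf[OF f wc]
        by (rule powers_pointwise[where P = "\<lambda>i. w \<in> D i"]) (use D paradox wc in blast)+
    qed
    also have "\<dots> = 2 * (\<Sum>i<n. \<Sum>w\<in>F. (cmod (f (t i \<otimes> w)))\<^sup>2)
        + 2 * real n * (\<Sum>i<n. \<Sum>w\<in>F. if t i \<otimes> w \<in> D i then (cmod (f (t i \<otimes> w)))\<^sup>2 else 0)"
      (is "_ = 2 * ?A + 2 * real n * ?B")
      by (simp add: sum.distrib sum_distrib_left[symmetric] sum.swap[of _ "{..<n}" F])
    finally have AB: "(\<Sum>w\<in>F. (cmod (T f w))\<^sup>2) \<le> 2 * ?A + 2 * real n * ?B" .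
    have A: "?A \<le> (\<Sum>i<n. nsq (carrier G) f)"
      by (intro sum_mono translate_sum(3)[OF f t F]) simp
    have "?B = (\<Sum>i<n. \<Sum>v\<in>E i. (cmod (f v))\<^sup>2)"
    proof (rule sum.cong[OF refl])
      fix i assume "i \<in> {..<n}"
      then have inj: "inj_on (\<lambda>w. t i \<otimes> w) F" using inj_on_subset[OF inj_on_cmult[OF t] F(2)] by simp
      have "(\<Sum>w\<in>F. if t i \<otimes> w \<in> D i then (cmod (f (t i \<otimes> w)))\<^sup>2 else 0)
          = (\<Sum>v\<in>(\<lambda>w. t i \<otimes> w) ` F. if v \<in> D i then (cmod (f v))\<^sup>2 else 0)"
        by (simp add: sum.reindex[OF inj])
      also have "\<dots> = (\<Sum>v\<in>E i. (cmod (f v))\<^sup>2)"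
        unfolding E_def using F by (intro sum.inter_restrict[symmetric]) simp
      finally show "(\<Sum>w\<in>F. if t i \<otimes> w \<in> D i then (cmod (f (t i \<otimes> w)))\<^sup>2 else 0)
        = (\<Sum>v\<in>E i. (cmod (f v))\<^sup>2)" .
    qed
    \<comment> \<open>Disjointness of the \<open>D i\<close> makes the \<open>n\<close> sums a
      single sum over distinct group elements.\<close>
    also have "\<dots> = (\<Sum>v\<in>(\<Union>i<n. E i). (cmod (f v))\<^sup>2)"
      by (rule sum.UNION_disjoint[symmetric]) (use F D in \<open>auto simp: E_def\<close>)
    also have "\<dots> \<le> nsq (carrier G) f"
    proof (rule ell2_fin[OF f])
      show "finite (\<Union>i<n. E i)" using F by (simp add: E_def)
      show "(\<Union>i<n. E i) \<subseteq> carrier G" using F t by (auto simp: E_def)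
    qed
    finally have "real n * ?B \<le> real n * nsq (carrier G) f" by (intro mult_left_mono) simp_all
    then show "(\<Sum>w\<in>F. (cmod (T f w))\<^sup>2) \<le> 4 * real n * nsq (carrier G) f"
      using AB A by simp
  qed
  have "cnorm (operator_algebra (ell2 (carrier G))) T \<le> sqrt (4 * real n)"
  proof (rule L.op_norm_le)
    fix f assume f: "f \<in> carrier (ell2 (carrier G))"
    have "vnorm (ell2 (carrier G)) (T f) = sqrt (nsq (carrier G) (T f))"
      by (rule vnorm_ell2[OF L.bopD(1)[OF T f]])
    also have "\<dots> \<le> sqrt (4 * real n * nsq (carrier G) f)" using bound[OF f] by (rule real_sqrt_le_mono)
    also have "\<dots> = sqrt (4 * real n) * vnorm (ell2 (carrier G)) f"
      by (simp add: vnorm_ell2[OF f] real_sqrt_mult)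
    finally show "vnorm (ell2 (carrier G)) (T f) \<le> sqrt (4 * real n) * vnorm (ell2 (carrier G)) f" .
  qed simp
  then have "(cnorm (operator_algebra (ell2 (carrier G))) T)\<^sup>2 \<le> (sqrt (4 * real n))\<^sup>2"
    using L.op_norm_nonneg[OF T] by (intro power_mono)
  then show ?thesis by simp
qed

end

text \<open>The generator \<open>M\<close> does not occur in \<open>k\<close>, so no letter of
  \<open>k\<close> cancels at either end, and \<open>w\<close> does not start with \<open>M\<close>,
  so nothing cancels there. The conjugate therefore multiplies onto \<open>w\<close> by
  concatenation and the product starts with \<open>M\<close>.\<close>

lemma free_group_paradox:
  assumes k: "k \<in> carrier \<F>" "k \<noteq> []" and M: "M \<notin> fst ` set k"
    and w: "w \<in> carrier \<F>" "w = [] \<or> hd w \<noteq> (M, True)"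
  shows "[(M, True)] \<otimes>\<^bsub>\<F>\<^esub> (k \<otimes>\<^bsub>\<F>\<^esub> [(M, False)]) \<otimes>\<^bsub>\<F>\<^esub> w = (M, True) # k @ (M, False) # w"
proof -
  have r: "red ((M, False) # w)" using w by (auto simp: F_carrier red_Cons inv_letter_def)
  have hdk: "fst (hd k) \<noteq> M" "fst (last k) \<noteq> M" using k(2) M by (metis imageI list.set_sel(1) last_in_set)+
  have rk: "red (k @ (M, False) # w)"
    using k r hdk(2) unfolding F_carrier red_def successively_append_iff
    by (auto simp: inv_letter_def)
  have "red ((M, True) # k @ (M, False) # w)"
    using rk hdk(1) k(2) by (auto simp: red_Cons inv_letter_def)
  note all = reduce_cons_red[OF this] foldr_append_red[OF rk] reduce_cons_red[OF r]
  have "[(M, True)] \<otimes>\<^bsub>\<F>\<^esub> (k \<otimes>\<^bsub>\<F>\<^esub> [(M, False)]) \<otimes>\<^bsub>\<F>\<^esub> w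
      = [(M, True)] \<otimes>\<^bsub>\<F>\<^esub> (k \<otimes>\<^bsub>\<F>\<^esub> ([(M, False)] \<otimes>\<^bsub>\<F>\<^esub> w))"
    using k(1) w(1) by (simp add: F.m_assoc)
  also have "\<dots> = (M, True) # k @ (M, False) # w"
    by (simp add: free_group_simps all)
  finally show ?thesis .
qed

text \<open>A trace is constant on conjugates, so on the sum of \<open>n\<close> conjugates it is
  \<open>n\<close> times its value at \<open>g\<close>, while \<open>powers_norm\<close> bounds the
  norm of the sum by \<open>2 sqrt n\<close>. For large \<open>n\<close> only the value 0 is
  possible.\<close>

theorem trace_left_regular:
  assumes \<tau>: "tracial_state F.\<R> \<tau>" and g: "g \<in> carrier \<F>" "g \<noteq> []"
  shows "\<tau> (left_regular \<F> g) = 0"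
proof -
  have "state F.\<R> \<tau>" using \<tau> by (simp add: tracial_state_def)
  then interpret T: cstar_state F.\<R> \<tau>
    by (intro cstar_state.intro cstar_state_axioms.intro F.reduced_algebra)
  have tr: "\<tau> (x \<otimes>\<^bsub>F.\<R>\<^esub> y) = \<tau> (y \<otimes>\<^bsub>F.\<R>\<^esub> x)" if "x \<in> carrier F.\<R>" "y \<in> carrier F.\<R>" for x y
    using \<tau> that by (auto simp: tracial_state_def)
  \<comment> \<open>The left regular representation evaluates at inverses, so the translations seen
    by \<open>powers_norm\<close> are conjugates of the inverse of \<open>g\<close>.\<close>
  define k where "k = inv\<^bsub>\<F>\<^esub> g"
  have k: "k \<in> carrier \<F>" "k \<noteq> []"
    using g F.inv_closed[OF g(1)] by (auto simp: k_def free_group_inv)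
  \<comment> \<open>All generators of \<open>k\<close> lie below \<open>N\<close>, so each generator
    \<open>N + i\<close> is fresh for \<open>k\<close>, and the sets of words starting with it are
    pairwise disjoint.\<close>
  obtain N where N: "\<And>m. m \<in> fst ` set k \<Longrightarrow> m < N"
    using finite_nat_set_iff_bounded[of "fst ` set k"] by auto
  define h where "h i = [(N + i, True)]" for i
  have hc: "h i \<in> carrier \<F>" for i by (simp add: h_def)
  have h_inv: "inv\<^bsub>\<F>\<^esub> (h i) = [(N + i, False)]" for i
    using free_group_inv[OF hc[of i]] by (simp add: h_def inv_letter_def)
  define c where "c i = h i \<otimes>\<^bsub>\<F>\<^esub> (g \<otimes>\<^bsub>\<F>\<^esub> inv\<^bsub>\<F>\<^esub> (h i))" for i
  have cc: "c i \<in> carrier \<F>" for i using hc[of i] g(1) by (simp add: c_def)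
  have c_inv: "inv\<^bsub>\<F>\<^esub> (c i) = h i \<otimes>\<^bsub>\<F>\<^esub> (k \<otimes>\<^bsub>\<F>\<^esub> [(N + i, False)])" for i
    using hc[of i] g(1) by (simp add: c_def k_def F.inv_mult_group F.m_assoc h_inv[symmetric])
  define S where "S = rec_nat \<zero>\<^bsub>F.\<R>\<^esub> (\<lambda>i s. s \<oplus>\<^bsub>F.\<R>\<^esub> left_regular \<F> (c i))"
  have S0: "S 0 = \<zero>\<^bsub>F.\<R>\<^esub>" and SS: "S (Suc n) = S n \<oplus>\<^bsub>F.\<R>\<^esub> left_regular \<F> (c n)" for n by (simp_all add: S_def)
  have lc: "left_regular \<F> (c i) \<in> carrier F.\<R>" for i by (rule F.left_regular_closed[OF cc])
  have Sc: "S n \<in> carrier F.\<R>" for n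
    by (induction n) (use lc F.L.OA.cstar_subalgebraD(3,4)[OF F.reduced_sub] in \<open>simp_all add: S0 SS\<close>)
  have Sb: "S n \<in> bounded_operators (ell2 (carrier \<F>))" for n
    using F.L.OA.cstar_subalgebraD(1)[OF F.reduced_sub Sc] by (simp add: F.L.carrier_op)
  have conj: "\<tau> (left_regular \<F> (c i)) = \<tau> (left_regular \<F> g)" for i
  proof -
    note hi = hc[of i] and ghi = F.m_closed[OF g(1) F.inv_closed[OF hc[of i]]]
    have "\<tau> (left_regular \<F> (c i)) = \<tau> (left_regular \<F> (h i) \<otimes>\<^bsub>F.\<R>\<^esub> left_regular \<F> (g \<otimes>\<^bsub>\<F>\<^esub> inv\<^bsub>\<F>\<^esub> (h i)))"
      unfolding c_def by (simp add: F.left_regular_mult[OF hi ghi])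
    also have "\<dots> = \<tau> (left_regular \<F> (g \<otimes>\<^bsub>\<F>\<^esub> inv\<^bsub>\<F>\<^esub> (h i)) \<otimes>\<^bsub>F.\<R>\<^esub> left_regular \<F> (h i))"
      by (rule tr) (use hi ghi F.left_regular_closed in auto)
    also have "\<dots> = \<tau> (left_regular \<F> (g \<otimes>\<^bsub>\<F>\<^esub> inv\<^bsub>\<F>\<^esub> (h i) \<otimes>\<^bsub>\<F>\<^esub> h i))"
      by (simp add: F.left_regular_mult[OF ghi hi])
    also have "g \<otimes>\<^bsub>\<F>\<^esub> inv\<^bsub>\<F>\<^esub> (h i) \<otimes>\<^bsub>\<F>\<^esub> h i = g"
      using hi g(1) by (simp add: F.m_assoc)
    finally show ?thesis .
  qed
  have S_tau: "\<tau> (S n) = of_nat n * \<tau> (left_regular \<F> g)" for n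
  proof (induction n)
    case 0
    then show ?case using T.rho_smult[of "\<zero>\<^bsub>F.\<R>\<^esub>" 0] Sc[of 0] by (simp add: S0)
  next
    case (Suc n)
    then show ?case unfolding SS T.rho_add[OF Sc lc] conj by (simp add: distrib_right)
  qed
  have S_apply: "S n f w = (\<Sum>i<n. f (inv\<^bsub>\<F>\<^esub> (c i) \<otimes>\<^bsub>\<F>\<^esub> w))"
    if f: "f \<in> carrier (ell2 (carrier \<F>))" and w: "w \<in> carrier \<F>" for n f w
  proof (induction n)
    case 0
    then show ?case using f by (simp add: S0 ell2_simps(2))
  next
    case (Suc n)
    then show ?case using f w by (simp add: SS F.left_regular_apply ell2_simps(3))
  qed
  have norm: "(cnorm F.\<R> (S n))\<^sup>2 \<le> 4 * real n" for n
    unfolding F.reduced_simps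
  proof (rule F.powers_norm[where t = "\<lambda>i. inv\<^bsub>\<F>\<^esub> (c i)" and D = "\<lambda>i. {w. w \<noteq> [] \<and> hd w = (N + i, True)}"])
    fix i w assume w: "w \<in> carrier \<F>" "w \<notin> {w. w \<noteq> [] \<and> hd w = (N + i, True)}"
    have M: "N + i \<notin> fst ` set k" using N[of "N + i"] by auto
    have "w = [] \<or> hd w \<noteq> (N + i, True)" using w(2) by auto
    from free_group_paradox[OF k M w(1) this]
    show "inv\<^bsub>\<F>\<^esub> (c i) \<otimes>\<^bsub>\<F>\<^esub> w \<in> {w. w \<noteq> [] \<and> hd w = (N + i, True)}"
      unfolding c_inv h_def by simp
  qed (use cc Sb S_apply in auto)
  have bound: "real n * (cmod (\<tau> (left_regular \<F> g)))\<^sup>2 \<le> 4" if n: "0 < n" for n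
  proof -
    have "(real n * cmod (\<tau> (left_regular \<F> g)))\<^sup>2 \<le> (cnorm F.\<R> (S n))\<^sup>2"
      using T.rho_bound[OF Sc[of n]] by (intro power_mono) (simp_all add: S_tau norm_mult)
    then have "real n * (real n * (cmod (\<tau> (left_regular \<F> g)))\<^sup>2) \<le> real n * 4"
      using norm[of n] by (simp add: power_mult_distrib power2_eq_square[of "real n"] mult_ac)
    then show ?thesis using n by simp
  qed
  show ?thesis
  proof (rule ccontr)
    assume "\<tau> (left_regular \<F> g) \<noteq> 0"
    then have pos: "0 < (cmod (\<tau> (left_regular \<F> g)))\<^sup>2" by simp
    obtain n where n: "4 < real n * (cmod (\<tau> (left_regular \<F> g)))\<^sup>2"
      using reals_Archimedean3[OF pos] by blast
    then have "0 < n" by (cases n) auto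
    then show False using bound[of n] n by linarith
  qed
qed

lemma norming_cong:
  assumes "norming A \<rho>" "unital_cstar_algebra A" "\<And>a. a \<in> carrier A \<Longrightarrow> \<rho>' a = \<rho> a"
  shows "norming A \<rho>'"
proof -
  interpret unital_cstar_algebra A by fact
  have "vnorm (gns_prespace A \<rho>') a = vnorm (gns_prespace A \<rho>) a" if "a \<in> carrier A" for a
    using assms(3)[of "star A a \<otimes>\<^bsub>A\<^esub> a"] that star_closed[OF that] by (simp add: vnorm_def)
  then show ?thesis using assms(1) unfolding norming_def by simp
qed

context
  notes One_nat_def [simp del]
  fixes \<tau> assumes \<tau>: "tracial_state F.\<R> \<tau>"
begin

lemma trace_value: "g \<in> carrier \<F> \<Longrightarrow> \<tau> (left_regular \<F> g) = (if g = [] then 1 else 0)"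
  using trace_left_regular[OF \<tau>] F.left_regular_one \<tau>
  by (auto simp: free_group_simps tracial_state_def state_def)

lemma trace_state: "cstar_state F.\<R> \<tau>"
  using \<tau> by (intro cstar_state.intro cstar_state_axioms.intro F.reduced_algebra) (simp add: tracial_state_def)

text \<open>On words \<open>\<tau>\<close> agrees with the vector state at the unit, hence
  everywhere; that state is norming.\<close>

lemma trace_norming: "norming F.\<R> \<tau>"
proof (rule norming_cong[OF F.canonical_norming F.reduced_algebra])
  fix a assume a: "a \<in> carrier F.\<R>"
  show "\<tau> a = vector_state (ell2 (carrier \<F>)) (basis_vec \<one>\<^bsub>\<F>\<^esub>) a"
  proof (rule state_eq_on_words[OF trace_state F.canonical_state gen_generates _ a])
    fix w
    have "foldr reduce_cons w [] \<in> carrier \<F>" by (simp add: F_carrier red_foldr)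
    then show "\<tau> (cword F.\<R> gen w) = vector_state (ell2 (carrier \<F>)) (basis_vec \<one>\<^bsub>\<F>\<^esub>) (cword F.\<R> gen w)"
      using trace_value F.canonical_state_left_regular by (simp add: cword_gen free_group_simps(3))
  qed
qed

section \<open>Words in two free copies of the group algebra\<close>

interpretation T: cstar_state F.\<R> \<tau> by (rule trace_state)

interpretation P: free_family "{1, 2 :: nat}" "\<lambda>_. F.\<R>" "\<lambda>_. \<tau>" by unfold_locales

interpretation PS: cstar_state P.\<P> P.\<omega> by (rule P.free_product_cstar_state)

definition copy :: "bool \<Rightarrow> nat" where "copy b = (if b then 1 else 2)"

lemma copy_mem [simp]: "copy b \<in> {1, 2}" and copy_eq [simp]: "copy b = copy c \<longleftrightarrow> b = c"
  by (auto simp: copy_def)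

definition pgen :: "nat \<times> bool \<Rightarrow> _" where
  "pgen q = P.emb (copy (snd q)) (gen (fst q))"

text \<open>The pair of generator index and copy is itself treated as a generator, so words in both
  copies are words of a free group on \<open>nat \<times> bool\<close>, with the second
  \<open>bool\<close> as exponent.\<close>

definition pletter :: "(nat \<times> bool) \<times> bool \<Rightarrow> _" where
  "pletter p = P.emb (copy (snd (fst p))) (left_regular \<F> [(fst (fst p), snd p)])"

lemma lr_closed: "g \<in> carrier \<F> \<Longrightarrow> left_regular \<F> g \<in> carrier F.\<R>"
  by (rule F.left_regular_closed)

lemma lr_mult:
  "g \<in> carrier \<F> \<Longrightarrow> h \<in> carrier \<F> \<Longrightarrow>
    left_regular \<F> g \<otimes>\<^bsub>F.\<R>\<^esub> left_regular \<F> h = left_regular \<F> (g \<otimes>\<^bsub>\<F>\<^esub> h)"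
  by (simp add: F.left_regular_mult)

lemma pletter_closed: "pletter p \<in> carrier P.\<P>"
  unfolding pletter_def by (intro P.emb_closed lr_closed copy_mem letter_carrier)

lemma pgen_letter: "(if s then pgen q else star P.\<P> (pgen q)) = pletter (q, s)"
proof -
  have "gen (fst q) \<in> carrier F.\<R>" using gen_sub by auto
  from unital_star_homD(6)[OF P.emb_hom[OF copy_mem] this, of "snd q", symmetric]
  show ?thesis
    using left_regular_letter[of s "fst q"]
    by (cases s) (simp_all add: pgen_def pletter_def gen_def del: P.free_product_simps F.reduced_simps)
qed

lemma pgen_sub: "range pgen \<subseteq> carrier P.\<P>"
  using pgen_letter[of True] pletter_closed by (auto simp del: P.free_product_simps)

lemma pword_Cons: "cword P.\<P> pgen (p # w) = pletter p \<otimes>\<^bsub>P.\<P>\<^esub> cword P.\<P> pgen w"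
  using pgen_letter[of "snd p" "fst p"] by (cases p) (simp only: cword_Cons fst_conv snd_conv)

lemma pletter_cancel:
  assumes "z \<in> carrier P.\<P>"
  shows "pletter p \<otimes>\<^bsub>P.\<P>\<^esub> (pletter (inv_letter p) \<otimes>\<^bsub>P.\<P>\<^esub> z) = z"
proof -
  let ?p = "(fst (fst p), snd p)"
  have "reduce_cons ?p [inv_letter ?p] = []" by simp
  then have "[?p] \<otimes>\<^bsub>\<F>\<^esub> [inv_letter ?p] = []" by (simp add: free_group_simps)
  then have "left_regular \<F> [?p] \<otimes>\<^bsub>F.\<R>\<^esub> left_regular \<F> [inv_letter ?p] = \<one>\<^bsub>F.\<R>\<^esub>"
    unfolding lr_mult[OF letter_carrier letter_carrier] using F.left_regular_one
    by (simp add: free_group_simps)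
  then have "pletter p \<otimes>\<^bsub>P.\<P>\<^esub> pletter (inv_letter p) = \<one>\<^bsub>P.\<P>\<^esub>"
    unfolding pletter_def
    using unital_star_homD(2)[OF P.emb_hom[OF copy_mem] lr_closed[OF letter_carrier] lr_closed[OF letter_carrier],
        of "snd (fst p)" ?p "inv_letter ?p", symmetric]
      unital_star_homD(4)[OF P.emb_hom[OF copy_mem]]
    by (simp add: inv_letter_def del: P.free_product_simps F.reduced_simps)
  then show ?thesis
    using PS.mult_assoc[OF pletter_closed pletter_closed assms, symmetric] assms
    by (simp del: P.free_product_simps)
qed

text \<open>A cancelling pair has the same generator and the same copy, so it already cancels inside
  one factor.\<close>

lemma pword_reduce: "cword P.\<P> pgen w = cword P.\<P> pgen (foldr reduce_cons w [])"
proof (induction w)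
  case (Cons p w)
  have "cword P.\<P> pgen (reduce_cons p v) = cword P.\<P> pgen (p # v)" for v
  proof (cases v)
    case (Cons q u)
    show ?thesis
    proof (cases "q = inv_letter p")
      case True
      then show ?thesis
        using Cons pletter_cancel[OF PS.cword_closed[OF pgen_sub], of p u]
        by (simp add: pword_Cons del: P.free_product_simps)
    qed (simp add: Cons)
  qed simp
  then show ?case using Cons by (simp add: pword_Cons del: P.free_product_simps)
qed simp

text \<open>A reduced word creates from the vacuum a single word of the free product whose letters
  are its maximal runs within one copy. The invariant on the first group element \<open>g\<close>
  records that it is nontrivial and begins with the leading letter, which is what keeps the next
  step free of cancellation and its syllable of trace zero.\<close>

lemma pword_vector:
  "red v \<Longrightarrow> \<exists>u\<in>P.W. cword P.\<P> pgen v P.\<Omega> = completion_vec P.V (word_vec u) \<and> (v = [] \<longrightarrow> u = []) \<and>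
     (v \<noteq> [] \<longrightarrow> (\<exists>g u'. u = (copy (snd (fst (hd v))), left_regular \<F> g) # u' \<and> g \<in> carrier \<F> \<and> g \<noteq> [] \<and>
       hd g = (fst (fst (hd v)), snd (hd v))))"
proof (induction v)
  case Nil
  have "\<one>\<^bsub>P.\<P>\<^esub> P.\<Omega> = P.\<Omega>" using P.vacuum_carrier by simp
  then show ?case by (intro bexI[of _ "[]"]) (simp_all del: P.free_product_simps)
next
  case (Cons p v)
  have v: "red v" "v = [] \<or> hd v \<noteq> inv_letter p" using Cons.prems by (auto simp: red_Cons)
  obtain u where u: "u \<in> P.W" "cword P.\<P> pgen v P.\<Omega> = completion_vec P.V (word_vec u)" "v = [] \<longrightarrow> u = []"
    "v \<noteq> [] \<longrightarrow> (\<exists>g u'. u = (copy (snd (fst (hd v))), left_regular \<F> g) # u' \<and> g \<in> carrier \<F> \<and> g \<noteq> [] \<and>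
       hd g = (fst (fst (hd v)), snd (hd v)))"
    using Cons.IH[OF v(1)] by blast
  let ?l = "(fst (fst p), snd p)" and ?j = "copy (snd (fst p))"
  have "cword P.\<P> pgen (p # v) P.\<Omega> = pletter p (completion_vec P.V (word_vec u))"
    unfolding pword_Cons using P.vacuum_carrier u(2) by simp
  also have "\<dots> = completion_vec P.V (free_act (\<lambda>_. F.\<R>) (\<lambda>_. \<tau>) ?j (left_regular \<F> [?l]) (word_vec u))"
    unfolding pletter_def by (rule P.emb_vec[OF copy_mem lr_closed[OF letter_carrier] P.word_vec_carrier[OF u(1)]])
  finally have vec: "cword P.\<P> pgen (p # v) P.\<Omega>
    = completion_vec P.V (free_act (\<lambda>_. F.\<R>) (\<lambda>_. \<tau>) ?j (left_regular \<F> [?l]) (word_vec u))" .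
  show ?case
  \<comment> \<open>In the same copy the new letter lengthens the first syllable; otherwise it opens
    a new one.\<close>
  proof (cases "v \<noteq> [] \<and> snd (fst (hd v)) = snd (fst p)")
    case True
    then obtain g u' where g: "u = (?j, left_regular \<F> g) # u'" "g \<in> carrier \<F>" "g \<noteq> []"
      "hd g = (fst (fst (hd v)), snd (hd v))" using u(4) by auto
    have "hd g \<noteq> inv_letter ?l" using v(2) True g(4) by (cases "hd v"; cases p) (auto simp: inv_letter_def)
    then have rg: "red (?l # g)" using g(2) by (simp add: red_Cons F_carrier)
    then have gc: "?l # g \<in> carrier \<F>" by (simp add: F_carrier)
    have prod: "left_regular \<F> [?l] \<otimes>\<^bsub>F.\<R>\<^esub> left_regular \<F> g = left_regular \<F> (?l # g)"
      unfolding lr_mult[OF letter_carrier g(2)] by (simp add: free_group_simps reduce_cons_red[OF rg])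
    have z: "\<tau> (left_regular \<F> (?l # g)) = 0" using trace_value[OF gc] by simp
    have "free_act (\<lambda>_. F.\<R>) (\<lambda>_. \<tau>) ?j (left_regular \<F> [?l]) (word_vec u)
        = word_vec ((?j, left_regular \<F> (?l # g)) # u')"
      unfolding g(1) using P.act_word_same[OF copy_mem lr_closed[OF letter_carrier] lr_closed[OF g(2)]] prod z
      by simp
    moreover have "(?j, left_regular \<F> (?l # g)) # u' \<in> P.W"
      using u(1) lr_closed[OF gc] z unfolding g(1) P.Cons_word by auto
    ultimately show ?thesis using vec gc by (intro bexI[of _ "(?j, left_regular \<F> (?l # g)) # u'"]) auto
  next
    case False
    have nh: "\<not> P.headed ?j u"
    proof (cases "v = []")
      case True
      then show ?thesis using u(3) by (simp add: P.headed_def)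
    next
      case v_ne: False
      then obtain g u' where "u = (copy (snd (fst (hd v))), left_regular \<F> g) # u'" using u(4) by blast
      then show ?thesis using False v_ne by (simp add: P.headed_def)
    qed
    have z: "\<tau> (left_regular \<F> [?l]) = 0" using trace_value[OF letter_carrier] by simp
    have "free_act (\<lambda>_. F.\<R>) (\<lambda>_. \<tau>) ?j (left_regular \<F> [?l]) (word_vec u)
        = word_vec ((?j, left_regular \<F> [?l]) # u)"
      by (rule P.act_word_new[OF copy_mem lr_closed[OF letter_carrier] z nh])
    moreover have "(?j, left_regular \<F> [?l]) # u \<in> P.W"
      by (rule P.Cons_wordI[OF copy_mem lr_closed[OF letter_carrier] z u(1) nh])
    ultimately show ?thesis using vec by (intro bexI[of _ "(?j, left_regular \<F> [?l]) # u"]) auto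
  qed
qed

text \<open>After reduction the word creates one basis word from the vacuum, and only the empty one
  is not orthogonal to it.\<close>

lemma pword_moment: "P.\<omega> (cword P.\<P> pgen w) = (if foldr reduce_cons w [] = [] then 1 else 0)"
proof -
  let ?v = "foldr reduce_cons w []"
  obtain u where u: "u \<in> P.W" "cword P.\<P> pgen ?v P.\<Omega> = completion_vec P.V (word_vec u)"
    "?v = [] \<longrightarrow> u = []" "?v \<noteq> [] \<longrightarrow> u \<noteq> []"
    using pword_vector[OF red_foldr[OF red_Nil], of w] by blast
  have "P.\<omega> (cword P.\<P> pgen w) = ip P.V (word_vec u) (word_vec [])"
    unfolding pword_reduce[of w] P.free_state_eq vector_state_def u(2)
    by (rule P.completion_vec_ip[OF P.word_vec_carrier[OF u(1)] P.word_vec_carrier[OF P.Nil_word]])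
  also have "\<dots> = word_ip (\<lambda>_. F.\<R>) (\<lambda>_. \<tau>) u []" by (rule P.ip_word_vec[OF u(1) P.Nil_word])
  also have "\<dots> = (if ?v = [] then 1 else 0)" using u(3,4) by (cases u) auto
  finally show ?thesis .
qed

theorem reduced_free_group_selfless: "selfless F.\<R> \<tau>"
proof (rule selfless_criterion[OF trace_state trace_norming gen_generates])
  \<comment> \<open>A unitary of trace zero that is scalar would be zero.\<close>
  show "carrier F.\<R> \<noteq> range (\<lambda>c. c \<odot>\<^bsub>F.\<R>\<^esub> \<one>\<^bsub>F.\<R>\<^esub>)"
  proof
    assume "carrier F.\<R> = range (\<lambda>c. c \<odot>\<^bsub>F.\<R>\<^esub> \<one>\<^bsub>F.\<R>\<^esub>)"
    then obtain c where c: "left_regular \<F> [(0, True)] = c \<odot>\<^bsub>F.\<R>\<^esub> \<one>\<^bsub>F.\<R>\<^esub>"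
      using lr_closed[OF letter_carrier[of "(0, True)"]] by blast
    then have "c = 0" using trace_value[OF letter_carrier[of "(0, True)"]] T.rho_smult[OF T.one_closed, of c]
      T.rho_one by simp
    then have 0: "left_regular \<F> [(0, True)] = \<zero>\<^bsub>F.\<R>\<^esub>" using c T.sm_zero_left[OF T.one_closed] by simp
    have "\<one>\<^bsub>F.\<R>\<^esub> = left_regular \<F> [(0, False)] \<otimes>\<^bsub>F.\<R>\<^esub> left_regular \<F> [(0, True)]"
      unfolding lr_mult[OF letter_carrier letter_carrier] using F.left_regular_one
      by (simp add: free_group_simps inv_letter_def)
    also have "\<dots> = \<zero>\<^bsub>F.\<R>\<^esub>"
      unfolding 0 using lr_closed[OF letter_carrier[of "(0, False)"]] by (simp del: F.reduced_simps)
    finally have "\<tau> \<one>\<^bsub>F.\<R>\<^esub> = \<tau> \<zero>\<^bsub>F.\<R>\<^esub>" by simp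
    then show False using T.rho_one T.rho_smult[of "\<zero>\<^bsub>F.\<R>\<^esub>" 0] by (simp del: F.reduced_simps)
  qed
  fix f :: "nat \<times> bool \<Rightarrow> nat" and w assume f: "inj f"
  \<comment> \<open>Both sides ask whether the word reduces to the empty one, and relabelling by the
    injection \<open>f\<close> preserves the answer.\<close>
  have "P.\<omega> (cword P.\<P> pgen w) = \<tau> (cword F.\<R> (gen \<circ> f) w)"
    unfolding pword_moment cword_map[symmetric] cword_gen reduce_map[OF f]
    using trace_value[of "map (map_prod f id) (foldr reduce_cons w [])"]
      red_foldr[OF red_Nil, of "map (map_prod f id) w"]
    by (simp add: F_carrier reduce_map[OF f])
  then show "P.\<omega> (cword P.\<P> (\<lambda>p. P.emb (if snd p then 1 else 2) (gen (fst p))) w) = \<tau> (cword F.\<R> (gen \<circ> f) w)"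
    by (simp add: pgen_def[abs_def] copy_def)
qed

end

section \<open>Isometries with orthogonal ranges\<close>

text \<open>The normal form \<open>s\<^sub>u\<close> of a word in isometries \<open>s\<^sub>i\<close> and their adjoints, applied to a vector
  annihilated by all adjoints; \<open>None\<close> if the result vanishes.\<close>

fun cuntz_run :: "('i \<times> bool) list \<Rightarrow> 'i list option" where
  "cuntz_run [] = Some []"
| "cuntz_run ((i, True) # w) = map_option ((#) i) (cuntz_run w)"
| "cuntz_run ((i, False) # w) =
     (case cuntz_run w of Some (j # u) \<Rightarrow> if i = j then Some u else None | _ \<Rightarrow> None)"

lemma cuntz_run_map:
  "inj f \<Longrightarrow> cuntz_run (map (map_prod f id) w) = map_option (map f) (cuntz_run w)"
  by (induction w rule: cuntz_run.induct) (auto simp: inj_eq option.map_comp comp_def split: option.splits list.splits)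

text \<open>The last condition says that every adjoint annihilates the GNS vector of the unit, so
  that vector plays the part of a vacuum.\<close>

definition cuntz_family :: "('a, 'm) cstar_scheme \<Rightarrow> ('a \<Rightarrow> complex) \<Rightarrow> ('i \<Rightarrow> 'a) \<Rightarrow> bool" where
  "cuntz_family A \<rho> x \<longleftrightarrow> range x \<subseteq> carrier A \<and>
     (\<forall>i j. star A (x i) \<otimes>\<^bsub>A\<^esub> x j = (if i = j then \<one>\<^bsub>A\<^esub> else \<zero>\<^bsub>A\<^esub>)) \<and>
     (\<forall>i. \<rho> (x i \<otimes>\<^bsub>A\<^esub> star A (x i)) = 0)"

lemma cuntz_familyD:
  assumes "cuntz_family A \<rho> x"
  shows "range x \<subseteq> carrier A" "x i \<in> carrier A"
    and "star A (x i) \<otimes>\<^bsub>A\<^esub> x j = (if i = j then \<one>\<^bsub>A\<^esub> else \<zero>\<^bsub>A\<^esub>)"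
    and "\<rho> (x i \<otimes>\<^bsub>A\<^esub> star A (x i)) = 0"
  using assms unfolding cuntz_family_def by auto

context cstar_state begin

lemma rho_mult_star_null:
  assumes x: "x \<in> carrier A" "\<rho> (x \<otimes> star A x) = 0" and b: "b \<in> carrier A"
  shows "\<rho> (b \<otimes> star A x) = 0"
  using G.ip_null_left[of "star A x" "star A b"] x b by (simp add: vnorm_def star_closed star_star)

context
  fixes x :: "'i \<Rightarrow> 'a" assumes cuntz: "cuntz_family A \<rho> x"
begin

text \<open>The factor \<open>b\<close> on the left is arbitrary so that the first letter can be
  absorbed into it and the induction hypothesis used for the rest of the word.\<close>

lemma cuntz_reduce:
  "b \<in> carrier A \<Longrightarrow> \<rho> (b \<otimes> cword A x w)
    = (case cuntz_run w of None \<Rightarrow> 0 | Some u \<Rightarrow> \<rho> (b \<otimes> cword A x (map (\<lambda>i. (i, True)) u)))"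
proof (induction w arbitrary: b rule: cuntz_run.induct)
  case (2 i w)
  note xi = cuntz_familyD(2)[OF cuntz, of i] and c = cword_closed[OF cuntz_familyD(1)[OF cuntz]]
  have "\<rho> (b \<otimes> cword A x ((i, True) # w)) = \<rho> ((b \<otimes> x i) \<otimes> cword A x w)"
    using 2(2) xi c[of w] by (simp add: mult_assoc)
  also have "\<dots> = (case cuntz_run w of None \<Rightarrow> 0
      | Some u \<Rightarrow> \<rho> ((b \<otimes> x i) \<otimes> cword A x (map (\<lambda>i. (i, True)) u)))"
    using 2 xi by simp
  finally show ?case using 2(2) xi c by (simp add: mult_assoc split: option.splits)
next
  case (3 i w)
  note xc = cuntz_familyD(2)[OF cuntz] and c = cword_closed[OF cuntz_familyD(1)[OF cuntz]]
  have xi: "star A (x i) \<in> carrier A" using xc by (rule star_closed)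
  have b: "b \<otimes> star A (x i) \<in> carrier A" using 3(2) xi by simp
  have "\<rho> (b \<otimes> cword A x ((i, False) # w)) = \<rho> ((b \<otimes> star A (x i)) \<otimes> cword A x w)"
    using 3(2) xi c[of w] by (simp add: mult_assoc)
  also have "\<dots> = (case cuntz_run w of None \<Rightarrow> 0
      | Some u \<Rightarrow> \<rho> ((b \<otimes> star A (x i)) \<otimes> cword A x (map (\<lambda>i. (i, True)) u)))"
    by (rule 3(1)[OF b])
  also have "\<dots> = (case cuntz_run ((i, False) # w) of None \<Rightarrow> 0
      | Some u \<Rightarrow> \<rho> (b \<otimes> cword A x (map (\<lambda>i. (i, True)) u)))"
  proof (cases "cuntz_run w")
    case (Some u)
    show ?thesis
    proof (cases u)
      \<comment> \<open>The rest of the word has been reduced to the unit, so the adjoint meets the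
        vacuum and vanishes.\<close>
      case Nil
      then show ?thesis
        using Some rho_mult_star_null[OF xc cuntz_familyD(4)[OF cuntz] 3(2), of i] b
        by (simp add: mult_one_right)
    next
      case (Cons j v)
      let ?p = "cword A x (map (\<lambda>i. (i, True)) v)"
      have "(b \<otimes> star A (x i)) \<otimes> (x j \<otimes> ?p) = b \<otimes> ((star A (x i) \<otimes> x j) \<otimes> ?p)"
        using 3(2) xi xc[of j] c[of "map (\<lambda>i. (i, True)) v"] by (simp add: mult_assoc)
      then show ?thesis
        using Some Cons 3(2) c[of "map (\<lambda>i. (i, True)) v"] rho_smult[of \<zero> 0]
        by (simp add: cuntz_familyD(3)[OF cuntz])
    qed
  qed simp
  finally show ?case .
qed simp

text \<open>What \<open>cuntz_reduce\<close> leaves is a product of isometries without adjoints.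
  Unless it is empty, its state value is the conjugate of that of an expression ending in an
  adjoint, hence zero.\<close>

lemma cuntz_moment: "\<rho> (cword A x w) = (if cuntz_run w = Some [] then 1 else 0)"
proof -
  note xc = cuntz_familyD(2)[OF cuntz] and c = cword_closed[OF cuntz_familyD(1)[OF cuntz]]
  have pos: "\<rho> (x j \<otimes> p) = 0" if p: "p \<in> carrier A" for j p
  proof -
    have "\<rho> (star A p \<otimes> star A (x j)) = 0"
      by (rule rho_mult_star_null[OF xc cuntz_familyD(4)[OF cuntz] star_closed[OF p]])
    then show ?thesis
      using rho_star[of "star A p \<otimes> star A (x j)"] p xc[of j] by (simp add: star_mult star_star star_closed)
  qed
  show ?thesis
    using cuntz_reduce[of \<one> w] c pos by (auto split: option.splits list.splits simp: neq_Nil_conv)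
qed

end

end

text \<open>Within one factor the relations are those of the factor, and across factors they are
  \<open>emb_orthogonal\<close>. The colouring \<open>c\<close> lets one statement serve both the
  doubled algebra, with infinitely many isometries per factor, and the infinite free product, with
  one each.\<close>

lemma (in free_family) cuntz_family_free:
  assumes c: "\<And>k. c k \<in> I" and x: "\<And>k. x k \<in> carrier (A (c k))"
    and same: "\<And>k l. c k = c l \<Longrightarrow>
      star (A (c k)) (x k) \<otimes>\<^bsub>A (c k)\<^esub> x l = (if k = l then \<one>\<^bsub>A (c k)\<^esub> else \<zero>\<^bsub>A (c k)\<^esub>)"
    and null: "\<And>k. \<rho> (c k) (x k \<otimes>\<^bsub>A (c k)\<^esub> star (A (c k)) (x k)) = 0"
  shows "cuntz_family \<P> \<omega> (\<lambda>k. emb (c k) (x k))"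
  unfolding cuntz_family_def
proof (intro conjI allI)
  have hom: "unital_star_hom (A (c k)) \<P> (emb (c k))" for k by (rule emb_hom[OF c])
  have xs: "star (A (c k)) (x k) \<in> carrier (A (c k))" for k
    by (rule unital_cstar_algebra.star_closed[OF alg[OF c] x])
  show "range (\<lambda>k. emb (c k) (x k)) \<subseteq> carrier \<P>" using emb_closed[OF c x] by blast
  fix k l
  have "star \<P> (emb (c k) (x k)) \<otimes>\<^bsub>\<P>\<^esub> emb (c l) (x l) = emb (c k) (star (A (c k)) (x k) \<otimes>\<^bsub>A (c k)\<^esub> x l)"
    if eq: "c k = c l"
  proof -
    have xl: "x l \<in> carrier (A (c k))" using x[of l] eq by simp
    show ?thesis
      using unital_star_homD(2)[OF hom[of k] xs[of k] xl] unital_star_homD(6)[OF hom[of k] x[of k]] eq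
      by (simp del: free_product_simps)
  qed
  moreover have "emb (c k) \<zero>\<^bsub>A (c k)\<^esub> = \<zero>\<^bsub>\<P>\<^esub>"
  proof -
    interpret K: unital_cstar_algebra "A (c k)" by (rule alg[OF c])
    interpret P: cstar_state \<P> \<omega> by (rule free_product_cstar_state)
    show ?thesis
      using unital_star_homD(5)[OF hom K.zero_closed, of 0] unital_star_homD(1)[OF hom K.zero_closed]
      by (simp add: K.sm_zero_left P.sm_zero_left del: free_product_simps)
  qed
  ultimately show "star \<P> (emb (c k) (x k)) \<otimes>\<^bsub>\<P>\<^esub> emb (c l) (x l) = (if k = l then \<one>\<^bsub>\<P>\<^esub> else \<zero>\<^bsub>\<P>\<^esub>)"
    using same[of k l] unital_star_homD(4)[OF hom[of k]] emb_orthogonal[OF c x null c x null, of k l]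
    by (cases "c k = c l") (auto simp del: free_product_simps)
  have "emb (c k) (x k) \<otimes>\<^bsub>\<P>\<^esub> star \<P> (emb (c k) (x k)) = emb (c k) (x k \<otimes>\<^bsub>A (c k)\<^esub> star (A (c k)) (x k))"
    using unital_star_homD(2)[OF hom[of k] x xs] unital_star_homD(6)[OF hom[of k] x] by (simp del: free_product_simps)
  moreover have "x k \<otimes>\<^bsub>A (c k)\<^esub> star (A (c k)) (x k) \<in> carrier (A (c k))"
  proof -
    interpret K: unital_cstar_algebra "A (c k)" by (rule alg[OF c])
    show ?thesis using x xs by simp
  qed
  ultimately show "\<omega> (emb (c k) (x k) \<otimes>\<^bsub>\<P>\<^esub> star \<P> (emb (c k) (x k))) = 0"
    using emb_state[OF c] null[of k] by (simp del: free_product_simps)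
qed

theorem cuntz_family_selfless:
  fixes x :: "nat \<Rightarrow> 'a"
  assumes A: "cstar_state A \<rho>" "norming A \<rho>" and gen: "generates A (range x)"
    and cuntz: "cuntz_family A \<rho> x"
  shows "selfless A \<rho>"
proof (rule selfless_criterion[OF A gen])
  note One_nat_def [simp del]
  interpret A: cstar_state A \<rho> by fact
  interpret F: free_family "{1, 2 :: nat}" "\<lambda>_. A" "\<lambda>_. \<rho>" by unfold_locales
  interpret P: cstar_state F.\<P> F.\<omega> by (rule F.free_product_cstar_state)
  \<comment> \<open>An isometry in the family has state value zero; as a scalar it would be zero,
    contradicting that its adjoint is a left inverse.\<close>
  show "carrier A \<noteq> range (\<lambda>c. c \<odot>\<^bsub>A\<^esub> \<one>\<^bsub>A\<^esub>)"
  proof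
    assume "carrier A = range (\<lambda>c. c \<odot>\<^bsub>A\<^esub> \<one>\<^bsub>A\<^esub>)"
    then obtain c where c: "x 0 = c \<odot>\<^bsub>A\<^esub> \<one>\<^bsub>A\<^esub>" using cuntz_familyD(2)[OF cuntz, of 0] by blast
    have "\<rho> (x 0) = 0"
      using A.cuntz_moment[OF cuntz, of "[(0, True)]"] cuntz_familyD(2)[OF cuntz, of 0]
      by (simp add: A.mult_one_right)
    then have "c = 0" using c A.rho_smult[OF A.one_closed, of c] by simp
    then have "x 0 = \<zero>\<^bsub>A\<^esub>" using c A.sm_zero_left[OF A.one_closed] by simp
    then have "\<one>\<^bsub>A\<^esub> = \<zero>\<^bsub>A\<^esub>"
      using cuntz_familyD(3)[OF cuntz, of 0 0] A.star_closed[OF A.zero_closed] by simp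
    then show False using A.rho_one A.rho_smult[OF A.one_closed, of 0] A.sm_zero_left[OF A.one_closed] by simp
  qed
  fix f :: "nat \<times> bool \<Rightarrow> nat" and w assume f: "inj f"
  have "cuntz_family F.\<P> F.\<omega> (\<lambda>p. F.emb (if snd p then 1 else 2) (x (fst p)))"
    by (rule F.cuntz_family_free[where c = "\<lambda>p. if snd p then 1 else 2"])
      (auto simp: cuntz_familyD[OF cuntz] prod_eq_iff split: if_splits)
  from P.cuntz_moment[OF this, of w]
  show "F.\<omega> (cword F.\<P> (\<lambda>p. F.emb (if snd p then 1 else 2) (x (fst p))) w) = \<rho> (cword A (x \<circ> f) w)"
    unfolding cword_map[symmetric] A.cuntz_moment[OF cuntz] cuntz_run_map[OF f] by simp
qed

section \<open>The Toeplitz algebra\<close>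

interpretation S: hilbert "ell2 (UNIV :: nat set)" by (rule ell2_hilbert)

lemma shift_apply:
  "f \<in> carrier (ell2 UNIV) \<Longrightarrow> unilateral_shift f = (\<lambda>n. case n of 0 \<Rightarrow> 0 | Suc m \<Rightarrow> f m)"
  by (simp add: unilateral_shift_def)

lemma shift_carrier:
  assumes f: "f \<in> carrier (ell2 UNIV)"
  shows "unilateral_shift f \<in> carrier (ell2 UNIV)" "nsq UNIV (unilateral_shift f) \<le> nsq UNIV f"
proof -
  have "(\<Sum>n\<in>F. (cmod (unilateral_shift f n))\<^sup>2) \<le> nsq UNIV f" if F: "finite F" for F
  proof -
    let ?E = "Suc -` F"
    have fin: "finite ?E" using F by (intro finite_vimageI) auto
    have "(\<Sum>n\<in>F. (cmod (unilateral_shift f n))\<^sup>2) = (\<Sum>n\<in>Suc ` ?E. (cmod (unilateral_shift f n))\<^sup>2)"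
    proof (rule sum.mono_neutral_right[OF F])
      show "\<forall>n\<in>F - Suc ` ?E. (cmod (unilateral_shift f n))\<^sup>2 = 0"
        by (auto simp: shift_apply[OF f] split: nat.splits)
    qed auto
    also have "\<dots> = (\<Sum>m\<in>?E. (cmod (f m))\<^sup>2)"
      by (subst sum.reindex) (simp_all add: shift_apply[OF f])
    also have "\<dots> \<le> nsq UNIV f" by (rule ell2_fin[OF f fin]) simp
    finally show ?thesis .
  qed
  then show "unilateral_shift f \<in> carrier (ell2 UNIV)" "nsq UNIV (unilateral_shift f) \<le> nsq UNIV f"
    using ell2_I[of UNIV "unilateral_shift f" "nsq UNIV f"] by auto
qed

lemma shift_bounded: "unilateral_shift \<in> bounded_operators (ell2 UNIV)"
proof -
  have "(\<lambda>f\<in>carrier (ell2 UNIV). unilateral_shift f) \<in> bounded_operators (ell2 UNIV)"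
  proof (rule S.bopI)
    fix f :: "nat \<Rightarrow> complex" assume f: "f \<in> carrier (ell2 UNIV)"
    show "unilateral_shift f \<in> carrier (ell2 UNIV)" by (rule shift_carrier(1)[OF f])
    show "vnorm (ell2 UNIV) (unilateral_shift f) \<le> 1 * vnorm (ell2 UNIV) f"
      using shift_carrier[OF f] f by (simp add: vnorm_ell2)
    show "unilateral_shift (c \<odot>\<^bsub>ell2 UNIV\<^esub> f) = c \<odot>\<^bsub>ell2 UNIV\<^esub> unilateral_shift f" for c
      unfolding shift_apply[OF f] shift_apply[OF S.sm_closed[OF f]]
      by (auto simp: ell2_simps(4) split: nat.splits)
    fix g :: "nat \<Rightarrow> complex" assume g: "g \<in> carrier (ell2 UNIV)"
    show "unilateral_shift (f \<oplus>\<^bsub>ell2 UNIV\<^esub> g) = unilateral_shift f \<oplus>\<^bsub>ell2 UNIV\<^esub> unilateral_shift g"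
      unfolding shift_apply[OF f] shift_apply[OF g] shift_apply[OF S.M.a_closed[OF f g]]
      by (auto simp: ell2_simps(3) split: nat.splits)
  qed
  moreover have "(\<lambda>f\<in>carrier (ell2 UNIV). unilateral_shift f) = unilateral_shift"
    by (rule ext) (simp add: unilateral_shift_def restrict_def)
  ultimately show ?thesis by simp
qed

lemma shift_ip:
  assumes "f \<in> carrier (ell2 UNIV)" "g \<in> carrier (ell2 UNIV)"
  shows "ip (ell2 UNIV) (unilateral_shift f) (unilateral_shift g) = ip (ell2 UNIV) f g"
proof -
  have "ip (ell2 UNIV) (unilateral_shift f) (unilateral_shift g)
      = (\<Sum>\<^sub>\<infinity>n\<in>range Suc. unilateral_shift f n * cnj (unilateral_shift g n))"
    unfolding ell2_simps
  proof (rule infsum_cong_neutral)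
    fix n assume "n \<in> UNIV - range Suc"
    then have "n = 0" by (cases n) auto
    then show "unilateral_shift f n * cnj (unilateral_shift g n) = 0" by (simp add: shift_apply assms)
  qed auto
  also have "\<dots> = ip (ell2 UNIV) f g"
    by (simp add: infsum_reindex comp_def shift_apply assms ell2_simps(5))
  finally show ?thesis .
qed

lemma shift_isometry:
  "star (operator_algebra (ell2 UNIV)) unilateral_shift \<otimes>\<^bsub>operator_algebra (ell2 UNIV)\<^esub> unilateral_shift
    = \<one>\<^bsub>operator_algebra (ell2 UNIV)\<^esub>" (is "?l = ?r")
proof (rule S.bop_eqI)
  note star = S.op_star[OF shift_bounded]
  show "?l \<in> bounded_operators (ell2 UNIV)" by (rule S.op_mult_closed[OF star(1) shift_bounded])
  show "?r \<in> bounded_operators (ell2 UNIV)" by (rule S.op_one_closed)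
  fix f :: "nat \<Rightarrow> complex" assume f: "f \<in> carrier (ell2 UNIV)"
  have "star (operator_algebra (ell2 UNIV)) unilateral_shift (unilateral_shift f) = f"
  proof (rule S.ip_eqI[OF S.bopD(1)[OF star(1) shift_carrier(1)[OF f]] f])
    fix g :: "nat \<Rightarrow> complex" assume g: "g \<in> carrier (ell2 UNIV)"
    show "ip (ell2 UNIV) g (star (operator_algebra (ell2 UNIV)) unilateral_shift (unilateral_shift f))
      = ip (ell2 UNIV) g f"
      using star(2)[OF g shift_carrier(1)[OF f]] shift_ip[OF g f] by simp
  qed
  then show "?l f = ?r f" using f by simp
qed

lemma toeplitz_sub: "cstar_subalgebra (carrier toeplitz_algebra) (operator_algebra (ell2 UNIV))"
  unfolding toeplitz_algebra_def
  by (rule S.OA.cstar_generated_subalgebra) (simp add: S.carrier_op shift_bounded)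

lemma toeplitz_generates: "generates toeplitz_algebra {unilateral_shift}"
  unfolding toeplitz_algebra_def
  by (rule S.OA.generates_cstar_generated) (simp add: S.carrier_op shift_bounded)

lemma toeplitz_state_eq: "toeplitz_state = vector_state (ell2 UNIV) (basis_vec 0)"
  by (simp add: toeplitz_state_def basis_vec_def)

lemma toeplitz_cstar_state: "cstar_state toeplitz_algebra toeplitz_state"
  using S.vector_state_gns(1)[OF toeplitz_sub, of "basis_vec 0"]
    S.OA.cstar_generated_eq[of "{unilateral_shift}"]
  by (simp add: toeplitz_state_eq basis_vec_norm toeplitz_algebra_def)

text \<open>For the vanishing state value: everything in the range of the shift has zero coordinate
  at 0.\<close>

lemma toeplitz_shift:
  "unilateral_shift \<in> carrier toeplitz_algebra"
  "star toeplitz_algebra unilateral_shift \<otimes>\<^bsub>toeplitz_algebra\<^esub> unilateral_shift = \<one>\<^bsub>toeplitz_algebra\<^esub>"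
  "toeplitz_state (unilateral_shift \<otimes>\<^bsub>toeplitz_algebra\<^esub> star toeplitz_algebra unilateral_shift) = 0"
proof -
  show "unilateral_shift \<in> carrier toeplitz_algebra" using toeplitz_generates by (simp add: generates_def)
  show "star toeplitz_algebra unilateral_shift \<otimes>\<^bsub>toeplitz_algebra\<^esub> unilateral_shift = \<one>\<^bsub>toeplitz_algebra\<^esub>"
    using shift_isometry by (simp add: toeplitz_algebra_def)
  have "star (operator_algebra (ell2 UNIV)) unilateral_shift (basis_vec 0) \<in> carrier (ell2 UNIV)"
    by (rule S.bopD(1)[OF S.op_star(1)[OF shift_bounded]]) simp
  then show "toeplitz_state (unilateral_shift \<otimes>\<^bsub>toeplitz_algebra\<^esub> star toeplitz_algebra unilateral_shift) = 0"
    by (simp add: toeplitz_state_eq toeplitz_algebra_def vector_state_def basis_vec_ip shift_apply)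
qed

section \<open>Transport along isomorphisms\<close>

text \<open>The Cuntz algebra is given only up to a state preserving isomorphism, so generation,
  \<open>norming\<close> and the isometries of the free product are carried back along its
  inverse.\<close>

locale isomorphic_spaces = P: cstar_state P \<omega> + B: unital_cstar_algebra B
  for P :: "('a, 'm) cstar_scheme" and \<omega> and B :: "('b, 'n) cstar_scheme" +
  fixes \<phi> \<Psi> assumes iso: "prob_space_isomorphism B \<phi> P \<omega> \<Psi>"
begin

abbreviation "\<Phi> \<equiv> inv_into (carrier B) \<Psi>"

lemma hom: "unital_star_hom B P \<Psi>" and inj: "inj_on \<Psi> (carrier B)" and surj: "\<Psi> ` carrier B = carrier P"
  and state: "b \<in> carrier B \<Longrightarrow> \<omega> (\<Psi> b) = \<phi> b"
  using iso by (auto simp: prob_space_isomorphism_def embedding_def)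

lemma \<Psi>_\<Phi> [simp]: "a \<in> carrier P \<Longrightarrow> \<Psi> (\<Phi> a) = a" and \<Phi>_\<Psi> [simp]: "b \<in> carrier B \<Longrightarrow> \<Phi> (\<Psi> b) = b"
  using surj inj by (auto simp: f_inv_into_f)

lemma \<Phi>_closed [simp]: "a \<in> carrier P \<Longrightarrow> \<Phi> a \<in> carrier B"
  using surj by (auto intro: inv_into_into)

lemma \<Phi>_hom: "unital_star_hom P B \<Phi>"
proof -
  note h = unital_star_homD[OF hom]
  have eq: "\<Phi> a = b" if "\<Psi> b = a" "b \<in> carrier B" for a b using that by auto
  show ?thesis
    by (rule unital_star_homI; (rule eq)?) (simp_all add: h P.star_closed B.star_closed)
qed

lemma \<phi>_state: "cstar_state B \<phi>"
proof (intro cstar_state.intro cstar_state_axioms.intro B.unital_cstar_algebra_axioms)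
  note h = unital_star_homD[OF hom]
  show "Defs.state B \<phi>"
    using P.is_state unfolding state_def
    by (auto simp: state[symmetric] h B.star_closed)
qed

lemma gnorm_\<Psi>:
  assumes "b \<in> carrier B"
  shows "vnorm (gns_prespace B \<phi>) b = P.gnorm (\<Psi> b)"
  using assms state[of "star B b \<otimes>\<^bsub>B\<^esub> b"] unital_star_homD[OF hom] B.star_closed[OF assms]
  by (simp add: vnorm_def)

text \<open>The GNS bound moves to \<open>P\<close> along \<open>\<Psi>\<close>; the resulting norm
  bound returns because the inverse homomorphism is contractive.\<close>

lemma \<phi>_norming:
  assumes "norming P \<omega>"
  shows "norming B \<phi>"
  unfolding norming_def
proof (intro ballI allI impI)
  fix a K assume a: "a \<in> carrier B" and K: "0 \<le> K"
    and le: "\<forall>b\<in>carrier B. vnorm (gns_prespace B \<phi>) (a \<otimes>\<^bsub>B\<^esub> b) \<le> K * vnorm (gns_prespace B \<phi>) b"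
  note h = unital_star_homD[OF hom]
  have "P.gnorm (\<Psi> a \<otimes>\<^bsub>P\<^esub> c) \<le> K * P.gnorm c" if c: "c \<in> carrier P" for c
    using bspec[OF le \<Phi>_closed[OF c]] gnorm_\<Psi>[of "a \<otimes>\<^bsub>B\<^esub> \<Phi> c"] gnorm_\<Psi>[OF \<Phi>_closed[OF c]] a c
    by (simp add: h(2))
  then have "cnorm P (\<Psi> a) \<le> K" using assms h(1)[OF a] K unfolding norming_def by blast
  then show "cnorm B a \<le> K"
    using star_hom_contractive[OF P.unital_cstar_algebra_axioms B.unital_cstar_algebra_axioms \<Phi>_hom h(1)[OF a]] a
    by simp
qed

lemma \<phi>_generates:
  assumes "generates P S"
  shows "generates B (\<Phi> ` S)"
  unfolding generates_def
proof (intro conjI allI impI subsetI)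
  fix C b assume C: "cstar_subalgebra C B \<and> \<Phi> ` S \<subseteq> C" and b: "b \<in> carrier B"
  have "\<Phi> (\<Psi> b) \<in> C"
    by (rule generates_hom_image[OF P.unital_cstar_algebra_axioms B.unital_cstar_algebra_axioms \<Phi>_hom _ assms])
      (use C b unital_star_homD(1)[OF hom] in auto)
  then show "b \<in> C" using b by simp
qed (use assms in \<open>auto simp: generates_def\<close>)

lemma \<phi>_cuntz_family:
  assumes "cuntz_family P \<omega> y"
  shows "cuntz_family B \<phi> (\<Phi> \<circ> y)"
proof -
  note y = cuntz_familyD[OF assms] and h = unital_star_homD[OF \<Phi>_hom]
  have zero: "\<Phi> \<zero>\<^bsub>P\<^esub> = \<zero>\<^bsub>B\<^esub>" using h(5)[of "\<zero>\<^bsub>P\<^esub>" 0] h(1)[of "\<zero>\<^bsub>P\<^esub>"] by (simp add: B.sm_zero_left)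
  have rel: "star B (\<Phi> (y i)) \<otimes>\<^bsub>B\<^esub> \<Phi> (y j) = \<Phi> (star P (y i) \<otimes>\<^bsub>P\<^esub> y j)"
    and null: "\<Phi> (y i) \<otimes>\<^bsub>B\<^esub> star B (\<Phi> (y i)) = \<Phi> (y i \<otimes>\<^bsub>P\<^esub> star P (y i))" for i j
    using y(2) by (simp_all add: h P.star_closed)
  have "\<phi> (\<Phi> a) = \<omega> a" if "a \<in> carrier P" for a using state[of "\<Phi> a"] that by simp
  then show ?thesis
    unfolding cuntz_family_def using y(2) by (auto simp: rel null y(3,4) zero h(4) P.star_closed)
qed

end

section \<open>The Cuntz algebra\<close>

text \<open>The pullbacks of the shifts, one from each Toeplitz factor, are a generating Cuntz
  family for \<open>\<phi>\<close>.\<close>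

theorem cuntz_algebra_selfless:
  assumes B: "cuntz_algebra_infinity B s"
    and iso: "prob_space_isomorphism B \<phi>
      (free_product {1 :: nat ..} (\<lambda>_. toeplitz_algebra) (\<lambda>_. toeplitz_state))
      (free_product_state {1 :: nat ..} (\<lambda>_. toeplitz_algebra) (\<lambda>_. toeplitz_state)) \<Psi>"
  shows "selfless B \<phi>"
proof -
  note One_nat_def [simp del]
  interpret F: free_family "{1 :: nat ..}" "\<lambda>_. toeplitz_algebra" "\<lambda>_. toeplitz_state"
    by (rule free_family.intro) (rule toeplitz_cstar_state)
  interpret isomorphic_spaces F.\<P> F.\<omega> B \<phi> \<Psi>
    using B iso by (intro isomorphic_spaces.intro isomorphic_spaces_axioms.intro F.free_product_cstar_state)
      (simp_all add: cuntz_algebra_infinity_def)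
  \<comment> \<open>\<open>Suc n\<close>, because the factors are numbered from 1 and the criterion
    wants a sequence indexed from 0.\<close>
  define y where "y n = F.emb (Suc n) unilateral_shift" for n
  have y: "cuntz_family F.\<P> F.\<omega> y"
    unfolding y_def by (rule F.cuntz_family_free) (auto simp: toeplitz_shift One_nat_def)
  have "{1 :: nat ..} = range Suc" by (auto simp: image_iff One_nat_def Suc_le_eq gr0_conv_Suc)
  then have "(\<Union>i\<in>{1..}. F.emb i ` {unilateral_shift}) = range y" by (auto simp: y_def)
  then have "generates F.\<P> (range y)"
    using F.free_product_generates[of "\<lambda>_. {unilateral_shift}"] toeplitz_generates by simp
  then have "generates B (range (\<Phi> \<circ> y))" using \<phi>_generates[of "range y"] by (simp add: image_image)
  then show ?thesis
    by (rule cuntz_family_selfless[OF \<phi>_state \<phi>_norming[OF F.free_product_norming] _ \<phi>_cuntz_family[OF y]])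
qed

theorem corollary2p3:
  shows "(\<forall>\<tau>. tracial_state (reduced_group_cstar (free_group (UNIV :: nat set))) \<tau> \<longrightarrow>
              selfless (reduced_group_cstar (free_group (UNIV :: nat set))) \<tau>) \<and>
         (\<forall>(B :: 'b cstar) s \<phi> \<Psi>.
              cuntz_algebra_infinity B s \<longrightarrow>
              prob_space_isomorphism B \<phi>
                (free_product {1 :: nat ..} (\<lambda>_. toeplitz_algebra) (\<lambda>_. toeplitz_state))
                (free_product_state {1 :: nat ..} (\<lambda>_. toeplitz_algebra) (\<lambda>_. toeplitz_state)) \<Psi> \<longrightarrow>
              selfless B \<phi>)"
  using reduced_free_group_selfless cuntz_algebra_selfless by blast

end
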